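(* Let $\Sigma$ be a closed connected surface endowed with a conformal class $c$. Then $c$ belongs to exactly one of the following categories: 1) There does not exist $g\in c$ such that $g$ admits a branched minimal immersion to a sphere by first eigenfunctions. 2) There exists a unique $g\in c$ such that $g$ admits a branched minimal immersion by first eigenfunctions to some $\mathbb{S}^m$ whose image is not an equatorial $2$-sphere. 3) There exists $g\in c$ such that $g$ admits a branched minimal immersion by first eigenfunctions to $\mathbb{S}^2$. In this case any two such immersions (i.e. any two branched minimal immersions to $\mathbb{S}^2$ by first eigenfunctions of metrics in $c$) differ by a post-composition with a conformal automorphism of $\mathbb{S}^2$.
   Context: $\mathbb{S}^n\subset\mathbb{R}^{n+1}$ is the unit sphere with its canonical metric $g_{\mathrm{can}}$. An equatorial $2$-sphere of $\mathbb{S}^n$ is the intersection of $\mathbb{S}^n$ with a $3$-dimensional linear subspace of $\mathbb{R}^{n+1}$. Conformal automorphisms of $\mathbb{S}^2$ are allowed to reverse orientation. Metrics with conical singularities: on a surface $\Sigma$ with a conformal structure, a metric $g$ with (possible) conical singularities is a metric compatible with the conformal structure which is smooth away from finitely many points $p_1,\dots,p_N$ and which in conformal coordinates $z$ centered at $p_i$ has the form $\rho_i(z)|z|^{2\beta_i}|dz|^2$ with $\beta_i>-1$ and $\rho_i>0$ smooth. Thus $g=fg_0$, where $g_0$ is a smooth Riemannian metric in the conformal class and $f$ is smooth and positive away from the $p_i$. Here "$g\in c$" means that $g$ is a metric with possible conical singularities in the conformal class $c$. Branched minimal immersion: a non-constant smooth map $\Phi\colon\Sigma\to\mathbb{S}^n$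 which is harmonic and conformal away from the points where $D_p\Phi=0$ (there are finitely many such points, called branch points). Then $\Phi^*g_{\mathrm{can}}$ is a metric with conical singularities at the branch points. A metric $g$ admits a branched minimal immersion to $\mathbb{S}^n$ if there is such a $\Phi$ with $\Phi^*g_{\mathrm{can}}=g$. First eigenvalue: for a metric $g=fg_0$ with possible conical singularities at finitely many points $p_1,\dots,p_N$, where $g_0$ is a smooth Riemannian metric in the conformal class of $g$ and $f$ is smooth and positive away from the $p_i$, $\lambda_1(g)=\inf\left\{\frac{\int_\Sigma|\nabla u|^2_{g_0}\,dV(g_0)}{\int_\Sigma u^2\,dV(g)} : u\in H^1(\Sigma,g),\ u\neq 0,\ \int_\Sigma u\,dV(g)=0\right\}$, where $H^1(\Sigma,g)$ is the completion of $\{u\in L^2(\Sigma,dV(g)):\int_\Sigma|\nabla u|^2_{g_0}dV(g_0)<\infty\}$ in the norm $\|u\|^2=\int_\Sigma u^2\,dV(g)+\int_\Sigma|\nabla u|^2_{g_0}\,dV(g_0)$. First eigenfunctions are the functions attaining the infimum; equivalently, they satisfy $\Delta_{g_0}u=\lambda_1(g)fu$. A branched minimal immersion $\Phi$ is by first eigenfunctions if each of its coordinate functions (as a map to $\mathbb{R}^{n+1}$) lies in the $\lambda_1(g)$-eigenspace of $g=\Phi^*g_{\mathrm{can}}$ (the zero function being allowed). *)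

theory Defs
  imports "HOL-Analysis.Analysis"
begin

section \<open>Smooth surfaces\<close>

text \<open>\<open>C\<^sup>\<infinity>\<close> maps on an \<^emph>\<open>open\<close> set of a normed space.\<close>

primrec Ck_on ::
  "nat \<Rightarrow> 'a::real_normed_vector set \<Rightarrow> ('a \<Rightarrow> 'b::real_normed_vector) \<Rightarrow> bool" where
  "Ck_on 0 S f \<longleftrightarrow> continuous_on S f"
| "Ck_on (Suc k) S f \<longleftrightarrow> (\<forall>x\<in>S. f differentiable (at x)) \<and>
     (\<forall>v. Ck_on k S (\<lambda>x. frechet_derivative f (at x) v))"

definition smooth_on ::
  "'a::real_normed_vector set \<Rightarrow> ('a \<Rightarrow> 'b::real_normed_vector) \<Rightarrow> bool" where
  "smooth_on S f \<longleftrightarrow> (\<forall>k. Ck_on k S f)"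

abbreviation pderiv_at :: "('a::real_normed_vector \<Rightarrow> 'b::real_normed_vector) \<Rightarrow> 'a \<Rightarrow> 'a \<Rightarrow> 'b" where
  "pderiv_at f z v \<equiv> frechet_derivative f (at z) v"

text \<open>The surface is a whole (Hausdorff) type. A chart is a pair of an open domain and a
  homeomorphism from it onto an open subset of the plane \<open>\<real>\<^sup>2 = complex\<close>;
  the plane is used as a real vector space with basis \<open>1, \<i>\<close>, and \<open>v \<bullet> w\<close> is its
  Euclidean inner product. No orientation is chosen, so
  surfaces need not be orientable.\<close>

type_synonym 'a chart = "'a set \<times> ('a \<Rightarrow> complex)"

abbreviation dom_ch :: "'a chart \<Rightarrow> 'a set" where "dom_ch \<kappa> \<equiv> fst \<kappa>"
abbreviation coord :: "'a chart \<Rightarrow> 'a \<Rightarrow> complex" where "coord \<kappa> \<equiv> snd \<kappa>"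
abbreviation im_ch :: "'a chart \<Rightarrow> complex set" where "im_ch \<kappa> \<equiv> snd \<kappa> ` fst \<kappa>"
abbreviation param :: "'a chart \<Rightarrow> complex \<Rightarrow> 'a" where "param \<kappa> \<equiv> inv_into (fst \<kappa>) (snd \<kappa>)"

definition is_chart :: "'a::t2_space chart \<Rightarrow> bool" where
  "is_chart \<kappa> \<longleftrightarrow> open (dom_ch \<kappa>) \<and> open (im_ch \<kappa>) \<and>
     homeomorphism (dom_ch \<kappa>) (im_ch \<kappa>) (coord \<kappa>) (param \<kappa>)"

definition smooth_transition :: "'a chart \<Rightarrow> 'a chart \<Rightarrow> bool" where
  "smooth_transition \<kappa> \<kappa>' \<longleftrightarrow>
     smooth_on (coord \<kappa> ` (dom_ch \<kappa> \<inter> dom_ch \<kappa>')) (coord \<kappa>' \<circ> param \<kappa>)"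

definition smooth_atlas :: "'a::t2_space chart set \<Rightarrow> bool" where
  "smooth_atlas A \<longleftrightarrow> (\<forall>\<kappa>\<in>A. is_chart \<kappa>) \<and> (\<Union>\<kappa>\<in>A. dom_ch \<kappa>) = UNIV \<and>
     (\<forall>\<kappa>\<in>A. \<forall>\<kappa>'\<in>A. smooth_transition \<kappa> \<kappa>')"

text \<open>The maximal atlas (smooth structure) generated by \<open>A\<close>.\<close>

definition smooth_charts :: "'a::t2_space chart set \<Rightarrow> 'a chart set" where
  "smooth_charts A = {\<kappa>. is_chart \<kappa> \<and>
     (\<forall>\<kappa>'\<in>A. smooth_transition \<kappa> \<kappa>' \<and> smooth_transition \<kappa>' \<kappa>)}"

definition charts_at :: "'a::t2_space chart set \<Rightarrow> 'a \<Rightarrow> 'a chart set" where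
  "charts_at A p = {\<kappa> \<in> smooth_charts A. p \<in> dom_ch \<kappa>}"

definition smooth_fun :: "'a::t2_space chart set \<Rightarrow> 'a set \<Rightarrow> ('a \<Rightarrow> real) \<Rightarrow> bool" where
  "smooth_fun A S u \<longleftrightarrow>
     (\<forall>\<kappa>\<in>smooth_charts A. smooth_on (coord \<kappa> ` (dom_ch \<kappa> \<inter> S)) (u \<circ> param \<kappa>))"


section \<open>Metrics and conformal classes\<close>

text \<open>A (possibly degenerate) symmetric 2-tensor field is the family of its components: \<open>h \<kappa> p v w\<close>
  is its value at \<open>p\<close> on the tangent vectors whose coordinates in the chart \<open>\<kappa>\<close> are \<open>v\<close>, \<open>w\<close>.
  Components with respect to different charts are related by the usual transformation rule;
  meaningless components are 0, so that equality of tensor fields is equality in HOL.\<close>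

type_synonym 'a tensor2 = "'a chart \<Rightarrow> 'a \<Rightarrow> complex \<Rightarrow> complex \<Rightarrow> real"

definition sym_tensor :: "'a::t2_space chart set \<Rightarrow> 'a tensor2 \<Rightarrow> bool" where
  "sym_tensor A h \<longleftrightarrow>
     (\<forall>p. \<forall>\<kappa>\<in>charts_at A p. bilinear (h \<kappa> p) \<and> (\<forall>v w. h \<kappa> p v w = h \<kappa> p w v)) \<and>
     (\<forall>p. \<forall>\<kappa>\<in>charts_at A p. \<forall>\<kappa>'\<in>charts_at A p. \<forall>v w.
        h \<kappa> p v w = h \<kappa>' p (pderiv_at (coord \<kappa>' \<circ> param \<kappa>) (coord \<kappa> p) v)
                          (pderiv_at (coord \<kappa>' \<circ> param \<kappa>) (coord \<kappa> p) w)) \<and>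
     (\<forall>p \<kappa> v w. \<kappa> \<notin> charts_at A p \<longrightarrow> h \<kappa> p v w = 0)"

definition riemannian_metric :: "'a::t2_space chart set \<Rightarrow> 'a tensor2 \<Rightarrow> bool" where
  "riemannian_metric A g \<longleftrightarrow> sym_tensor A g \<and>
     (\<forall>\<kappa>\<in>smooth_charts A. \<forall>v w. smooth_on (im_ch \<kappa>) (\<lambda>z. g \<kappa> (param \<kappa> z) v w)) \<and>
     (\<forall>p. \<forall>\<kappa>\<in>charts_at A p. \<forall>v. v \<noteq> 0 \<longrightarrow> g \<kappa> p v v > 0)"

definition conformal_class :: "'a::t2_space chart set \<Rightarrow> 'a tensor2 set \<Rightarrow> bool" where
  "conformal_class A c \<longleftrightarrow> (\<exists>g. riemannian_metric A g \<and>
     c = {h. riemannian_metric A h \<and>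
             (\<exists>r. (\<forall>p. r p > 0) \<and> (\<forall>\<kappa> p v w. h \<kappa> p v w = r p * g \<kappa> p v w))})"

text \<open>Conformal coordinates: those in which the metrics of \<open>c\<close> are multiples of \<open>|dz|\<^sup>2\<close>.\<close>

definition conformal_charts :: "'a::t2_space chart set \<Rightarrow> 'a tensor2 set \<Rightarrow> 'a chart set" where
  "conformal_charts A c = {\<kappa> \<in> smooth_charts A. \<forall>g\<in>c. \<forall>p\<in>dom_ch \<kappa>. \<exists>r>0. \<forall>v w.
     g \<kappa> p v w = r * (v \<bullet> w)}"

text \<open>The factor \<open>|z|\<^sup>2\<^sup>\<beta>\<close>. As \<open>0 powr a = 0\<close> for all \<open>a\<close>, it is 0 at the origin when
  \<open>\<beta> \<noteq> 0\<close>; thus a metric is given the value 0 at its genuine conical singularities.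
  For \<open>\<beta> > 0\<close> this is the continuous extension, and it is the value of \<open>\<Phi>\<^sup>*g\<close> at
  a branch point of \<open>\<Phi>\<close>; for \<open>\<beta> < 0\<close> it is a mere convention.\<close>

definition cone_weight :: "real \<Rightarrow> complex \<Rightarrow> real" where
  "cone_weight \<beta> z = (if \<beta> = 0 then 1 else norm z powr (2 * \<beta>))"

text \<open>The metrics with possible conical singularities in the class \<open>c\<close>.\<close>

definition conical_metrics :: "'a::t2_space chart set \<Rightarrow> 'a tensor2 set \<Rightarrow> 'a tensor2 set" where
  "conical_metrics A c = {g. sym_tensor A g \<and> (\<exists>P. finite P \<and>
     (\<exists>g\<^sub>0\<in>c. \<exists>f. smooth_fun A (- P) f \<and> (\<forall>p\<in>- P. f p > 0) \<and>
        (\<forall>p\<in>- P. \<forall>\<kappa> v w. g \<kappa> p v w = f p * g\<^sub>0 \<kappa> p v w)) \<and>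
     (\<forall>p\<in>P. \<exists>\<kappa>\<in>conformal_charts A c. p \<in> dom_ch \<kappa> \<and> coord \<kappa> p = 0 \<and>
        (\<exists>\<beta>>-1. \<exists>\<rho>. smooth_on (im_ch \<kappa>) \<rho> \<and> (\<forall>z\<in>im_ch \<kappa>. \<rho> z > 0) \<and>
           (\<forall>q\<in>dom_ch \<kappa>. \<forall>v w.
              g \<kappa> q v w = \<rho> (coord \<kappa> q) * cone_weight \<beta> (coord \<kappa> q) * (v \<bullet> w)))))}"


section \<open>Area measure, weak differentials and the first eigenvalue\<close>

definition gram_det :: "'a tensor2 \<Rightarrow> 'a chart \<Rightarrow> 'a \<Rightarrow> real" where
  "gram_det h \<kappa> p = h \<kappa> p 1 1 * h \<kappa> p \<i> \<i> - (h \<kappa> p 1 \<i>)\<^sup>2"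

text \<open>The area measure is the unique Borel measure with the density
  \<open>sqrt (det h)\<close> in every chart.\<close>

definition area_measure :: "'a::t2_space chart set \<Rightarrow> 'a tensor2 \<Rightarrow> 'a measure" where
  "area_measure A h = (THE \<mu>. sets \<mu> = sets borel \<and>
     (\<forall>\<kappa>\<in>smooth_charts A. \<forall>B\<in>sets borel. B \<subseteq> dom_ch \<kappa> \<longrightarrow>
        emeasure \<mu> B = (\<integral>\<^sup>+z\<in>coord \<kappa> ` B. ennreal (sqrt (gram_det h \<kappa> (param \<kappa> z))) \<partial>lborel)))"

text \<open>1-forms are given by components, like 2-tensors.\<close>

type_synonym 'a form1 = "'a chart \<Rightarrow> 'a \<Rightarrow> complex \<Rightarrow> real"

definition one_form :: "'a::t2_space chart set \<Rightarrow> 'a form1 \<Rightarrow> bool" where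
  "one_form A \<omega> \<longleftrightarrow>
     (\<forall>p. \<forall>\<kappa>\<in>charts_at A p. linear (\<omega> \<kappa> p)) \<and>
     (\<forall>p. \<forall>\<kappa>\<in>charts_at A p. \<forall>\<kappa>'\<in>charts_at A p. \<forall>v.
        \<omega> \<kappa> p v = \<omega> \<kappa>' p (pderiv_at (coord \<kappa>' \<circ> param \<kappa>) (coord \<kappa> p) v))"

text \<open>\<open>|\<omega>|\<^sup>2\<close> with respect to a Riemannian metric, i.e. \<open>g\<^sup>i\<^sup>j \<omega>\<^sub>i \<omega>\<^sub>j\<close> with the inverse of the
  2 by 2 Gram matrix written out; it does not depend on the chart chosen.\<close>

definition form_norm_sq :: "'a::t2_space chart set \<Rightarrow> 'a tensor2 \<Rightarrow> 'a form1 \<Rightarrow> 'a \<Rightarrow> real" where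
  "form_norm_sq A g \<omega> p = (let \<kappa> = (SOME \<kappa>. \<kappa> \<in> charts_at A p) in
     (g \<kappa> p \<i> \<i> * (\<omega> \<kappa> p 1)\<^sup>2 - 2 * g \<kappa> p 1 \<i> * \<omega> \<kappa> p 1 * \<omega> \<kappa> p \<i> + g \<kappa> p 1 1 * (\<omega> \<kappa> p \<i>)\<^sup>2)
     / gram_det g \<kappa> p)"

text \<open>\<open>\<omega>\<close> is the distributional differential of \<open>u\<close>.\<close>

definition is_weak_differential ::
  "'a::t2_space chart set \<Rightarrow> ('a \<Rightarrow> real) \<Rightarrow> 'a form1 \<Rightarrow> bool" where
  "is_weak_differential A u \<omega> \<longleftrightarrow> one_form A \<omega> \<and> (\<forall>\<kappa>\<in>smooth_charts A.
     \<forall>K v. compact K \<and> K \<subseteq> im_ch \<kappa> \<longrightarrow>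
       set_integrable lborel K (\<lambda>z. u (param \<kappa> z)) \<and>
       set_integrable lborel K (\<lambda>z. \<omega> \<kappa> (param \<kappa> z) v) \<and>
       (\<forall>\<eta>. smooth_on UNIV \<eta> \<and> (\<forall>z. z \<notin> K \<longrightarrow> \<eta> z = 0) \<longrightarrow>
         (LINT z|lborel. u (param \<kappa> z) * pderiv_at \<eta> z v) =
         - (LINT z|lborel. \<omega> \<kappa> (param \<kappa> z) v * \<eta> z)))"

definition weak_differential :: "'a::t2_space chart set \<Rightarrow> ('a \<Rightarrow> real) \<Rightarrow> 'a form1" where
  "weak_differential A u = (SOME \<omega>. is_weak_differential A u \<omega>)"

definition dirichlet_energy ::
  "'a::t2_space chart set \<Rightarrow> 'a tensor2 \<Rightarrow> ('a \<Rightarrow> real) \<Rightarrow> real" where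
  "dirichlet_energy A g\<^sub>0 u =
     (LINT p|area_measure A g\<^sub>0. form_norm_sq A g\<^sub>0 (weak_differential A u) p)"

text \<open>\<open>{u \<in> L\<^sup>2(dV(g)). \<integral>|\<nabla>u|\<^sup>2 dV(g\<^sub>0) < \<infinity>}\<close>. As functions, its elements are Borel
  representatives of \<open>L\<^sup>2\<close> classes.\<close>

definition finite_energy_functions ::
  "'a::t2_space chart set \<Rightarrow> 'a tensor2 \<Rightarrow> 'a tensor2 \<Rightarrow> ('a \<Rightarrow> real) set" where
  "finite_energy_functions A g\<^sub>0 g = {u. u \<in> borel_measurable borel \<and>
     integrable (area_measure A g) (\<lambda>p. (u p)\<^sup>2) \<and>
     (\<exists>\<omega>. is_weak_differential A u \<omega>) \<and>
     integrable (area_measure A g\<^sub>0) (form_norm_sq A g\<^sub>0 (weak_differential A u))}"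

definition h1_norm_sq ::
  "'a::t2_space chart set \<Rightarrow> 'a tensor2 \<Rightarrow> 'a tensor2 \<Rightarrow> ('a \<Rightarrow> real) \<Rightarrow> real" where
  "h1_norm_sq A g\<^sub>0 g u = (LINT p|area_measure A g. (u p)\<^sup>2) + dirichlet_energy A g\<^sub>0 u"

text \<open>The elements of the completion \<open>H\<^sup>1\<close> are represented by Cauchy sequences; the norm, the energy
  and the integrals in the Rayleigh quotient extend to them as limits.
  A function \<open>u\<close> is identified with the constant sequence \<open>u, u, u, \<dots>\<close>.\<close>

definition H1 ::
  "'a::t2_space chart set \<Rightarrow> 'a tensor2 \<Rightarrow> 'a tensor2 \<Rightarrow> (nat \<Rightarrow> 'a \<Rightarrow> real) set" where
  "H1 A g\<^sub>0 g = {u. (\<forall>k. u k \<in> finite_energy_functions A g\<^sub>0 g) \<and>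
     (\<forall>e>0. \<exists>N. \<forall>m\<ge>N. \<forall>n\<ge>N. h1_norm_sq A g\<^sub>0 g (\<lambda>p. u m p - u n p) < e)}"

definition lambda1_competitors ::
  "'a::t2_space chart set \<Rightarrow> 'a tensor2 \<Rightarrow> 'a tensor2 \<Rightarrow> (nat \<Rightarrow> 'a \<Rightarrow> real) set" where
  "lambda1_competitors A g\<^sub>0 g = {u \<in> H1 A g\<^sub>0 g.
     lim (\<lambda>k. h1_norm_sq A g\<^sub>0 g (u k)) \<noteq> 0 \<and>
     lim (\<lambda>k. LINT p|area_measure A g. u k p) = 0}"

definition rayleigh_quotient ::
  "'a::t2_space chart set \<Rightarrow> 'a tensor2 \<Rightarrow> 'a tensor2 \<Rightarrow> (nat \<Rightarrow> 'a \<Rightarrow> real) \<Rightarrow> real" where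
  "rayleigh_quotient A g\<^sub>0 g u = lim (\<lambda>k. dirichlet_energy A g\<^sub>0 (u k)) /
     lim (\<lambda>k. LINT p|area_measure A g. (u k p)\<^sup>2)"

definition lambda1 :: "'a::t2_space chart set \<Rightarrow> 'a tensor2 \<Rightarrow> 'a tensor2 \<Rightarrow> real" where
  "lambda1 A g\<^sub>0 g = Inf (rayleigh_quotient A g\<^sub>0 g ` lambda1_competitors A g\<^sub>0 g)"

definition lambda1_eigenspace ::
  "'a::t2_space chart set \<Rightarrow> 'a tensor2 \<Rightarrow> 'a tensor2 \<Rightarrow> ('a \<Rightarrow> real) set" where
  "lambda1_eigenspace A g\<^sub>0 g = {u. (\<forall>p. u p = 0) \<or>
     ((\<lambda>k. u) \<in> lambda1_competitors A g\<^sub>0 g \<and>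
      rayleigh_quotient A g\<^sub>0 g (\<lambda>k. u) = lambda1 A g\<^sub>0 g)}"


section \<open>Branched minimal immersions\<close>

text \<open>Spheres are \<open>nsphere n\<close>: the points of \<open>\<real>\<^sup>n\<^sup>+\<^sup>1\<close> are the sequences
  \<open>nat \<Rightarrow> real\<close> vanishing beyond index \<open>n\<close>.\<close>

definition coord_deriv :: "('a \<Rightarrow> nat \<Rightarrow> real) \<Rightarrow> 'a chart \<Rightarrow> 'a \<Rightarrow> complex \<Rightarrow> nat \<Rightarrow> real" where
  "coord_deriv \<Phi> \<kappa> p v i = pderiv_at (\<lambda>z. \<Phi> (param \<kappa> z) i) (coord \<kappa> p) v"

text \<open>\<open>\<Phi>\<^sup>*g\<^sub>c\<^sub>a\<^sub>n\<close>\<close>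

definition pullback_metric ::
  "'a::t2_space chart set \<Rightarrow> nat \<Rightarrow> ('a \<Rightarrow> nat \<Rightarrow> real) \<Rightarrow> 'a tensor2" where
  "pullback_metric A n \<Phi> = (\<lambda>\<kappa> p v w. if \<kappa> \<in> charts_at A p
     then \<Sum>i\<le>n. coord_deriv \<Phi> \<kappa> p v i * coord_deriv \<Phi> \<kappa> p w i else 0)"

text \<open>The (positive) Laplacian \<open>-(det g)\<^sup>-\<^sup>1\<^sup>/\<^sup>2 \<partial>\<^sub>i((det g)\<^sup>1\<^sup>/\<^sup>2 g\<^sup>i\<^sup>j \<partial>\<^sub>j u)\<close> in the coordinates \<open>\<kappa>\<close>.\<close>

definition laplacian :: "'a tensor2 \<Rightarrow> 'a chart \<Rightarrow> ('a \<Rightarrow> real) \<Rightarrow> 'a \<Rightarrow> real" where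
  "laplacian g \<kappa> u p =
     (let W = (\<lambda>z. sqrt (gram_det g \<kappa> (param \<kappa> z)));
          ux = (\<lambda>z. pderiv_at (u \<circ> param \<kappa>) z 1);
          uy = (\<lambda>z. pderiv_at (u \<circ> param \<kappa>) z \<i>);
          X = (\<lambda>z. (g \<kappa> (param \<kappa> z) \<i> \<i> * ux z - g \<kappa> (param \<kappa> z) 1 \<i> * uy z) / W z);
          Y = (\<lambda>z. (g \<kappa> (param \<kappa> z) 1 1 * uy z - g \<kappa> (param \<kappa> z) 1 \<i> * ux z) / W z)
      in - (pderiv_at X (coord \<kappa> p) 1 + pderiv_at Y (coord \<kappa> p) \<i>) / W (coord \<kappa> p))"

text \<open>Vanishing of the tension field of \<open>\<Phi> : \<Sigma> \<rightarrow> S\<^sup>n\<close> at \<open>p\<close>, the tension field being the component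
  of the vector \<open>\<Delta>\<Phi>(p)\<close> of \<open>\<real>\<^sup>n\<^sup>+\<^sup>1\<close> tangent to the sphere at \<open>\<Phi>(p)\<close>.\<close>

definition harmonic_at ::
  "'a::t2_space chart set \<Rightarrow> 'a tensor2 \<Rightarrow> nat \<Rightarrow> ('a \<Rightarrow> nat \<Rightarrow> real) \<Rightarrow> 'a \<Rightarrow> bool" where
  "harmonic_at A g\<^sub>0 n \<Phi> p \<longleftrightarrow> (\<forall>\<kappa>\<in>charts_at A p. \<forall>w::nat \<Rightarrow> real.
     (\<Sum>i\<le>n. w i * \<Phi> p i) = 0 \<longrightarrow> (\<Sum>i\<le>n. w i * laplacian g\<^sub>0 \<kappa> (\<lambda>q. \<Phi> q i) p) = 0)"

definition conformal_at ::
  "'a::t2_space chart set \<Rightarrow> 'a tensor2 \<Rightarrow> nat \<Rightarrow> ('a \<Rightarrow> nat \<Rightarrow> real) \<Rightarrow> 'a \<Rightarrow> bool" where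
  "conformal_at A g\<^sub>0 n \<Phi> p \<longleftrightarrow>
     (\<exists>r>0. \<forall>\<kappa> v w. pullback_metric A n \<Phi> \<kappa> p v w = r * g\<^sub>0 \<kappa> p v w)"

definition branch_point ::
  "'a::t2_space chart set \<Rightarrow> nat \<Rightarrow> ('a \<Rightarrow> nat \<Rightarrow> real) \<Rightarrow> 'a \<Rightarrow> bool" where
  "branch_point A n \<Phi> p \<longleftrightarrow> (\<forall>\<kappa>\<in>charts_at A p. \<forall>v. \<forall>i\<le>n. coord_deriv \<Phi> \<kappa> p v i = 0)"

definition branched_minimal_immersion ::
  "'a::t2_space chart set \<Rightarrow> 'a tensor2 set \<Rightarrow> nat \<Rightarrow> ('a \<Rightarrow> nat \<Rightarrow> real) \<Rightarrow> bool" where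
  "branched_minimal_immersion A c n \<Phi> \<longleftrightarrow>
     (\<forall>p. \<Phi> p \<in> topspace (nsphere n)) \<and>
     (\<forall>i\<le>n. smooth_fun A UNIV (\<lambda>p. \<Phi> p i)) \<and>
     (\<exists>p q. \<Phi> p \<noteq> \<Phi> q) \<and>
     finite {p. branch_point A n \<Phi> p} \<and>
     (\<forall>g\<^sub>0\<in>c. \<forall>p. \<not> branch_point A n \<Phi> p \<longrightarrow> harmonic_at A g\<^sub>0 n \<Phi> p \<and> conformal_at A g\<^sub>0 n \<Phi> p)"

text \<open>\<open>g\<close>, a metric with possible conical singularities in \<open>c\<close>, admits the branched minimal
  immersion \<open>\<Phi>\<close> to \<open>S\<^sup>n\<close>, and \<open>\<Phi>\<close> is by first eigenfunctions. The eigenspace does not depend on the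
  choice of \<open>g\<^sub>0\<close> in \<open>c\<close>, the Dirichlet energy being conformally invariant.\<close>

definition immersed_by_first_eigenfunctions ::
  "'a::t2_space chart set \<Rightarrow> 'a tensor2 set \<Rightarrow> 'a tensor2 \<Rightarrow> nat \<Rightarrow> ('a \<Rightarrow> nat \<Rightarrow> real) \<Rightarrow> bool" where
  "immersed_by_first_eigenfunctions A c g n \<Phi> \<longleftrightarrow>
     g \<in> conical_metrics A c \<and> branched_minimal_immersion A c n \<Phi> \<and>
     pullback_metric A n \<Phi> = g \<and>
     (\<exists>g\<^sub>0\<in>c. \<forall>i\<le>n. (\<lambda>p. \<Phi> p i) \<in> lambda1_eigenspace A g\<^sub>0 g)"


section \<open>Equatorial 2-spheres and conformal automorphisms\<close>

text \<open>\<open>a\<close>, \<open>b\<close>, \<open>d\<close> is a basis of the 3-dimensional linear subspace.\<close>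

definition equatorial_two_sphere :: "nat \<Rightarrow> (nat \<Rightarrow> real) set \<Rightarrow> bool" where
  "equatorial_two_sphere n E \<longleftrightarrow> (\<exists>a b d.
     {a, b, d} \<subseteq> topspace (Euclidean_space (Suc n)) \<and>
     (\<forall>x y z. (\<forall>i. x * a i + y * b i + z * d i = 0) \<longrightarrow> x = 0 \<and> y = 0 \<and> z = 0) \<and>
     E = topspace (nsphere n) \<inter> {\<lambda>i. x * a i + y * b i + z * d i | x y z :: real. True})"

text \<open>Smooth conformal self-maps of the unit sphere of \<open>\<real>\<^sup>3\<close>. Smoothness means smooth extendability
  to a neighbourhood; the differential is only tested on tangent vectors, so it
  does not depend on the extension. Orientation reversing maps are included.\<close>

definition conformal_sphere_map :: "(real^3 \<Rightarrow> real^3) \<Rightarrow> bool" where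
  "conformal_sphere_map T \<longleftrightarrow> T ` sphere 0 1 \<subseteq> sphere 0 1 \<and>
     (\<exists>U F. open U \<and> sphere 0 1 \<subseteq> U \<and> smooth_on U F \<and> (\<forall>x\<in>sphere 0 1. F x = T x) \<and>
        (\<forall>x\<in>sphere 0 1. \<exists>r>0. \<forall>v w. v \<bullet> x = 0 \<and> w \<bullet> x = 0 \<longrightarrow>
           pderiv_at F x v \<bullet> pderiv_at F x w = r * (v \<bullet> w)))"

definition conformal_automorphism_S2 :: "(real^3 \<Rightarrow> real^3) \<Rightarrow> bool" where
  "conformal_automorphism_S2 T \<longleftrightarrow> bij_betw T (sphere 0 1) (sphere 0 1) \<and>
     conformal_sphere_map T \<and> conformal_sphere_map (inv_into (sphere 0 1) T)"

text \<open>The identification of \<open>topspace (nsphere 2)\<close> with the unit sphere of \<open>\<real>\<^sup>3\<close>.\<close>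

definition to_R3 :: "(nat \<Rightarrow> real) \<Rightarrow> real^3" where
  "to_R3 x = vector [x 0, x 1, x 2]"


section \<open>The three categories\<close>

definition category_1 :: "'a::t2_space chart set \<Rightarrow> 'a tensor2 set \<Rightarrow> bool" where
  "category_1 A c \<longleftrightarrow> \<not> (\<exists>g n \<Phi>. immersed_by_first_eigenfunctions A c g n \<Phi>)"

definition category_2 :: "'a::t2_space chart set \<Rightarrow> 'a tensor2 set \<Rightarrow> bool" where
  "category_2 A c \<longleftrightarrow> (\<exists>!g. \<exists>m \<Phi>. immersed_by_first_eigenfunctions A c g m \<Phi> \<and>
     \<not> equatorial_two_sphere m (range \<Phi>))"

definition category_3 :: "'a::t2_space chart set \<Rightarrow> 'a tensor2 set \<Rightarrow> bool" where
  "category_3 A c \<longleftrightarrow> (\<exists>g \<Phi>. immersed_by_first_eigenfunctions A c g 2 \<Phi>)"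

end

theory Submission
  imports Defs "HOL-Computational_Algebra.Polynomial"
begin

text \<open>An immersion by first eigenfunctions has first eigenvalue 2. Given two of them, with maps \<open>F\<close>
  and \<open>G\<close>, Hersch's trick provides a conformal map of the target ball, with parameter \<open>b\<close>, such that
  the composition with \<open>F\<close> has mean zero for the metric of \<open>G\<close> and can serve as a family of test
  functions. The two resulting inequalities between the areas force equality: the
  metric of \<open>G\<close> is the one induced by the composition, and the gradient of \<open>b \<bullet> F\<close> is as large as
  possible, so that \<open>b\<close> lies in the span of \<open>F\<close> and its differential at every point. If \<open>b = 0\<close>, the
  metrics agree. If \<open>b \<noteq> 0\<close>, differentiating this relation and using minimality shows that
  the second fundamental form is degenerate and trace-free, hence zero. By unique continuation,
  \<open>F\<close> then stays in a 3-dimensional subspace and covers its unit sphere, and two such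
  maps which induce the same metric differ by an isometry.\<close>

section \<open>Finite-dimensional vectors as sequences\<close>

text \<open>The eigenvalue is 2 because the squared coordinates of a map into a unit sphere sum to 1
  while their energies sum to twice the area. All variational arguments run over one smooth metric
  of the class: the Dirichlet integral is conformally invariant in dimension two, so another metric
  of the class enters only through its area density, a weight that may vanish at branch points. The
  test functions are rational in the coordinates of smooth maps, hence C^1; eigenfunctions are used
  only as minimisers against C^1 variations, and from the completion it must only be known that
  Rayleigh quotients stay nonnegative. Hersch's parameter maximises an explicit functional on the
  ball, which replaces a degree argument; its behaviour at the boundary rests on fibres being null
  sets. That conformal maps of the ball do not increase the area is the eigenvalue equation for
  \<open>b . F\<close> tested with \<open>1 / (1 + b . F)\<close>. Branch points do not interrupt
  unique continuation, as they are finite in number and punctured discs are connected.\<close>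

definition dot :: "nat \<Rightarrow> (nat \<Rightarrow> real) \<Rightarrow> (nat \<Rightarrow> real) \<Rightarrow> real" where
  "dot n x y = (\<Sum>i\<le>n. x i * y i)"

lemma dot_commute: "dot n x y = dot n y x"
  by (simp add: dot_def mult.commute)

lemma dot_add_left: "dot n (\<lambda>i. x i + y i) z = dot n x z + dot n y z"
  by (simp add: dot_def sum.distrib algebra_simps)

lemma dot_diff_left: "dot n (\<lambda>i. x i - y i) z = dot n x z - dot n y z"
  by (simp add: dot_def sum_subtractf algebra_simps)

lemma dot_minus_left: "dot n (\<lambda>i. - x i) z = - dot n x z"
  by (simp add: dot_def sum_negf)

lemma dot_scale_left: "dot n (\<lambda>i. a * x i) z = a * dot n x z"
  by (simp add: dot_def sum_distrib_left mult.assoc)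

lemma dot_zero_left [simp]: "dot n (\<lambda>i. 0) z = 0"
  by (simp add: dot_def)

lemma dot_add_right: "dot n z (\<lambda>i. x i + y i) = dot n z x + dot n z y"
  by (simp add: dot_def sum.distrib algebra_simps)

lemma dot_diff_right: "dot n z (\<lambda>i. x i - y i) = dot n z x - dot n z y"
  by (simp add: dot_def sum_subtractf algebra_simps)

lemma dot_minus_right: "dot n z (\<lambda>i. - x i) = - dot n z x"
  by (simp add: dot_def sum_negf)

lemma dot_scale_right: "dot n z (\<lambda>i. a * x i) = a * dot n z x"
  by (simp add: dot_def sum_distrib_left algebra_simps)

lemma dot_zero_right [simp]: "dot n z (\<lambda>i. 0) = 0"
  by (simp add: dot_def)

lemmas dot_linear = dot_add_left dot_diff_left dot_minus_left dot_scale_left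
  dot_add_right dot_diff_right dot_minus_right dot_scale_right

lemma dot_self_nonneg [simp]: "0 \<le> dot n x x"
  by (simp add: dot_def sum_nonneg)

lemma dot_self_eq_0_iff: "dot n x x = 0 \<longleftrightarrow> (\<forall>i\<le>n. x i = 0)"
  by (auto simp: dot_def sum_nonneg_eq_0_iff)

lemma dot_Cauchy_Schwarz: "(dot n x y)\<^sup>2 \<le> dot n x x * dot n y y"
  using Cauchy_Schwarz_ineq_sum[of x y "{..n}"] by (simp add: dot_def power2_eq_square)

lemma dot_cong: "(\<And>i. i \<le> n \<Longrightarrow> x i = x' i) \<Longrightarrow> (\<And>i. i \<le> n \<Longrightarrow> y i = y' i) \<Longrightarrow> dot n x y = dot n x' y'"
  by (simp add: dot_def)

lemma coord_le_dot: "i \<le> n \<Longrightarrow> (x i)\<^sup>2 \<le> dot n x x"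
  unfolding dot_def power2_eq_square
  by (rule member_le_sum[where f = "\<lambda>i. x i * x i"]) auto

text \<open>Pythagoras: \<open>w\<close> is what remains of \<open>b\<close> after projecting off
  the orthogonal system \<open>f\<close>, \<open>x\<close>, \<open>y\<close>. In the application
  \<open>f\<close> is a point of the image and \<open>x\<close>, \<open>y\<close> are derivatives
  along an orthonormal frame, both of squared length \<open>r\<close>, the conformal factor.\<close>

lemma dot_residual_square:
  fixes b :: "nat \<Rightarrow> real"
  assumes "dot n f f = 1" "dot n x x = r" "dot n y y = r" "dot n x y = 0" "dot n f x = 0"
    "dot n f y = 0" "r \<noteq> 0"
    and w: "w = (\<lambda>i. b i - dot n b f * f i - (dot n b x / r) * x i - (dot n b y / r) * y i)"
  shows "r * dot n w w = r * (dot n b b - (dot n b f)\<^sup>2) - (dot n b x)\<^sup>2 - (dot n b y)\<^sup>2"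
proof -
  have "dot n w w = dot n b b - (dot n b f)\<^sup>2 - (dot n b x)\<^sup>2 / r - (dot n b y)\<^sup>2 / r"
    unfolding w dot_linear using assms(1-7)
    by (simp add: dot_commute[of n x f] dot_commute[of n y f] dot_commute[of n y x]
        dot_commute[of n x b] dot_commute[of n y b] dot_commute[of n f b] power2_eq_square)
  thus ?thesis using assms(7) by (simp add: right_diff_distrib)
qed

text \<open>Bessel's inequality multiplied by \<open>r\<close>; in this form it survives at branch
  points, where \<open>x\<close> and \<open>y\<close> vanish.\<close>

lemma dot_Bessel:
  assumes "dot n f f = 1" "dot n x x = r" "dot n y y = r" "dot n x y = 0" "dot n f x = 0"
    "dot n f y = 0"
  shows "(dot n b x)\<^sup>2 + (dot n b y)\<^sup>2 \<le> r * (dot n b b - (dot n b f)\<^sup>2)"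
proof (cases "r = 0")
  case True
  hence "\<forall>i\<le>n. x i = 0" "\<forall>i\<le>n. y i = 0"
    using assms dot_self_eq_0_iff by auto
  thus ?thesis using True by (simp add: dot_def)
next
  case False
  hence "r > 0" using assms(2) dot_self_nonneg[of n x] by linarith
  define w where "w = (\<lambda>i. b i - dot n b f * f i - (dot n b x / r) * x i - (dot n b y / r) * y i)"
  have "0 \<le> r * dot n w w" using \<open>r > 0\<close> by simp
  thus ?thesis
    using dot_residual_square[OF assms False w_def] by linarith
qed

lemma dot_Bessel_eq:
  assumes "dot n f f = 1" "dot n x x = r" "dot n y y = r" "dot n x y = 0" "dot n f x = 0"
    "dot n f y = 0" "r > 0" "(dot n b x)\<^sup>2 + (dot n b y)\<^sup>2 = r * (dot n b b - (dot n b f)\<^sup>2)" "i \<le> n"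
  shows "b i = dot n b f * f i + (dot n b x / r) * x i + (dot n b y / r) * y i"
proof -
  define w where "w = (\<lambda>i. b i - dot n b f * f i - (dot n b x / r) * x i - (dot n b y / r) * y i)"
  have "r * dot n w w = 0"
    using dot_residual_square[OF assms(1-6) _ w_def] assms(7,8) by linarith
  hence "w i = 0" using assms(7,9) dot_self_eq_0_iff by auto
  thus ?thesis by (simp add: w_def)
qed

text \<open>Bolzano-Weierstrass, one coordinate at a time: vectors are sequences of which only the
  coordinates up to \<open>n\<close> matter, so convergence is always taken coordinatewise.\<close>

lemma bounded_coordinates_subsequence:
  fixes b :: "nat \<Rightarrow> nat \<Rightarrow> real"
  assumes "\<And>k i. i \<le> n \<Longrightarrow> \<bar>b k i\<bar> \<le> B"
  shows "\<exists>s l. strict_mono (s :: nat \<Rightarrow> nat) \<and> (\<forall>i\<le>n. (\<lambda>k. b (s k) i) \<longlonglongrightarrow> l i)"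
  using assms
proof (induction n)
  case 0
  have "bounded (range (\<lambda>k. b k 0))" unfolding bounded_iff using 0 by (auto intro!: exI[of _ B])
  then obtain l s where "strict_mono (s :: nat \<Rightarrow> nat)" "((\<lambda>k. b k 0) \<circ> s) \<longlonglongrightarrow> l"
    using bounded_imp_convergent_subsequence by blast
  thus ?case by (intro exI[of _ s] exI[of _ "\<lambda>_. l"]) (auto simp: o_def)
next
  case (Suc n)
  then obtain s l where s: "strict_mono (s :: nat \<Rightarrow> nat)" "\<forall>i\<le>n. (\<lambda>k. b (s k) i) \<longlonglongrightarrow> l i"
    by (metis le_SucI)
  have "bounded (range (\<lambda>k. b (s k) (Suc n)))"
    unfolding bounded_iff using Suc.prems by (auto intro!: exI[of _ B])
  then obtain l' s' where s': "strict_mono (s' :: nat \<Rightarrow> nat)" "((\<lambda>k. b (s k) (Suc n)) \<circ> s') \<longlonglongrightarrow> l'"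
    using bounded_imp_convergent_subsequence by blast
  have "(\<lambda>k. b ((s \<circ> s') k) i) \<longlonglongrightarrow> (l(Suc n := l')) i" if "i \<le> Suc n" for i
  proof (cases "i = Suc n")
    case True
    thus ?thesis using s'(2) by (simp add: o_def)
  next
    case False
    hence "(\<lambda>k. b (s k) i) \<longlonglongrightarrow> l i" using s(2) that by auto
    from LIMSEQ_subseq_LIMSEQ[OF this s'(1)] show ?thesis using False by (simp add: o_def)
  qed
  moreover have "strict_mono (s \<circ> s')" using s(1) s'(1) by (rule strict_mono_o)
  ultimately show ?case by blast
qed

section \<open>Abstract gradient structures\<close>

text \<open>The part of surface geometry that the variational argument uses. \<open>C\<close> stands
  for the C^1 functions, \<open>D1\<close> and \<open>D2\<close> for the derivatives along an
  orthonormal frame of a background metric with area measure \<open>\<mu>\<close>. On the surface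
  the frame is taken in a chart chosen separately at each point, so \<open>D1 u\<close> and
  \<open>D2 u\<close> need not be continuous; only the frame independent sum in
  \<open>grad_cont\<close> is required to be.\<close>

locale gradient_structure = finite_measure \<mu>
  for \<mu> :: "'a::t2_space measure" +
  fixes C :: "('a \<Rightarrow> real) set" and D1 D2 :: "('a \<Rightarrow> real) \<Rightarrow> 'a \<Rightarrow> real"
  assumes compact_space: "compact (UNIV :: 'a set)"
    and sets_mu: "sets \<mu> = sets borel"
    and open_pos: "\<And>U. open U \<Longrightarrow> U \<noteq> {} \<Longrightarrow> emeasure \<mu> U \<noteq> 0"
    and C_cont: "\<And>u. u \<in> C \<Longrightarrow> continuous_on UNIV u"
    and C_const: "\<And>a. (\<lambda>_. a) \<in> C"
    and C_add: "\<And>u v. u \<in> C \<Longrightarrow> v \<in> C \<Longrightarrow> (\<lambda>p. u p + v p) \<in> C"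
    and C_mult: "\<And>u v. u \<in> C \<Longrightarrow> v \<in> C \<Longrightarrow> (\<lambda>p. u p * v p) \<in> C"
    and C_inverse: "\<And>u. u \<in> C \<Longrightarrow> (\<And>p. u p \<noteq> 0) \<Longrightarrow> (\<lambda>p. inverse (u p)) \<in> C"
    and D1_const: "\<And>a p. D1 (\<lambda>_. a) p = 0"
    and D2_const: "\<And>a p. D2 (\<lambda>_. a) p = 0"
    and D1_add: "\<And>u v p. u \<in> C \<Longrightarrow> v \<in> C \<Longrightarrow> D1 (\<lambda>p. u p + v p) p = D1 u p + D1 v p"
    and D2_add: "\<And>u v p. u \<in> C \<Longrightarrow> v \<in> C \<Longrightarrow> D2 (\<lambda>p. u p + v p) p = D2 u p + D2 v p"
    and D1_mult: "\<And>u v p. u \<in> C \<Longrightarrow> v \<in> C \<Longrightarrow> D1 (\<lambda>p. u p * v p) p = u p * D1 v p + D1 u p * v p"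
    and D2_mult: "\<And>u v p. u \<in> C \<Longrightarrow> v \<in> C \<Longrightarrow> D2 (\<lambda>p. u p * v p) p = u p * D2 v p + D2 u p * v p"
    and grad_cont: "\<And>u v. u \<in> C \<Longrightarrow> v \<in> C \<Longrightarrow> continuous_on UNIV (\<lambda>p. D1 u p * D1 v p + D2 u p * D2 v p)"
begin

definition grad_inner :: "('a \<Rightarrow> real) \<Rightarrow> ('a \<Rightarrow> real) \<Rightarrow> 'a \<Rightarrow> real" where
  "grad_inner u v p = D1 u p * D1 v p + D2 u p * D2 v p"

definition energy :: "('a \<Rightarrow> real) \<Rightarrow> ('a \<Rightarrow> real) \<Rightarrow> real" where
  "energy u v = (LINT p|\<mu>. grad_inner u v p)"

lemma space_mu: "space \<mu> = UNIV"
  using sets_eq_imp_space_eq[OF sets_mu] by simp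

lemma cont_measurable: "continuous_on UNIV f \<Longrightarrow> f \<in> borel_measurable \<mu>"
  using borel_measurable_continuous_onI measurable_cong_sets[OF sets_mu refl] by blast

lemma cont_integrable:
  fixes f :: "'a \<Rightarrow> real"
  assumes "continuous_on UNIV f"
  shows "integrable \<mu> f"
proof -
  have "bounded (f ` UNIV)"
    using assms compact_space compact_continuous_image compact_imp_bounded by blast
  then obtain B where "\<And>p. norm (f p) \<le> B" by (auto simp: bounded_iff)
  thus ?thesis
    using integrable_const_bound[of f B] cont_measurable[OF assms] by auto
qed

lemma C_integrable: "u \<in> C \<Longrightarrow> integrable \<mu> u"
  by (simp add: C_cont cont_integrable)

lemma C_scale: "u \<in> C \<Longrightarrow> (\<lambda>p. a * u p) \<in> C"
  using C_mult[OF C_const] .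

lemma C_minus: "u \<in> C \<Longrightarrow> (\<lambda>p. - u p) \<in> C"
  using C_scale[of u "-1"] by simp

lemma C_diff: "u \<in> C \<Longrightarrow> v \<in> C \<Longrightarrow> (\<lambda>p. u p - v p) \<in> C"
  using C_add[OF _ C_minus] by simp

lemma C_power2: "u \<in> C \<Longrightarrow> (\<lambda>p. (u p)\<^sup>2) \<in> C"
  using C_mult[of u u] by (simp add: power2_eq_square)

lemma C_divide: "u \<in> C \<Longrightarrow> v \<in> C \<Longrightarrow> (\<And>p. v p \<noteq> 0) \<Longrightarrow> (\<lambda>p. u p / v p) \<in> C"
  using C_mult[OF _ C_inverse] by (simp add: divide_inverse)

lemma C_sum: "(\<And>i. i \<in> I \<Longrightarrow> f i \<in> C) \<Longrightarrow> (\<lambda>p. \<Sum>i\<in>I. f i p) \<in> C"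
  by (induction I rule: infinite_finite_induct) (auto intro: C_const C_add)

lemmas C_intros = C_const C_add C_mult C_scale C_minus C_diff C_power2 C_divide C_sum

lemma D1_scale: "u \<in> C \<Longrightarrow> D1 (\<lambda>p. a * u p) p = a * D1 u p"
  using D1_mult[OF C_const] D1_const by simp

lemma D2_scale: "u \<in> C \<Longrightarrow> D2 (\<lambda>p. a * u p) p = a * D2 u p"
  using D2_mult[OF C_const] D2_const by simp

lemma D1_sum: "(\<And>i. i \<in> I \<Longrightarrow> f i \<in> C) \<Longrightarrow> D1 (\<lambda>p. \<Sum>i\<in>I. f i p) p = (\<Sum>i\<in>I. D1 (f i) p)"
  by (induction I rule: infinite_finite_induct) (auto simp: D1_const D1_add C_sum)

lemma D2_sum: "(\<And>i. i \<in> I \<Longrightarrow> f i \<in> C) \<Longrightarrow> D2 (\<lambda>p. \<Sum>i\<in>I. f i p) p = (\<Sum>i\<in>I. D2 (f i) p)"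
  by (induction I rule: infinite_finite_induct) (auto simp: D2_const D2_add C_sum)

lemma D1_divide:
  assumes "u \<in> C" "v \<in> C" "\<And>p. v p \<noteq> 0"
  shows "D1 (\<lambda>p. u p / v p) p = D1 u p / v p - u p * D1 v p / (v p)\<^sup>2"
proof -
  have "D1 (\<lambda>p. (u p / v p) * v p) p = (u p / v p) * D1 v p + D1 (\<lambda>p. u p / v p) p * v p"
    using assms by (intro D1_mult C_divide)
  moreover have "(\<lambda>p. (u p / v p) * v p) = u" using assms(3) by auto
  ultimately show ?thesis using assms(3)[of p] by (simp add: field_simps power2_eq_square)
qed

lemma D2_divide:
  assumes "u \<in> C" "v \<in> C" "\<And>p. v p \<noteq> 0"
  shows "D2 (\<lambda>p. u p / v p) p = D2 u p / v p - u p * D2 v p / (v p)\<^sup>2"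
proof -
  have "D2 (\<lambda>p. (u p / v p) * v p) p = (u p / v p) * D2 v p + D2 (\<lambda>p. u p / v p) p * v p"
    using assms by (intro D2_mult C_divide)
  moreover have "(\<lambda>p. (u p / v p) * v p) = u" using assms(3) by auto
  ultimately show ?thesis using assms(3)[of p] by (simp add: field_simps power2_eq_square)
qed

lemma grad_inner_cont: "u \<in> C \<Longrightarrow> v \<in> C \<Longrightarrow> continuous_on S (grad_inner u v)"
  using grad_cont[of u v] continuous_on_subset unfolding grad_inner_def by blast

lemma grad_inner_integrable: "u \<in> C \<Longrightarrow> v \<in> C \<Longrightarrow> integrable \<mu> (grad_inner u v)"
  by (simp add: cont_integrable grad_inner_cont)

lemma energy_commute: "energy u v = energy v u"
  by (simp add: energy_def grad_inner_def mult.commute)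

lemma energy_add_right:
  "u \<in> C \<Longrightarrow> v \<in> C \<Longrightarrow> w \<in> C \<Longrightarrow> energy u (\<lambda>p. v p + w p) = energy u v + energy u w"
  using Bochner_Integration.integral_add[OF grad_inner_integrable[of u v] grad_inner_integrable[of u w]]
  by (simp add: energy_def grad_inner_def[abs_def] D1_add D2_add algebra_simps)

lemma energy_scale_right:
  "u \<in> C \<Longrightarrow> v \<in> C \<Longrightarrow> energy u (\<lambda>p. a * v p) = a * energy u v"
  by (simp add: energy_def grad_inner_def D1_scale D2_scale algebra_simps
      flip: integral_mult_right_zero)

lemma energy_const_right: "energy u (\<lambda>_. a) = 0"
  by (simp add: energy_def grad_inner_def D1_const D2_const)

lemma energy_sum_right:
  "u \<in> C \<Longrightarrow> (\<And>i. i \<in> I \<Longrightarrow> f i \<in> C) \<Longrightarrow> energy u (\<lambda>p. \<Sum>i\<in>I. f i p) = (\<Sum>i\<in>I. energy u (f i))"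
  by (induction I rule: infinite_finite_induct) (auto simp: energy_const_right energy_add_right C_sum)

lemma integral_pos_zero:
  fixes f :: "'a \<Rightarrow> real"
  assumes "continuous_on UNIV f" "\<And>p. 0 \<le> f p" "(LINT p|\<mu>. f p) = 0"
  shows "f p = 0"
proof (rule ccontr)
  assume "f p \<noteq> 0"
  have "AE p in \<mu>. f p = 0"
    using integral_nonneg_eq_0_iff_AE[OF cont_integrable[OF assms(1)]] assms(2,3) by auto
  moreover have op: "open {p. f p \<noteq> 0}"
    using assms(1) open_Collect_neq[of f "\<lambda>_. 0"] continuous_on_const by blast
  ultimately have "emeasure \<mu> {p. f p \<noteq> 0} = 0"
    using AE_iff_measurable[of "{p. f p \<noteq> 0}" \<mu> "\<lambda>p. f p = 0"] sets_mu space_mu by auto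
  moreover have "{p. f p \<noteq> 0} \<noteq> {}" using \<open>f p \<noteq> 0\<close> by auto
  ultimately show False using open_pos[OF op] by simp
qed

text \<open>For the conformal metric with area density \<open>r\<close> this says that the first
  eigenvalue is at least 2, as tested on \<open>C\<close>. The energy carries no weight because it
  is conformally invariant.\<close>

definition poincare :: "('a \<Rightarrow> real) \<Rightarrow> bool" where
  "poincare r \<longleftrightarrow> (\<forall>w\<in>C. (LINT p|\<mu>. w p * r p) = 0 \<longrightarrow>
     2 * (LINT p|\<mu>. (w p)\<^sup>2 * r p) \<le> energy w w)"

lemma linear_coefficient_zero:
  fixes a k :: real
  assumes "\<And>t. 0 \<le> t * a + t\<^sup>2 * k"
  shows "a = 0"
proof (rule ccontr)
  assume "a \<noteq> 0"
  \<comment> \<open>\<open>K\<close> exceeds \<open>k\<close> and is positive, so at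
    \<open>t = - a / K\<close> the negative linear term outweighs the quadratic one.\<close>
  define K where "K = \<bar>k\<bar> + 1"
  have K: "K > 0" "k < K" by (auto simp: K_def)
  have "0 \<le> (- a / K) * a + (- a / K)\<^sup>2 * k" using assms .
  also have "\<dots> = (a\<^sup>2 / K) * (k / K - 1)"
    using K by (simp add: field_simps power2_eq_square)
  also have "\<dots> < 0"
    using K \<open>a \<noteq> 0\<close> by (intro mult_pos_neg) auto
  finally show False by simp
qed

text \<open>First variation at an extremal \<open>v\<close>. Admissible variations have weighted
  mean zero, so \<open>h\<close> is corrected by its mean; the correction is a constant, which has
  no energy and pairs to zero with \<open>v\<close>. The outcome is the weak eigenvalue equation for
  \<open>v\<close>.\<close>

lemma euler_lagrange:
  assumes v: "v \<in> C" and r: "r \<in> C" and P: "poincare r" and M: "(LINT p|\<mu>. r p) \<noteq> 0"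
    and mean: "(LINT p|\<mu>. v p * r p) = 0"
    and eq: "energy v v = 2 * (LINT p|\<mu>. (v p)\<^sup>2 * r p)" and h: "h \<in> C"
  shows "energy v h = 2 * (LINT p|\<mu>. v p * h p * r p)"
proof -
  define m where "m = (LINT p|\<mu>. h p * r p) / (LINT p|\<mu>. r p)"
  define k where "k = (\<lambda>p. h p + (- m))"
  have k: "k \<in> C" unfolding k_def using h by (intro C_intros)
  note [intro!] = C_integrable C_intros and [simp] = v r h k
  have "(LINT p|\<mu>. k p * r p) = (LINT p|\<mu>. h p * r p - m * r p)"
    unfolding k_def by (intro Bochner_Integration.integral_cong) (auto simp: algebra_simps)
  also have "\<dots> = (LINT p|\<mu>. h p * r p) - m * (LINT p|\<mu>. r p)"
    by (subst Bochner_Integration.integral_diff) auto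
  finally have k0: "(LINT p|\<mu>. k p * r p) = 0" using M by (simp add: m_def)
  have "0 \<le> t * (2 * (energy v k - 2 * (LINT p|\<mu>. v p * k p * r p)))
      + t\<^sup>2 * (energy k k - 2 * (LINT p|\<mu>. (k p)\<^sup>2 * r p))" for t
  proof -
    define w where "w = (\<lambda>p. v p + t * k p)"
    have w: "w \<in> C" unfolding w_def by auto
    have "(LINT p|\<mu>. w p * r p) = (LINT p|\<mu>. v p * r p + t * (k p * r p))"
      unfolding w_def by (intro Bochner_Integration.integral_cong) (auto simp: algebra_simps)
    also have "\<dots> = 0" using mean k0
      by (subst Bochner_Integration.integral_add) auto
    finally have "2 * (LINT p|\<mu>. (w p)\<^sup>2 * r p) \<le> energy w w" using P w unfolding poincare_def by blast
    moreover have "(LINT p|\<mu>. (w p)\<^sup>2 * r p) =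
        (LINT p|\<mu>. ((v p)\<^sup>2 * r p + (2 * t) * (v p * k p * r p)) + t\<^sup>2 * ((k p)\<^sup>2 * r p))"
      unfolding w_def by (intro Bochner_Integration.integral_cong) (auto simp: algebra_simps power2_eq_square)
    moreover have "\<dots> = (LINT p|\<mu>. (v p)\<^sup>2 * r p) + (2 * t) * (LINT p|\<mu>. v p * k p * r p)
        + t\<^sup>2 * (LINT p|\<mu>. (k p)\<^sup>2 * r p)"
      by (subst Bochner_Integration.integral_add, auto)+
    moreover have "energy w w = energy v v + 2 * t * energy v k + t\<^sup>2 * energy k k"
    proof -
      have tk: "(\<lambda>p. t * k p) \<in> C" by auto
      have "energy w w = energy w v + energy w (\<lambda>p. t * k p)"
        using energy_add_right[OF w v tk] by (simp add: w_def)
      also have "\<dots> = energy w v + t * energy w k" using w by (simp add: energy_scale_right)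
      also have "energy w v = energy v v + t * energy v k"
        using energy_add_right[OF v v tk] by (simp add: energy_commute[of w v] energy_scale_right flip: w_def)
      also have "energy w k = energy v k + t * energy k k"
        using energy_add_right[OF k v tk]
        by (simp add: energy_commute[of w k] energy_commute[of k v] energy_scale_right flip: w_def)
      finally show ?thesis by (simp add: algebra_simps power2_eq_square)
    qed
    ultimately show ?thesis using eq by (simp add: algebra_simps)
  qed
  hence ek: "energy v k = 2 * (LINT p|\<mu>. v p * k p * r p)"
    using linear_coefficient_zero by fastforce
  have "energy v k = energy v h"
    unfolding k_def by (subst energy_add_right) (auto simp: energy_const_right)
  moreover have "(LINT p|\<mu>. v p * k p * r p) = (LINT p|\<mu>. v p * h p * r p + (- m) * (v p * r p))"
    unfolding k_def by (intro Bochner_Integration.integral_cong) (auto simp: algebra_simps)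
  moreover have "\<dots> = (LINT p|\<mu>. v p * h p * r p)"
    using mean by (subst Bochner_Integration.integral_add) auto
  ultimately show ?thesis using ek by simp
qed

end

section \<open>Conformal barycentres on the unit ball\<close>

lemma ln_lipschitz:
  fixes x y e :: real
  assumes "0 < e" "e \<le> x" "e \<le> y"
  shows "\<bar>ln x - ln y\<bar> \<le> \<bar>x - y\<bar> / e"
proof -
  have *: "ln x - ln y \<le> \<bar>x - y\<bar> / e" if "e \<le> x" "e \<le> y" for x y
  proof -
    have "ln x - ln y \<le> (x - y) / y" using ln_diff_le[of x y] that assms(1) by simp
    also have "\<dots> \<le> \<bar>x - y\<bar> / y" using that assms(1) by (intro divide_right_mono) auto
    also have "\<dots> \<le> \<bar>x - y\<bar> / e" using that assms(1) by (intro divide_left_mono) auto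
    finally show ?thesis .
  qed
  show ?thesis using *[OF assms(2,3)] *[OF assms(3,2)] by (simp add: abs_minus_commute)
qed

lemma quadratic_small:
  fixes a c :: real
  assumes "a < 1"
  shows "\<exists>d>0. \<forall>t. \<bar>t\<bar> < d \<longrightarrow> a + 2 * t * c + t\<^sup>2 < 1"
proof (intro exI conjI allI impI)
  let ?d = "min 1 ((1 - a) / (2 * \<bar>c\<bar> + 1))"
  show "?d > 0" using assms by simp
  fix t assume t: "\<bar>t\<bar> < ?d"
  have "t * c \<le> \<bar>t\<bar> * \<bar>c\<bar>" by (metis abs_ge_self abs_mult)
  moreover have "t\<^sup>2 \<le> \<bar>t\<bar>" using t by (metis abs_ge_zero less_imp_le min_less_iff_conj mult_left_le power2_abs power2_eq_square)
  moreover have "\<bar>t\<bar> * (2 * \<bar>c\<bar> + 1) < 1 - a" using t by (simp add: pos_less_divide_eq)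
  ultimately show "a + 2 * t * c + t\<^sup>2 < 1" by (simp add: algebra_simps)
qed

text \<open>With \<open>x = b . f\<close>, Cauchy-Schwarz gives
  \<open>1 - |b|^2 \<le> (1 - x) (1 + x) \<le> 2 (1 + x)\<close>. The bound keeps denominators away
  from zero inside the ball, controls the logarithm as \<open>b\<close> approaches the boundary, and
  still gives nonnegativity on it.\<close>

lemma dot_unit_lower:
  assumes "dot n f f = 1" "dot n b b \<le> 1"
  shows "(1 - dot n b b) / 2 \<le> 1 + dot n b f"
proof -
  define x where "x = dot n b f"
  have x2: "x\<^sup>2 \<le> dot n b b" using dot_Cauchy_Schwarz[of n b f] assms(1) by (simp add: x_def)
  hence "x\<^sup>2 \<le> 1" using assms(2) by simp
  hence x1: "\<bar>x\<bar> \<le> 1" by (simp add: abs_square_le_1)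
  have "1 - dot n b b \<le> (1 - x) * (1 + x)" using x2 by (simp add: algebra_simps power2_eq_square)
  also have "\<dots> \<le> 2 * (1 + x)" using x1 by (intro mult_right_mono) auto
  finally show ?thesis by (simp add: x_def)
qed

definition lin :: "nat \<Rightarrow> (nat \<Rightarrow> 'a \<Rightarrow> real) \<Rightarrow> (nat \<Rightarrow> real) \<Rightarrow> 'a \<Rightarrow> real" where
  "lin n F b p = dot n b (\<lambda>i. F i p)"

lemma lin_lower:
  "dot n (\<lambda>i. F i p) (\<lambda>i. F i p) = 1 \<Longrightarrow> dot n b b \<le> 1 \<Longrightarrow> (1 - dot n b b) / 2 \<le> 1 + lin n F b p"
  unfolding lin_def by (rule dot_unit_lower)

lemma lin_pos:
  "dot n (\<lambda>i. F i p) (\<lambda>i. F i p) = 1 \<Longrightarrow> dot n b b < 1 \<Longrightarrow> 0 < 1 + lin n F b p"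
  using lin_lower[of n F p b] by simp

context gradient_structure
begin

lemma lin_C: "(\<And>i. i \<le> n \<Longrightarrow> F i \<in> C) \<Longrightarrow> lin n F b \<in> C"
  unfolding lin_def[abs_def] dot_def by (auto intro!: C_intros)

text \<open>\<open>F\<close> maps into the unit sphere and \<open>w\<close> is the area density of
  the metric to be balanced. The null fibres keep the mass from concentrating over one point of the
  sphere.\<close>

context
  fixes n :: nat and F :: "nat \<Rightarrow> 'a \<Rightarrow> real" and w :: "'a \<Rightarrow> real"
  assumes FC: "\<And>i. i \<le> n \<Longrightarrow> F i \<in> C"
    and unit: "\<And>p. dot n (\<lambda>i. F i p) (\<lambda>i. F i p) = 1"
    and null: "\<And>x. emeasure \<mu> {p. \<forall>i\<le>n. F i p = x i} = 0"
    and wC: "w \<in> C" and w0: "\<And>p. 0 \<le> w p"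
begin

lemma lower: "dot n b b \<le> 1 \<Longrightarrow> (1 - dot n b b) / 2 \<le> 1 + lin n F b p"
  by (rule lin_lower) (rule unit)

lemma pos: "dot n b b < 1 \<Longrightarrow> 0 < 1 + lin n F b p"
  by (rule lin_pos) (rule unit)

lemma F_le_1: "i \<le> n \<Longrightarrow> \<bar>F i p\<bar> \<le> 1"
  using coord_le_dot[of i n "\<lambda>i. F i p"] unit[of p] by (simp add: abs_square_le_1)

lemma lin_diff: "\<bar>lin n F b p - lin n F b' p\<bar> \<le> (\<Sum>i\<le>n. \<bar>b i - b' i\<bar>)"
proof -
  have "lin n F b p - lin n F b' p = (\<Sum>i\<le>n. (b i - b' i) * F i p)"
    by (simp add: lin_def dot_def sum_subtractf algebra_simps)
  also have "\<bar>\<dots>\<bar> \<le> (\<Sum>i\<le>n. \<bar>(b i - b' i) * F i p\<bar>)" by (rule sum_abs)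
  also have "\<dots> \<le> (\<Sum>i\<le>n. \<bar>b i - b' i\<bar>)"
    using F_le_1 by (intro sum_mono) (auto simp: abs_mult intro!: mult_left_le)
  finally show ?thesis .
qed

text \<open>The \<open>w\<close>-integral of the logarithm of
  \<open>(1 - |b|^2) / (1 + b . F)^2\<close>, the conformal factor of the Moebius map with parameter
  \<open>b\<close>. Its critical points are the parameters for which the transformed map has mean
  zero.\<close>

definition J :: "(nat \<Rightarrow> real) \<Rightarrow> real" where
  "J b = (LINT p|\<mu>. w p) * ln (1 - dot n b b) - 2 * (LINT p|\<mu>. ln (1 + lin n F b p) * w p)"

lemma ln_lin_integrable:
  assumes "\<And>p. 0 < 1 + lin n F b p"
  shows "integrable \<mu> (\<lambda>p. ln (1 + lin n F b p) * w p)"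
proof -
  have "1 + lin n F b p \<noteq> 0" for p using assms[of p] by simp
  thus ?thesis by (intro cont_integrable continuous_intros C_cont wC lin_C FC) auto
qed

lemma tendsto_dot_self:
  assumes "\<And>i. i \<le> n \<Longrightarrow> (\<lambda>k. b k i) \<longlonglongrightarrow> l i"
  shows "(\<lambda>k. dot n (b k) (b k)) \<longlonglongrightarrow> dot n l l"
  unfolding dot_def using assms by (intro tendsto_intros) auto

lemma tendsto_sum_dist:
  assumes "\<And>i. i \<le> n \<Longrightarrow> (\<lambda>k. b k i) \<longlonglongrightarrow> l i"
  shows "(\<lambda>k. \<Sum>i\<le>n. \<bar>b k i - l i\<bar>) \<longlonglongrightarrow> (0::real)"
proof -
  have "(\<lambda>k. \<Sum>i\<le>n. \<bar>b k i - l i\<bar>) \<longlonglongrightarrow> (\<Sum>i\<le>n. \<bar>l i - l i\<bar>)"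
    using assms by (intro tendsto_intros) auto
  thus ?thesis by simp
qed

lemma J_tendsto_interior:
  assumes conv: "\<And>i. i \<le> n \<Longrightarrow> (\<lambda>k. b k i) \<longlonglongrightarrow> l i" and l: "dot n l l < 1"
    and b: "\<And>k. dot n (b k) (b k) < 1"
  shows "(\<lambda>k. J (b k)) \<longlonglongrightarrow> J l"
proof -
  \<comment> \<open>\<open>lower\<close> bounds the argument of the logarithm at \<open>l\<close>
    below by \<open>2 * e\<close>; parameters closer than \<open>e\<close> keep at least
    \<open>e\<close>, where the logarithm has Lipschitz constant \<open>1 / e\<close>.\<close>
  define e where "e = (1 - dot n l l) / 4"
  have e: "e > 0" using l by (simp add: e_def)
  have low: "2 * e \<le> 1 + lin n F l p" for p using lower[of l p] l by (simp add: e_def)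
  have "(\<lambda>k. LINT p|\<mu>. ln (1 + lin n F (b k) p) * w p) \<longlonglongrightarrow> (LINT p|\<mu>. ln (1 + lin n F l p) * w p)"
  proof (rule LIM_zero_cancel, rule Lim_null_comparison)
    show "(\<lambda>k. (\<Sum>i\<le>n. \<bar>b k i - l i\<bar>) / e * (LINT p|\<mu>. w p)) \<longlonglongrightarrow> 0"
      by (intro tendsto_mult_left_zero tendsto_divide_zero tendsto_sum_dist conv)
    have "\<forall>\<^sub>F k in sequentially. (\<Sum>i\<le>n. \<bar>b k i - l i\<bar>) < e"
      using order_tendstoD(2)[OF tendsto_sum_dist[OF conv] e] .
    thus "\<forall>\<^sub>F k in sequentially. norm ((LINT p|\<mu>. ln (1 + lin n F (b k) p) * w p) -
        (LINT p|\<mu>. ln (1 + lin n F l p) * w p)) \<le> (\<Sum>i\<le>n. \<bar>b k i - l i\<bar>) / e * (LINT p|\<mu>. w p)"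
    proof eventually_elim
      case (elim k)
      let ?S = "\<Sum>i\<le>n. \<bar>b k i - l i\<bar>"
      have pt: "norm (ln (1 + lin n F (b k) p) * w p - ln (1 + lin n F l p) * w p) \<le> ?S / e * w p" for p
      proof -
        have "e \<le> 1 + lin n F (b k) p" using low[of p] lin_diff[of "b k" p l] elim by linarith
        hence "\<bar>ln (1 + lin n F (b k) p) - ln (1 + lin n F l p)\<bar> \<le> \<bar>(1 + lin n F (b k) p) - (1 + lin n F l p)\<bar> / e"
          using low[of p] e by (intro ln_lipschitz) auto
        also have "\<dots> \<le> ?S / e" using lin_diff[of "b k" p l] e by (intro divide_right_mono) auto
        finally have "\<bar>ln (1 + lin n F (b k) p) - ln (1 + lin n F l p)\<bar> * w p \<le> ?S / e * w p"
          by (rule mult_right_mono) (rule w0)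
        thus ?thesis using w0[of p] by (simp add: abs_mult flip: left_diff_distrib)
      qed
      have i1: "integrable \<mu> (\<lambda>p. ln (1 + lin n F (b k) p) * w p)"
        and i2: "integrable \<mu> (\<lambda>p. ln (1 + lin n F l p) * w p)"
        using ln_lin_integrable pos b l by auto
      have "norm (LINT p|\<mu>. ln (1 + lin n F (b k) p) * w p - ln (1 + lin n F l p) * w p)
          \<le> (LINT p|\<mu>. norm (ln (1 + lin n F (b k) p) * w p - ln (1 + lin n F l p) * w p))"
        by (rule integral_norm_bound)
      also have "\<dots> \<le> (LINT p|\<mu>. ?S / e * w p)"
        using pt i1 i2 C_integrable[OF wC]
        by (intro integral_mono integrable_norm Bochner_Integration.integrable_diff) auto
      finally have "norm (LINT p|\<mu>. ln (1 + lin n F (b k) p) * w p - ln (1 + lin n F l p) * w p)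
          \<le> (LINT p|\<mu>. ?S / e * w p)" .
      thus ?case using i1 i2 by simp
    qed
  qed
  moreover have "(\<lambda>k. ln (1 - dot n (b k) (b k))) \<longlonglongrightarrow> ln (1 - dot n l l)"
    using l by (intro tendsto_intros tendsto_dot_self conv) auto
  ultimately show ?thesis unfolding J_def
    by (intro tendsto_diff[OF tendsto_mult[OF tendsto_const] tendsto_mult[OF tendsto_const]])
qed

text \<open>For unit vectors \<open>1 + l . F = 0\<close> forces \<open>F = - l\<close>, which
  happens on a null fibre only. The sublevel sets shrink to this fibre, and dominated convergence
  applies.\<close>

lemma small_mass:
  assumes "dot n l l = 1" "0 < (e::real)"
  shows "\<exists>d>0. d < 1 \<and> (LINT p|\<mu>. indicator {p. 1 + lin n F l p < d} p * w p) < e"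
proof -
  \<comment> \<open>The thresholds start at 1/2 to guarantee \<open>d < 1\<close>.\<close>
  let ?g = "\<lambda>k p. indicator {p. 1 + lin n F l p < 1 / Suc (Suc k)} p * w p"
  have meas: "{p. 1 + lin n F l p < d} \<in> sets \<mu>" for d
  proof -
    have "open {p. 1 + lin n F l p < d}"
      by (intro open_Collect_less continuous_intros C_cont lin_C FC)
    thus ?thesis using sets_mu by auto
  qed
  obtain B where B: "\<And>p. norm (w p) \<le> B"
  proof -
    have "bounded (w ` UNIV)"
      using C_cont[OF wC] compact_space compact_continuous_image compact_imp_bounded by blast
    thus ?thesis using that by (auto simp: bounded_iff)
  qed
  have ptw: "(\<lambda>k. ?g k p) \<longlonglongrightarrow> 0" if "1 + lin n F l p \<noteq> 0" for p
  proof -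
    have "0 \<le> 1 + lin n F l p" using lower[of l p] assms(1) by simp
    hence pos: "0 < 1 + lin n F l p" using that by simp
    have "(\<lambda>k. 1 / real (Suc (Suc k))) \<longlonglongrightarrow> 0"
      using LIMSEQ_Suc[OF LIMSEQ_Suc[OF lim_inverse_n']] by (simp add: inverse_eq_divide)
    from order_tendstoD(2)[OF this pos]
    have "\<forall>\<^sub>F k in sequentially. ?g k p = 0"
      by eventually_elim (auto simp: indicator_def)
    thus ?thesis by (rule tendsto_eventually)
  qed
  have nul: "AE p in \<mu>. 1 + lin n F l p \<noteq> 0"
  proof (rule AE_I)
    show "{p \<in> space \<mu>. \<not> 1 + lin n F l p \<noteq> 0} \<subseteq> {p. \<forall>i\<le>n. F i p = (\<lambda>i. - l i) i}"
    proof (intro subsetI CollectI allI impI)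
      fix p i assume "p \<in> {p \<in> space \<mu>. \<not> 1 + lin n F l p \<noteq> 0}" and "i \<le> n"
      hence "1 + lin n F l p = 0" by simp
      have "dot n (\<lambda>i. F i p + l i) (\<lambda>i. F i p + l i) = 0"
        using \<open>1 + lin n F l p = 0\<close> assms(1) unit[of p]
        by (simp add: dot_linear lin_def dot_commute[of n "\<lambda>i. F i p" l])
      thus "F i p = (\<lambda>i. - l i) i" using dot_self_eq_0_iff \<open>i \<le> n\<close> by (simp add: add_eq_0_iff2)
    qed
    show "emeasure \<mu> {p. \<forall>i\<le>n. F i p = (\<lambda>i. - l i) i} = 0" by (rule null)
    have "closed {p. \<forall>i\<le>n. F i p = - l i}"
    proof -
      have "{p. \<forall>i\<le>n. F i p = - l i} = (\<Inter>i\<in>{..n}. {p. F i p = - l i})" by auto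
      moreover have "closed \<dots>"
        by (intro closed_INT ballI closed_Collect_eq continuous_intros C_cont FC) auto
      ultimately show ?thesis by simp
    qed
    thus "{p. \<forall>i\<le>n. F i p = (\<lambda>i. - l i) i} \<in> sets \<mu>"
      unfolding sets_mu by (rule borel_closed)
  qed
  have "(\<lambda>k. LINT p|\<mu>. ?g k p) \<longlonglongrightarrow> (LINT p|\<mu>. 0)"
  proof (rule integral_dominated_convergence[where w = "\<lambda>_. B"])
    show "?g k \<in> borel_measurable \<mu>" for k
      using meas C_integrable[OF wC] by (intro borel_measurable_times borel_measurable_indicator) auto
    show "AE p in \<mu>. (\<lambda>k. ?g k p) \<longlonglongrightarrow> 0" using nul by eventually_elim (rule ptw)
    have "0 \<le> B" using B norm_ge_zero order_trans by blast
    thus "AE p in \<mu>. norm (?g k p) \<le> B" for k using B by (auto simp: indicator_def)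
  qed auto
  hence "(\<lambda>k. LINT p|\<mu>. ?g k p) \<longlonglongrightarrow> 0" by simp
  from eventually_happens'[OF sequentially_bot order_tendstoD(2)[OF this assms(2)]]
  obtain k where "(LINT p|\<mu>. ?g k p) < e" by blast
  thus ?thesis by (intro exI[of _ "1 / real (Suc (Suc k))"]) auto
qed

text \<open>Near the boundary the logarithm of \<open>1 + b . F\<close> is very negative only close
  to the fibre over \<open>- l\<close>, and there it is at least \<open>ln (e k / 2)\<close>. As
  that region carries less than a quarter of the mass, the second term of \<open>J\<close>
  compensates, up to constants, at most half of \<open>?M * ln (e k)\<close>, which tends to minus
  infinity.\<close>

lemma J_boundary:
  assumes conv: "\<And>i. i \<le> n \<Longrightarrow> (\<lambda>k. b k i) \<longlonglongrightarrow> l i" and l: "dot n l l = 1"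
    and b: "\<And>k. dot n (b k) (b k) < 1" and M: "(LINT p|\<mu>. w p) > 0"
  shows "filterlim (\<lambda>k. J (b k)) at_bot sequentially"
proof -
  let ?M = "LINT p|\<mu>. w p"
  obtain d where d: "0 < d" "d < 1" and dm: "(LINT p|\<mu>. indicator {p. 1 + lin n F l p < d} p * w p) < ?M / 4"
    using small_mass[OF l, of "?M / 4"] M by auto
  define S where "S = {p. 1 + lin n F l p < d}"
  have S: "S \<in> sets \<mu>"
  proof -
    have "open S" unfolding S_def
      by (intro open_Collect_less continuous_intros C_cont lin_C FC)
    thus ?thesis using sets_mu by auto
  qed
  have iS: "integrable \<mu> (\<lambda>p. indicator S p * w p)"
    using integrable_mult_indicator[OF S C_integrable[OF wC]] by simp
  define e where "e = (\<lambda>k. 1 - dot n (b k) (b k))"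
  have e: "0 < e k" "e k \<le> 1" for k using b[of k] by (auto simp: e_def)
  have e0: "e \<longlonglongrightarrow> 0"
  proof -
    have "e \<longlonglongrightarrow> 1 - dot n l l" unfolding e_def by (intro tendsto_intros tendsto_dot_self conv)
    thus ?thesis using l by simp
  qed
  have bnd: "\<forall>\<^sub>F k in sequentially. J (b k) \<le> ?M / 2 * ln (e k) + ?M / 2 * ln 2 - 2 * ?M * ln (d / 2)"
  proof -
    have "(\<lambda>k. \<Sum>i\<le>n. \<bar>b k i - l i\<bar>) \<longlonglongrightarrow> 0" by (rule tendsto_sum_dist[OF conv])
    from order_tendstoD(2)[OF this, of "d / 2"]
    have "\<forall>\<^sub>F k in sequentially. (\<Sum>i\<le>n. \<bar>b k i - l i\<bar>) < d / 2"
      using d(1) by simp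
    thus ?thesis
    proof eventually_elim
      case (elim k)
      have neg: "ln (e k / 2) < 0" "ln (d / 2) < 0" using e[of k] d by auto
      \<comment> \<open>The negative constant \<open>ln (d / 2)\<close> is added on \<open>S\<close>
        as well, so that one formula covers both cases.\<close>
      have pt: "ln (d / 2) * w p + ln (e k / 2) * (indicator S p * w p) \<le> ln (1 + lin n F (b k) p) * w p" for p
      proof (cases "p \<in> S")
        case True
        have "e k / 2 \<le> 1 + lin n F (b k) p" using lower[of "b k" p] b[of k] by (simp add: e_def)
        hence "ln (e k / 2) \<le> ln (1 + lin n F (b k) p)" using e[of k] pos[OF b] by (subst ln_le_cancel_iff) auto
        hence "ln (d / 2) + ln (e k / 2) \<le> ln (1 + lin n F (b k) p)" using neg by simp
        from mult_right_mono[OF this w0[of p]] show ?thesis using True by (simp add: algebra_simps)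
      next
        case False
        hence "d / 2 \<le> 1 + lin n F (b k) p" using lin_diff[of "b k" p l] elim by (simp add: S_def)
        hence "ln (d / 2) \<le> ln (1 + lin n F (b k) p)" using d pos[OF b] by (subst ln_le_cancel_iff) auto
        from mult_right_mono[OF this w0[of p]] show ?thesis using False by simp
      qed
      have "(LINT p|\<mu>. ln (d / 2) * w p + ln (e k / 2) * (indicator S p * w p))
          \<le> (LINT p|\<mu>. ln (1 + lin n F (b k) p) * w p)"
        using pt iS C_integrable[OF wC] ln_lin_integrable[of "b k"] pos[OF b]
        by (intro integral_mono) auto
      hence "ln (d / 2) * ?M + ln (e k / 2) * (LINT p|\<mu>. indicator S p * w p)
          \<le> (LINT p|\<mu>. ln (1 + lin n F (b k) p) * w p)"
        using iS C_integrable[OF wC] by simp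
      moreover have "ln (e k / 2) * (?M / 4) \<le> ln (e k / 2) * (LINT p|\<mu>. indicator S p * w p)"
        using dm neg by (intro mult_left_mono_neg) (auto simp: S_def)
      ultimately have "ln (d / 2) * ?M + ln (e k / 2) * (?M / 4) \<le> (LINT p|\<mu>. ln (1 + lin n F (b k) p) * w p)"
        by linarith
      moreover have "J (b k) = ?M * ln (e k) - 2 * (LINT p|\<mu>. ln (1 + lin n F (b k) p) * w p)"
        by (simp add: J_def e_def)
      moreover have "ln (e k / 2) * (?M / 4) = (?M * ln (e k) - ?M * ln 2) / 4"
      proof -
        have "ln (e k / 2) = ln (e k) - ln 2" using e[of k] by (simp add: ln_div)
        thus ?thesis by (simp only:) (simp add: field_simps)
      qed
      moreover have "j \<le> m / 2 * y + m / 2 * t - 2 * m * c"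
        if "c * m + x \<le> I" "j = m * y - 2 * I" "x = (m * y - m * t) / 4" for c m x I j y t :: real
        using that by (simp add: field_simps)
      ultimately show ?case by blast
    qed
  qed
  have "filterlim e (at_right 0) sequentially"
  proof -
    have "e k \<in> {0<..} \<and> e k \<noteq> 0" for k using e(1)[of k] by simp
    thus ?thesis using e0 by (simp add: filterlim_at)
  qed
  hence "filterlim (\<lambda>k. ln (e k)) at_bot sequentially"
    by (rule filterlim_compose[OF ln_at_0])
  hence "filterlim (\<lambda>k. ?M / 2 * ln (e k)) at_bot sequentially"
    by (rule filterlim_tendsto_pos_mult_at_bot[OF tendsto_const, rotated]) (use M in simp)
  hence lim: "filterlim (\<lambda>k. (?M / 2 * ln 2 - 2 * ?M * ln (d / 2)) + ?M / 2 * ln (e k)) at_bot sequentially"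
    by (subst filterlim_tendsto_add_at_bot_iff[OF tendsto_const])
  show ?thesis
    unfolding filterlim_at_bot
  proof
    fix Z
    have "\<forall>\<^sub>F k in sequentially. (?M / 2 * ln 2 - 2 * ?M * ln (d / 2)) + ?M / 2 * ln (e k) \<le> Z"
      using lim unfolding filterlim_at_bot by blast
    with bnd show "\<forall>\<^sub>F k in sequentially. J (b k) \<le> Z" by eventually_elim linarith
  qed
qed

text \<open>A maximising sequence has a limit in the closed ball. A boundary limit is impossible,
  since \<open>J\<close> tends to minus infinity there while its value at the centre is finite; at
  an interior limit \<open>J\<close> is continuous.\<close>

lemma J_attains_max:
  assumes M: "(LINT p|\<mu>. w p) > 0"
  shows "\<exists>l. dot n l l < 1 \<and> (\<forall>b. dot n b b < 1 \<longrightarrow> J b \<le> J l)"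
proof -
  \<comment> \<open>Extended reals, because boundedness of \<open>J\<close> from above is not known
    at this point.\<close>
  define X where "X = (\<lambda>b. ereal (J b)) ` {b. dot n b b < 1}"
  have z: "(\<lambda>_. 0) \<in> {b. dot n b b < 1}" by simp
  hence "X \<noteq> {}" unfolding X_def by blast
  then obtain f :: "nat \<Rightarrow> ereal" where f: "incseq f" "range f \<subseteq> X" "Sup X = (SUP i. f i)"
    using Sup_countable_SUP by metis
  have "\<forall>k. \<exists>b. dot n b b < 1 \<and> f k = ereal (J b)" using f(2) by (auto simp: X_def)
  then obtain b where b: "\<And>k. dot n (b k) (b k) < 1" "\<And>k. f k = ereal (J (b k))" by metis
  have fl: "f \<longlonglongrightarrow> Sup X" using LIMSEQ_SUP[OF f(1)] f(3) by simp
  have "\<bar>b k i\<bar> \<le> 1" if "i \<le> n" for k i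
    using coord_le_dot[OF that, of "b k"] b(1)[of k] abs_square_le_1[of "b k i"] by linarith
  from bounded_coordinates_subsequence[of n b 1, OF this]
  obtain s l where s: "strict_mono (s :: nat \<Rightarrow> nat)" and l: "\<And>i. i \<le> n \<Longrightarrow> (\<lambda>k. b (s k) i) \<longlonglongrightarrow> l i"
    by blast
  have fs: "(\<lambda>k. ereal (J (b (s k)))) \<longlonglongrightarrow> Sup X"
    using LIMSEQ_subseq_LIMSEQ[OF fl s] b(2) by (simp add: o_def)
  have "dot n l l \<le> 1"
  proof (rule LIMSEQ_le_const2)
    show "(\<lambda>k. dot n (b (s k)) (b (s k))) \<longlonglongrightarrow> dot n l l" by (rule tendsto_dot_self) (rule l)
    show "\<exists>N. \<forall>k\<ge>N. dot n (b (s k)) (b (s k)) \<le> 1" using b(1) less_imp_le by blast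
  qed
  moreover have "dot n l l \<noteq> 1"
  proof
    assume "dot n l l = 1"
    hence "filterlim (\<lambda>k. J (b (s k))) at_bot sequentially"
      using J_boundary[of "\<lambda>k. b (s k)" l] l b(1) M by auto
    hence "(\<lambda>k. ereal (J (b (s k)))) \<longlonglongrightarrow> - \<infinity>"
      by (simp add: tendsto_MInfty filterlim_at_bot_dense)
    hence "Sup X = - \<infinity>" using fs LIMSEQ_unique by blast
    moreover have "ereal (J (\<lambda>_. 0)) \<le> Sup X" using z by (intro Sup_upper) (auto simp: X_def)
    ultimately show False by simp
  qed
  ultimately have l1: "dot n l l < 1" by simp
  hence "(\<lambda>k. ereal (J (b (s k)))) \<longlonglongrightarrow> ereal (J l)"
    using J_tendsto_interior[of "\<lambda>k. b (s k)" l] l b(1) by auto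
  hence eq: "Sup X = ereal (J l)" using fs LIMSEQ_unique by blast
  have "J b' \<le> J l" if "dot n b' b' < 1" for b'
  proof -
    have "ereal (J b') \<le> Sup X" using that by (intro Sup_upper) (auto simp: X_def)
    thus ?thesis using eq by simp
  qed
  thus ?thesis using l1 by blast
qed

text \<open>These are the critical equations of \<open>J\<close> at a maximum point, coordinate by
  coordinate.\<close>

lemma conformal_barycenter:
  assumes M: "(LINT p|\<mu>. w p) > 0"
  shows "\<exists>b. dot n b b < 1 \<and>
    (\<forall>i\<le>n. (LINT p|\<mu>. F i p / (1 + lin n F b p) * w p) = - b i / (1 - dot n b b) * (LINT p|\<mu>. w p))"
proof -
  let ?M = "LINT p|\<mu>. w p"
  obtain b where b: "dot n b b < 1" and mx: "\<And>b'. dot n b' b' < 1 \<Longrightarrow> J b' \<le> J b"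
    using J_attains_max[OF M] by blast
  have "(LINT p|\<mu>. F i p / (1 + lin n F b p) * w p) = - b i / (1 - dot n b b) * ?M" if i: "i \<le> n" for i
  proof -
    let ?c = "LINT p|\<mu>. F i p / (1 + lin n F b p) * w p"
    \<comment> \<open>By concavity of \<open>ln\<close>, \<open>h t\<close> minus a constant is a
      lower bound of \<open>J\<close> on the line through \<open>b\<close> in direction
      \<open>i\<close>, with equality at 0. So \<open>h\<close> also has a maximum at 0, and only
      this explicit function is differentiated, not the integral.\<close>
    define h where "h = (\<lambda>t. ?M * ln (1 - (dot n b b + 2 * t * b i + t\<^sup>2)) - 2 * t * ?c)"
    have dott: "dot n (b(i := b i + t)) (b(i := b i + t)) = dot n b b + 2 * t * b i + t\<^sup>2" for t
    proof -
      have "dot n (b(i := b i + t)) (b(i := b i + t)) = (\<Sum>j\<le>n. b j * b j + (if j = i then 2 * t * b i + t\<^sup>2 else 0))"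
        unfolding dot_def by (intro sum.cong) (auto simp: algebra_simps power2_eq_square)
      thus ?thesis using i by (simp add: sum.distrib dot_def)
    qed
    have lint: "lin n F (b(i := b i + t)) p = lin n F b p + t * F i p" for t p
    proof -
      have "lin n F (b(i := b i + t)) p = (\<Sum>j\<le>n. b j * F j p + (if j = i then t * F i p else 0))"
        unfolding lin_def dot_def by (intro sum.cong) (auto simp: algebra_simps)
      thus ?thesis using i by (simp add: sum.distrib dot_def lin_def)
    qed
    have le: "h t \<le> h 0" if small: "dot n b b + 2 * t * b i + t\<^sup>2 < 1" for t
    proof -
      let ?b = "b(i := b i + t)"
      have bt: "dot n ?b ?b < 1" using small by (simp add: dott)
      have pt: "ln (1 + lin n F ?b p) * w p \<le> ln (1 + lin n F b p) * w p + t * (F i p / (1 + lin n F b p) * w p)" for p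
      proof -
        have q: "0 < 1 + lin n F b p" "0 < 1 + lin n F ?b p" using pos b bt by auto
        have "ln (1 + lin n F ?b p) - ln (1 + lin n F b p) \<le> ((1 + lin n F ?b p) - (1 + lin n F b p)) / (1 + lin n F b p)"
          using q by (intro ln_diff_le)
        also have "\<dots> = t * (F i p / (1 + lin n F b p))" by (simp add: lint)
        finally have "ln (1 + lin n F ?b p) \<le> ln (1 + lin n F b p) + t * (F i p / (1 + lin n F b p))" by linarith
        from mult_right_mono[OF this w0[of p]] show ?thesis by (simp add: algebra_simps)
      qed
      have iF: "integrable \<mu> (\<lambda>p. F i p / (1 + lin n F b p) * w p)"
      proof -
        have "\<And>p. 1 + lin n F b p \<noteq> 0" using pos[OF b] by (simp add: less_imp_neq[THEN not_sym])
        thus ?thesis by (intro C_integrable C_mult[OF C_divide wC] FC i C_add C_const lin_C)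
      qed
      have i1: "integrable \<mu> (\<lambda>p. ln (1 + lin n F ?b p) * w p)" by (intro ln_lin_integrable pos bt)
      have i2: "integrable \<mu> (\<lambda>p. ln (1 + lin n F b p) * w p)" by (intro ln_lin_integrable pos b)
      have "(LINT p|\<mu>. ln (1 + lin n F ?b p) * w p)
          \<le> (LINT p|\<mu>. ln (1 + lin n F b p) * w p + t * (F i p / (1 + lin n F b p) * w p))"
        by (intro integral_mono pt i1 Bochner_Integration.integrable_add i2
            Bochner_Integration.integrable_mult_right iF)
      moreover have "(LINT p|\<mu>. ln (1 + lin n F b p) * w p + t * (F i p / (1 + lin n F b p) * w p))
          = (LINT p|\<mu>. ln (1 + lin n F b p) * w p) + t * ?c"
        unfolding Bochner_Integration.integral_add[OF i2 Bochner_Integration.integrable_mult_right[OF iF]]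
        by (simp only: integral_mult_right_zero)
      moreover have "J ?b \<le> J b" using mx bt by blast
      hence "?M * ln (1 - dot n ?b ?b) - 2 * (LINT p|\<mu>. ln (1 + lin n F ?b p) * w p)
          \<le> ?M * ln (1 - dot n b b) - 2 * (LINT p|\<mu>. ln (1 + lin n F b p) * w p)"
        by (simp only: J_def)
      moreover have "h t = ?M * ln (1 - dot n ?b ?b) - 2 * t * ?c" unfolding h_def by (simp only: dott)
      moreover have "h 0 = ?M * ln (1 - dot n b b)" unfolding h_def by simp
      ultimately show ?thesis by linarith
    qed
    obtain d where d: "d > 0" "\<And>t. \<bar>t\<bar> < d \<Longrightarrow> dot n b b + 2 * t * b i + t\<^sup>2 < 1"
      using quadratic_small[OF b] by blast
    have "(h has_real_derivative (?M * (- (2 * b i) / (1 - dot n b b)) - 2 * ?c)) (at 0)"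
      unfolding h_def using b by (auto intro!: derivative_eq_intros)
    moreover have "\<forall>t. \<bar>0 - t\<bar> < d \<longrightarrow> h t \<le> h 0"
    proof (intro allI impI)
      fix t assume "\<bar>0 - t\<bar> < d"
      thus "h t \<le> h 0" using le[of t] d(2)[of t] by simp
    qed
    ultimately have "?M * (- (2 * b i) / (1 - dot n b b)) - 2 * ?c = 0"
      using DERIV_local_max[OF _ d(1)] by blast
    moreover have "?M * (- (2 * b i) / (1 - dot n b b)) = 2 * (- b i / (1 - dot n b b) * ?M)" by simp
    ultimately show ?thesis by linarith
  qed
  thus ?thesis using b by blast
qed

end

end

section \<open>Moebius transformations of the ball and the areas they induce\<close>

lemma moebius_dot:
  assumes f: "dot n f f = 1" and x: "dot n f x = 0" and y: "dot n f y = 0"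
    and b: "dot n b b = 1 - s\<^sup>2" and s: "0 < s" and q: "q = 1 + dot n b f" "q \<noteq> 0" and c: "c = 1 / (1 + s)"
  shows "dot n (\<lambda>i. (s / q) * x i - (s * dot n b x / q\<^sup>2) * (f i + c * b i))
      (\<lambda>i. (s / q) * y i - (s * dot n b y / q\<^sup>2) * (f i + c * b i)) = s\<^sup>2 / q\<^sup>2 * dot n x y" (is ?A)
    and "dot n (\<lambda>i. c * b i + (s / q) * (f i + c * b i)) (\<lambda>i. c * b i + (s / q) * (f i + c * b i)) = 1" (is ?B)
proof -
  \<comment> \<open>The Moebius map sends \<open>f\<close> to
    \<open>c b + (s / q) (f + c b)\<close>; the vectors in the first claim are its derivatives along
    \<open>x\<close> and \<open>y\<close>. From \<open>c (1 + s) = 1\<close> follow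
    \<open>|f + c b|^2 = 2 c q\<close> and \<open>x . (f + c b) = c (b . x)\<close>, so the cross
    terms cancel the quadratic one and the map is conformal on the sphere with factor
    \<open>s^2 / q^2\<close>.\<close>
  have c1: "c * (1 + s) = 1" using s c by simp
  have ff: "dot n (\<lambda>i. f i + c * b i) (\<lambda>i. f i + c * b i) = 2 * c * q"
  proof -
    have "dot n (\<lambda>i. f i + c * b i) (\<lambda>i. f i + c * b i) = 1 + 2 * c * (q - 1) + c\<^sup>2 * (1 - s\<^sup>2)"
    proof -
      have "dot n (\<lambda>i. f i + c * b i) (\<lambda>i. f i + c * b i) = 1 + 2 * c * dot n b f + c\<^sup>2 * dot n b b"
        using f by (simp add: dot_linear dot_commute[of n f b] power2_eq_square algebra_simps)
      thus ?thesis using b q(1) by simp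
    qed
    moreover have "c\<^sup>2 * (1 - s\<^sup>2) = 2 * c - 1" using c1 by algebra
    ultimately show ?thesis by (simp add: algebra_simps)
  qed
  have xf: "dot n x (\<lambda>i. f i + c * b i) = c * dot n b x" "dot n (\<lambda>i. f i + c * b i) x = c * dot n b x"
    "dot n y (\<lambda>i. f i + c * b i) = c * dot n b y" "dot n (\<lambda>i. f i + c * b i) y = c * dot n b y"
    using x y by (simp_all add: dot_linear dot_commute[of n x] dot_commute[of n y])
  define X Y where "X = dot n b x" and "Y = dot n b y"
  have "(s / q) * ((s / q) * dot n x y - (s * Y / q\<^sup>2) * (c * X))
      - (s * X / q\<^sup>2) * ((s / q) * (c * Y) - (s * Y / q\<^sup>2) * (2 * c * q)) = s\<^sup>2 / q\<^sup>2 * dot n x y"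
  proof -
    have "(s * X / q\<^sup>2) * ((s * Y / q\<^sup>2) * (2 * c * q)) = 2 * ((s / q) * ((s * Y / q\<^sup>2) * (c * X)))"
      using q(2) by (simp add: field_simps power2_eq_square)
    moreover have "(s * X / q\<^sup>2) * ((s / q) * (c * Y)) = (s / q) * ((s * Y / q\<^sup>2) * (c * X))"
      by (simp add: field_simps)
    moreover have "(s / q) * ((s / q) * dot n x y) = s\<^sup>2 / q\<^sup>2 * dot n x y"
      by (simp add: power2_eq_square)
    ultimately show ?thesis by (simp add: right_diff_distrib)
  qed
  thus ?A
    unfolding dot_diff_left dot_diff_right dot_scale_left dot_scale_right ff xf X_def Y_def
    by (simp add: right_diff_distrib left_diff_distrib algebra_simps)
  have bf: "dot n b (\<lambda>i. f i + c * b i) = q - 1 + c * (1 - s\<^sup>2)"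
    "dot n (\<lambda>i. f i + c * b i) b = q - 1 + c * (1 - s\<^sup>2)"
    using q(1) b by (simp_all add: dot_linear dot_commute[of n f b])
  have "dot n (\<lambda>i. c * b i + (s / q) * (f i + c * b i)) (\<lambda>i. c * b i + (s / q) * (f i + c * b i))
      = c\<^sup>2 * (1 - s\<^sup>2) + 2 * c * (s / q) * (q - 1 + c * (1 - s\<^sup>2)) + (s / q)\<^sup>2 * (2 * c * q)"
    unfolding dot_add_left[of n "\<lambda>i. c * b i"] dot_add_right[of n _ "\<lambda>i. c * b i"]
      dot_scale_left dot_scale_right ff bf b
    using q(2) by (simp add: power2_eq_square field_simps)
  also have "\<dots> = 1"
  proof -
    have 1: "c * (1 - s\<^sup>2) = 1 - s" "c\<^sup>2 * (1 - s\<^sup>2) = c * (1 - s)" using c1 by algebra+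
    have 2: "(s / q)\<^sup>2 * (2 * c * q) = 2 * c * s\<^sup>2 / q" using q(2) by (simp add: field_simps power2_eq_square)
    have "2 * c * (s / q) * (q - 1 + c * (1 - s\<^sup>2)) = 2 * c * s - 2 * c * s\<^sup>2 / q"
    proof -
      have X: "q - 1 + c * (1 - s\<^sup>2) = q - s" using 1(1) by simp
      show ?thesis unfolding X using q(2) by (simp add: field_simps power2_eq_square)
    qed
    hence "c\<^sup>2 * (1 - s\<^sup>2) + 2 * c * (s / q) * (q - 1 + c * (1 - s\<^sup>2)) + (s / q)\<^sup>2 * (2 * c * q)
      = c * (1 + s)" unfolding 1(2) 2 by (simp add: algebra_simps)
    thus ?thesis using c1 by simp
  qed
  finally show ?B .
qed

context gradient_structure
begin

text \<open>The abstract form of a branched minimal immersion by first eigenfunctions: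
  \<open>r\<close> is the conformal factor of the induced metric over the background, and the
  eigenvalue is already normalised to 2. The null fibres serve the conformal barycentre.\<close>

definition first_immersion :: "nat \<Rightarrow> (nat \<Rightarrow> 'a \<Rightarrow> real) \<Rightarrow> ('a \<Rightarrow> real) \<Rightarrow> bool" where
  "first_immersion n F r \<longleftrightarrow> (\<forall>i\<le>n. F i \<in> C) \<and> r \<in> C \<and> (\<forall>p. 0 \<le> r p) \<and>
     (\<forall>U. open U \<longrightarrow> U \<noteq> {} \<longrightarrow> (\<exists>p\<in>U. r p \<noteq> 0)) \<and>
     (\<forall>p. dot n (\<lambda>i. F i p) (\<lambda>i. F i p) = 1 \<and>
       dot n (\<lambda>i. D1 (F i) p) (\<lambda>i. D1 (F i) p) = r p \<and>
       dot n (\<lambda>i. D2 (F i) p) (\<lambda>i. D2 (F i) p) = r p \<and>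
       dot n (\<lambda>i. D1 (F i) p) (\<lambda>i. D2 (F i) p) = 0) \<and>
     (\<forall>x. emeasure \<mu> {p. \<forall>i\<le>n. F i p = x i} = 0) \<and>
     (\<forall>i\<le>n. (LINT p|\<mu>. F i p * r p) = 0 \<and> energy (F i) (F i) = 2 * (LINT p|\<mu>. (F i p)\<^sup>2 * r p)) \<and>
     poincare r"

text \<open>For an immersion, by \<open>dot_residual_square\<close>, where \<open>r p > 0\<close>
  this is \<open>r p\<close> times the squared length of the part of \<open>b\<close> orthogonal to
  \<open>F\<close> and to its derivatives at \<open>p\<close>.\<close>

definition defect :: "nat \<Rightarrow> (nat \<Rightarrow> 'a \<Rightarrow> real) \<Rightarrow> ('a \<Rightarrow> real) \<Rightarrow> (nat \<Rightarrow> real) \<Rightarrow> 'a \<Rightarrow> real" where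
  "defect n F r b p = r p * (dot n b b - (lin n F b p)\<^sup>2) - grad_inner (lin n F b) (lin n F b) p"

text \<open>\<open>F\<close> followed by the Moebius map of \<open>moebius_dot\<close> with
  parameter \<open>b\<close>.\<close>

definition mob :: "nat \<Rightarrow> (nat \<Rightarrow> 'a \<Rightarrow> real) \<Rightarrow> (nat \<Rightarrow> real) \<Rightarrow> nat \<Rightarrow> 'a \<Rightarrow> real" where
  "mob n F b i p = (let s = sqrt (1 - dot n b b); c = 1 / (1 + s)
     in c * b i + (s / (1 + lin n F b p)) * (F i p + c * b i))"

lemma unit_orthogonal:
  assumes "\<And>i. i \<le> n \<Longrightarrow> F i \<in> C" "\<And>p. dot n (\<lambda>i. F i p) (\<lambda>i. F i p) = 1"
  shows "dot n (\<lambda>i. F i p) (\<lambda>i. D1 (F i) p) = 0" "dot n (\<lambda>i. F i p) (\<lambda>i. D2 (F i) p) = 0"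
proof -
  have eq: "(\<lambda>p. \<Sum>i\<le>n. F i p * F i p) = (\<lambda>_. 1)" using assms(2) by (simp add: dot_def)
  have "D1 (\<lambda>p. \<Sum>i\<le>n. F i p * F i p) p = (\<Sum>i\<le>n. 2 * (F i p * D1 (F i) p))"
    using assms(1) by (subst D1_sum) (auto intro!: C_mult sum.cong simp: D1_mult)
  thus "dot n (\<lambda>i. F i p) (\<lambda>i. D1 (F i) p) = 0"
    unfolding eq D1_const dot_def by (simp flip: sum_distrib_left)
  have "D2 (\<lambda>p. \<Sum>i\<le>n. F i p * F i p) p = (\<Sum>i\<le>n. 2 * (F i p * D2 (F i) p))"
    using assms(1) by (subst D2_sum) (auto intro!: C_mult sum.cong simp: D2_mult)
  thus "dot n (\<lambda>i. F i p) (\<lambda>i. D2 (F i) p) = 0"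
    unfolding eq D2_const dot_def by (simp flip: sum_distrib_left)
qed

lemma mass_pos:
  assumes "r \<in> C" "\<And>p. 0 \<le> r p" "\<exists>p. r p \<noteq> 0"
  shows "(LINT p|\<mu>. r p) > 0"
proof -
  have "(LINT p|\<mu>. r p) \<noteq> 0" using integral_pos_zero[OF C_cont[OF assms(1)] assms(2)] assms(3) by blast
  moreover have "(LINT p|\<mu>. r p) \<ge> 0" using assms(2) by simp
  ultimately show ?thesis by simp
qed

context
  fixes n F r
  assumes fi: "first_immersion n F r"
begin

lemma FC: "i \<le> n \<Longrightarrow> F i \<in> C" and rC: "r \<in> C" and r0: "0 \<le> r p"
  and unit: "dot n (\<lambda>i. F i p) (\<lambda>i. F i p) = 1"
  and D11: "dot n (\<lambda>i. D1 (F i) p) (\<lambda>i. D1 (F i) p) = r p"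
  and D22: "dot n (\<lambda>i. D2 (F i) p) (\<lambda>i. D2 (F i) p) = r p"
  and D12: "dot n (\<lambda>i. D1 (F i) p) (\<lambda>i. D2 (F i) p) = 0"
  and null: "emeasure \<mu> {p. \<forall>i\<le>n. F i p = x i} = 0"
  and pr: "poincare r"
  using fi unfolding first_immersion_def by blast+

lemma rM: "(LINT p|\<mu>. r p) > 0"
proof -
  have "\<exists>p\<in>UNIV. r p \<noteq> 0" using fi unfolding first_immersion_def by (metis UNIV_not_empty open_UNIV)
  thus ?thesis using mass_pos rC r0 by blast
qed

lemma lin_in_C: "lin n F b \<in> C"
  by (rule lin_C) (rule FC)

lemma D1_lin: "D1 (lin n F b) p = dot n b (\<lambda>i. D1 (F i) p)"
  unfolding lin_def[abs_def] dot_def using FC by (subst D1_sum) (auto simp: C_scale D1_scale)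

lemma D2_lin: "D2 (lin n F b) p = dot n b (\<lambda>i. D2 (F i) p)"
  unfolding lin_def[abs_def] dot_def using FC by (subst D2_sum) (auto simp: C_scale D2_scale)

text \<open>\<open>euler_lagrange\<close> holds for each coordinate of \<open>F\<close>, and both
  sides are linear in it.\<close>

lemma energy_lin:
  assumes h: "h \<in> C"
  shows "energy (lin n F b) h = 2 * (LINT p|\<mu>. lin n F b p * h p * r p)"
proof -
  have "energy (lin n F b) h = energy h (\<lambda>p. \<Sum>i\<le>n. b i * F i p)"
    by (simp add: energy_commute lin_def[abs_def] dot_def)
  also have "\<dots> = (\<Sum>i\<le>n. b i * energy (F i) h)"
    using FC h by (subst energy_sum_right) (auto simp: C_scale energy_scale_right energy_commute intro!: sum.cong)
  also have "\<dots> = (\<Sum>i\<le>n. b i * (2 * (LINT p|\<mu>. F i p * h p * r p)))"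
    using fi h euler_lagrange[OF FC rC pr less_imp_neq[OF rM, symmetric]]
    by (intro sum.cong) (auto simp: first_immersion_def)
  also have "\<dots> = 2 * (\<Sum>i\<le>n. LINT p|\<mu>. b i * (F i p * h p * r p))"
    by (simp add: sum_distrib_left algebra_simps)
  also have "\<dots> = 2 * (LINT p|\<mu>. (\<Sum>i\<le>n. b i * (F i p * h p * r p)))"
    using FC h rC by (subst Bochner_Integration.integral_sum) (auto intro!: C_integrable C_intros)
  also have "(\<lambda>p. \<Sum>i\<le>n. b i * (F i p * h p * r p)) = (\<lambda>p. lin n F b p * h p * r p)"
    by (simp add: lin_def dot_def sum_distrib_right mult.assoc fun_eq_iff)
  finally show ?thesis .
qed

lemma defect_nonneg: "0 \<le> defect n F r b p"
  using dot_Bessel[OF unit D11 D22 D12 unit_orthogonal[of n F, OF FC unit], of b p]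
  unfolding defect_def grad_inner_def D1_lin D2_lin by (simp add: lin_def power2_eq_square)

lemma defect_cont: "continuous_on UNIV (defect n F r b)"
  unfolding defect_def[abs_def]
  by (intro continuous_intros grad_inner_cont C_cont lin_in_C rC)

text \<open>The eigenvalue equation for \<open>u = b . F\<close> is tested with
  \<open>1 / (1 + u)\<close>. Expressing the energy density of \<open>u\<close> through the defect
  turns it into an identity of areas: the Moebius image has the area of \<open>F\<close> minus an
  integral of the nonnegative defect. Stated with a positive denominator instead of
  \<open>|b| < 1\<close>, it also covers boundary parameters \<open>b\<close> whose antipode is
  missed by \<open>F\<close>.\<close>

lemma lin_identity:
  assumes q: "\<And>p. 0 < 1 + lin n F b p"
  shows "(LINT p|\<mu>. defect n F r b p / (1 + lin n F b p)\<^sup>2)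
    = (LINT p|\<mu>. r p) - (LINT p|\<mu>. (1 - dot n b b) / (1 + lin n F b p)\<^sup>2 * r p)"
proof -
  let ?u = "lin n F b"
  let ?h = "\<lambda>p. 1 / (1 + ?u p)"
  have q': "1 + ?u p \<noteq> 0" for p using q[of p] by simp
  have q1: "(\<lambda>p. 1 + ?u p) \<in> C" by (intro C_intros lin_in_C)
  have h: "?h \<in> C" using q' q1 by (intro C_divide C_const)
  have Dh: "D1 ?h p = - D1 ?u p / (1 + ?u p)\<^sup>2" "D2 ?h p = - D2 ?u p / (1 + ?u p)\<^sup>2" for p
    using D1_divide[OF C_const q1 q', of 1 p] D2_divide[OF C_const q1 q', of 1 p]
    by (simp_all add: D1_const D2_const D1_add D2_add C_const lin_in_C)
  have g: "grad_inner ?u ?h p = - (grad_inner ?u ?u p / (1 + ?u p)\<^sup>2)" for p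
    unfolding grad_inner_def Dh by (simp add: add_divide_distrib)
  have igg: "integrable \<mu> (\<lambda>p. grad_inner ?u ?u p / (1 + ?u p)\<^sup>2)"
    using q' by (intro cont_integrable continuous_intros grad_inner_cont lin_in_C C_cont) auto
  have "(LINT p|\<mu>. grad_inner ?u ?u p / (1 + ?u p)\<^sup>2) + 2 * (LINT p|\<mu>. ?u p * ?h p * r p) = 0"
    using energy_lin[OF h, of b] unfolding energy_def g by simp
  moreover have iu: "integrable \<mu> (\<lambda>p. ?u p * ?h p * r p)"
    by (intro C_integrable C_mult lin_in_C h rC)
  moreover have id: "integrable \<mu> (\<lambda>p. defect n F r b p / (1 + ?u p)\<^sup>2)"
    using q' by (intro cont_integrable continuous_intros defect_cont lin_in_C C_cont) auto
  moreover have ir: "integrable \<mu> (\<lambda>p. (1 - dot n b b) / (1 + ?u p)\<^sup>2 * r p)"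
    using q' by (intro cont_integrable continuous_intros rC lin_in_C C_cont) auto
  moreover have "grad_inner ?u ?u p / (1 + ?u p)\<^sup>2 + 2 * (?u p * ?h p * r p)
     = r p - (1 - dot n b b) / (1 + ?u p)\<^sup>2 * r p - defect n F r b p / (1 + ?u p)\<^sup>2" for p
  proof -
    define Q where "Q = 1 + ?u p"
    have Q: "Q \<noteq> 0" "?u p = Q - 1" using q'[of p] by (auto simp: Q_def)
    have "grad_inner ?u ?u p = r p * (dot n b b - (Q - 1)\<^sup>2) - defect n F r b p"
      using Q by (simp add: defect_def)
    moreover have "(r p * (dot n b b - (Q - 1)\<^sup>2) - defect n F r b p) / Q\<^sup>2 + 2 * ((Q - 1) * (1 / Q) * r p)
       = r p - (1 - dot n b b) / Q\<^sup>2 * r p - defect n F r b p / Q\<^sup>2"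
      using Q(1) by (simp add: divide_simps) (simp add: algebra_simps power2_eq_square)
    moreover have "1 + ?u p = Q" by (simp add: Q_def)
    ultimately show ?thesis unfolding Q(2) by simp
  qed
  hence "(LINT p|\<mu>. grad_inner ?u ?u p / (1 + ?u p)\<^sup>2 + 2 * (?u p * ?h p * r p))
    = (LINT p|\<mu>. r p - (1 - dot n b b) / (1 + ?u p)\<^sup>2 * r p - defect n F r b p / (1 + ?u p)\<^sup>2)" by simp
  ultimately show ?thesis
    using Bochner_Integration.integral_add[OF igg Bochner_Integration.integrable_mult_right[OF iu, of 2]]
      Bochner_Integration.integral_diff[OF Bochner_Integration.integrable_diff[OF C_integrable[OF rC] ir] id]
      Bochner_Integration.integral_diff[OF C_integrable[OF rC] ir] integral_mult_right_zero[of \<mu> 2 "\<lambda>p. ?u p * ?h p * r p"]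
    by linarith
qed

context
  fixes b
  assumes b: "dot n b b < 1"
begin

lemma qpos: "0 < 1 + lin n F b p"
  by (rule lin_pos[OF unit b])

lemma mob_C: "i \<le> n \<Longrightarrow> mob n F b i \<in> C"
  unfolding mob_def[abs_def] Let_def
  using qpos by (intro C_add C_const C_mult C_divide lin_in_C FC) (auto simp: less_imp_neq[THEN not_sym])

lemma mob_deriv:
  assumes "i \<le> n"
    and s_def: "s = sqrt (1 - dot n b b)" and q_def: "q = 1 + lin n F b p"
  shows "D1 (mob n F b i) p = (s / q) * D1 (F i) p - (s * dot n b (\<lambda>i. D1 (F i) p) / q\<^sup>2) * (F i p + (1 / (1 + s)) * b i)"
    "D2 (mob n F b i) p = (s / q) * D2 (F i) p - (s * dot n b (\<lambda>i. D2 (F i) p) / q\<^sup>2) * (F i p + (1 / (1 + s)) * b i)"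
proof -
  define c where "c = 1 / (1 + s)"
  have q': "1 + lin n F b p \<noteq> 0" for p using qpos[of p] by simp
  have q1: "(\<lambda>p. 1 + lin n F b p) \<in> C" by (intro C_intros lin_in_C)
  have sq: "(\<lambda>p. s / (1 + lin n F b p)) \<in> C" using q' q1 by (intro C_divide C_const)
  have fc: "(\<lambda>p. F i p + c * b i) \<in> C" using FC assms(1) by (intro C_add C_const)
  have *: "mob n F b i = (\<lambda>p. c * b i + (s / (1 + lin n F b p)) * (F i p + c * b i))"
    by (simp add: mob_def[abs_def] Let_def s_def c_def)
  note C = C_const C_mult[OF sq fc] q1 q' sq fc lin_in_C FC[OF assms(1)]
  show "D1 (mob n F b i) p = (s / q) * D1 (F i) p - (s * dot n b (\<lambda>i. D1 (F i) p) / q\<^sup>2) * (F i p + (1 / (1 + s)) * b i)"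
    unfolding * D1_add[OF C_const C_mult[OF sq fc]] D1_mult[OF sq fc] D1_divide[OF C_const q1 q']
      D1_add[OF C_const lin_in_C] D1_add[OF FC[OF assms(1)] C_const] D1_const D1_lin
    by (simp add: q_def c_def)
  show "D2 (mob n F b i) p = (s / q) * D2 (F i) p - (s * dot n b (\<lambda>i. D2 (F i) p) / q\<^sup>2) * (F i p + (1 / (1 + s)) * b i)"
    unfolding * D2_add[OF C_const C_mult[OF sq fc]] D2_mult[OF sq fc] D2_divide[OF C_const q1 q']
      D2_add[OF C_const lin_in_C] D2_add[OF FC[OF assms(1)] C_const] D2_const D2_lin
    by (simp add: q_def c_def)
qed

lemma sqrt_facts: "dot n b b = 1 - (sqrt (1 - dot n b b))\<^sup>2" "0 < sqrt (1 - dot n b b)"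
  using b by auto

lemma mob_unit: "dot n (\<lambda>i. mob n F b i p) (\<lambda>i. mob n F b i p) = 1"
proof -
  have q: "1 + lin n F b p = 1 + dot n b (\<lambda>i. F i p)" "1 + lin n F b p \<noteq> 0"
    using qpos[of p] by (auto simp: lin_def)
  show ?thesis unfolding mob_def Let_def
    by (rule moebius_dot(2)[where f = "\<lambda>i. F i p" and x = "\<lambda>_. 0" and y = "\<lambda>_. 0",
          OF unit _ _ sqrt_facts q refl]) simp_all
qed

text \<open>A conformal map has energy density twice its area density.\<close>

lemma mob_grad: "(\<Sum>i\<le>n. grad_inner (mob n F b i) (mob n F b i) p) = 2 * ((1 - dot n b b) / (1 + lin n F b p)\<^sup>2 * r p)"
proof -
  let ?s = "sqrt (1 - dot n b b)"
  have q: "1 + lin n F b p = 1 + dot n b (\<lambda>i. F i p)" "1 + lin n F b p \<noteq> 0"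
    using qpos[of p] by (auto simp: lin_def)
  note o = unit_orthogonal[of n F, OF FC unit]
  let ?x1 = "\<lambda>i. (?s / (1 + lin n F b p)) * D1 (F i) p - (?s * dot n b (\<lambda>i. D1 (F i) p) / (1 + lin n F b p)\<^sup>2) * (F i p + (1 / (1 + ?s)) * b i)"
  let ?x2 = "\<lambda>i. (?s / (1 + lin n F b p)) * D2 (F i) p - (?s * dot n b (\<lambda>i. D2 (F i) p) / (1 + lin n F b p)\<^sup>2) * (F i p + (1 / (1 + ?s)) * b i)"
  have "dot n (\<lambda>i. D1 (mob n F b i) p) (\<lambda>i. D1 (mob n F b i) p) = ?s\<^sup>2 / (1 + lin n F b p)\<^sup>2 * r p"
  proof -
    have "dot n (\<lambda>i. D1 (mob n F b i) p) (\<lambda>i. D1 (mob n F b i) p) = dot n ?x1 ?x1"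
      by (intro dot_cong) (simp_all only: mob_deriv(1)[OF _ refl refl])
    also have "\<dots> = ?s\<^sup>2 / (1 + lin n F b p)\<^sup>2 * dot n (\<lambda>i. D1 (F i) p) (\<lambda>i. D1 (F i) p)"
      by (rule moebius_dot(1)[where f = "\<lambda>i. F i p", OF unit o(1) o(1) sqrt_facts q refl])
    finally show ?thesis by (simp only: D11)
  qed
  moreover have "dot n (\<lambda>i. D2 (mob n F b i) p) (\<lambda>i. D2 (mob n F b i) p) = ?s\<^sup>2 / (1 + lin n F b p)\<^sup>2 * r p"
  proof -
    have "dot n (\<lambda>i. D2 (mob n F b i) p) (\<lambda>i. D2 (mob n F b i) p) = dot n ?x2 ?x2"
      by (intro dot_cong) (simp_all only: mob_deriv(2)[OF _ refl refl])
    also have "\<dots> = ?s\<^sup>2 / (1 + lin n F b p)\<^sup>2 * dot n (\<lambda>i. D2 (F i) p) (\<lambda>i. D2 (F i) p)"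
      by (rule moebius_dot(1)[where f = "\<lambda>i. F i p", OF unit o(2) o(2) sqrt_facts q refl])
    finally show ?thesis by (simp only: D22)
  qed
  moreover have "?s\<^sup>2 = 1 - dot n b b" using b by simp
  ultimately show ?thesis
    by (simp add: grad_inner_def sum.distrib dot_def)
qed

end

end

text \<open>Hersch's argument: at the conformal barycentre for \<open>w\<close> the coordinates of
  the Moebius image have mean zero, so \<open>poincare w\<close> applies to each of them. Their
  squares sum to 1 and their energies to twice the area of the image.\<close>

lemma compare_step:
  assumes fi: "first_immersion n F r" and w: "w \<in> C" "\<And>p. 0 \<le> w p" and P: "poincare w"
    and M: "(LINT p|\<mu>. w p) > 0"
  shows "\<exists>b. dot n b b < 1 \<and> (\<forall>i\<le>n. (LINT p|\<mu>. mob n F b i p * w p) = 0) \<and>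
    2 * (LINT p|\<mu>. w p) \<le> (\<Sum>i\<le>n. energy (mob n F b i) (mob n F b i)) \<and>
    (\<Sum>i\<le>n. energy (mob n F b i) (mob n F b i)) = 2 * (LINT p|\<mu>. (1 - dot n b b) / (1 + lin n F b p)\<^sup>2 * r p) \<and>
    (\<forall>i\<le>n. 2 * (LINT p|\<mu>. (mob n F b i p)\<^sup>2 * w p) \<le> energy (mob n F b i) (mob n F b i)) \<and>
    (\<Sum>i\<le>n. LINT p|\<mu>. (mob n F b i p)\<^sup>2 * w p) = (LINT p|\<mu>. w p)"
proof -
  let ?M = "LINT p|\<mu>. w p"
  obtain b where b: "dot n b b < 1"
    and bary: "\<And>i. i \<le> n \<Longrightarrow> (LINT p|\<mu>. F i p / (1 + lin n F b p) * w p) = - b i / (1 - dot n b b) * ?M"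
    using conformal_barycenter[of n F w, OF FC[OF fi] unit[OF fi] null[OF fi] w M] by blast
  define s where "s = sqrt (1 - dot n b b)"
  define c where "c = 1 / (1 + s)"
  define q where "q = (\<lambda>p. 1 + lin n F b p)"
  have s: "s > 0" "s\<^sup>2 = 1 - dot n b b" using b by (auto simp: s_def)
  have q: "q p > 0" "q p \<noteq> 0" for p using qpos[OF fi b, of p] by (auto simp: q_def)
  have qC: "q \<in> C" unfolding q_def by (intro C_add C_const lin_in_C[OF fi])
  have Fq: "(\<lambda>p. F i p / q p * w p) \<in> C" if "i \<le> n" for i
    using that q(2) by (intro C_mult C_divide FC[OF fi] qC w(1))
  have wq: "(\<lambda>p. w p / q p) \<in> C" using q(2) by (intro C_divide qC w(1))
  have bary': "(LINT p|\<mu>. F i p / q p * w p) = - b i / s\<^sup>2 * ?M" if "i \<le> n" for i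
    using bary[OF that] unfolding q_def s(2) .
  \<comment> \<open>\<open>1 = 1 / q + (b . F) / q\<close> is integrated against \<open>w\<close>,
    and the barycentre equations are summed with coefficients \<open>b i\<close>.\<close>
  have one: "(LINT p|\<mu>. w p / q p) = ?M / s\<^sup>2"
  proof -
    have "?M = (LINT p|\<mu>. w p / q p + (\<Sum>i\<le>n. b i * (F i p / q p * w p)))"
    proof (rule Bochner_Integration.integral_cong)
      fix p
      have "(\<Sum>i\<le>n. b i * (F i p / q p * w p)) = lin n F b p / q p * w p"
        by (simp add: lin_def dot_def sum_distrib_right sum_divide_distrib mult.assoc)
      thus "w p = w p / q p + (\<Sum>i\<le>n. b i * (F i p / q p * w p))"
        using q(2)[of p] by (simp add: q_def field_simps)
    qed simp
    also have "\<dots> = (LINT p|\<mu>. w p / q p) + (\<Sum>i\<le>n. b i * (LINT p|\<mu>. F i p / q p * w p))"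
    proof -
      have iS: "integrable \<mu> (\<lambda>p. \<Sum>i\<le>n. b i * (F i p / q p * w p))"
        by (intro C_integrable C_sum C_scale Fq) auto
      have "(LINT p|\<mu>. (\<Sum>i\<le>n. b i * (F i p / q p * w p))) = (\<Sum>i\<le>n. LINT p|\<mu>. b i * (F i p / q p * w p))"
        by (intro Bochner_Integration.integral_sum C_integrable C_scale Fq) auto
      thus ?thesis
        unfolding Bochner_Integration.integral_add[OF C_integrable[OF wq] iS] by (simp only: integral_mult_right_zero)
    qed
    also have "(\<Sum>i\<le>n. b i * (LINT p|\<mu>. F i p / q p * w p)) = (\<Sum>i\<le>n. - (b i * b i) * (?M / s\<^sup>2))"
      using bary' by (intro sum.cong) auto
    also have "\<dots> = - (1 - s\<^sup>2) * (?M / s\<^sup>2)"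
    proof -
      have "(\<Sum>i\<le>n. b i * b i) = 1 - s\<^sup>2" using s(2) by (simp add: dot_def)
      thus ?thesis by (simp only: sum_distrib_right[symmetric] sum_negf)
    qed
    finally show ?thesis using s(1) by (simp add: field_simps)
  qed
  \<comment> \<open>The barycentre equation and \<open>one\<close> reduce the mean to a multiple of
    \<open>c - 1 / s + c / s\<close>, which is zero because \<open>c (1 + s) = 1\<close>.\<close>
  have mean: "(LINT p|\<mu>. mob n F b i p * w p) = 0" if i: "i \<le> n" for i
  proof -
    have "(LINT p|\<mu>. mob n F b i p * w p)
        = (LINT p|\<mu>. (c * b i) * w p + (s * (F i p / q p * w p) + (s * c * b i) * (w p / q p)))"
      by (intro Bochner_Integration.integral_cong)
        (auto simp: mob_def Let_def q_def s_def c_def add_divide_distrib algebra_simps)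
    also have "\<dots> = (c * b i) * ?M + (s * (LINT p|\<mu>. F i p / q p * w p) + (s * c * b i) * (LINT p|\<mu>. w p / q p))"
      using Fq[OF i] wq w(1)
      by (simp add: Bochner_Integration.integral_add C_integrable C_scale C_add del: times_divide_eq_left times_divide_eq_right)
    also have "\<dots> = ?M * b i * (c - 1 / s + c / s)"
      unfolding one bary'[OF i] using s(1) by (simp add: field_simps power2_eq_square)
    also have "c - 1 / s + c / s = 0" using s(1) by (simp add: c_def field_simps)
    finally show ?thesis by simp
  qed
  have sum1: "(\<Sum>i\<le>n. LINT p|\<mu>. (mob n F b i p)\<^sup>2 * w p) = ?M"
  proof -
    have "(\<Sum>i\<le>n. LINT p|\<mu>. (mob n F b i p)\<^sup>2 * w p) = (LINT p|\<mu>. (\<Sum>i\<le>n. (mob n F b i p)\<^sup>2 * w p))"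
      using mob_C[OF fi b] w(1)
      by (subst Bochner_Integration.integral_sum) (auto intro!: C_integrable C_mult C_power2)
    also have "(\<lambda>p. \<Sum>i\<le>n. (mob n F b i p)\<^sup>2 * w p) = w"
      using mob_unit[OF fi b] by (simp add: dot_def power2_eq_square flip: sum_distrib_right)
    finally show ?thesis .
  qed
  have sum2: "(\<Sum>i\<le>n. energy (mob n F b i) (mob n F b i)) = 2 * (LINT p|\<mu>. (1 - dot n b b) / (1 + lin n F b p)\<^sup>2 * r p)"
  proof -
    have "(\<Sum>i\<le>n. energy (mob n F b i) (mob n F b i)) = (LINT p|\<mu>. (\<Sum>i\<le>n. grad_inner (mob n F b i) (mob n F b i) p))"
      unfolding energy_def using mob_C[OF fi b]
      by (subst Bochner_Integration.integral_sum) (auto intro!: grad_inner_integrable)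
    thus ?thesis unfolding mob_grad[OF fi b] by (simp only: integral_mult_right_zero)
  qed
  have le: "2 * (LINT p|\<mu>. (mob n F b i p)\<^sup>2 * w p) \<le> energy (mob n F b i) (mob n F b i)" if "i \<le> n" for i
    using P mob_C[OF fi b that] mean[OF that] unfolding poincare_def by blast
  have "2 * ?M \<le> (\<Sum>i\<le>n. energy (mob n F b i) (mob n F b i))"
    unfolding sum1[symmetric] sum_distrib_left using le by (intro sum_mono) auto
  thus ?thesis using b mean le sum1 sum2 by blast
qed

text \<open>The area identity \<open>lin_identity\<close> with its nonnegative defect. Equality
  forces the continuous defect to vanish identically, since nonempty open sets have positive
  measure.\<close>

lemma mass_le:
  assumes fi: "first_immersion n F r" and b: "dot n b b < 1"
  shows "(LINT p|\<mu>. (1 - dot n b b) / (1 + lin n F b p)\<^sup>2 * r p) \<le> (LINT p|\<mu>. r p)"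
    and "(LINT p|\<mu>. (1 - dot n b b) / (1 + lin n F b p)\<^sup>2 * r p) = (LINT p|\<mu>. r p) \<Longrightarrow> defect n F r b p = 0"
proof -
  have q: "0 < 1 + lin n F b p" for p by (rule qpos[OF fi b])
  have q': "(1 + lin n F b p)\<^sup>2 \<noteq> 0" for p using q[of p] by simp
  have nn: "0 \<le> defect n F r b p / (1 + lin n F b p)\<^sup>2" for p
    using defect_nonneg[OF fi, of b p] by simp
  have "0 \<le> (LINT p|\<mu>. defect n F r b p / (1 + lin n F b p)\<^sup>2)" using nn by simp
  thus "(LINT p|\<mu>. (1 - dot n b b) / (1 + lin n F b p)\<^sup>2 * r p) \<le> (LINT p|\<mu>. r p)"
    using lin_identity[OF fi q] by simp
  assume "(LINT p|\<mu>. (1 - dot n b b) / (1 + lin n F b p)\<^sup>2 * r p) = (LINT p|\<mu>. r p)"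
  hence z: "(LINT p|\<mu>. defect n F r b p / (1 + lin n F b p)\<^sup>2) = 0"
    using lin_identity[OF fi q] by simp
  have "continuous_on UNIV (\<lambda>p. defect n F r b p / (1 + lin n F b p)\<^sup>2)"
    using q' by (intro continuous_intros defect_cont[OF fi] C_cont lin_in_C[OF fi]) auto
  from integral_pos_zero[OF this nn z, of p] show "defect n F r b p = 0" using q'[of p] by simp
qed

text \<open>By \<open>compare_step\<close> and \<open>mass_le\<close> the area of \<open>G\<close>
  is at most that of a Moebius image of \<open>F\<close>, hence at most that of \<open>F\<close>.
  Exchanging the roles closes the circle, and every inequality becomes an equality. The defect
  therefore vanishes, and the Moebius coordinates are extremal for \<open>r'\<close>, so they
  satisfy the eigenvalue equation with weight \<open>r'\<close>.\<close>

theorem compare: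
  assumes fi: "first_immersion n F r" and fi': "first_immersion m G r'"
  shows "\<exists>b. dot n b b < 1 \<and> (\<forall>p. r' p = (1 - dot n b b) / (1 + lin n F b p)\<^sup>2 * r p \<and> defect n F r b p = 0)"
proof -
  obtain b where b: "dot n b b < 1" and mean: "\<And>i. i \<le> n \<Longrightarrow> (LINT p|\<mu>. mob n F b i p * r' p) = 0"
    and le: "2 * (LINT p|\<mu>. r' p) \<le> (\<Sum>i\<le>n. energy (mob n F b i) (mob n F b i))"
    and eq: "(\<Sum>i\<le>n. energy (mob n F b i) (mob n F b i)) = 2 * (LINT p|\<mu>. (1 - dot n b b) / (1 + lin n F b p)\<^sup>2 * r p)"
    and lei: "\<And>i. i \<le> n \<Longrightarrow> 2 * (LINT p|\<mu>. (mob n F b i p)\<^sup>2 * r' p) \<le> energy (mob n F b i) (mob n F b i)"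
    and sm: "(\<Sum>i\<le>n. LINT p|\<mu>. (mob n F b i p)\<^sup>2 * r' p) = (LINT p|\<mu>. r' p)"
    using compare_step[OF fi rC[OF fi'] r0[OF fi'] pr[OF fi'] rM[OF fi']] by blast
  obtain d where d: "dot m d d < 1"
    and le': "2 * (LINT p|\<mu>. r p) \<le> (\<Sum>i\<le>m. energy (mob m G d i) (mob m G d i))"
    and eq': "(\<Sum>i\<le>m. energy (mob m G d i) (mob m G d i)) = 2 * (LINT p|\<mu>. (1 - dot m d d) / (1 + lin m G d p)\<^sup>2 * r' p)"
    using compare_step[OF fi' rC[OF fi] r0[OF fi] pr[OF fi] rM[OF fi]] by blast
  note mle = mass_le(1)[OF fi b] mass_le(1)[OF fi' d]
  have M1: "(LINT p|\<mu>. (1 - dot n b b) / (1 + lin n F b p)\<^sup>2 * r p) = (LINT p|\<mu>. r p)"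
    and M2: "(LINT p|\<mu>. r' p) = (LINT p|\<mu>. r p)"
    using mle le le' eq eq' by linarith+
  have def0: "defect n F r b p = 0" for p by (rule mass_le(2)[OF fi b M1])
  let ?E = "\<lambda>i. energy (mob n F b i) (mob n F b i)" and ?I = "\<lambda>i. LINT p|\<mu>. (mob n F b i p)\<^sup>2 * r' p"
  have sE: "(\<Sum>i\<le>n. ?E i - 2 * ?I i) = 0"
    using sm eq M1 M2 by (simp add: sum_subtractf flip: sum_distrib_left)
  have "\<forall>i\<in>{..n}. ?E i - 2 * ?I i = 0"
    using sum_nonneg_eq_0_iff[of "{..n}" "\<lambda>i. ?E i - 2 * ?I i"] sE lei by auto
  hence Ei: "?E i = 2 * ?I i" if "i \<le> n" for i using that by simp
  have el: "energy (mob n F b i) h = 2 * (LINT p|\<mu>. mob n F b i p * h p * r' p)" if "i \<le> n" "h \<in> C" for i h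
    by (rule euler_lagrange[OF mob_C[OF fi b] rC[OF fi'] pr[OF fi'] less_imp_neq[OF rM[OF fi'], symmetric]
          mean Ei]) (use that in auto)
  define k where "k = (\<lambda>p. (1 - dot n b b) / (1 + lin n F b p)\<^sup>2 * r p)"
  have q': "(1 + lin n F b p)\<^sup>2 \<noteq> 0" for p using qpos[OF fi b, of p] by simp
  have k: "k \<in> C" unfolding k_def
    using q' by (intro C_mult C_divide C_const C_power2 C_add lin_in_C[OF fi] rC[OF fi])
  \<comment> \<open>The equations for \<open>?v i\<close> are tested with \<open>?v i * h\<close>
    and summed. Since the squares of the \<open>?v i\<close> sum to 1, the terms with derivatives of
    \<open>h\<close> cancel, and what remains says that \<open>k - r'\<close> is orthogonal to
    \<open>h\<close>; the choice of \<open>h\<close> is \<open>k - r'\<close> itself.\<close>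
  define h where "h = (\<lambda>p. k p - r' p)"
  have h: "h \<in> C" unfolding h_def by (intro C_diff k rC[OF fi'])
  let ?v = "mob n F b"
  note v = mob_C[OF fi b]
  note o = unit_orthogonal[of n ?v, OF v mob_unit[OF fi b]]
  have "(\<Sum>i\<le>n. energy (?v i) (\<lambda>p. ?v i p * h p)) = (LINT p|\<mu>. (\<Sum>i\<le>n. grad_inner (?v i) (\<lambda>p. ?v i p * h p) p))"
    unfolding energy_def using v h
    by (subst Bochner_Integration.integral_sum) (auto intro!: grad_inner_integrable C_mult)
  also have "\<dots> = (LINT p|\<mu>. 2 * (k p * h p))"
  proof (rule Bochner_Integration.integral_cong)
    fix p
    have "(\<Sum>i\<le>n. grad_inner (?v i) (\<lambda>p. ?v i p * h p) p) = (\<Sum>i\<le>n. grad_inner (?v i) (?v i) p * h p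
        + ((?v i p * D1 (?v i) p) * D1 h p + (?v i p * D2 (?v i) p) * D2 h p))"
      using v h by (intro sum.cong) (auto simp: grad_inner_def D1_mult D2_mult algebra_simps)
    also have "\<dots> = (\<Sum>i\<le>n. grad_inner (?v i) (?v i) p) * h p
        + (dot n (\<lambda>i. ?v i p) (\<lambda>i. D1 (?v i) p) * D1 h p + dot n (\<lambda>i. ?v i p) (\<lambda>i. D2 (?v i) p) * D2 h p)"
      by (simp add: sum.distrib dot_def sum_distrib_right)
    also have "\<dots> = 2 * (k p * h p)"
    proof -
      have "dot n (\<lambda>i. ?v i p) (\<lambda>i. D1 (?v i) p) = 0" "dot n (\<lambda>i. ?v i p) (\<lambda>i. D2 (?v i) p) = 0"
        by (simp_all add: o)
      thus ?thesis unfolding mob_grad[OF fi b] k_def by simp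
    qed
    finally show "(\<Sum>i\<le>n. grad_inner (?v i) (\<lambda>p. ?v i p * h p) p) = 2 * (k p * h p)" .
  qed simp
  finally have 1: "(\<Sum>i\<le>n. energy (?v i) (\<lambda>p. ?v i p * h p)) = 2 * (LINT p|\<mu>. k p * h p)" by simp
  have "(\<Sum>i\<le>n. energy (?v i) (\<lambda>p. ?v i p * h p)) = (\<Sum>i\<le>n. 2 * (LINT p|\<mu>. ?v i p * (?v i p * h p) * r' p))"
    using el v h by (intro sum.cong) (auto intro!: C_mult)
  also have "\<dots> = 2 * (LINT p|\<mu>. (\<Sum>i\<le>n. ?v i p * (?v i p * h p) * r' p))"
    using v h rC[OF fi']
    by (subst Bochner_Integration.integral_sum) (auto intro!: C_integrable C_mult simp: sum_distrib_left)
  also have "(\<lambda>p. \<Sum>i\<le>n. ?v i p * (?v i p * h p) * r' p) = (\<lambda>p. h p * r' p)"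
  proof
    fix p
    have "(\<Sum>i\<le>n. ?v i p * (?v i p * h p) * r' p) = dot n (\<lambda>i. ?v i p) (\<lambda>i. ?v i p) * (h p * r' p)"
      by (simp add: dot_def sum_distrib_right mult.assoc)
    thus "(\<Sum>i\<le>n. ?v i p * (?v i p * h p) * r' p) = h p * r' p" by (simp add: mob_unit[OF fi b])
  qed
  finally have 2: "(LINT p|\<mu>. k p * h p) = (LINT p|\<mu>. h p * r' p)" using 1 by simp
  have "(LINT p|\<mu>. (h p)\<^sup>2) = (LINT p|\<mu>. k p * h p - h p * r' p)"
    by (intro Bochner_Integration.integral_cong) (auto simp: h_def power2_eq_square algebra_simps)
  also have "\<dots> = 0" using 2 C_integrable[OF C_mult[OF k h]] C_integrable[OF C_mult[OF h rC[OF fi']]] by simp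
  finally have z: "(LINT p|\<mu>. (h p)\<^sup>2) = 0" .
  have "(h p)\<^sup>2 = 0" for p using integral_pos_zero[OF C_cont[OF C_power2[OF h]] _ z, of p] by simp
  hence "r' p = k p" for p by (simp add: h_def)
  thus ?thesis using b def0 by (auto simp: k_def)
qed

text \<open>If \<open>-b\<close> is not in the image of a map into a round 2-sphere, the identity behind the
  conformal volume estimate, taken at the boundary point \<open>b\<close>, forces the area to vanish.\<close>

lemma two_sphere_onto:
  assumes fi: "first_immersion n F r" and b: "dot n b b = 1" and d: "\<And>p. defect n F r b p = 0"
  shows "\<exists>p. \<forall>i\<le>n. F i p = - b i"
proof (rule ccontr)
  assume none: "\<not> ?thesis"
  have q: "0 < 1 + lin n F b p" for p
  proof (rule ccontr)
    assume "\<not> 0 < 1 + lin n F b p"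
    moreover have "0 \<le> 1 + lin n F b p" using lin_lower[of n F p b, OF unit[OF fi]] b by simp
    ultimately have "lin n F b p = - 1" by simp
    hence "dot n (\<lambda>i. F i p + b i) (\<lambda>i. F i p + b i) = 0"
      using unit[OF fi, of p] b by (simp add: dot_linear lin_def dot_commute[of n "\<lambda>i. F i p" b])
    thus False using none dot_self_eq_0_iff by (metis add_eq_0_iff2)
  qed
  have "(LINT p|\<mu>. r p) = 0" using lin_identity[OF fi q] b d by simp
  thus False using rM[OF fi] by simp
qed

end

section \<open>Calculus of \<open>C\<^sup>k\<close> functions\<close>

lemma has_derivative_cong_open:
  assumes "open S" "x \<in> S" "\<And>y. y \<in> S \<Longrightarrow> f y = g y"
  shows "(f has_derivative f') (at x) \<longleftrightarrow> (g has_derivative f') (at x)"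
  using assms by (metis has_derivative_transform_within_open)

lemma differentiable_cong_open:
  assumes "open S" "x \<in> S" "\<And>y. y \<in> S \<Longrightarrow> f y = g y"
  shows "f differentiable (at x) \<longleftrightarrow> g differentiable (at x)"
  unfolding differentiable_def using has_derivative_cong_open[OF assms] by simp

lemma frechet_derivative_cong_open:
  assumes "open S" "x \<in> S" "\<And>y. y \<in> S \<Longrightarrow> f y = g y"
  shows "frechet_derivative f (at x) = frechet_derivative g (at x)"
  unfolding frechet_derivative_def using has_derivative_cong_open[OF assms] by simp

lemma frechet_derivative_eqI: "(f has_derivative f') (at x) \<Longrightarrow> frechet_derivative f (at x) = f'"
  using frechet_derivative_at by metis

lemma differentiable_has_derivative:
  "f differentiable (at x) \<Longrightarrow> (f has_derivative frechet_derivative f (at x)) (at x)"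
  using frechet_derivative_works by blast

lemma Ck_on_subset: "Ck_on k S f \<Longrightarrow> T \<subseteq> S \<Longrightarrow> Ck_on k T f"
  by (induction k arbitrary: f) (auto intro: continuous_on_subset)

lemma Ck_on_cong:
  assumes "open S" "\<And>x. x \<in> S \<Longrightarrow> f x = g x" "Ck_on k S f"
  shows "Ck_on k S g"
  using assms(2,3)
proof (induction k arbitrary: f g)
  case 0
  thus ?case using continuous_on_cong by fastforce
next
  case (Suc k)
  have "g differentiable (at x)" if "x \<in> S" for x
    using Suc.prems differentiable_cong_open[OF assms(1) that, of f g] that by auto
  moreover have "Ck_on k S (\<lambda>x. frechet_derivative g (at x) v)" for v
  proof (rule Suc.IH)
    show "frechet_derivative f (at x) v = frechet_derivative g (at x) v" if "x \<in> S" for x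
      using frechet_derivative_cong_open[OF assms(1) that, of f g] Suc.prems(1) by simp
    show "Ck_on k S (\<lambda>x. frechet_derivative f (at x) v)" using Suc.prems(2) by simp
  qed
  ultimately show ?case by simp
qed

lemma Ck_on_SucI:
  assumes "open S" "\<And>x. x \<in> S \<Longrightarrow> (f has_derivative f' x) (at x)" "\<And>v. Ck_on k S (\<lambda>x. f' x v)"
  shows "Ck_on (Suc k) S f"
proof -
  have "Ck_on k S (\<lambda>x. frechet_derivative f (at x) v)" for v
    by (rule Ck_on_cong[OF assms(1) _ assms(3)[of v]]) (simp add: frechet_derivative_eqI[OF assms(2)])
  thus ?thesis using assms(2) by (auto simp: differentiable_def)
qed

lemma Ck_on_SucD:
  assumes "Ck_on (Suc k) S f"
  shows "\<And>x. x \<in> S \<Longrightarrow> (f has_derivative frechet_derivative f (at x)) (at x)"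
    "Ck_on k S (\<lambda>x. frechet_derivative f (at x) v)"
  using assms by (auto intro: differentiable_has_derivative)

lemma Ck_on_Suc_imp: "Ck_on (Suc k) S f \<Longrightarrow> Ck_on k S f"
proof (induction k arbitrary: f)
  case 0
  hence "continuous_on S f"
    by (intro differentiable_imp_continuous_on) (auto simp: differentiable_on_def intro: differentiable_at_withinI)
  thus ?case by simp
next
  case (Suc k)
  thus ?case by simp
qed

lemma Ck_on_mono: "Ck_on k S f \<Longrightarrow> j \<le> k \<Longrightarrow> Ck_on j S f"
proof (induction k)
  case (Suc k)
  thus ?case using Ck_on_Suc_imp[of k S f] by (cases "j = Suc k") auto
qed simp

lemma Ck_on_continuous: "Ck_on k S f \<Longrightarrow> continuous_on S f"
  using Ck_on_mono[of k S f 0] by simp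

lemma Ck_on_Un:
  assumes "open S" "open T" "Ck_on k S f" "Ck_on k T f"
  shows "Ck_on k (S \<union> T) f"
  using assms(3,4) by (induction k arbitrary: f) (auto intro: continuous_on_open_Un[OF assms(1,2)])

lemma Ck_on_const: "Ck_on k S (\<lambda>x. c)"
  by (induction k arbitrary: c) auto

lemma Ck_on_linear:
  assumes "bounded_linear f"
  shows "Ck_on k S f"
proof (cases k)
  case 0
  thus ?thesis using assms by (simp add: linear_continuous_on)
next
  case (Suc j)
  have d: "(f has_derivative f) (at x)" for x using assms by (rule bounded_linear_imp_has_derivative)
  thus ?thesis
    using Suc by (auto simp: differentiable_def frechet_derivative_eqI[OF d] intro: Ck_on_const)
qed

lemma Ck_on_add:
  assumes "open S" "Ck_on k S f" "Ck_on k S g"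
  shows "Ck_on k S (\<lambda>x. f x + g x)"
  using assms(2,3)
proof (induction k arbitrary: f g)
  case 0
  thus ?case by (auto intro: continuous_on_add)
next
  case (Suc k)
  show ?case
    by (rule Ck_on_SucI[OF assms(1) has_derivative_add[OF Ck_on_SucD(1)[OF Suc.prems(1)] Ck_on_SucD(1)[OF Suc.prems(2)]]])
      (auto intro!: Suc.IH Ck_on_SucD(2)[OF Suc.prems(1)] Ck_on_SucD(2)[OF Suc.prems(2)])
qed

text \<open>The Leibniz rule in the bilinear setting, which yields products and scalar multiples at
  once.\<close>

lemma (in bounded_bilinear) Ck_on_prod:
  assumes "open S" "Ck_on k S f" "Ck_on k S g"
  shows "Ck_on k S (\<lambda>x. prod (f x) (g x))"
  using assms(2,3)
proof (induction k arbitrary: f g)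
  case 0
  thus ?case by (auto intro: continuous_on)
next
  case (Suc k)
  show ?case
  proof (rule Ck_on_SucI[OF assms(1)])
    show "((\<lambda>x. prod (f x) (g x)) has_derivative
        (\<lambda>h. prod (f x) (frechet_derivative g (at x) h) + prod (frechet_derivative f (at x) h) (g x))) (at x)"
      if "x \<in> S" for x
      using FDERIV[OF Ck_on_SucD(1)[OF Suc.prems(1) that] Ck_on_SucD(1)[OF Suc.prems(2) that]] .
    show "Ck_on k S (\<lambda>x. prod (f x) (frechet_derivative g (at x) v) + prod (frechet_derivative f (at x) v) (g x))" for v
      by (intro Ck_on_add[OF assms(1)] Suc.IH Ck_on_Suc_imp[OF Suc.prems(1)] Ck_on_Suc_imp[OF Suc.prems(2)]
          Ck_on_SucD(2)[OF Suc.prems(1)] Ck_on_SucD(2)[OF Suc.prems(2)])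
  qed
qed

lemmas Ck_on_mult = bounded_bilinear.Ck_on_prod[OF bounded_bilinear_mult]
lemmas Ck_on_scaleR = bounded_bilinear.Ck_on_prod[OF bounded_bilinear_scaleR]

lemma Ck_on_minus: "open S \<Longrightarrow> Ck_on k S f \<Longrightarrow> Ck_on k S (\<lambda>x. - f x)"
  using Ck_on_scaleR[OF _ Ck_on_const[of k S "-1::real"], of f] by simp

lemma Ck_on_diff: "open S \<Longrightarrow> Ck_on k S f \<Longrightarrow> Ck_on k S g \<Longrightarrow> Ck_on k S (\<lambda>x. f x - g x)"
  using Ck_on_add[of S k f "\<lambda>x. - g x"] Ck_on_minus[of S k g] by simp

lemma Ck_on_sum: "open S \<Longrightarrow> (\<And>i. i \<in> I \<Longrightarrow> Ck_on k S (f i)) \<Longrightarrow> Ck_on k S (\<lambda>x. \<Sum>i\<in>I. f i x)"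
  by (induction I rule: infinite_finite_induct) (auto intro: Ck_on_const Ck_on_add)

text \<open>All powers are treated together: differentiating the power \<open>m\<close> produces the
  power \<open>m + 1\<close>, so the induction on \<open>k\<close> must range over every
  \<open>m\<close>.\<close>

lemma Ck_on_inverse_power:
  fixes q :: "'a::real_normed_vector \<Rightarrow> real"
  assumes "open S" "Ck_on k S q" "\<And>x. x \<in> S \<Longrightarrow> q x \<noteq> 0"
  shows "Ck_on k S (\<lambda>x. inverse (q x) ^ m)"
  using assms(2)
proof (induction k arbitrary: m)
  case 0
  thus ?case using assms(3) by (auto intro!: continuous_intros)
next
  case (Suc k)
  show ?case
  proof (rule Ck_on_SucI[OF assms(1)])
    show "((\<lambda>x. inverse (q x) ^ m) has_derivative
        (\<lambda>h. (- real m * inverse (q x) ^ Suc m) * frechet_derivative q (at x) h)) (at x)" if "x \<in> S" for x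
    proof -
      have "((\<lambda>y. inverse y ^ m) has_real_derivative - real m * inverse (q x) ^ Suc m) (at (q x))"
        by (rule DERIV_cong[OF DERIV_power[OF DERIV_inverse[OF assms(3)[OF that]], of m]])
          (cases m; simp add: algebra_simps)
      from has_derivative_compose[OF Ck_on_SucD(1)[OF Suc.prems that] this[unfolded has_field_derivative_def]]
      show ?thesis .
    qed
    show "Ck_on k S (\<lambda>x. (- real m * inverse (q x) ^ Suc m) * frechet_derivative q (at x) v)" for v
      by (intro Ck_on_mult assms(1) Ck_on_const Suc.IH Ck_on_SucD(2)[OF Suc.prems] Ck_on_Suc_imp[OF Suc.prems])
  qed
qed

lemma Ck_on_inverse:
  fixes q :: "'a::real_normed_vector \<Rightarrow> real"
  shows "open S \<Longrightarrow> Ck_on k S q \<Longrightarrow> (\<And>x. x \<in> S \<Longrightarrow> q x \<noteq> 0) \<Longrightarrow> Ck_on k S (\<lambda>x. inverse (q x))"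
  using Ck_on_inverse_power[of S k q 1] by simp

lemma Ck_on_divide:
  fixes q :: "'a::real_normed_vector \<Rightarrow> real"
  shows "open S \<Longrightarrow> Ck_on k S f \<Longrightarrow> Ck_on k S q \<Longrightarrow> (\<And>x. x \<in> S \<Longrightarrow> q x \<noteq> 0) \<Longrightarrow> Ck_on k S (\<lambda>x. f x / q x)"
  unfolding divide_inverse by (intro Ck_on_mult Ck_on_inverse)

subsection \<open>Bump functions\<close>

text \<open>The functions \<open>P(1/t) exp(-1/t)\<close>, extended by 0, are closed under
  differentiation: the derivative belongs to the polynomial \<open>x^2 (P - P')\<close>, where the
  factor \<open>x^2\<close> is written as two \<open>pCons 0\<close>. Smoothness follows by
  induction over all \<open>P\<close>.\<close>

definition flat_exp :: "real poly \<Rightarrow> real \<Rightarrow> real" where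
  "flat_exp P t = (if t > 0 then poly P (1 / t) * exp (- (1 / t)) else 0)"

lemma poly_times_exp_tendsto_0: "((\<lambda>x. poly P x * exp (- x)) \<longlongrightarrow> (0::real)) at_top"
proof -
  have "((\<lambda>x. \<Sum>i\<le>degree P. coeff P i * (x ^ i / exp x)) \<longlongrightarrow> (\<Sum>i\<le>degree P. coeff P i * 0)) at_top"
    by (intro tendsto_sum tendsto_mult tendsto_const tendsto_power_div_exp_0)
  thus ?thesis
    by (simp add: poly_altdef exp_minus sum_distrib_right divide_inverse mult.assoc)
qed

lemma flat_exp_deriv:
  "(flat_exp P has_real_derivative flat_exp (pCons 0 (pCons 0 (P - pderiv P))) t) (at t)"
proof -
  consider "t > 0" | "t < 0" | "t = 0" by linarith
  thus ?thesis
  proof cases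
    case 1
    have "((\<lambda>t. poly P (1 / t) * exp (- (1 / t))) has_real_derivative
        flat_exp (pCons 0 (pCons 0 (P - pderiv P))) t) (at t)"
      unfolding flat_exp_def using 1
      by (auto intro!: derivative_eq_intros DERIV_chain2[OF poly_DERIV] simp: field_simps power2_eq_square)
    thus ?thesis
      by (rule DERIV_cong_ev[THEN iffD1, rotated -1, OF _ refl _ refl])
        (use 1 in \<open>auto simp: flat_exp_def eventually_nhds intro!: exI[of _ "{0<..}"]\<close>)
  next
    case 2
    have "((\<lambda>t. 0) has_real_derivative flat_exp (pCons 0 (pCons 0 (P - pderiv P))) t) (at t)"
      using 2 by (simp add: flat_exp_def)
    thus ?thesis
      by (rule DERIV_cong_ev[THEN iffD1, rotated -1, OF _ refl _ refl])
        (use 2 in \<open>auto simp: flat_exp_def eventually_nhds intro!: exI[of _ "{..<0}"]\<close>)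
  next
    case 3
    \<comment> \<open>With \<open>x = 1 / h\<close> the difference quotient at 0 is
      \<open>x P(x) exp(-x)\<close>, which tends to 0 as \<open>x\<close> grows.\<close>
    have r: "((\<lambda>h. flat_exp P h / h) \<longlongrightarrow> 0) (at_right 0)"
    proof -
      have "((\<lambda>h. poly (pCons 0 P) (inverse h) * exp (- inverse h)) \<longlongrightarrow> 0) (at_right (0::real))"
        by (rule filterlim_compose[OF poly_times_exp_tendsto_0 filterlim_inverse_at_top_right])
      thus ?thesis
        by (rule Lim_transform_eventually)
          (auto simp: eventually_at_filter flat_exp_def field_simps)
    qed
    have l: "((\<lambda>h. flat_exp P h / h) \<longlongrightarrow> 0) (at_left 0)"
      by (rule tendsto_eventually) (auto simp: eventually_at_filter flat_exp_def)
    have "((\<lambda>h. flat_exp P h / h) \<longlongrightarrow> 0) (at 0)" using r l by (simp add: filterlim_split_at)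
    thus ?thesis using 3 by (simp add: has_field_derivative_iff flat_exp_def)
  qed
qed

lemma Ck_on_flat_exp:
  assumes "bounded_linear l"
  shows "Ck_on k UNIV (\<lambda>z. flat_exp P (l z + c))"
proof (induction k arbitrary: P)
  case 0
  have "continuous_on UNIV (flat_exp P)"
    using flat_exp_deriv by (intro DERIV_continuous_on) (auto intro: has_field_derivative_at_within)
  moreover have "continuous_on UNIV (\<lambda>z. l z + c)"
    by (intro continuous_on_add continuous_on_const linear_continuous_on assms)
  ultimately have "continuous_on UNIV (\<lambda>z. flat_exp P (l z + c))"
    by (rule continuous_on_compose2) auto
  thus ?case by simp
next
  case (Suc k)
  let ?Q = "pCons 0 (pCons 0 (P - pderiv P))"
  show ?case
  proof (rule Ck_on_SucI[OF open_UNIV])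
    fix z
    have "((\<lambda>z. l z + c) has_derivative l) (at z)"
      using has_derivative_add[OF bounded_linear_imp_has_derivative[OF assms] has_derivative_const] by simp
    from has_derivative_compose[OF this flat_exp_deriv[of P "l z + c", unfolded has_field_derivative_def]]
    show "((\<lambda>z. flat_exp P (l z + c)) has_derivative (\<lambda>h. flat_exp ?Q (l z + c) * l h)) (at z)" .
  next
    show "Ck_on k UNIV (\<lambda>z. flat_exp ?Q (l z + c) * l v)" for v
      by (intro Ck_on_mult open_UNIV Suc.IH Ck_on_const)
  qed
qed

text \<open>Each factor is smooth and vanishes beyond one side of the box. Growing \<open>N\<close>
  pushes the factors to 1 inside, so these test functions converge boundedly to the indicator of the
  box.\<close>

definition box_bump :: "complex \<Rightarrow> complex \<Rightarrow> real \<Rightarrow> complex \<Rightarrow> real" where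
  "box_bump a b N z = flat_exp 1 (N * Re z + - N * Re a) * flat_exp 1 (- N * Re z + N * Re b) *
     (flat_exp 1 (N * Im z + - N * Im a) * flat_exp 1 (- N * Im z + N * Im b))"

lemma smooth_box_bump: "smooth_on UNIV (box_bump a b N)"
  unfolding smooth_on_def box_bump_def[abs_def]
  by (intro allI Ck_on_mult open_UNIV Ck_on_flat_exp bounded_linear_const_mult bounded_linear_Re bounded_linear_Im)

lemma flat_exp_1: "flat_exp 1 t = (if t > 0 then exp (- (1 / t)) else 0)"
  by (simp add: flat_exp_def)

lemma flat_exp_1_bounds: "0 \<le> flat_exp 1 t" "flat_exp 1 t \<le> 1"
  by (auto simp: flat_exp_1)

lemma box_bump_bounds: "0 \<le> box_bump a b N z" "box_bump a b N z \<le> 1"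
  unfolding box_bump_def by (auto intro!: mult_nonneg_nonneg mult_le_one flat_exp_1_bounds)

lemma box_bump_outside: "N > 0 \<Longrightarrow> z \<notin> box a b \<Longrightarrow> box_bump a b N z = 0"
  by (auto simp: box_bump_def flat_exp_1 in_box_complex_iff mult_less_cancel_left_pos)

lemma box_bump_tendsto:
  "(\<lambda>k. box_bump a b (real (Suc k)) z) \<longlonglongrightarrow> indicator (box a b) z"
proof (cases "z \<in> box a b")
  case False
  thus ?thesis using box_bump_outside[of "real (Suc k)" z a b for k] by (simp add: box_bump_outside)
next
  case True
  have *: "(\<lambda>k. flat_exp 1 (real (Suc k) * x + - real (Suc k) * y)) \<longlonglongrightarrow> 1" if "x > y" for x y
  proof -
    have "(\<lambda>k. exp (- (inverse (real (Suc k)) / (x - y)))) \<longlonglongrightarrow> exp (- (0 / (x - y)))"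
      using LIMSEQ_Suc[OF lim_inverse_n'] that by (intro tendsto_intros LIMSEQ_inverse_real_of_nat) auto
    moreover have "flat_exp 1 (real (Suc k) * x + - real (Suc k) * y) = exp (- (inverse (real (Suc k)) / (x - y)))" for k
    proof -
      have "real (Suc k) * x + - real (Suc k) * y = real (Suc k) * (x - y)" by (simp add: algebra_simps)
      moreover have "real (Suc k) * (x - y) > 0" using that by simp
      ultimately show ?thesis by (simp add: flat_exp_1 divide_inverse del: of_nat_Suc)
    qed
    ultimately show ?thesis by simp
  qed
  have "Re a < Re z" "Re z < Re b" "Im a < Im z" "Im z < Im b" using True by (auto simp: in_box_complex_iff)
  hence "(\<lambda>k. box_bump a b (real (Suc k)) z) \<longlonglongrightarrow> 1 * 1 * (1 * 1)"
    unfolding box_bump_def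
    using *[of "Re a" "Re z"] *[of "Re z" "Re b"] *[of "Im a" "Im z"] *[of "Im z" "Im b"]
    by (intro tendsto_mult) (auto simp: add.commute)
  thus ?thesis using True by simp
qed

subsection \<open>Functions on the plane\<close>

lemma frechet_derivative_complex:
  fixes f :: "complex \<Rightarrow> 'b::real_normed_vector"
  assumes "f differentiable (at z)"
  shows "frechet_derivative f (at z) v = Re v *\<^sub>R frechet_derivative f (at z) 1 + Im v *\<^sub>R frechet_derivative f (at z) \<i>"
proof -
  have l: "linear (frechet_derivative f (at z))" using assms by (rule linear_frechet_derivative)
  have "v = Re v *\<^sub>R 1 + Im v *\<^sub>R \<i>" by (simp add: complex_eq_iff)
  from arg_cong[OF this, of "frechet_derivative f (at z)"]
  show ?thesis by (simp only: linear_add[OF l] linear_scale[OF l])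
qed

lemma directional_DERIV:
  fixes f :: "complex \<Rightarrow> real"
  assumes "f differentiable (at (z + s *\<^sub>R v))"
  shows "((\<lambda>s. f (z + s *\<^sub>R v)) has_real_derivative pderiv_at f (z + s *\<^sub>R v) v) (at s)"
proof -
  have "((\<lambda>s. z + s *\<^sub>R v) has_derivative (\<lambda>h. h *\<^sub>R v)) (at s)"
    by (auto intro!: derivative_eq_intros)
  from has_derivative_compose[OF this differentiable_has_derivative[OF assms]]
  have "((\<lambda>s. f (z + s *\<^sub>R v)) has_derivative (\<lambda>h. frechet_derivative f (at (z + s *\<^sub>R v)) (h *\<^sub>R v))) (at s)" .
  moreover have "frechet_derivative f (at (z + s *\<^sub>R v)) (h *\<^sub>R v) = pderiv_at f (z + s *\<^sub>R v) v * h" for h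
    using linear_frechet_derivative[OF assms] by (simp add: linear_scale)
  ultimately show ?thesis by (simp add: has_field_derivative_def)
qed

text \<open>Translation invariance makes the integral of every difference quotient vanish; dominated
  convergence passes this on to the derivative.\<close>

lemma integral_directional_derivative_zero:
  fixes F :: "complex \<Rightarrow> real"
  assumes F: "Ck_on 1 UNIV F" and K: "compact K" and supp: "\<And>z. z \<notin> K \<Longrightarrow> F z = 0"
  shows "(LINT z|lborel. pderiv_at F z v) = 0"
proof -
  let ?D = "\<lambda>z. pderiv_at F z v"
  have Dc: "continuous_on UNIV ?D" using F by simp
  have Fc: "continuous_on UNIV F" using F Ck_on_continuous by blast
  have Dsupp: "?D z = 0" if "z \<notin> K" for z
  proof -
    have "frechet_derivative F (at z) = frechet_derivative (\<lambda>_. 0) (at z)"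
      using supp that by (intro frechet_derivative_cong_open[of "- K"]) (auto simp: compact_imp_closed K)
    thus ?thesis by simp
  qed
  obtain B where B: "\<And>z. \<bar>?D z\<bar> \<le> B"
  proof -
    have "bounded (?D ` K)"
      using K Dc by (meson compact_continuous_image compact_imp_bounded continuous_on_subset subset_UNIV)
    then obtain B where "\<forall>z\<in>K. \<bar>?D z\<bar> \<le> B" by (auto simp: bounded_iff)
    hence "\<bar>?D z\<bar> \<le> max B 0" for z using Dsupp[of z] by (cases "z \<in> K") auto
    thus ?thesis using that by blast
  qed
  have lip: "\<bar>F (z + t *\<^sub>R v) - F z\<bar> \<le> B * t" if "t > 0" for z t
  proof -
    have "\<exists>s. 0 < s \<and> s < t \<and> F (z + t *\<^sub>R v) - F (z + 0 *\<^sub>R v) = (t - 0) * ?D (z + s *\<^sub>R v)"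
    proof (rule MVT2[OF that])
      fix s
      show "((\<lambda>s. F (z + s *\<^sub>R v)) has_real_derivative ?D (z + s *\<^sub>R v)) (at s)"
        using F by (intro directional_DERIV) simp
    qed
    then obtain s where "F (z + t *\<^sub>R v) - F z = t * ?D (z + s *\<^sub>R v)" by auto
    thus ?thesis using B[of "z + s *\<^sub>R v"] that by (simp add: abs_mult mult.commute mult_left_mono)
  qed
  \<comment> \<open>\<open>K'\<close> is \<open>K\<close> swept along \<open>- s v\<close> for
    \<open>s\<close> between 0 and 1; it contains the support of every difference quotient with step
    at most 1.\<close>
  define K' where "K' = (\<lambda>(x, s). x - s *\<^sub>R v) ` (K \<times> {0..1::real})"
  have K': "compact K'" unfolding K'_def
    by (intro compact_continuous_image compact_Times K compact_Icc) (auto intro!: continuous_intros simp: case_prod_beta)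
  have KK': "K \<subseteq> K'" unfolding K'_def by (auto intro!: image_eqI[where x = "(x, 0)" for x])
  have iF: "integrable lborel F"
  proof -
    have "integrable lborel (\<lambda>z. indicator K z *\<^sub>R F z)"
      using borel_integrable_compact[OF K continuous_on_subset[OF Fc]] by simp
    moreover have "(\<lambda>z. indicator K z *\<^sub>R F z) = F" using supp by (force simp: indicator_def)
    ultimately show ?thesis by simp
  qed
  have trans: "(LINT z|lborel. F (z + w)) = (LINT z|lborel. F z)" "integrable lborel (\<lambda>z. F (z + w))" for w
  proof -
    have "(LINT z|lborel. F z) = (LINT z|distr lborel borel ((+) w). F z)" by (simp add: lborel_distr_plus)
    also have "\<dots> = (LINT z|lborel. F (w + z))"
      by (rule integral_distr) (use iF in auto)
    finally show "(LINT z|lborel. F (z + w)) = (LINT z|lborel. F z)" by (simp add: add.commute)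
    have "integrable (distr lborel borel ((+) w)) F" using iF by (simp add: lborel_distr_plus)
    thus "integrable lborel (\<lambda>z. F (z + w))"
      by (subst (asm) integrable_distr_eq) (use iF in \<open>auto simp: add.commute\<close>)
  qed
  let ?t = "\<lambda>k. inverse (real (Suc k))"
  let ?q = "\<lambda>k z. (F (z + ?t k *\<^sub>R v) - F z) / ?t k"
  have "(\<lambda>k. LINT z|lborel. ?q k z) \<longlonglongrightarrow> (LINT z|lborel. ?D z)"
  proof (rule integral_dominated_convergence[where w = "\<lambda>z. indicator K' z *\<^sub>R B"])
    show "?D \<in> borel_measurable lborel" using Dc borel_measurable_continuous_onI by simp
    show "?q k \<in> borel_measurable lborel" for k using trans(2) iF by (intro borel_measurable_divide borel_measurable_diff) auto
    show "integrable lborel (\<lambda>z. indicator K' z *\<^sub>R B)"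
      using borel_integrable_compact[OF K', of "\<lambda>_. B"] by simp
    show "AE z in lborel. (\<lambda>k. ?q k z) \<longlonglongrightarrow> ?D z"
    proof (rule AE_I2)
      fix z
      have "((\<lambda>s. F (z + s *\<^sub>R v)) has_real_derivative ?D (z + 0 *\<^sub>R v)) (at 0)"
        using F by (intro directional_DERIV) simp
      hence "((\<lambda>h. (F (z + h *\<^sub>R v) - F z) / h) \<longlongrightarrow> ?D z) (at 0)" by (simp add: has_field_derivative_iff)
      moreover have "filterlim ?t (at 0) sequentially"
        using LIMSEQ_inverse_real_of_nat by (auto simp: filterlim_at)
      ultimately show "(\<lambda>k. ?q k z) \<longlonglongrightarrow> ?D z" by (rule filterlim_compose)
    qed
    show "AE z in lborel. norm (?q k z) \<le> indicator K' z *\<^sub>R B" for k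
    proof (rule AE_I2)
      fix z
      show "norm (?q k z) \<le> indicator K' z *\<^sub>R B"
      proof (cases "z \<in> K'")
        case True
        have "\<bar>F (z + ?t k *\<^sub>R v) - F z\<bar> \<le> B * ?t k" by (rule lip) simp
        hence "\<bar>?q k z\<bar> \<le> B" by (simp add: abs_divide divide_le_eq del: of_nat_Suc inverse_eq_divide)
        thus ?thesis using True by simp
      next
        case False
        have "z \<notin> K" using False KK' by auto
        moreover have "z + ?t k *\<^sub>R v \<notin> K"
        proof
          assume "z + ?t k *\<^sub>R v \<in> K"
          moreover have "?t k \<in> {0..1}" by (auto simp: field_simps)
          moreover have "z = (z + ?t k *\<^sub>R v) - ?t k *\<^sub>R v" by simp
          ultimately have "z \<in> K'" unfolding K'_def by (intro image_eqI[where x = "(z + ?t k *\<^sub>R v, ?t k)"]) auto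
          thus False using False by simp
        qed
        ultimately show ?thesis using supp False by simp
      qed
    qed
  qed
  moreover have "(LINT z|lborel. ?q k z) = 0" for k
    using trans(1)[of "?t k *\<^sub>R v"] trans(2)[of "?t k *\<^sub>R v"] iF by simp
  ultimately have "(\<lambda>k::nat. 0) \<longlonglongrightarrow> (LINT z|lborel. ?D z)" by (simp only:)
  from LIMSEQ_unique[OF this tendsto_const] show ?thesis .
qed

text \<open>The product, extended by 0, is C^1 on the whole plane because \<open>V\<close> and the
  complement of \<open>K\<close> are open and cover it; its derivative integrates to 0.\<close>

lemma integration_by_parts_plane:
  fixes u \<eta> :: "complex \<Rightarrow> real"
  assumes V: "open V" and u: "Ck_on 1 V u" and e: "Ck_on 1 UNIV \<eta>"
    and K: "compact K" "K \<subseteq> V" and supp: "\<And>z. z \<notin> K \<Longrightarrow> \<eta> z = 0"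
  shows "(LINT z|lborel. u z * pderiv_at \<eta> z v) = - (LINT z|lborel. pderiv_at u z v * \<eta> z)"
proof -
  define F where "F = (\<lambda>z. if z \<in> V then u z * \<eta> z else 0)"
  have oK: "open (- K)" using K(1) by (simp add: compact_imp_closed open_Compl)
  have eV: "Ck_on 1 V \<eta>" using e Ck_on_subset by blast
  have FV: "Ck_on 1 V F"
    by (rule Ck_on_cong[OF V _ Ck_on_mult[OF V u eV]]) (simp add: F_def)
  have FK: "Ck_on 1 (- K) F"
    by (rule Ck_on_cong[OF oK _ Ck_on_const[of _ _ 0]]) (use supp in \<open>auto simp: F_def\<close>)
  have "V \<union> - K = UNIV" using K(2) by auto
  hence F: "Ck_on 1 UNIV F" using Ck_on_Un[OF V oK FV FK] by simp
  have eK: "pderiv_at \<eta> z v = 0" if "z \<notin> K" for z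
  proof -
    have "frechet_derivative \<eta> (at z) = frechet_derivative (\<lambda>_. 0) (at z)"
      using supp that by (intro frechet_derivative_cong_open[OF oK]) auto
    thus ?thesis by simp
  qed
  have D: "pderiv_at F z v = u z * pderiv_at \<eta> z v + pderiv_at u z v * \<eta> z" for z
  proof (cases "z \<in> V")
    case True
    have "(F has_derivative (\<lambda>h. u z * frechet_derivative \<eta> (at z) h + frechet_derivative u (at z) h * \<eta> z)) (at z)"
    proof -
      have "((\<lambda>z. u z * \<eta> z) has_derivative (\<lambda>h. u z * frechet_derivative \<eta> (at z) h + frechet_derivative u (at z) h * \<eta> z)) (at z)"
        using u e True by (intro has_derivative_mult) (auto intro: differentiable_has_derivative)
      thus ?thesis
        using has_derivative_cong_open[OF V True, of F "\<lambda>z. u z * \<eta> z"] by (simp add: F_def)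
    qed
    thus ?thesis by (simp add: frechet_derivative_eqI)
  next
    case False
    hence "z \<notin> K" using K(2) by auto
    moreover have "frechet_derivative F (at z) = frechet_derivative (\<lambda>_. 0) (at z)"
      using \<open>z \<notin> K\<close> supp by (intro frechet_derivative_cong_open[OF oK]) (auto simp: F_def)
    ultimately show ?thesis using eK supp by simp
  qed
  have int: "integrable lborel (\<lambda>z. f z * g z)"
    if "continuous_on K f" "continuous_on K g" "\<And>z. z \<notin> K \<Longrightarrow> g z = 0" for f g :: "complex \<Rightarrow> real"
  proof -
    have "integrable lborel (\<lambda>z. indicator K z *\<^sub>R (f z * g z))"
      using that by (intro borel_integrable_compact K(1) continuous_intros)
    moreover have "(\<lambda>z. indicator K z *\<^sub>R (f z * g z)) = (\<lambda>z. f z * g z)"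
      using that(3) by (force simp: indicator_def fun_eq_iff)
    ultimately show ?thesis by simp
  qed
  have cont: "continuous_on K u" "continuous_on K (\<lambda>z. pderiv_at u z v)" "continuous_on K \<eta>" "continuous_on K (\<lambda>z. pderiv_at \<eta> z v)"
    using u e K(2) Ck_on_continuous[OF u] Ck_on_continuous[OF e] by (auto intro: continuous_on_subset)
  have i1: "integrable lborel (\<lambda>z. u z * pderiv_at \<eta> z v)" using cont eK by (intro int)
  have i2: "integrable lborel (\<lambda>z. pderiv_at u z v * \<eta> z)" using cont supp by (intro int)
  have "(LINT z|lborel. pderiv_at F z v) = 0"
    using integral_directional_derivative_zero[OF F K(1)] supp by (auto simp: F_def)
  thus ?thesis unfolding D using i1 i2 by simp
qed

text \<open>The second difference is symmetric in \<open>v\<close> and \<open>w\<close>, and two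
  applications of the mean value theorem express it by a mixed derivative at a nearby point.
  Comparing both orders as the increment shrinks gives the symmetry of mixed derivatives.\<close>

lemma second_difference:
  fixes f :: "complex \<Rightarrow> real"
  assumes f: "Ck_on 2 (ball z e) f" and t: "0 < t" "t * (norm v + norm w) < e"
  shows "\<exists>p. dist z p \<le> t * (norm v + norm w) \<and>
    f (z + t *\<^sub>R v + t *\<^sub>R w) - f (z + t *\<^sub>R v) - f (z + t *\<^sub>R w) + f z
      = t * t * pderiv_at (\<lambda>x. pderiv_at f x v) p w"
proof -
  have f1: "Ck_on (Suc 1) (ball z e) f" using f by (simp add: numeral_2_eq_2)
  have inb: "dist z (z + a *\<^sub>R v + b *\<^sub>R w) \<le> t * (norm v + norm w)" "z + a *\<^sub>R v + b *\<^sub>R w \<in> ball z e"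
    if "0 \<le> a" "a \<le> t" "0 \<le> b" "b \<le> t" for a b
  proof -
    have "dist z (z + a *\<^sub>R v + b *\<^sub>R w) = norm (a *\<^sub>R v + b *\<^sub>R w)"       by (metis add.assoc add_diff_cancel_left' dist_commute dist_norm)
    also have "\<dots> \<le> a * norm v + b * norm w" using that norm_triangle_ineq[of "a *\<^sub>R v" "b *\<^sub>R w"] by simp
    also have "\<dots> \<le> t * norm v + t * norm w" using that by (intro add_mono mult_right_mono) auto
    finally show "dist z (z + a *\<^sub>R v + b *\<^sub>R w) \<le> t * (norm v + norm w)" by (simp add: algebra_simps)
    thus "z + a *\<^sub>R v + b *\<^sub>R w \<in> ball z e" using t(2) by simp
  qed
  have d1: "f differentiable (at x)" if "x \<in> ball z e" for x using f1 that by auto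
  have d2: "(\<lambda>x. pderiv_at f x v) differentiable (at x)" if "x \<in> ball z e" for x using f1 that by auto
  define g where "g = (\<lambda>s. f ((z + t *\<^sub>R w) + s *\<^sub>R v) - f (z + s *\<^sub>R v))"
  have "\<exists>s. 0 < s \<and> s < t \<and> g t - g 0 = (t - 0) * (pderiv_at f ((z + t *\<^sub>R w) + s *\<^sub>R v) v - pderiv_at f (z + s *\<^sub>R v) v)"
  proof (rule MVT2[OF t(1)])
    fix s assume s: "0 \<le> s" "s \<le> t"
    have "(z + t *\<^sub>R w) + s *\<^sub>R v \<in> ball z e" "z + s *\<^sub>R v \<in> ball z e"
      using inb(2)[of s t] inb(2)[of s 0] s t(1) by (simp_all add: add.commute add.left_commute)
    thus "(g has_real_derivative (pderiv_at f ((z + t *\<^sub>R w) + s *\<^sub>R v) v - pderiv_at f (z + s *\<^sub>R v) v)) (at s)"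
      unfolding g_def by (intro DERIV_diff directional_DERIV d1)
  qed
  then obtain s where s: "0 < s" "s < t" and
    gs: "g t - g 0 = t * (pderiv_at f ((z + s *\<^sub>R v) + t *\<^sub>R w) v - pderiv_at f ((z + s *\<^sub>R v) + 0 *\<^sub>R w) v)"
    by (auto simp: algebra_simps)
  have "\<exists>r. 0 < r \<and> r < t \<and> pderiv_at f ((z + s *\<^sub>R v) + t *\<^sub>R w) v - pderiv_at f ((z + s *\<^sub>R v) + 0 *\<^sub>R w) v
      = (t - 0) * pderiv_at (\<lambda>x. pderiv_at f x v) ((z + s *\<^sub>R v) + r *\<^sub>R w) w"
    by (rule MVT2[OF t(1)]) (intro directional_DERIV d2 inb(2), use s in auto)
  then obtain r where r: "0 < r" "r < t" and
    rs: "pderiv_at f ((z + s *\<^sub>R v) + t *\<^sub>R w) v - pderiv_at f ((z + s *\<^sub>R v) + 0 *\<^sub>R w) v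
      = t * pderiv_at (\<lambda>x. pderiv_at f x v) ((z + s *\<^sub>R v) + r *\<^sub>R w) w" by auto
  show ?thesis
  proof (intro exI conjI)
    show "dist z ((z + s *\<^sub>R v) + r *\<^sub>R w) \<le> t * (norm v + norm w)" using inb(1)[of s r] s r by simp
    show "f (z + t *\<^sub>R v + t *\<^sub>R w) - f (z + t *\<^sub>R v) - f (z + t *\<^sub>R w) + f z
      = t * t * pderiv_at (\<lambda>x. pderiv_at f x v) ((z + s *\<^sub>R v) + r *\<^sub>R w) w"
      using gs unfolding rs g_def by (simp add: algebra_simps)
  qed
qed

lemma mixed_partials_commute:
  fixes f :: "complex \<Rightarrow> real"
  assumes V: "open V" "z \<in> V" and f: "Ck_on 2 V f"
  shows "pderiv_at (\<lambda>x. pderiv_at f x v) z w = pderiv_at (\<lambda>x. pderiv_at f x w) z v"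
proof -
  define A where "A = (\<lambda>p. pderiv_at (\<lambda>x. pderiv_at f x v) p w)"
  define B where "B = (\<lambda>p. pderiv_at (\<lambda>x. pderiv_at f x w) p v)"
  obtain e where e: "e > 0" "ball z e \<subseteq> V" using V open_contains_ball by blast
  have fe: "Ck_on 2 (ball z e) f" using f e(2) Ck_on_subset by blast
  have cont: "continuous_on (ball z e) A" "continuous_on (ball z e) B"
    using fe by (auto simp: A_def B_def numeral_2_eq_2)
  have "\<bar>A z - B z\<bar> < d" if "d > 0" for d
  proof -
    have "\<exists>r>0. \<forall>p\<in>ball z e. dist p z < r \<longrightarrow> dist (A p) (A z) < d / 2"
      "\<exists>r>0. \<forall>p\<in>ball z e. dist p z < r \<longrightarrow> dist (B p) (B z) < d / 2"
      using cont(1)[unfolded continuous_on_iff, rule_format, of z "d / 2"]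
        cont(2)[unfolded continuous_on_iff, rule_format, of z "d / 2"] that e(1) by auto
    then obtain r1 r2 where r: "r1 > 0" "r2 > 0"
      "\<And>p. p \<in> ball z e \<Longrightarrow> dist p z < r1 \<Longrightarrow> dist (A p) (A z) < d / 2"
      "\<And>p. p \<in> ball z e \<Longrightarrow> dist p z < r2 \<Longrightarrow> dist (B p) (B z) < d / 2" by blast
    define m where "m = min e (min r1 r2)"
    define t where "t = m / (norm v + norm w + 1)"
    have m: "m > 0" using e r by (simp add: m_def)
    have n: "norm v + norm w + 1 > 0" using norm_ge_zero[of v] norm_ge_zero[of w] by linarith
    have t: "t > 0" using m n by (simp add: t_def)
    have tm: "t * (norm v + norm w) < m"
    proof -
      have "t * (norm v + norm w + 1) = m" using n by (simp add: t_def)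
      thus ?thesis using t by (simp add: algebra_simps)
    qed
    have te: "t * (norm v + norm w) < e" "t * (norm w + norm v) < e" using tm by (auto simp: m_def add.commute)
    obtain p where p: "dist z p \<le> t * (norm v + norm w)"
      "f (z + t *\<^sub>R v + t *\<^sub>R w) - f (z + t *\<^sub>R v) - f (z + t *\<^sub>R w) + f z = t * t * A p"
      using second_difference[OF fe t te(1)] unfolding A_def by blast
    obtain q where q: "dist z q \<le> t * (norm w + norm v)"
      "f (z + t *\<^sub>R w + t *\<^sub>R v) - f (z + t *\<^sub>R w) - f (z + t *\<^sub>R v) + f z = t * t * B q"
      using second_difference[OF fe t te(2)] unfolding B_def by blast
    have "t * t * A p = t * t * B q"
    proof -
      have "z + t *\<^sub>R w + t *\<^sub>R v = z + t *\<^sub>R v + t *\<^sub>R w" by simp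
      thus ?thesis using p(2) q(2) by (simp only:)
    qed
    hence "A p = B q" using t by simp
    moreover have "dist (A p) (A z) < d / 2" "dist (B q) (B z) < d / 2"
    proof -
      have "dist p z < m" "dist q z < m" using p(1) q(1) tm by (simp_all add: dist_commute add.commute)
      thus "dist (A p) (A z) < d / 2" "dist (B q) (B z) < d / 2"
        by (auto intro!: r simp: m_def dist_commute simp del: less_divide_eq_numeral1)
    qed
    ultimately show ?thesis unfolding dist_real_def by linarith
  qed
  from this[of "\<bar>A z - B z\<bar>"] have "A z = B z" by (cases "A z = B z") simp_all
  thus ?thesis by (simp add: A_def B_def)
qed

section \<open>Change of variables in the plane\<close>

definition to_complex :: "real^2 \<Rightarrow> complex" where "to_complex x = Complex (x $ 1) (x $ 2)"
definition of_complex2 :: "complex \<Rightarrow> real^2" where "of_complex2 z = vector [Re z, Im z]"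

lemma to_of_complex [simp]: "to_complex (of_complex2 z) = z" "of_complex2 (to_complex x) = x"
  by (auto simp: to_complex_def of_complex2_def complex_eq_iff vec_eq_iff forall_2)

lemma of_complex2_nth [simp]: "of_complex2 z $ 1 = Re z" "of_complex2 z $ 2 = Im z"
  by (simp_all add: of_complex2_def)

lemma Re_Im_to_complex [simp]: "Re (to_complex x) = x $ 1" "Im (to_complex x) = x $ 2"
  by (simp_all add: to_complex_def)

lemma of_complex2_image: "of_complex2 ` X = to_complex -` X"
  by (force simp: image_iff)

lemma bounded_linear_to_complex: "bounded_linear to_complex"
  by (intro linear_conv_bounded_linear[THEN iffD1] linearI) (simp_all add: complex_eq_iff)

lemma bounded_linear_of_complex2: "bounded_linear of_complex2"
  by (intro linear_conv_bounded_linear[THEN iffD1] linearI) (simp_all add: vec_eq_iff forall_2)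

lemma measurable_to_complex [measurable]: "to_complex \<in> borel_measurable borel"
  by (intro borel_measurable_continuous_onI linear_continuous_on bounded_linear_to_complex)

lemma prod_Basis_real2: "(\<Prod>b\<in>(Basis :: (real^2) set). f b) = f (axis 1 1) * f (axis 2 1)"
proof -
  have B: "(Basis :: (real^2) set) = {axis 1 1, axis 2 1}" by (auto simp: Basis_vec_def UNIV_2)
  have "axis 1 1 \<noteq> (axis 2 1 :: real^2)" by (simp add: axis_eq_axis)
  thus ?thesis unfolding B by simp
qed

text \<open>Both measures give every box its area. This moves the change of variables formula from
  \<open>real^2\<close> to the complex plane.\<close>

lemma distr_to_complex: "(lborel :: complex measure) = distr (lborel :: (real^2) measure) borel to_complex"
proof (rule lborel_eqI)
  fix l u :: complex assume le: "\<And>b. b \<in> Basis \<Longrightarrow> l \<bullet> b \<le> u \<bullet> b"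
  have *: "Re l \<le> Re u" "Im l \<le> Im u" using le[of 1] le[of \<i>] by (auto simp: Basis_complex_def inner_complex_def)
  have "to_complex -` box l u = box (of_complex2 l) (of_complex2 u)"
    by (auto simp: in_box_complex_iff mem_box_cart forall_2)
  hence "emeasure (distr lborel borel to_complex) (box l u) = emeasure lborel (box (of_complex2 l) (of_complex2 u))"
    by (simp add: emeasure_distr)
  also have "\<dots> = ennreal ((Re u - Re l) * (Im u - Im l))"
  proof (subst emeasure_lborel_box)
    show "of_complex2 l \<bullet> b \<le> of_complex2 u \<bullet> b" if "b \<in> Basis" for b
      using that * by (auto simp: Basis_vec_def inner_axis forall_2 UNIV_2 dest!: spec)
    show "ennreal (\<Prod>b\<in>Basis. (of_complex2 u - of_complex2 l) \<bullet> b) = ennreal ((Re u - Re l) * (Im u - Im l))"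
      by (simp add: prod_Basis_real2 inner_axis)
  qed
  also have "(Re u - Re l) * (Im u - Im l) = (\<Prod>b\<in>Basis. (u - l) \<bullet> b)"
    by (simp add: Basis_complex_def inner_complex_def)
  finally show "emeasure (distr lborel borel to_complex) (box l u) = (\<Prod>b\<in>Basis. (u - l) \<bullet> b)" .
qed simp

lemma nn_integral_complex:
  "f \<in> borel_measurable borel \<Longrightarrow> (\<integral>\<^sup>+z. f z \<partial>lborel) = (\<integral>\<^sup>+x. f (to_complex x) \<partial>lborel)"
  by (subst distr_to_complex) (simp add: nn_integral_distr)

lemma nn_integral_eq_absolute_integral:
  fixes k :: "'a::euclidean_space \<Rightarrow> real"
  assumes m: "(\<lambda>x. indicator T x * k x) \<in> borel_measurable borel" and k: "\<And>x. x \<in> T \<Longrightarrow> 0 \<le> k x" and b: "0 \<le> b"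
  shows "(\<integral>\<^sup>+x. ennreal (indicator T x * k x) \<partial>lborel) = ennreal b \<longleftrightarrow> k absolutely_integrable_on T \<and> integral T k = b"
proof -
  let ?f = "\<lambda>x. indicator T x * k x"
  have nn: "0 \<le> ?f x" for x using k by (auto simp: indicator_def)
  have mL: "?f \<in> borel_measurable lborel" using m by simp
  have abs: "k absolutely_integrable_on T \<longleftrightarrow> integrable lebesgue ?f"
    by (simp add: set_integrable_def)
  have comp: "integrable lebesgue ?f \<longleftrightarrow> integrable lborel ?f"
    using integrable_completion[OF mL] by simp
  show ?thesis
  proof
    assume eq: "(\<integral>\<^sup>+x. ennreal (?f x) \<partial>lborel) = ennreal b"
    hence i: "integrable lborel ?f"
      using nn mL by (intro integrableI_nonneg) auto
    hence a: "k absolutely_integrable_on T" using abs comp by simp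
    have "ennreal (integral\<^sup>L lborel ?f) = ennreal b"
      using nn_integral_eq_integral[OF i] nn eq by simp
    hence "integral\<^sup>L lborel ?f = b" using b nn by (subst (asm) ennreal_inj) auto
    moreover have "integral T k = integral\<^sup>L lebesgue ?f"
      using set_lebesgue_integral_eq_integral(2)[OF a] by (simp add: set_lebesgue_integral_def)
    ultimately show "k absolutely_integrable_on T \<and> integral T k = b" using a integral_completion[OF mL] by simp
  next
    assume a: "k absolutely_integrable_on T \<and> integral T k = b"
    hence i: "integrable lborel ?f" using abs comp by simp
    have "integral T k = integral\<^sup>L lebesgue ?f"
      using set_lebesgue_integral_eq_integral(2)[of T k] a unfolding set_lebesgue_integral_def by simp
    thus "(\<integral>\<^sup>+x. ennreal (?f x) \<partial>lborel) = ennreal b"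
      using nn_integral_eq_integral[OF i] nn a integral_completion[OF mL] by simp
  qed
qed

text \<open>The formula for absolutely integrable functions settles every finite value; as one side
  attains a finite value exactly when the other does, they are also infinite together.\<close>

lemma nn_integral_change_of_variables:
  fixes g :: "real^2 \<Rightarrow> real^2" and h :: "real^2 \<Rightarrow> real"
  assumes S: "S \<in> sets borel" and der: "\<And>x. x \<in> S \<Longrightarrow> (g has_derivative g' x) (at x within S)"
    and inj: "inj_on g S" and h: "\<And>x. x \<in> g ` S \<Longrightarrow> 0 \<le> h x"
    and m1: "(\<lambda>x. indicator (g ` S) x * h x) \<in> borel_measurable borel"
    and m2: "(\<lambda>x. indicator S x * (\<bar>det (matrix (g' x))\<bar> * h (g x))) \<in> borel_measurable borel"
  shows "(\<integral>\<^sup>+x. ennreal (indicator (g ` S) x * h x) \<partial>lborel)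
    = (\<integral>\<^sup>+x. ennreal (indicator S x * (\<bar>det (matrix (g' x))\<bar> * h (g x))) \<partial>lborel)" (is "?L = ?R")
proof -
  have iff: "?L = ennreal b \<longleftrightarrow> ?R = ennreal b" if "0 \<le> b" for b
  proof -
    have "?R = ennreal b \<longleftrightarrow> (\<lambda>x. \<bar>det (matrix (g' x))\<bar> * h (g x)) absolutely_integrable_on S
        \<and> integral S (\<lambda>x. \<bar>det (matrix (g' x))\<bar> * h (g x)) = b"
      by (rule nn_integral_eq_absolute_integral[OF m2 _ that]) (auto intro!: mult_nonneg_nonneg h)
    also have "\<dots> \<longleftrightarrow> h absolutely_integrable_on (g ` S) \<and> integral (g ` S) h = b"
      using has_absolute_integral_change_of_variables[OF _ der inj, of "\<lambda>x. vec (h x) :: real^1" "vec b"] S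
      by (simp add: absolutely_integrable_on_1_iff integral_on_1_eq vec_eq_iff)
    also have "\<dots> \<longleftrightarrow> ?L = ennreal b"
      by (rule nn_integral_eq_absolute_integral[OF m1 _ that, symmetric]) (auto intro: h)
    finally show ?thesis by simp
  qed
  show ?thesis
  proof (cases "?L = \<infinity>")
    case True
    have "?R = \<infinity>"
    proof (rule ccontr)
      assume "?R \<noteq> \<infinity>"
      hence "?R = ennreal (enn2real ?R)" by (simp add: ennreal_enn2real_if)
      hence "?L = ennreal (enn2real ?R)" using iff[of "enn2real ?R"] by simp
      thus False using True by simp
    qed
    thus ?thesis using True by simp
  next
    case False
    hence "?L = ennreal (enn2real ?L)" by (simp add: ennreal_enn2real_if)
    thus ?thesis using iff[of "enn2real ?L"] by simp
  qed
qed

text \<open>The determinant of a real linear map of the plane in the basis 1,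
  \<open>\<i>\<close>.\<close>

definition jac_det :: "(complex \<Rightarrow> complex) \<Rightarrow> real" where
  "jac_det D = Re (D 1) * Im (D \<i>) - Re (D \<i>) * Im (D 1)"

lemma nn_integral_change_of_variables_complex:
  fixes t :: "complex \<Rightarrow> complex" and h :: "complex \<Rightarrow> real"
  assumes S: "S \<in> sets borel" and der: "\<And>z. z \<in> S \<Longrightarrow> (t has_derivative t' z) (at z)"
    and inj: "inj_on t S" and h: "\<And>z. z \<in> t ` S \<Longrightarrow> 0 \<le> h z"
    and m1: "(\<lambda>z. indicator (t ` S) z * h z) \<in> borel_measurable borel"
    and m2: "(\<lambda>z. indicator S z * (\<bar>jac_det (t' z)\<bar> * h (t z))) \<in> borel_measurable borel"
  shows "(\<integral>\<^sup>+z. ennreal (indicator (t ` S) z * h z) \<partial>lborel)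
    = (\<integral>\<^sup>+z. ennreal (indicator S z * (\<bar>jac_det (t' z)\<bar> * h (t z))) \<partial>lborel)"
proof -
  define S' where "S' = of_complex2 ` S"
  define g where "g = of_complex2 \<circ> t \<circ> to_complex"
  define g' where "g' = (\<lambda>x. of_complex2 \<circ> t' (to_complex x) \<circ> to_complex)"
  have S'_eq: "S' = to_complex -` S" unfolding S'_def by (rule of_complex2_image)
  have gS: "g ` S' = to_complex -` (t ` S)"
  proof -
    have "g ` S' = of_complex2 ` (t ` S)" by (simp add: g_def S'_def image_comp o_def)
    also have "\<dots> = to_complex -` (t ` S)" by (rule of_complex2_image)
    finally show ?thesis .
  qed
  have ind: "indicator (to_complex -` X) x = indicator X (to_complex x)" for X x
    by (simp add: indicator_def)
  have jac: "det (matrix (g' x)) = jac_det (t' (to_complex x))" for x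
  proof -
    have "to_complex (axis 1 1) = 1" "to_complex (axis 2 1) = \<i>"
      by (simp_all add: complex_eq_iff axis_def)
    thus ?thesis by (simp add: det_2 matrix_def g'_def jac_det_def mult.commute)
  qed
  have S'b: "S' \<in> sets borel"
    unfolding S'_eq using measurable_sets[OF measurable_to_complex S] by simp
  have dg: "(g has_derivative g' x) (at x within S')" if "x \<in> S'" for x
  proof -
    have "to_complex x \<in> S" using that by (simp add: S'_eq)
    hence "(t \<circ> to_complex has_derivative t' (to_complex x) \<circ> to_complex) (at x)"
      by (intro diff_chain_at bounded_linear_imp_has_derivative bounded_linear_to_complex der)
    hence "(of_complex2 \<circ> (t \<circ> to_complex) has_derivative of_complex2 \<circ> (t' (to_complex x) \<circ> to_complex)) (at x)"
      by (rule diff_chain_at) (intro bounded_linear_imp_has_derivative bounded_linear_of_complex2)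
    thus ?thesis unfolding g_def g'_def by (simp add: o_assoc has_derivative_at_withinI)
  qed
  have ig: "inj_on g S'"
  proof (rule inj_onI)
    fix x y assume "x \<in> S'" "y \<in> S'" "g x = g y"
    hence "t (to_complex x) = t (to_complex y)" by (metis comp_apply g_def to_of_complex(1))
    hence "to_complex x = to_complex y" using inj \<open>x \<in> S'\<close> \<open>y \<in> S'\<close> unfolding S'_eq by (auto dest: inj_onD)
    thus "x = y" by (metis to_of_complex(2))
  qed
  have h': "to_complex (g x) = t (to_complex x)" for x by (simp add: g_def)
  have m1': "(\<lambda>x. indicator (g ` S') x * h (to_complex x)) \<in> borel_measurable borel"
    using measurable_compose[OF measurable_to_complex m1] by (simp add: gS ind)
  have m2': "(\<lambda>x. indicator S' x * (\<bar>det (matrix (g' x))\<bar> * h (to_complex (g x)))) \<in> borel_measurable borel"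
    using measurable_compose[OF measurable_to_complex m2] by (simp add: S'_eq ind jac h')
  have "(\<integral>\<^sup>+x. ennreal (indicator (g ` S') x * h (to_complex x)) \<partial>lborel)
    = (\<integral>\<^sup>+x. ennreal (indicator S' x * (\<bar>det (matrix (g' x))\<bar> * h (to_complex (g x)))) \<partial>lborel)"
    by (rule nn_integral_change_of_variables[OF S'b dg ig _ m1' m2']) (use h gS in auto)
  moreover have "(\<integral>\<^sup>+z. ennreal (indicator (t ` S) z * h z) \<partial>lborel) = (\<integral>\<^sup>+x. ennreal (indicator (g ` S') x * h (to_complex x)) \<partial>lborel)"
    by (subst nn_integral_complex) (use m1 in \<open>simp_all add: gS ind\<close>)
  moreover have "(\<integral>\<^sup>+z. ennreal (indicator S z * (\<bar>jac_det (t' z)\<bar> * h (t z))) \<partial>lborel)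
     = (\<integral>\<^sup>+x. ennreal (indicator S' x * (\<bar>det (matrix (g' x))\<bar> * h (to_complex (g x)))) \<partial>lborel)"
    by (subst nn_integral_complex) (use m2 in \<open>simp_all add: S'_eq ind jac h'\<close>)
  ultimately show ?thesis by simp
qed

text \<open>Transition maps enter the proof through their first derivatives; higher derivatives are
  always taken inside one chart.\<close>

lemma Ck1_compose:
  fixes f :: "complex \<Rightarrow> complex" and g :: "complex \<Rightarrow> 'b::real_normed_vector"
  assumes "open S" "open T" "Ck_on 1 S f" "Ck_on 1 T g" "f ` S \<subseteq> T"
  shows "Ck_on 1 S (\<lambda>z. g (f z))"
    and "z \<in> S \<Longrightarrow> pderiv_at (\<lambda>z. g (f z)) z v = pderiv_at g (f z) (pderiv_at f z v)"
proof -
  have d: "((\<lambda>z. g (f z)) has_derivative (\<lambda>h. pderiv_at g (f z) (pderiv_at f z h))) (at z)" if "z \<in> S" for z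
  proof -
    have "(f has_derivative pderiv_at f z) (at z)" "(g has_derivative pderiv_at g (f z)) (at (f z))"
      using assms(3,4,5) that by (auto intro!: differentiable_has_derivative)
    thus ?thesis by (rule has_derivative_compose)
  qed
  show "pderiv_at (\<lambda>z. g (f z)) z v = pderiv_at g (f z) (pderiv_at f z v)" if "z \<in> S"
    using frechet_derivative_eqI[OF d[OF that]] by simp
  have fc: "continuous_on S f" by (rule Ck_on_continuous[OF assms(3)])
  have "Ck_on (Suc 0) S (\<lambda>z. g (f z))"
  proof (rule Ck_on_SucI[OF assms(1) d])
    fix v
    \<comment> \<open>\<open>Ck_on\<close> controls derivatives in a fixed direction, so the moving
      direction \<open>pderiv_at f z v\<close> is expanded in the basis 1,
      \<open>\<i>\<close>.\<close>
    have "continuous_on S (\<lambda>z. Re (pderiv_at f z v) *\<^sub>R pderiv_at g (f z) 1 + Im (pderiv_at f z v) *\<^sub>R pderiv_at g (f z) \<i>)"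
      using assms(3,4)
      by (intro continuous_on_add continuous_on_scaleR continuous_on_Re continuous_on_Im
          continuous_on_compose2[OF _ fc assms(5)]) auto
    moreover have "pderiv_at g (f z) (pderiv_at f z v) = Re (pderiv_at f z v) *\<^sub>R pderiv_at g (f z) 1 + Im (pderiv_at f z v) *\<^sub>R pderiv_at g (f z) \<i>" if "z \<in> S" for z
      using assms(4,5) that by (intro frechet_derivative_complex) auto
    ultimately have "continuous_on S (\<lambda>z. pderiv_at g (f z) (pderiv_at f z v))"
      using continuous_on_cong by (metis (mono_tags, lifting))
    thus "Ck_on 0 S (\<lambda>z. pderiv_at g (f z) (pderiv_at f z v))" by simp
  qed
  thus "Ck_on 1 S (\<lambda>z. g (f z))" by simp
qed

lemma Ck_on_local:
  assumes "\<And>x. x \<in> S \<Longrightarrow> \<exists>N. open N \<and> x \<in> N \<and> Ck_on k N f"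
  shows "Ck_on k S f"
  using assms
proof (induction k arbitrary: f)
  case 0
  have "isCont f x" if "x \<in> S" for x
    using 0[OF that] continuous_on_eq_continuous_at by auto
  thus ?case by (simp add: continuous_at_imp_continuous_on)
next
  case (Suc k)
  have "f differentiable (at x)" if "x \<in> S" for x using Suc.prems[OF that] by auto
  moreover have "Ck_on k S (\<lambda>x. frechet_derivative f (at x) v)" for v
    by (rule Suc.IH) (use Suc.prems in fastforce)
  ultimately show ?case by simp
qed

section \<open>Charts\<close>

lemma chart_param_coord: "is_chart X \<Longrightarrow> p \<in> dom_ch X \<Longrightarrow> param X (coord X p) = p"
  by (simp add: is_chart_def homeomorphism_def)

lemma chart_coord_param: "z \<in> im_ch X \<Longrightarrow> coord X (param X z) = z"
  by (simp add: f_inv_into_f)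

lemma chart_param_dom: "z \<in> im_ch X \<Longrightarrow> param X z \<in> dom_ch X"
  by (simp add: inv_into_into)

lemma chart_image_eq: "is_chart X \<Longrightarrow> coord X ` (dom_ch X \<inter> U) = im_ch X \<inter> param X -` U"
proof (intro set_eqI iffI)
  fix z assume "is_chart X" "z \<in> coord X ` (dom_ch X \<inter> U)"
  thus "z \<in> im_ch X \<inter> param X -` U" using chart_param_coord by fastforce
next
  fix z assume "z \<in> im_ch X \<inter> param X -` U"
  thus "z \<in> coord X ` (dom_ch X \<inter> U)"
    using chart_coord_param[of z X] chart_param_dom[of z X] by (intro image_eqI[where x = "param X z"]) auto
qed

lemma chart_open:
  assumes "is_chart X"
  shows "open (dom_ch X)" "open (im_ch X)" "continuous_on (dom_ch X) (coord X)"
    "continuous_on (im_ch X) (param X)" "inj_on (coord X) (dom_ch X)"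
  using assms by (auto simp: is_chart_def homeomorphism_def inj_on_def) metis

lemma chart_image_open: "is_chart X \<Longrightarrow> open U \<Longrightarrow> open (coord X ` (dom_ch X \<inter> U))"
  unfolding chart_image_eq using chart_open continuous_open_preimage by blast

text \<open>A Borel map on the whole plane, along which measures can be pushed forward to the
  surface.\<close>

definition par :: "'a::t2_space chart \<Rightarrow> complex \<Rightarrow> 'a" where
  "par X z = (if z \<in> im_ch X then param X z else undefined)"

lemma par_measurable: "is_chart X \<Longrightarrow> par X \<in> borel_measurable borel"
  unfolding par_def[abs_def]
  by (intro borel_measurable_continuous_on_if chart_open continuous_on_const borel_open)

lemma chart_image_borel:
  assumes "is_chart X" "B \<in> sets borel" "B \<subseteq> dom_ch X"
  shows "coord X ` B \<in> sets borel"
proof -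
  have "coord X ` B = im_ch X \<inter> par X -` B"
    using chart_image_eq[OF assms(1), of B] assms(3) by (auto simp: par_def Int_absorb1)
  moreover have "par X -` B \<in> sets borel"
    using measurable_sets[OF par_measurable[OF assms(1)] assms(2)] by simp
  ultimately show ?thesis using chart_open(2)[OF assms(1)] by auto
qed

text \<open>The classical differential in chart components, the counterpart of
  \<open>weak_differential\<close> for C^1 functions.\<close>

definition cdiff :: "('a::t2_space \<Rightarrow> real) \<Rightarrow> 'a form1" where
  "cdiff u X p v = pderiv_at (u \<circ> param X) (coord X p) v"

definition density_of :: "'a::t2_space tensor2 \<Rightarrow> 'a chart \<Rightarrow> complex \<Rightarrow> real" where
  "density_of h X z = sqrt (gram_det h X (param X z))"

text \<open>The predicate under the \<open>THE\<close> of \<open>area_measure\<close>, separated so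
  that existence and uniqueness can be stated.\<close>

definition is_area :: "'a::t2_space chart set \<Rightarrow> 'a tensor2 \<Rightarrow> 'a measure \<Rightarrow> bool" where
  "is_area A h \<mu> \<longleftrightarrow> sets \<mu> = sets borel \<and>
     (\<forall>X\<in>smooth_charts A. \<forall>B\<in>sets borel. B \<subseteq> dom_ch X \<longrightarrow>
        emeasure \<mu> B = (\<integral>\<^sup>+z\<in>coord X ` B. ennreal (density_of h X z) \<partial>lborel))"

lemma bilinear_complex:
  assumes "bilinear b" "\<And>v w. b v w = b w v"
  shows "b v w = Re v * Re w * b 1 1 + (Re v * Im w + Im v * Re w) * b 1 \<i> + Im v * Im w * (b \<i> \<i> :: real)"
proof -
  have l: "linear (b x)" "linear (\<lambda>y. b y x)" for x using assms(1) by (auto simp: bilinear_def)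
  have e: "x = Re x *\<^sub>R 1 + Im x *\<^sub>R \<i>" for x by (simp add: complex_eq_iff)
  have "b v w = Re w * b v 1 + Im w * b v \<i>"
    using arg_cong[OF e[of w], of "b v"] by (simp only: linear_add[OF l(1)] linear_scale[OF l(1)] real_scaleR_def)
  moreover have "b v x = Re v * b 1 x + Im v * b \<i> x" for x
    using arg_cong[OF e[of v], of "\<lambda>y. b y x"] by (simp only: linear_add[OF l(2)] linear_scale[OF l(2)] real_scaleR_def)
  moreover have "b \<i> 1 = b 1 \<i>" by (rule assms(2))
  ultimately show ?thesis by (simp add: algebra_simps)
qed

lemma linear_complex:
  assumes "linear a"
  shows "a v = Re v * a 1 + Im v * (a \<i> :: real)"
proof -
  have "v = Re v *\<^sub>R 1 + Im v *\<^sub>R \<i>" by (simp add: complex_eq_iff)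
  from arg_cong[OF this, of a] show ?thesis
    by (simp only: linear_add[OF assms] linear_scale[OF assms] real_scaleR_def)
qed

text \<open>The inverse metric on covectors, polarised from the formula in
  \<open>form_norm_sq\<close>.\<close>

definition finner :: "'a tensor2 \<Rightarrow> 'a chart \<Rightarrow> 'a \<Rightarrow> (complex \<Rightarrow> real) \<Rightarrow> (complex \<Rightarrow> real) \<Rightarrow> real" where
  "finner g X p a b = (g X p \<i> \<i> * (a 1 * b 1) - g X p 1 \<i> * (a 1 * b \<i> + a \<i> * b 1) + g X p 1 1 * (a \<i> * b \<i>))
     / gram_det g X p"

locale conformal_surface =
  fixes A :: "'a::t2_space chart set" and c :: "'a tensor2 set"
  assumes atlas: "smooth_atlas A"
    and compact_surface: "compact (UNIV :: 'a set)"
    and connected_surface: "connected (UNIV :: 'a set)"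
    and class_c: "conformal_class A c"
begin

lemma atlas_charts: "A \<subseteq> smooth_charts A"
  using atlas by (auto simp: smooth_atlas_def smooth_charts_def)

lemma is_chart: "X \<in> smooth_charts A \<Longrightarrow> is_chart X"
  by (simp add: smooth_charts_def)

lemma charts_atD: "X \<in> charts_at A p \<Longrightarrow> X \<in> smooth_charts A" "X \<in> charts_at A p \<Longrightarrow> p \<in> dom_ch X"
  by (auto simp: charts_at_def)

lemma charts_atI: "X \<in> smooth_charts A \<Longrightarrow> p \<in> dom_ch X \<Longrightarrow> X \<in> charts_at A p"
  by (auto simp: charts_at_def)

lemma ex_chart: "\<exists>X. X \<in> charts_at A p"
proof -
  have "p \<in> (\<Union>X\<in>A. dom_ch X)" using atlas by (simp add: smooth_atlas_def)
  then obtain X where "X \<in> A" "p \<in> dom_ch X" by blast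
  thus ?thesis using atlas_charts by (intro exI[of _ X]) (auto simp: charts_at_def)
qed

text \<open>The same choice as inside \<open>form_norm_sq\<close>. Charts chosen at neighbouring
  points are unrelated, so continuity is always checked after passing to a fixed chart.\<close>

definition ch :: "'a \<Rightarrow> 'a chart" where "ch p = (SOME X. X \<in> charts_at A p)"

lemma ch: "ch p \<in> charts_at A p"
  unfolding ch_def using ex_chart by (rule someI_ex)

text \<open>Charts of the maximal atlas are by definition related only to charts of
  \<open>A\<close>; around each point the transition factors through one of these.\<close>

lemma transition_C1:
  assumes k: "X \<in> smooth_charts A" and k': "X' \<in> smooth_charts A"
  shows "Ck_on 1 (coord X ` (dom_ch X \<inter> dom_ch X')) (coord X' \<circ> param X)"
proof (rule Ck_on_local)
  fix z assume "z \<in> coord X ` (dom_ch X \<inter> dom_ch X')"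
  then obtain p where p: "p \<in> dom_ch X" "p \<in> dom_ch X'" "z = coord X p" by auto
  have "p \<in> (\<Union>X\<in>A. dom_ch X)" using atlas by (simp add: smooth_atlas_def)
  then obtain l where l: "l \<in> A" "p \<in> dom_ch l" by auto
  note c1 = is_chart[OF k] and c2 = is_chart[OF k'] and c3 = is_chart[OF subsetD[OF atlas_charts l(1)]]
  have t1: "Ck_on 1 (coord X ` (dom_ch X \<inter> dom_ch l)) (coord l \<circ> param X)"
    using k l(1) unfolding smooth_charts_def smooth_transition_def smooth_on_def by blast
  have t2: "Ck_on 1 (coord l ` (dom_ch l \<inter> dom_ch X')) (coord X' \<circ> param l)"
    using k' l(1) unfolding smooth_charts_def smooth_transition_def smooth_on_def by blast
  let ?N = "coord X ` (dom_ch X \<inter> (dom_ch X' \<inter> dom_ch l))"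
  have oN: "open ?N" by (intro chart_image_open c1 open_Int chart_open(1)[OF c2] chart_open(1)[OF c3])
  have zN: "z \<in> ?N" using p l by auto
  have sub: "(coord l \<circ> param X) ` ?N \<subseteq> coord l ` (dom_ch l \<inter> dom_ch X')"
    using chart_param_coord[OF c1] by auto
  have "Ck_on 1 ?N (\<lambda>z. (coord X' \<circ> param l) ((coord l \<circ> param X) z))"
    by (rule Ck1_compose(1)[OF oN _ Ck_on_subset[OF t1] t2 sub])
      (auto intro!: chart_image_open c3 chart_open(1)[OF c2])
  hence "Ck_on 1 ?N (coord X' \<circ> param X)"
  proof (rule Ck_on_cong[OF oN, rotated])
    fix w assume "w \<in> ?N"
    thus "(coord X' \<circ> param l) ((coord l \<circ> param X) w) = (coord X' \<circ> param X) w"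
      using chart_param_coord[OF c1] chart_param_coord[OF c3] by auto
  qed
  thus "\<exists>N. open N \<and> z \<in> N \<and> Ck_on 1 N (coord X' \<circ> param X)" using oN zN by blast
qed

abbreviation tmap :: "'a chart \<Rightarrow> 'a chart \<Rightarrow> complex \<Rightarrow> complex" where
  "tmap X X' \<equiv> coord X' \<circ> param X"

abbreviation tder :: "'a chart \<Rightarrow> 'a chart \<Rightarrow> 'a \<Rightarrow> complex \<Rightarrow> complex" where
  "tder X X' p \<equiv> pderiv_at (coord X' \<circ> param X) (coord X p)"

lemma cdiff_transform:
  assumes k: "X \<in> charts_at A p" and k': "X' \<in> charts_at A p"
    and u: "(u \<circ> param X') differentiable (at (coord X' p))"
  shows "cdiff u X p v = cdiff u X' p (tder X X' p v)"
    and "(u \<circ> param X) differentiable (at (coord X p))"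
proof -
  note c = is_chart[OF charts_atD(1)[OF k]] is_chart[OF charts_atD(1)[OF k']]
  note d = charts_atD(2)[OF k] charts_atD(2)[OF k']
  let ?W = "coord X ` (dom_ch X \<inter> dom_ch X')"
  have oW: "open ?W" by (intro chart_image_open c chart_open)
  have zW: "coord X p \<in> ?W" using d by auto
  have "tmap X X' differentiable (at (coord X p))"
    using transition_C1[OF charts_atD(1)[OF k] charts_atD(1)[OF k']] zW by auto
  hence 1: "(tmap X X' has_derivative tder X X' p) (at (coord X p))"
    by (rule differentiable_has_derivative)
  have tp: "tmap X X' (coord X p) = coord X' p" using chart_param_coord[OF c(1) d(1)] by simp
  have 2: "(u \<circ> param X' has_derivative pderiv_at (u \<circ> param X') (coord X' p)) (at (tmap X X' (coord X p)))"
    unfolding tp by (rule differentiable_has_derivative[OF u])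
  have "((\<lambda>z. (u \<circ> param X') (tmap X X' z)) has_derivative (\<lambda>v. cdiff u X' p (tder X X' p v))) (at (coord X p))"
    using has_derivative_compose[OF 1 2] by (simp add: cdiff_def)
  hence 3: "((u \<circ> param X) has_derivative (\<lambda>v. cdiff u X' p (tder X X' p v))) (at (coord X p))"
  proof (rule has_derivative_cong_open[OF oW zW, THEN iffD1, rotated])
    fix w assume "w \<in> ?W"
    thus "(u \<circ> param X') (tmap X X' w) = (u \<circ> param X) w"
      using chart_param_coord[OF c(1)] chart_param_coord[OF c(2)] by auto
  qed
  thus "cdiff u X p v = cdiff u X' p (tder X X' p v)"
    by (simp add: cdiff_def frechet_derivative_eqI)
  show "(u \<circ> param X) differentiable (at (coord X p))" using 3 by (auto simp: differentiable_def)
qed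

lemma metric_transform:
  assumes h: "sym_tensor A h" and k: "X \<in> charts_at A p" and k': "X' \<in> charts_at A p"
  defines "D \<equiv> tder X X' p"
  shows "h X p 1 1 = (Re (D 1))\<^sup>2 * h X' p 1 1 + 2 * Re (D 1) * Im (D 1) * h X' p 1 \<i> + (Im (D 1))\<^sup>2 * h X' p \<i> \<i>"
    and "h X p 1 \<i> = Re (D 1) * Re (D \<i>) * h X' p 1 1 + (Re (D 1) * Im (D \<i>) + Im (D 1) * Re (D \<i>)) * h X' p 1 \<i> + Im (D 1) * Im (D \<i>) * h X' p \<i> \<i>"
    and "h X p \<i> \<i> = (Re (D \<i>))\<^sup>2 * h X' p 1 1 + 2 * Re (D \<i>) * Im (D \<i>) * h X' p 1 \<i> + (Im (D \<i>))\<^sup>2 * h X' p \<i> \<i>"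
    and "gram_det h X p = (jac_det D)\<^sup>2 * gram_det h X' p"
proof -
  have b: "bilinear (h X' p)" "\<And>v w. h X' p v w = h X' p w v" using h k' unfolding sym_tensor_def by blast+
  have t: "h X p v w = h X' p (D v) (D w)" for v w using h k k' unfolding sym_tensor_def D_def by blast
  show 1: "h X p 1 1 = (Re (D 1))\<^sup>2 * h X' p 1 1 + 2 * Re (D 1) * Im (D 1) * h X' p 1 \<i> + (Im (D 1))\<^sup>2 * h X' p \<i> \<i>"
    and 2: "h X p 1 \<i> = Re (D 1) * Re (D \<i>) * h X' p 1 1 + (Re (D 1) * Im (D \<i>) + Im (D 1) * Re (D \<i>)) * h X' p 1 \<i> + Im (D 1) * Im (D \<i>) * h X' p \<i> \<i>"
    and 3: "h X p \<i> \<i> = (Re (D \<i>))\<^sup>2 * h X' p 1 1 + 2 * Re (D \<i>) * Im (D \<i>) * h X' p 1 \<i> + (Im (D \<i>))\<^sup>2 * h X' p \<i> \<i>"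
    unfolding t using bilinear_complex[OF b, of "D 1" "D 1"] bilinear_complex[OF b, of "D 1" "D \<i>"] bilinear_complex[OF b, of "D \<i>" "D \<i>"]
    by (simp_all add: power2_eq_square algebra_simps)
  show "gram_det h X p = (jac_det D)\<^sup>2 * gram_det h X' p"
    unfolding gram_det_def 1 2 3 jac_det_def by (simp add: power2_eq_square algebra_simps)
qed

text \<open>Under a change of chart the numerator and the Gram determinant both pick up the squared
  Jacobian.\<close>

lemma finner_transform:
  assumes h: "sym_tensor A h" and k: "X \<in> charts_at A p" and k': "X' \<in> charts_at A p"
    and pos: "gram_det h X p \<noteq> 0" and la: "linear a'" and lb: "linear b'"
    and a: "\<And>v. a v = a' (tder X X' p v)" and b: "\<And>v. b v = b' (tder X X' p v)"
  shows "finner h X p a b = finner h X' p a' b'"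
proof -
  let ?D = "tder X X' p"
  note m = metric_transform[OF h k k']
  have ab: "a 1 = Re (?D 1) * a' 1 + Im (?D 1) * a' \<i>" "a \<i> = Re (?D \<i>) * a' 1 + Im (?D \<i>) * a' \<i>"
    "b 1 = Re (?D 1) * b' 1 + Im (?D 1) * b' \<i>" "b \<i> = Re (?D \<i>) * b' 1 + Im (?D \<i>) * b' \<i>"
    unfolding a b using linear_complex[OF la, of "?D 1"] linear_complex[OF la, of "?D \<i>"]
      linear_complex[OF lb, of "?D 1"] linear_complex[OF lb, of "?D \<i>"] by simp_all
  have num: "h X p \<i> \<i> * (a 1 * b 1) - h X p 1 \<i> * (a 1 * b \<i> + a \<i> * b 1) + h X p 1 1 * (a \<i> * b \<i>)
    = (jac_det ?D)\<^sup>2 * (h X' p \<i> \<i> * (a' 1 * b' 1) - h X' p 1 \<i> * (a' 1 * b' \<i> + a' \<i> * b' 1) + h X' p 1 1 * (a' \<i> * b' \<i>))"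
    unfolding m(1) m(2) m(3) ab jac_det_def by algebra
  have "(jac_det ?D)\<^sup>2 \<noteq> 0" using pos m(4) by auto
  thus ?thesis unfolding finner_def num m(4) by simp
qed

lemma class_metric: "g \<in> c \<Longrightarrow> riemannian_metric A g"
  using class_c by (auto simp: conformal_class_def)

lemma class_nonempty: "\<exists>g. g \<in> c"
proof -
  obtain g where "riemannian_metric A g" "c = {h. riemannian_metric A h \<and>
             (\<exists>r. (\<forall>p. r p > 0) \<and> (\<forall>X p v w. h X p v w = r p * g X p v w))}"
    using class_c by (auto simp: conformal_class_def)
  thus ?thesis by (auto intro!: exI[of _ g] exI[of _ "\<lambda>_. 1"])
qed

lemma class_conformal:
  assumes "g \<in> c" "h \<in> c"
  shows "\<exists>r. (\<forall>p. r p > 0) \<and> (\<forall>X p v w. h X p v w = r p * g X p v w)"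
proof -
  obtain g0 r1 r2 where r: "\<And>p. r1 p > (0::real)" "\<And>X p v w. g X p v w = r1 p * g0 X p v w"
    "\<And>p. r2 p > (0::real)" "\<And>X p v w. h X p v w = r2 p * g0 X p v w"
    using class_c assms unfolding conformal_class_def by auto
  thus ?thesis
    by (intro exI[of _ "\<lambda>p. r2 p / r1 p"]) (simp add: less_imp_neq[OF r(1), THEN not_sym])
qed

lemma metric_pos:
  assumes g: "riemannian_metric A g" and k: "X \<in> charts_at A p"
  shows "g X p 1 1 > 0" "gram_det g X p > 0"
proof -
  have b: "bilinear (g X p)" "\<And>v w. g X p v w = g X p w v"
    using g k unfolding riemannian_metric_def sym_tensor_def by blast+
  have pos: "v \<noteq> 0 \<Longrightarrow> g X p v v > 0" for v using g k unfolding riemannian_metric_def by blast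
  show E: "g X p 1 1 > 0" by (rule pos) simp
  \<comment> \<open>\<open>?v\<close> is orthogonal to the first coordinate vector, and its squared
    length is \<open>g X p 1 1\<close> times the Gram determinant.\<close>
  let ?v = "Complex (- g X p 1 \<i>) (g X p 1 1)"
  have "0 < g X p ?v ?v" by (rule pos) (use E in \<open>simp add: complex_eq_iff\<close>)
  also have "g X p ?v ?v = g X p 1 1 * gram_det g X p"
    unfolding bilinear_complex[OF b, of ?v ?v] gram_det_def by (simp add: power2_eq_square algebra_simps)
  finally show "gram_det g X p > 0" using E by (simp add: zero_less_mult_iff)
qed

lemma metric_sym: "riemannian_metric A g \<Longrightarrow> sym_tensor A g"
  by (simp add: riemannian_metric_def)

lemma metric_Ck:
  assumes "riemannian_metric A g" "X \<in> smooth_charts A"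
  shows "Ck_on k (im_ch X) (\<lambda>z. g X (param X z) v w)"
  using assms by (simp add: riemannian_metric_def smooth_on_def)

lemma gram_Ck:
  assumes "riemannian_metric A g" "X \<in> smooth_charts A"
  shows "Ck_on k (im_ch X) (\<lambda>z. gram_det g X (param X z))"
  unfolding gram_det_def power2_eq_square
  by (intro Ck_on_diff Ck_on_mult metric_Ck assms chart_open(2) is_chart)

section \<open>Area measures\<close>

lemma finite_chart_cover:
  "\<exists>xs. set xs \<subseteq> smooth_charts A \<and> (\<Union>j<length xs. dom_ch (xs ! j)) = UNIV"
proof -
  have "\<exists>F\<subseteq>A. finite F \<and> UNIV \<subseteq> (\<Union>X\<in>F. dom_ch X)"
    using compactE_image[OF compact_surface, of A dom_ch] atlas
    unfolding smooth_atlas_def is_chart_def by (metis subset_UNIV set_eq_subset)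
  then obtain F where F: "F \<subseteq> A" "finite F" "UNIV \<subseteq> (\<Union>X\<in>F. dom_ch X)" by blast
  obtain xs where xs: "set xs = F" using F(2) finite_list by blast
  have "p \<in> (\<Union>j<length xs. dom_ch (xs ! j))" for p
  proof -
    obtain X where k: "X \<in> set xs" "p \<in> dom_ch X" using F(3) xs by blast
    obtain j where "j < length xs" "xs ! j = X" using k(1) by (auto simp: in_set_conv_nth)
    thus ?thesis using k(2) by blast
  qed
  hence "(\<Union>j<length xs. dom_ch (xs ! j)) = UNIV" by blast
  thus ?thesis using xs F(1) atlas_charts by blast
qed

definition cover :: "'a chart list" where
  "cover = (SOME xs. set xs \<subseteq> smooth_charts A \<and> (\<Union>j<length xs. dom_ch (xs ! j)) = UNIV)"

lemma cover: "j < length cover \<Longrightarrow> cover ! j \<in> smooth_charts A" "(\<Union>j<length cover. dom_ch (cover ! j)) = UNIV"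
  using someI_ex[OF finite_chart_cover] unfolding cover_def[symmetric] by auto

text \<open>Disjoint Borel pieces, each inside one chart, from which measures on the surface are
  assembled.\<close>

definition piece :: "nat \<Rightarrow> 'a set" where
  "piece j = dom_ch (cover ! j) - (\<Union>i<j. dom_ch (cover ! i))"

lemma piece_borel: "j < length cover \<Longrightarrow> piece j \<in> sets borel"
proof -
  assume j: "j < length cover"
  have op: "open (dom_ch (cover ! i))" if "i < length cover" for i
    by (rule chart_open(1)[OF is_chart[OF cover(1)[OF that]]])
  show ?thesis unfolding piece_def using j by (intro sets.Diff borel_open open_UN ballI op) simp_all
qed

lemma piece_dom: "piece j \<subseteq> dom_ch (cover ! j)"
  by (auto simp: piece_def)

lemma piece_disjoint: "disjoint_family_on piece I"
  unfolding disjoint_family_on_def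
proof (intro ballI impI)
  fix m n :: nat assume "m \<noteq> n"
  then consider "m < n" | "n < m" by linarith
  thus "piece m \<inter> piece n = {}" by cases (auto simp: piece_def)
qed

lemma piece_Union: "(\<Union>j<length cover. piece j) = UNIV"
proof -
  have "p \<in> (\<Union>j<length cover. piece j)" for p
  proof -
    have ex: "\<exists>j. j < length cover \<and> p \<in> dom_ch (cover ! j)" using cover(2) by blast
    define j where "j = (LEAST j. j < length cover \<and> p \<in> dom_ch (cover ! j))"
    have j: "j < length cover" "p \<in> dom_ch (cover ! j)" using LeastI_ex[OF ex] by (auto simp: j_def)
    have "p \<notin> dom_ch (cover ! i)" if "i < j" for i
      using not_less_Least[of i "\<lambda>j. j < length cover \<and> p \<in> dom_ch (cover ! j)"] that j(1) unfolding j_def by auto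
    thus ?thesis using j by (auto simp: piece_def)
  qed
  thus ?thesis by auto
qed

lemma emeasure_pieces:
  assumes "sets \<mu> = sets borel" "B \<in> sets borel"
  shows "emeasure \<mu> B = (\<Sum>j<length cover. emeasure \<mu> (B \<inter> piece j))"
proof -
  have "(\<Sum>j<length cover. emeasure \<mu> (B \<inter> piece j)) = emeasure \<mu> (\<Union>j<length cover. B \<inter> piece j)"
  proof (intro sum_emeasure)
    show "disjoint_family_on (\<lambda>j. B \<inter> piece j) {..<length cover}"
      using piece_disjoint[of "{..<length cover}"] unfolding disjoint_family_on_def by blast
  qed (use assms piece_borel in auto)
  also have "(\<Union>j<length cover. B \<inter> piece j) = B" using piece_Union by blast
  finally show ?thesis by simp
qed

lemma area_unique:
  assumes "is_area A h \<mu>" "is_area A h \<nu>"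
  shows "\<mu> = \<nu>"
proof (rule measure_eqI)
  show "sets \<mu> = sets \<nu>" using assms by (simp add: is_area_def)
  fix B assume "B \<in> sets \<mu>"
  hence B: "B \<in> sets borel" using assms by (simp add: is_area_def)
  have "emeasure \<mu> (B \<inter> piece j) = emeasure \<nu> (B \<inter> piece j)" if "j < length cover" for j
  proof -
    have 1: "B \<inter> piece j \<in> sets borel" "B \<inter> piece j \<subseteq> dom_ch (cover ! j)"
      using B piece_borel[OF that] piece_dom by auto
    show ?thesis using assms cover(1)[OF that] 1 unfolding is_area_def by simp
  qed
  thus "emeasure \<mu> B = emeasure \<nu> B"
    using emeasure_pieces[OF _ B, of \<mu>] emeasure_pieces[OF _ B, of \<nu>] assms by (simp add: is_area_def)
qed

lemma area_measure_eq:
  assumes "is_area A h \<mu>"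
  shows "area_measure A h = \<mu>"
proof -
  have "area_measure A h = (THE \<mu>. is_area A h \<mu>)"
    unfolding area_measure_def is_area_def density_of_def by (rule refl)
  also have "\<dots> = \<mu>" by (rule the_equality) (rule assms, rule area_unique[OF _ assms])
  finally show ?thesis .
qed

section \<open>Existence and basic properties of the area measure\<close>

context
  fixes g assumes g: "riemannian_metric A g"
begin

lemma density_cont: "X \<in> smooth_charts A \<Longrightarrow> continuous_on (im_ch X) (density_of g X)"
  unfolding density_of_def[abs_def]
  by (intro continuous_on_real_sqrt Ck_on_continuous[OF gram_Ck[OF g, of _ 0]])

lemma density_pos:
  assumes "X \<in> smooth_charts A" "z \<in> im_ch X"
  shows "density_of g X z > 0"
  unfolding density_of_def
  by (intro real_sqrt_gt_zero metric_pos(2)[OF g] charts_atI assms(1) chart_param_dom[OF assms(2)])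

lemma density_measurable:
  assumes k: "X \<in> smooth_charts A" and B: "B \<in> sets borel" "B \<subseteq> dom_ch X"
  shows "(\<lambda>z. indicator (coord X ` B) z * density_of g X z) \<in> borel_measurable borel"
proof -
  have "(\<lambda>z. if z \<in> im_ch X then density_of g X z else 0) \<in> borel_measurable borel"
    by (intro borel_measurable_continuous_on_if density_cont k continuous_on_const borel_open chart_open(2) is_chart)
  hence "(\<lambda>z. indicator (coord X ` B) z * (if z \<in> im_ch X then density_of g X z else 0)) \<in> borel_measurable borel"
    by (intro borel_measurable_times borel_measurable_indicator chart_image_borel is_chart k B)
  moreover have "(\<lambda>z. indicator (coord X ` B) z * (if z \<in> im_ch X then density_of g X z else 0))
     = (\<lambda>z. indicator (coord X ` B) z * density_of g X z)"
  proof
    fix z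
    show "indicator (coord X ` B) z * (if z \<in> im_ch X then density_of g X z else 0) = indicator (coord X ` B) z * density_of g X z"
      using B(2) by (cases "z \<in> coord X ` B") auto
  qed
  ultimately show ?thesis by simp
qed

lemma ennreal_indicator_mult: "ennreal x * indicator S z = ennreal (indicator S z * x)"
  by (simp add: indicator_def)

text \<open>The square root of the Gram determinant is multiplied by the absolute Jacobian of the
  transition map, exactly as the change of variables formula requires.\<close>

lemma density_change_chart:
  assumes k: "X \<in> smooth_charts A" and k': "X' \<in> smooth_charts A"
    and B: "B \<in> sets borel" "B \<subseteq> dom_ch X" "B \<subseteq> dom_ch X'"
  shows "(\<integral>\<^sup>+z\<in>coord X ` B. ennreal (density_of g X z) \<partial>lborel) = (\<integral>\<^sup>+z\<in>coord X' ` B. ennreal (density_of g X' z) \<partial>lborel)"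
proof -
  note c = is_chart[OF k] is_chart[OF k']
  let ?t = "tmap X X'" and ?S = "coord X ` B"
  have tS: "?t ` ?S = coord X' ` B"
    using chart_param_coord[OF c(1)] B(2) by (force simp: image_iff)
  have der: "(?t has_derivative pderiv_at ?t z) (at z)" if "z \<in> ?S" for z
    using transition_C1[OF k k'] that B by (intro differentiable_has_derivative) auto
  have inj: "inj_on ?t ?S"
  proof (rule inj_onI)
    fix z w assume "z \<in> ?S" "w \<in> ?S" and e: "?t z = ?t w"
    then obtain p q where pq: "p \<in> B" "q \<in> B" "z = coord X p" "w = coord X q" by blast
    hence "param X z = p" "param X w = q" using chart_param_coord[OF c(1)] B by blast+
    hence "coord X' p = coord X' q" using e by simp
    hence "p = q" using chart_open(5)[OF c(2)] pq B by (meson inj_onD subsetD)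
    thus "z = w" using pq by simp
  qed
  have eq: "\<bar>jac_det (pderiv_at ?t z)\<bar> * density_of g X' (?t z) = density_of g X z" if z: "z \<in> ?S" for z
  proof -
    obtain p where p: "p \<in> B" "z = coord X p" using z by auto
    have pz1: "param X z = p" using p B chart_param_coord[OF c(1)] by blast
    hence "?t z = coord X' p" by simp
    hence "param X' (?t z) = p" using p B chart_param_coord[OF c(2)] by auto
    note pz = pz1 this
    have "X \<in> charts_at A p" "X' \<in> charts_at A p" using p B k k' by (auto intro: charts_atI)
    from metric_transform(4)[OF metric_sym[OF g] this] show ?thesis
      unfolding density_of_def pz p(2)[symmetric] by (simp add: real_sqrt_mult)
  qed
  have m2': "indicator ?S z * (\<bar>jac_det (pderiv_at ?t z)\<bar> * density_of g X' (?t z)) = indicator ?S z * density_of g X z" for z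
    using eq[of z] by (cases "z \<in> ?S") auto
  hence m2: "(\<lambda>z. indicator ?S z * (\<bar>jac_det (pderiv_at ?t z)\<bar> * density_of g X' (?t z))) = (\<lambda>z. indicator ?S z * density_of g X z)"
    by (rule ext)
  have "(\<integral>\<^sup>+z. ennreal (indicator (?t ` ?S) z * density_of g X' z) \<partial>lborel)
    = (\<integral>\<^sup>+z. ennreal (indicator ?S z * (\<bar>jac_det (pderiv_at ?t z)\<bar> * density_of g X' (?t z))) \<partial>lborel)"
  proof (rule nn_integral_change_of_variables_complex[OF chart_image_borel[OF c(1) B(1,2)] der inj])
    show "0 \<le> density_of g X' z" if "z \<in> ?t ` ?S" for z
      using that density_pos[OF k', of z] B unfolding tS by (auto intro: less_imp_le)
    show "(\<lambda>z. indicator (?t ` ?S) z * density_of g X' z) \<in> borel_measurable borel"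
      unfolding tS by (rule density_measurable[OF k' B(1,3)])
    show "(\<lambda>z. indicator ?S z * (\<bar>jac_det (pderiv_at ?t z)\<bar> * density_of g X' (?t z))) \<in> borel_measurable borel"
      unfolding m2 by (rule density_measurable[OF k B(1,2)])
  qed
  thus ?thesis unfolding m2' tS ennreal_indicator_mult by simp
qed

definition chart_measure :: "'a chart \<Rightarrow> 'a set \<Rightarrow> 'a measure" where
  "chart_measure X P = distr (density lborel (\<lambda>z. ennreal (indicator (coord X ` P) z * density_of g X z))) borel (par X)"

lemma nn_integral_chart_measure:
  assumes k: "X \<in> smooth_charts A" and P: "P \<in> sets borel" "P \<subseteq> dom_ch X" and f: "f \<in> borel_measurable borel"
  shows "(\<integral>\<^sup>+p. f p \<partial>chart_measure X P) = (\<integral>\<^sup>+z\<in>coord X ` P. ennreal (density_of g X z) * f (param X z) \<partial>lborel)"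
proof -
  note pm = par_measurable[OF is_chart[OF k]]
  have "(\<integral>\<^sup>+p. f p \<partial>chart_measure X P) = (\<integral>\<^sup>+z. ennreal (indicator (coord X ` P) z * density_of g X z) * f (par X z) \<partial>lborel)"
    unfolding chart_measure_def using pm f density_measurable[OF k P]
    by (subst nn_integral_distr) (auto simp: nn_integral_density intro: measurable_compose)
  also have "\<dots> = (\<integral>\<^sup>+z\<in>coord X ` P. ennreal (density_of g X z) * f (param X z) \<partial>lborel)"
    using P(2) by (intro nn_integral_cong) (auto simp: indicator_def par_def)
  finally show ?thesis .
qed

lemma emeasure_chart_measure:
  assumes k: "X \<in> smooth_charts A" and P: "P \<in> sets borel" "P \<subseteq> dom_ch X" and B: "B \<in> sets borel"
  shows "emeasure (chart_measure X P) B = (\<integral>\<^sup>+z\<in>coord X ` (B \<inter> P). ennreal (density_of g X z) \<partial>lborel)"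
proof -
  have "emeasure (chart_measure X P) B = (\<integral>\<^sup>+p. indicator B p \<partial>chart_measure X P)"
    using B by (simp add: chart_measure_def)
  also have "\<dots> = (\<integral>\<^sup>+z\<in>coord X ` P. ennreal (density_of g X z) * indicator B (param X z) \<partial>lborel)"
    using B by (intro nn_integral_chart_measure k P) auto
  also have "\<dots> = (\<integral>\<^sup>+z\<in>coord X ` (B \<inter> P). ennreal (density_of g X z) \<partial>lborel)"
  proof (rule nn_integral_cong)
    fix z
    have pc: "param X (coord X p) = p" if "p \<in> P" for p
      using chart_param_coord[OF is_chart[OF k]] P(2) that by blast
    have "z \<in> coord X ` (B \<inter> P) \<longleftrightarrow> z \<in> coord X ` P \<and> param X z \<in> B"
    proof
      assume "z \<in> coord X ` (B \<inter> P)"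
      then obtain p where "p \<in> B" "p \<in> P" "z = coord X p" by blast
      thus "z \<in> coord X ` P \<and> param X z \<in> B" using pc by simp
    next
      assume z: "z \<in> coord X ` P \<and> param X z \<in> B"
      then obtain p where "p \<in> P" "z = coord X p" by blast
      thus "z \<in> coord X ` (B \<inter> P)" using pc z by auto
    qed
    thus "ennreal (density_of g X z) * indicator B (param X z) * indicator (coord X ` P) z
      = ennreal (density_of g X z) * indicator (coord X ` (B \<inter> P)) z"
      by (auto simp: indicator_def)
  qed
  finally show ?thesis .
qed

text \<open>The cover fixes one measure; that every other chart sees the right density is
  \<open>is_area_area\<close>.\<close>

definition area :: "'a measure" where
  "area = measure_of UNIV (sets borel) (\<lambda>B. \<Sum>j<length cover. emeasure (chart_measure (cover ! j) (piece j)) B)"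

lemma sets_area: "sets area = sets borel"
  by (simp add: area_def sets.sigma_sets_eq[of borel, simplified])

lemma emeasure_area:
  assumes "B \<in> sets borel"
  shows "emeasure area B = (\<Sum>j<length cover. emeasure (chart_measure (cover ! j) (piece j)) B)"
proof (rule emeasure_measure_of[OF area_def])
  show "sets borel \<subseteq> Pow (UNIV :: 'a set)" by simp
  show "B \<in> sets area" using assms by (simp add: sets_area)
  show "positive (sets area) (\<lambda>B. \<Sum>j<length cover. emeasure (chart_measure (cover ! j) (piece j)) B)"
    by (simp add: positive_def)
  show "countably_additive (sets area) (\<lambda>B. \<Sum>j<length cover. emeasure (chart_measure (cover ! j) (piece j)) B)"
  proof (rule countably_additiveI)
    fix S :: "nat \<Rightarrow> 'a set" assume S: "range S \<subseteq> sets area" "disjoint_family S"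
    have "(\<Sum>i. \<Sum>j<length cover. emeasure (chart_measure (cover ! j) (piece j)) (S i))
       = (\<Sum>j<length cover. \<Sum>i. emeasure (chart_measure (cover ! j) (piece j)) (S i))"
      by (rule suminf_sum) simp
    also have "\<dots> = (\<Sum>j<length cover. emeasure (chart_measure (cover ! j) (piece j)) (\<Union>i. S i))"
      using S by (intro sum.cong suminf_emeasure) (auto simp: sets_area chart_measure_def)
    finally show "(\<Sum>i. \<Sum>j<length cover. emeasure (chart_measure (cover ! j) (piece j)) (S i))
      = (\<Sum>j<length cover. emeasure (chart_measure (cover ! j) (piece j)) (\<Union> (range S)))" .
  qed
qed

text \<open>Over each piece the density of the covering chart is exchanged for that of
  \<open>X\<close>, and the pieces are summed.\<close>

lemma is_area_area: "is_area A g area"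
  unfolding is_area_def
proof (intro conjI ballI impI)
  show "sets area = sets borel" by (rule sets_area)
  fix X B assume k: "X \<in> smooth_charts A" and B: "B \<in> sets borel" "B \<subseteq> dom_ch X"
  have P: "P \<in> sets borel \<Longrightarrow> emeasure (chart_measure X B) P = (\<integral>\<^sup>+z\<in>coord X ` (P \<inter> B). ennreal (density_of g X z) \<partial>lborel)" for P
    by (rule emeasure_chart_measure[OF k B])
  have "emeasure area B = (\<Sum>j<length cover. \<integral>\<^sup>+z\<in>coord (cover ! j) ` (B \<inter> piece j). ennreal (density_of g (cover ! j) z) \<partial>lborel)"
    unfolding emeasure_area[OF B(1)]
    by (intro sum.cong emeasure_chart_measure cover(1) piece_borel piece_dom B(1)) auto
  also have "\<dots> = (\<Sum>j<length cover. \<integral>\<^sup>+z\<in>coord X ` (B \<inter> piece j). ennreal (density_of g X z) \<partial>lborel)"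
    using cover(1) piece_borel piece_dom B k
    by (intro sum.cong density_change_chart) (auto intro: subsetD[OF piece_dom])
  also have "\<dots> = (\<Sum>j<length cover. emeasure (chart_measure X B) (B \<inter> piece j))"
    using B piece_borel by (intro sum.cong) (auto simp: P Int_absorb2 Int_commute Int_left_commute)
  also have "\<dots> = emeasure (chart_measure X B) B"
    by (rule emeasure_pieces[symmetric]) (simp_all add: chart_measure_def B)
  also have "\<dots> = (\<integral>\<^sup>+z\<in>coord X ` B. ennreal (density_of g X z) \<partial>lborel)"
    using P[OF B(1)] by simp
  finally show "emeasure area B = (\<integral>\<^sup>+z\<in>coord X ` B. ennreal (density_of g X z) \<partial>lborel)" .
qed

lemma area_measure_area: "area_measure A g = area"
  by (rule area_measure_eq[OF is_area_area])

lemma nn_integral_area: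
  assumes k: "X \<in> smooth_charts A" and B: "B \<in> sets borel" "B \<subseteq> dom_ch X" and f: "f \<in> borel_measurable borel"
  shows "(\<integral>\<^sup>+p\<in>B. f p \<partial>area) = (\<integral>\<^sup>+z\<in>coord X ` B. ennreal (density_of g X z) * f (param X z) \<partial>lborel)"
proof -
  have "chart_measure X B = density area (indicator B)"
  proof (rule measure_eqI)
    show "sets (chart_measure X B) = sets (density area (indicator B))"
      by (simp add: chart_measure_def sets_area)
    fix P assume "P \<in> sets (chart_measure X B)"
    hence P: "P \<in> sets borel" by (simp add: chart_measure_def)
    have "emeasure (density area (indicator B)) P = emeasure area (B \<inter> P)"
      using P B(1) by (simp add: emeasure_restricted sets_area)
    also have "\<dots> = (\<integral>\<^sup>+z\<in>coord X ` (B \<inter> P). ennreal (density_of g X z) \<partial>lborel)"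
    proof -
      have "B \<inter> P \<in> sets borel" "B \<inter> P \<subseteq> dom_ch X" using B P by auto
      thus ?thesis using is_area_area k unfolding is_area_def by blast
    qed
    finally show "emeasure (chart_measure X B) P = emeasure (density area (indicator B)) P"
      using emeasure_chart_measure[OF k B P] by (simp add: Int_commute)
  qed
  hence "(\<integral>\<^sup>+p. f p \<partial>density area (indicator B)) = (\<integral>\<^sup>+z\<in>coord X ` B. ennreal (density_of g X z) * f (param X z) \<partial>lborel)"
    using nn_integral_chart_measure[OF k B f] by simp
  moreover have "(\<integral>\<^sup>+p. f p \<partial>density area (indicator B)) = (\<integral>\<^sup>+p\<in>B. f p \<partial>area)"
    using B(1) f by (subst nn_integral_density) (auto simp: measurable_cong_sets[OF sets_area refl] sets_area mult.commute)
  ultimately show ?thesis by simp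
qed

lemma area_open_pos:
  assumes "open U" "U \<noteq> {}"
  shows "emeasure area U \<noteq> 0"
proof
  assume z: "emeasure area U = 0"
  obtain p where p: "p \<in> U" using assms(2) by blast
  obtain X where k: "X \<in> smooth_charts A" "p \<in> dom_ch X" using ex_chart charts_atD by blast
  note ck = is_chart[OF k(1)]
  let ?B = "dom_ch X \<inter> U"
  have B: "?B \<in> sets borel" "?B \<subseteq> dom_ch X" using assms(1) chart_open(1)[OF ck] by auto
  have oB: "open (coord X ` ?B)" by (rule chart_image_open[OF ck assms(1)])
  have "emeasure area ?B = 0"
    using emeasure_mono[of ?B U area] z assms(1) by (auto simp: sets_area)
  hence "(\<integral>\<^sup>+z. ennreal (indicator (coord X ` ?B) z * density_of g X z) \<partial>lborel) = 0"
    using is_area_area k(1) B unfolding is_area_def ennreal_indicator_mult by simp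
  hence "AE z in lborel. indicator (coord X ` ?B) z * density_of g X z \<le> 0"
    using density_measurable[OF k(1) B] by (subst (asm) nn_integral_0_iff_AE) (auto simp: ennreal_eq_0_iff)
  hence "AE z in lborel. z \<notin> coord X ` ?B"
  proof eventually_elim
    case (elim z)
    thus ?case using density_pos[OF k(1), of z] by (auto simp: indicator_def split: if_splits)
  qed
  hence "emeasure lborel (coord X ` ?B) = 0"
    using oB by (subst (asm) AE_iff_measurable[of "coord X ` ?B"]) auto
  hence "coord X ` ?B \<in> null_sets lborel" using oB by auto
  hence "negligible (coord X ` ?B)" using negligible_iff_null_sets null_sets_completionI by blast
  thus False using open_not_negligible[OF oB] p k(2) by blast
qed

text \<open>The density is bounded on a small coordinate disc around each point, and by compactness
  finitely many such discs cover the surface.\<close>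

lemma area_finite: "emeasure area UNIV \<noteq> \<infinity>"
proof -
  have "\<exists>U. open U \<and> p \<in> U \<and> emeasure area U < \<infinity>" for p
  proof -
    obtain X where k: "X \<in> smooth_charts A" "p \<in> dom_ch X" using ex_chart charts_atD by blast
    note ck = is_chart[OF k(1)]
    obtain e where e: "e > 0" "cball (coord X p) e \<subseteq> im_ch X"
      using chart_open(2)[OF ck] k(2) open_contains_cball by (metis image_eqI)
    let ?b = "ball (coord X p) e"
    let ?U = "dom_ch X \<inter> coord X -` ?b"
    have U: "open ?U" by (intro continuous_open_preimage chart_open ck open_ball)
    have cU: "coord X ` ?U \<subseteq> ?b" by auto
    have "compact (density_of g X ` cball (coord X p) e)"
      by (intro compact_continuous_image continuous_on_subset[OF density_cont[OF k(1)] e(2)] compact_cball)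
    then obtain M where M: "\<And>z. z \<in> cball (coord X p) e \<Longrightarrow> density_of g X z \<le> M"
      using compact_imp_bounded bounded_iff by (metis (no_types, lifting) abs_le_D1 imageI real_norm_def)
    have "emeasure area ?U = (\<integral>\<^sup>+z\<in>coord X ` ?U. ennreal (density_of g X z) \<partial>lborel)"
      using is_area_area k(1) U unfolding is_area_def by auto
    also have "\<dots> \<le> (\<integral>\<^sup>+z. ennreal M * indicator ?b z \<partial>lborel)"
    proof (rule nn_integral_mono)
      fix z
      show "ennreal (density_of g X z) * indicator (coord X ` ?U) z \<le> ennreal M * indicator ?b z"
        using cU M[of z] by (auto simp: indicator_def intro!: ennreal_leI)
    qed
    also have "\<dots> = ennreal M * emeasure lborel ?b" by (rule nn_integral_cmult_indicator) simp
    also have "\<dots> < \<infinity>"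
      using emeasure_bounded_finite[OF bounded_ball[of "coord X p" e]] by (simp add: ennreal_mult_less_top)
    finally have "emeasure area ?U < \<infinity>" .
    moreover have "p \<in> ?U" using k(2) e(1) by simp
    ultimately show ?thesis using U by blast
  qed
  then obtain U where U: "\<And>p. open (U p)" "\<And>p. p \<in> U p" "\<And>p. emeasure area (U p) < \<infinity>" by metis
  obtain F where F: "finite F" "UNIV \<subseteq> (\<Union>p\<in>F. U p)"
  proof -
    have sub: "UNIV \<subseteq> (\<Union>p\<in>UNIV. U p)" using U(2) by blast
    show ?thesis by (rule compactE_image[OF compact_surface U(1) sub]) (use that in blast)
  qed
  have "(\<Union>p\<in>F. U p) = UNIV" using F(2) by blast
  hence "emeasure area UNIV \<le> emeasure area (\<Union>p\<in>F. U p)" by simp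
  also have "\<dots> \<le> (\<Sum>p\<in>F. emeasure area (U p))"
    using U(1) F(1) by (intro emeasure_subadditive_finite) (auto simp: sets_area)
  also have "\<dots> < \<infinity>" using U(3) F(1) by (simp add: less_top[symmetric])
  finally show ?thesis by simp
qed

lemma area_chart_null:
  assumes k: "X \<in> smooth_charts A" and ae: "AE z in lborel. z \<in> im_ch X \<longrightarrow> P (param X z)"
    and m: "{p \<in> dom_ch X. \<not> P p} \<in> sets borel"
  shows "emeasure area {p \<in> dom_ch X. \<not> P p} = 0"
proof -
  let ?B = "{p \<in> dom_ch X. \<not> P p}"
  have "emeasure area ?B = (\<integral>\<^sup>+z\<in>coord X ` ?B. ennreal (density_of g X z) \<partial>lborel)"
    using is_area_area k m unfolding is_area_def by auto
  also have "\<dots> = (\<integral>\<^sup>+(z::complex). 0 \<partial>lborel)"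
  proof (rule nn_integral_cong_AE)
    show "AE z in lborel. ennreal (density_of g X z) * indicator (coord X ` ?B) z = 0"
      using ae by eventually_elim (auto simp: indicator_def chart_param_coord[OF is_chart[OF k]])
  qed
  finally show ?thesis by simp
qed

end

end

section \<open>Uniqueness of weak derivatives almost everywhere\<close>

lemma lborel_AE_eq_boxes:
  fixes f :: "'a::euclidean_space \<Rightarrow> real"
  assumes f: "integrable lborel f" and z: "\<And>a b. (LINT x|lborel. indicator (box a b) x * f x) = 0"
  shows "AE x in lborel. f x = 0"
proof -
  let ?p = "\<lambda>x. ennreal (max (f x) 0)" and ?n = "\<lambda>x. ennreal (max (- f x) 0)"
  have m: "f \<in> borel_measurable lborel" using f by auto
  have i: "integrable lborel (\<lambda>x. max (f x) 0)" "integrable lborel (\<lambda>x. max (- f x) 0)" using f by auto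
  \<comment> \<open>Positive and negative part are densities of two measures that agree on boxes, an
    intersection-stable generator.\<close>
  have dm: "density lborel ?p = density lborel ?n"
  proof (rule measure_eqI_generator_eq)
    let ?E = "range (\<lambda>(a, b). box a b::'a set)"
    show "Int_stable ?E" by (auto simp: Int_stable_def box_Int_box)
    show "?E \<subseteq> Pow UNIV" "sets (density lborel ?p) = sigma_sets UNIV ?E" "sets (density lborel ?n) = sigma_sets UNIV ?E"
      by (simp_all add: borel_eq_box)
    let ?A = "\<lambda>n::nat. box (- (real n *\<^sub>R One)) (real n *\<^sub>R One) :: 'a set"
    show "range ?A \<subseteq> ?E" "(\<Union>i. ?A i) = UNIV" unfolding UN_box_eq_UNIV by auto
    have em: "emeasure (density lborel (\<lambda>x. ennreal (max (g x) 0))) (box a b) = ennreal (LINT x|lborel. indicator (box a b) x * max (g x) 0)"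
      if g: "integrable lborel g" for g :: "'a \<Rightarrow> real" and a b
    proof -
      have ib: "integrable lborel (\<lambda>x. indicator (box a b) x * max (g x) 0)"
        using integrable_real_mult_indicator[of "box a b" lborel "\<lambda>x. max (g x) 0"] g by (simp add: mult.commute)
      have "emeasure (density lborel (\<lambda>x. ennreal (max (g x) 0))) (box a b)
          = (\<integral>\<^sup>+x. ennreal (max (g x) 0) * indicator (box a b) x \<partial>lborel)"
        using g by (intro emeasure_density) auto
      also have "\<dots> = (\<integral>\<^sup>+x. ennreal (indicator (box a b) x * max (g x) 0) \<partial>lborel)"
        by (intro nn_integral_cong) (auto simp: indicator_def)
      also have "\<dots> = ennreal (LINT x|lborel. indicator (box a b) x * max (g x) 0)"
        using ib by (intro nn_integral_eq_integral) auto
      finally show ?thesis .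
    qed
    show "emeasure (density lborel ?p) (?A k) \<noteq> \<infinity>" for k using em[OF f] by simp
    fix X assume "X \<in> ?E"
    then obtain a b where X: "X = box a b" by auto
    have ib: "integrable lborel (\<lambda>x. indicator (box a b) x * max (f x) 0)" "integrable lborel (\<lambda>x. indicator (box a b) x * max (- f x) 0)"
      using integrable_real_mult_indicator[OF _ i(1), of "box a b"] integrable_real_mult_indicator[OF _ i(2), of "box a b"]
      by (simp_all add: mult.commute)
    have "(LINT x|lborel. indicator (box a b) x * max (f x) 0) - (LINT x|lborel. indicator (box a b) x * max (- f x) 0)
        = (LINT x|lborel. indicator (box a b) x * max (f x) 0 - indicator (box a b) x * max (- f x) 0)"
      using ib by simp
    also have "\<dots> = (LINT x|lborel. indicator (box a b) x * f x)"
      by (intro Bochner_Integration.integral_cong) (auto simp: indicator_def max_def)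
    also have "\<dots> = 0" by (rule z)
    finally show "emeasure (density lborel ?p) X = emeasure (density lborel ?n) X"
      unfolding X em[OF f] using em[of "\<lambda>x. - f x" a b] f by simp
  qed
  have "AE x in lborel. ?p x = ?n x"
    using sigma_finite_measure.density_unique_iff[OF lborel.sigma_finite_measure_axioms, of ?p ?n] dm m by simp
  thus ?thesis
  proof eventually_elim
    case (elim x)
    hence "max (f x) 0 = max (- f x) 0" by (subst (asm) ennreal_inj) auto
    thus ?case by (auto simp: max_def split: if_splits)
  qed
qed

lemma set_integrable_times_bounded:
  fixes f \<eta> :: "complex \<Rightarrow> real"
  assumes f: "set_integrable lborel K f" and e: "\<eta> \<in> borel_measurable borel" "\<And>z. \<bar>\<eta> z\<bar> \<le> 1" "\<And>z. z \<notin> K \<Longrightarrow> \<eta> z = 0"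
  shows "integrable lborel (\<lambda>z. f z * \<eta> z)"
proof -
  have i: "integrable lborel (\<lambda>z. indicator K z * f z)" using f by (simp add: set_integrable_def)
  have eq: "f z * \<eta> z = indicator K z * f z * \<eta> z" for z using e(3)[of z] by (cases "z \<in> K") auto
  have "integrable lborel (\<lambda>z. indicator K z * f z * \<eta> z)"
  proof (rule Bochner_Integration.integrable_bound[OF i])
    show "(\<lambda>z. indicator K z * f z * \<eta> z) \<in> borel_measurable lborel" using i e(1) by auto
    show "AE z in lborel. norm (indicator K z * f z * \<eta> z) \<le> norm (indicator K z * f z)"
      using e(2) by (auto simp: abs_mult intro!: mult_left_le)
  qed
  thus ?thesis by (simp add: eq)
qed

text \<open>Bump functions converge to indicators of boxes, so both functions have equal integrals
  over boxes compactly inside \<open>V\<close>; countably many such boxes cover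
  \<open>V\<close>.\<close>

lemma equal_weak_forms_AE:
  fixes f g :: "complex \<Rightarrow> real"
  assumes V: "open V" and int: "\<And>K. compact K \<Longrightarrow> K \<subseteq> V \<Longrightarrow> set_integrable lborel K f \<and> set_integrable lborel K g"
    and eq: "\<And>K \<eta>. compact K \<Longrightarrow> K \<subseteq> V \<Longrightarrow> smooth_on UNIV \<eta> \<Longrightarrow> (\<And>z. z \<notin> K \<Longrightarrow> \<eta> z = 0) \<Longrightarrow>
      (LINT z|lborel. f z * \<eta> z) = (LINT z|lborel. g z * \<eta> z)"
  shows "AE z in lborel. z \<in> V \<longrightarrow> f z = g z"
proof -
  have box_eq: "(LINT z|lborel. indicator (box a b) z * f z) = (LINT z|lborel. indicator (box a b) z * g z)"
    if sub: "cbox a b \<subseteq> V" for a b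
  proof -
    have bm: "box_bump a b N \<in> borel_measurable borel" for N
      using smooth_box_bump[of a b N] by (auto simp: smooth_on_def dest!: spec[of _ 0] intro: borel_measurable_continuous_onI)
    have supp: "box_bump a b (real (Suc k)) z = 0" if "z \<notin> cbox a b" for k z
      using box_bump_outside[of "real (Suc k)" z a b] that box_subset_cbox[of a b] by auto
    have lim: "(\<lambda>k. LINT z|lborel. h z * box_bump a b (real (Suc k)) z) \<longlonglongrightarrow> (LINT z|lborel. indicator (box a b) z * h z)"
      if h: "set_integrable lborel (cbox a b) h" for h :: "complex \<Rightarrow> real"
    proof (rule integral_dominated_convergence[where w = "\<lambda>z. norm (indicator (cbox a b) z * h z)"])
      have ih: "integrable lborel (\<lambda>z. indicator (cbox a b) z * h z)" using h by (simp add: set_integrable_def)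
      have ind: "indicator (box a b) z * h z = indicator (box a b) z * (indicator (cbox a b) z * h z)" for z :: complex
        using box_subset_cbox[of a b] by (auto simp: indicator_def)
      show "(\<lambda>z. indicator (box a b) z * h z) \<in> borel_measurable lborel"
      proof -
        have "(\<lambda>z. indicator (box a b) z * (indicator (cbox a b) z * h z)) \<in> borel_measurable lborel"
          by (intro borel_measurable_times borel_measurable_indicator borel_measurable_integrable[OF ih]) simp
        thus ?thesis by (simp only: ind[symmetric])
      qed
      show "(\<lambda>z. h z * box_bump a b (real (Suc k)) z) \<in> borel_measurable lborel" for k
        using set_integrable_times_bounded[OF h bm] supp box_bump_bounds by (metis abs_of_nonneg borel_measurable_integrable)
      show "integrable lborel (\<lambda>z. norm (indicator (cbox a b) z * h z))" using ih by (rule integrable_norm)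
      show "AE z in lborel. (\<lambda>k. h z * box_bump a b (real (Suc k)) z) \<longlonglongrightarrow> indicator (box a b) z * h z"
        using tendsto_mult[OF tendsto_const box_bump_tendsto] by (auto simp: mult.commute)
      show "AE z in lborel. norm (h z * box_bump a b (real (Suc k)) z) \<le> norm (indicator (cbox a b) z * h z)" for k
      proof (rule AE_I2)
        fix z
        show "norm (h z * box_bump a b (real (Suc k)) z) \<le> norm (indicator (cbox a b) z * h z)"
          using supp[of z k] box_bump_bounds[of a b "real (Suc k)" z]
          by (cases "z \<in> cbox a b") (auto simp: abs_mult intro!: mult_left_le)
      qed
    qed
    have "(LINT z|lborel. f z * box_bump a b (real (Suc k)) z) = (LINT z|lborel. g z * box_bump a b (real (Suc k)) z)" for k
      by (rule eq[OF compact_cbox sub smooth_box_bump]) (rule supp)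
    thus ?thesis
      using lim[of f] lim[of g] int[OF compact_cbox sub] LIMSEQ_unique by fastforce
  qed
  have loc: "AE z in lborel. z \<in> box a b \<longrightarrow> f z = g z" if sub: "cbox a b \<subseteq> V" for a b
  proof -
    let ?d = "\<lambda>z. indicator (box a b) z * f z - indicator (box a b) z * g z"
    have ib: "integrable lborel (\<lambda>z. indicator (box x y) z * h z)"
      if "cbox x y \<subseteq> V" "\<And>K. compact K \<Longrightarrow> K \<subseteq> V \<Longrightarrow> set_integrable lborel K h" for x y and h :: "complex \<Rightarrow> real"
    proof -
      have "set_integrable lborel (box x y) h"
        by (rule set_integrable_subset[OF that(2)[OF compact_cbox that(1)]]) (auto simp: box_subset_cbox)
      thus ?thesis by (simp add: set_integrable_def)
    qed
    have "AE z in lborel. ?d z = 0"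
    proof (rule lborel_AE_eq_boxes)
      show "integrable lborel ?d" using ib[OF sub] int by auto
      fix x y :: complex
      obtain a' b' where ab: "box x y \<inter> box a b = box a' b'" "box a' b' = {} \<or> cbox a' b' \<subseteq> V"
      proof -
        let ?a = "\<Sum>i\<in>Basis. max (x \<bullet> i) (a \<bullet> i) *\<^sub>R i" and ?b = "\<Sum>i\<in>Basis. min (y \<bullet> i) (b \<bullet> i) *\<^sub>R i"
        have 1: "box x y \<inter> box a b = box ?a ?b" by (rule box_Int_box)
        have "cbox ?a ?b \<subseteq> cbox a b" by (auto simp: mem_box)
        thus ?thesis using that[OF 1] sub by blast
      qed
      have e: "indicator (box x y) z * (indicator (box a b) z * h z) = indicator (box a' b') z * (h z :: real)" for h z
        using ab(1) by (auto simp: indicator_def)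
      have "(LINT z|lborel. indicator (box a' b') z * f z) = (LINT z|lborel. indicator (box a' b') z * g z)"
        using ab(2) box_eq by auto
      moreover have "integrable lborel (\<lambda>z. indicator (box a' b') z * f z)" "integrable lborel (\<lambda>z. indicator (box a' b') z * g z)"
        using ab(2) ib int by auto
      ultimately show "(LINT z|lborel. indicator (box x y) z * ?d z) = 0"
        by (simp add: right_diff_distrib e)
    qed
    thus ?thesis by eventually_elim (auto simp: indicator_def)
  qed
  let ?F = "{box a b | a b. cbox a b \<subseteq> V}"
  obtain F' where F': "F' \<subseteq> ?F" "countable F'" "\<Union>F' = \<Union>?F"
    using Lindelof[of ?F] by (auto simp: open_box)
  have "AE z in lborel. \<forall>S\<in>F'. z \<in> S \<longrightarrow> f z = g z"
  proof (subst AE_ball_countable[OF F'(2)], rule ballI)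
    fix S assume "S \<in> F'"
    then obtain a b where "S = box a b" "cbox a b \<subseteq> V" using F'(1) by blast
    thus "AE z in lborel. z \<in> S \<longrightarrow> f z = g z" using loc by simp
  qed
  thus ?thesis
  proof eventually_elim
    case (elim z)
    show ?case
    proof
      assume "z \<in> V"
      then obtain a b where "z \<in> box a b" "cbox a b \<subseteq> V"
        by (rule open_contains_cbox[OF V])
      hence "z \<in> \<Union>F'" using F'(3) by blast
      thus "f z = g z" using elim by blast
    qed
  qed
qed

lemma borel_measurable_exhaust:
  fixes f :: "complex \<Rightarrow> real"
  assumes V: "open V" and int: "\<And>K. compact K \<Longrightarrow> K \<subseteq> V \<Longrightarrow> set_integrable lborel K f"
  shows "(\<lambda>z. indicator V z * f z) \<in> borel_measurable borel"
proof -
  obtain K :: "nat \<Rightarrow> complex set" where K: "\<And>n. compact (K n)" "\<And>n. K n \<subseteq> V" "\<And>n. K n \<subseteq> interior (K (Suc n))" "\<Union>(range K) = V"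
    using open_Union_compact_subsets[OF V] by metis
  have inc: "K m \<subseteq> K n" if "m \<le> n" for m n
    using that by (induction n rule: dec_induct) (use K(3) interior_subset in blast)+
  show ?thesis
  proof (rule borel_measurable_LIMSEQ_real)
    show "(\<lambda>z. indicator (K n) z * f z) \<in> borel_measurable borel" for n
      using int[OF K(1,2), of n] by (auto simp: set_integrable_def dest: borel_measurable_integrable)
    fix z
    show "(\<lambda>n. indicator (K n) z * f z) \<longlonglongrightarrow> indicator V z * f z"
    proof (cases "z \<in> V")
      case True
      then obtain m where "z \<in> K m" using K(4) by blast
      hence "\<forall>n\<ge>m. indicator (K n) z * f z = indicator V z * f z"
        using inc True by (metis indicator_simps(1) subsetD)
      thus ?thesis by (intro tendsto_eventually) (auto simp: eventually_sequentially)
    next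
      case False
      hence "z \<notin> K n" for n using K(2) by blast
      thus ?thesis using False by simp
    qed
  qed
qed

context conformal_surface
begin

lemma surface_measurableI:
  fixes f :: "'a \<Rightarrow> real"
  assumes "\<And>X. X \<in> smooth_charts A \<Longrightarrow> (\<lambda>z. indicator (im_ch X) z * f (param X z)) \<in> borel_measurable borel"
  shows "f \<in> borel_measurable borel"
proof -
  have pm: "(\<lambda>p. indicator (piece j) p * f p) \<in> borel_measurable borel" if j: "j < length cover" for j
  proof -
    let ?k = "cover ! j"
    note k = cover(1)[OF j] and ck = is_chart[OF cover(1)[OF j]]
    have "(\<lambda>p. if p \<in> dom_ch ?k then coord ?k p else 0) \<in> borel_measurable borel"
      by (intro borel_measurable_continuous_on_if chart_open ck continuous_on_const borel_open)
    from measurable_compose[OF this assms[OF k]]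
    have "(\<lambda>p. indicator (piece j) p * (indicator (im_ch ?k) (if p \<in> dom_ch ?k then coord ?k p else 0)
        * f (param ?k (if p \<in> dom_ch ?k then coord ?k p else 0)))) \<in> borel_measurable borel"
      by (rule borel_measurable_times[OF borel_measurable_indicator[OF piece_borel[OF j]]])
    moreover have "indicator (piece j) p * (indicator (im_ch ?k) (if p \<in> dom_ch ?k then coord ?k p else 0)
        * f (param ?k (if p \<in> dom_ch ?k then coord ?k p else 0))) = indicator (piece j) p * f p" for p
    proof (cases "p \<in> piece j")
      case True
      hence "p \<in> dom_ch ?k" using piece_dom by blast
      thus ?thesis using chart_param_coord[OF ck] by simp
    qed simp
    ultimately show ?thesis by simp
  qed
  have "(\<lambda>p. \<Sum>j<length cover. indicator (piece j) p * f p) \<in> borel_measurable borel"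
    using pm by (intro borel_measurable_sum) auto
  moreover have "(\<Sum>j<length cover. indicator (piece j) p * f p) = f p" for p
  proof -
    obtain j where j: "j < length cover" "p \<in> piece j" using piece_Union by blast
    have "(\<Sum>i<length cover. indicator (piece i) p * f p) = (\<Sum>i<length cover. if i = j then f p else 0)"
    proof (rule sum.cong[OF refl])
      fix i assume "i \<in> {..<length cover}"
      show "indicator (piece i) p * f p = (if i = j then f p else 0)"
        using j(2) piece_disjoint[of UNIV] unfolding disjoint_family_on_def by (cases "i = j") (auto simp: indicator_def)
    qed
    thus ?thesis using j(1) by simp
  qed
  ultimately show ?thesis by simp
qed

lemma surface_continuousI:
  fixes f :: "'a \<Rightarrow> real"
  assumes "\<And>X. X \<in> smooth_charts A \<Longrightarrow> continuous_on (im_ch X) (\<lambda>z. f (param X z))"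
  shows "continuous_on UNIV f"
proof (rule continuous_at_imp_continuous_on, rule ballI)
  fix p
  obtain X where k: "X \<in> smooth_charts A" "p \<in> dom_ch X" using ex_chart charts_atD by blast
  note ck = is_chart[OF k(1)]
  have "continuous_on (dom_ch X) (\<lambda>q. f (param X (coord X q)))"
    by (rule continuous_on_compose2[OF assms[OF k(1)] chart_open(3)[OF ck]]) auto
  hence "continuous_on (dom_ch X) f"
    by (rule continuous_on_cong[THEN iffD1, rotated -1]) (simp_all add: chart_param_coord[OF ck])
  thus "isCont f p" using continuous_on_eq_continuous_at chart_open(1)[OF ck] k(2) by blast
qed

section \<open>Differentials and the Dirichlet energy\<close>

definition C1 :: "('a \<Rightarrow> real) set" where
  "C1 = {u. \<forall>X\<in>smooth_charts A. Ck_on 1 (im_ch X) (u \<circ> param X)}"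

lemma C1_Ck: "u \<in> C1 \<Longrightarrow> X \<in> smooth_charts A \<Longrightarrow> Ck_on 1 (im_ch X) (u \<circ> param X)"
  by (simp add: C1_def)

lemma C1_continuous: "u \<in> C1 \<Longrightarrow> continuous_on UNIV u"
  by (rule surface_continuousI) (use C1_Ck Ck_on_continuous in \<open>fastforce simp: o_def\<close>)

lemma C1_differentiable: "u \<in> C1 \<Longrightarrow> X \<in> smooth_charts A \<Longrightarrow> z \<in> im_ch X \<Longrightarrow> (u \<circ> param X) differentiable (at z)"
  using C1_Ck[of u X] unfolding One_nat_def Ck_on.simps by blast

lemma cdiff_linear: "u \<in> C1 \<Longrightarrow> X \<in> charts_at A p \<Longrightarrow> linear (cdiff u X p)"
  unfolding cdiff_def[abs_def]
  by (intro linear_frechet_derivative C1_differentiable) (auto dest: charts_atD)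

lemma cdiff_one_form: "u \<in> C1 \<Longrightarrow> one_form A (cdiff u)"
  unfolding one_form_def
proof (intro conjI allI ballI)
  fix p X assume u: "u \<in> C1" and k: "X \<in> charts_at A p"
  show "linear (cdiff u X p)" by (rule cdiff_linear[OF u k])
  fix X' v assume k': "X' \<in> charts_at A p"
  have "(u \<circ> param X') differentiable (at (coord X' p))"
    using charts_atD[OF k'] by (intro C1_differentiable u) auto
  thus "cdiff u X p v = cdiff u X' p (tder X X' p v)"
    by (rule cdiff_transform(1)[OF k k'])
qed

lemma cdiff_param: "z \<in> im_ch X \<Longrightarrow> cdiff u X (param X z) v = pderiv_at (u \<circ> param X) z v"
  by (simp add: cdiff_def chart_coord_param)

lemma cdiff_continuous: "u \<in> C1 \<Longrightarrow> X \<in> smooth_charts A \<Longrightarrow> continuous_on (im_ch X) (\<lambda>z. cdiff u X (param X z) v)"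
proof -
  assume "u \<in> C1" "X \<in> smooth_charts A"
  hence "continuous_on (im_ch X) (\<lambda>z. pderiv_at (u \<circ> param X) z v)" using C1_Ck[of u X] by simp
  thus ?thesis by (rule continuous_on_cong[THEN iffD1, rotated -1]) (simp_all add: cdiff_param)
qed

lemma set_integrable_continuous_compact:
  fixes f :: "complex \<Rightarrow> real"
  shows "compact K \<Longrightarrow> continuous_on K f \<Longrightarrow> set_integrable lborel K f"
  unfolding set_integrable_def by (rule borel_integrable_compact)

text \<open>Integration by parts in each chart.\<close>

lemma cdiff_weak:
  assumes u: "u \<in> C1"
  shows "is_weak_differential A u (cdiff u)"
  unfolding is_weak_differential_def
proof (intro conjI ballI allI impI)
  show "one_form A (cdiff u)" by (rule cdiff_one_form[OF u])
next
  fix X K v assume k: "X \<in> smooth_charts A" and K: "compact K \<and> K \<subseteq> im_ch X"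
  note Ck = C1_Ck[OF u k]
  show "set_integrable lborel K (\<lambda>z. u (param X z))"
    using Ck_on_continuous[OF Ck] K
    by (intro set_integrable_continuous_compact) (auto simp: o_def intro: continuous_on_subset)
  show "set_integrable lborel K (\<lambda>z. cdiff u X (param X z) v)"
    using cdiff_continuous[OF u k] K
    by (intro set_integrable_continuous_compact) (auto intro: continuous_on_subset)
  fix \<eta> assume e: "smooth_on UNIV \<eta> \<and> (\<forall>z. z \<notin> K \<longrightarrow> \<eta> z = (0::real))"
  have "(LINT z|lborel. (u \<circ> param X) z * pderiv_at \<eta> z v) = - (LINT z|lborel. pderiv_at (u \<circ> param X) z v * \<eta> z)"
    by (rule integration_by_parts_plane[OF chart_open(2)[OF is_chart[OF k]] Ck, of _ K])
      (use e K in \<open>auto simp: smooth_on_def\<close>)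
  also have "(\<lambda>z. pderiv_at (u \<circ> param X) z v * \<eta> z) = (\<lambda>z. cdiff u X (param X z) v * \<eta> z)"
  proof
    fix z
    show "pderiv_at (u \<circ> param X) z v * \<eta> z = cdiff u X (param X z) v * \<eta> z"
      using e K cdiff_param[of z X u v] by (cases "z \<in> K") auto
  qed
  finally show "(LINT z|lborel. u (param X z) * pderiv_at \<eta> z v) = - (LINT z|lborel. cdiff u X (param X z) v * \<eta> z)"
    by simp
qed

text \<open>\<open>weak_differential\<close> is an arbitrary choice among forms that may differ on
  null sets; this makes integrals over it meaningful.\<close>

lemma weak_differential_AE_unique:
  assumes w: "is_weak_differential A u \<omega>" and w': "is_weak_differential A u \<omega>'" and k: "X \<in> smooth_charts A"
  shows "AE z in lborel. z \<in> im_ch X \<longrightarrow> \<omega> X (param X z) v = \<omega>' X (param X z) v"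
proof (rule equal_weak_forms_AE[OF chart_open(2)[OF is_chart[OF k]]])
  fix K assume K: "compact K" "K \<subseteq> im_ch X"
  show "set_integrable lborel K (\<lambda>z. \<omega> X (param X z) v) \<and> set_integrable lborel K (\<lambda>z. \<omega>' X (param X z) v)"
    using w w' k K unfolding is_weak_differential_def by blast
  fix \<eta> :: "complex \<Rightarrow> real" assume e: "smooth_on UNIV \<eta>" "\<And>z. z \<notin> K \<Longrightarrow> \<eta> z = 0"
  have "(LINT z|lborel. u (param X z) * pderiv_at \<eta> z v) = - (LINT z|lborel. \<omega> X (param X z) v * \<eta> z)"
    using w k K e unfolding is_weak_differential_def by blast
  moreover have "(LINT z|lborel. u (param X z) * pderiv_at \<eta> z v) = - (LINT z|lborel. \<omega>' X (param X z) v * \<eta> z)"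
    using w' k K e unfolding is_weak_differential_def by blast
  ultimately show "(LINT z|lborel. \<omega> X (param X z) v * \<eta> z) = (LINT z|lborel. \<omega>' X (param X z) v * \<eta> z)" by simp
qed

end

text \<open>By the Lindelof property countably many open sets, each meeting \<open>S\<close> in at
  most one point, cover \<open>S\<close>.\<close>

lemma countable_discrete:
  fixes S :: "'b::second_countable_topology set"
  assumes "\<And>z. z \<in> S \<Longrightarrow> \<exists>U. open U \<and> z \<in> U \<and> U \<inter> S \<subseteq> {z}"
  shows "countable S"
proof -
  let ?F = "{U. open U \<and> (\<exists>z. U \<inter> S \<subseteq> {z})}"
  obtain F' where F': "F' \<subseteq> ?F" "countable F'" "\<Union>F' = \<Union>?F"
    using Lindelof[of ?F] by blast
  have "S \<subseteq> \<Union>F'" unfolding F'(3) using assms by blast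
  hence "S = (\<Union>U\<in>F'. U \<inter> S)" by blast
  moreover have "countable (U \<inter> S)" if U: "U \<in> F'" for U
  proof -
    obtain z where "U \<inter> S \<subseteq> {z}" using U F'(1) by blast
    thus ?thesis by (rule countable_subset) simp
  qed
  ultimately show ?thesis using F'(2) countable_UN by metis
qed

text \<open>Young's inequality, from the nonnegative square of \<open>d * y - (x - y)\<close>
  divided by \<open>d\<close>.\<close>

lemma square_split:
  fixes x y d :: real
  assumes "0 < d"
  shows "x\<^sup>2 \<le> (1 + d) * y\<^sup>2 + (1 + 1 / d) * (x - y)\<^sup>2"
proof -
  have "0 \<le> (d * y - (x - y))\<^sup>2 / d" using assms by simp
  also have "\<dots> = d * y\<^sup>2 - 2 * y * (x - y) + (x - y)\<^sup>2 / d"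
    using assms by (simp add: power2_eq_square field_simps)
  finally show ?thesis
    by (simp add: power2_eq_square algebra_simps add_divide_distrib diff_divide_distrib)
qed

text \<open>A substitute for the triangle inequality of a seminorm: \<open>X\<close> is its square
  along a sequence and \<open>N\<close> the square of the differences. Choosing first
  \<open>d\<close> and then \<open>N\<close> small makes \<open>X\<close> a Cauchy sequence.\<close>

lemma convergent_of_square_split:
  fixes X :: "nat \<Rightarrow> real" and N :: "nat \<Rightarrow> nat \<Rightarrow> real"
  assumes X: "\<And>k. 0 \<le> X k" and split: "\<And>m n d. 0 < d \<Longrightarrow> X m \<le> (1 + d) * X n + (1 + 1 / d) * N m n"
    and N: "\<And>e. 0 < e \<Longrightarrow> \<exists>K. \<forall>m\<ge>K. \<forall>n\<ge>K. N m n < e"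
  shows "convergent X"
proof -
  obtain K where K: "\<And>m n. m \<ge> K \<Longrightarrow> n \<ge> K \<Longrightarrow> N m n < 1" using N[of 1] by auto
  define B where "B = 2 * X K + 2"
  have B: "B > 0" using X[of K] by (simp add: B_def)
  have XB: "X m \<le> B" if "m \<ge> K" for m
    using split[of 1 m K] K[of m K] that by (simp add: B_def)
  have "Cauchy X"
  proof (rule metric_CauchyI)
    fix e :: real assume e: "0 < e"
    \<comment> \<open>Late terms are bounded by \<open>B\<close>, so this \<open>d\<close> makes
      \<open>d * X n\<close> at most \<open>e / 2\<close>.\<close>
    define d where "d = e / (2 * B)"
    have d: "d > 0" using e B by (simp add: d_def)
    have e': "e / (2 * (1 + 1 / d)) > 0" using e d by (simp add: add_pos_pos)
    then obtain K' where K': "\<And>m n. m \<ge> K' \<Longrightarrow> n \<ge> K' \<Longrightarrow> N m n < e / (2 * (1 + 1 / d))" using N by blast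
    have *: "X m - X n < e" if "m \<ge> max K K'" "n \<ge> max K K'" for m n
    proof -
      have p: "1 + 1 / d > 0" using d by (simp add: add_pos_pos)
      have "X m - X n \<le> d * X n + (1 + 1 / d) * N m n" using split[OF d, of m n] by (simp add: algebra_simps)
      also have "d * X n \<le> d * B" using d XB that by (intro mult_left_mono) auto
      also have "d * B = e / 2" using B by (simp add: d_def)
      also have "(1 + 1 / d) * N m n < (1 + 1 / d) * (e / (2 * (1 + 1 / d)))"
        using K'[of m n] that p by (intro mult_strict_left_mono) auto
      also have "(1 + 1 / d) * (e / (2 * (1 + 1 / d))) = e / 2"
      proof -
        have "P * (e / (2 * P)) = e / 2" if "P > 0" for P using that by simp
        thus ?thesis using p by blast
      qed
      finally show ?thesis by simp
    qed
    show "\<exists>M. \<forall>m\<ge>M. \<forall>n\<ge>M. dist (X m) (X n) < e"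
    proof (intro exI allI impI)
      fix m n assume "m \<ge> max K K'" "n \<ge> max K K'"
      thus "dist (X m) (X n) < e" using *[of m n] *[of n m] unfolding dist_real_def by linarith
    qed
  qed
  thus ?thesis by (simp add: Cauchy_convergent_iff)
qed

context conformal_surface
begin

section \<open>Norms of differentials and their independence of the choices made\<close>

lemma form_norm_sq_ch: "form_norm_sq A g \<omega> p = finner g (ch p) p (\<omega> (ch p) p) (\<omega> (ch p) p)"
  unfolding form_norm_sq_def Let_def ch_def[symmetric] finner_def
  by (simp add: power2_eq_square algebra_simps)

lemma form_norm_sq_eq:
  assumes g: "riemannian_metric A g" and w: "one_form A \<omega>" and k: "X \<in> charts_at A p"
  shows "form_norm_sq A g \<omega> p = finner g X p (\<omega> X p) (\<omega> X p)"
proof -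
  have l: "linear (\<omega> X p)" using w k unfolding one_form_def by blast
  have t: "\<omega> (ch p) p v = \<omega> X p (tder (ch p) X p v)" for v
    using w ch k unfolding one_form_def by blast
  show ?thesis unfolding form_norm_sq_ch
    by (rule finner_transform[OF metric_sym[OF g] ch k _ l l t t])
      (use metric_pos(2)[OF g ch, of p] in simp)
qed

text \<open>\<open>frame1\<close> and \<open>frame2\<close> are the orthonormal basis that
  Gram-Schmidt produces from the coordinate vectors 1 and \<open>\<i>\<close>.\<close>

definition frame1 :: "'a tensor2 \<Rightarrow> 'a chart \<Rightarrow> 'a \<Rightarrow> complex" where
  "frame1 g X p = complex_of_real (1 / sqrt (g X p 1 1))"

definition frame2 :: "'a tensor2 \<Rightarrow> 'a chart \<Rightarrow> 'a \<Rightarrow> complex" where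
  "frame2 g X p = Complex (- g X p 1 \<i> / sqrt (g X p 1 1 * gram_det g X p)) (g X p 1 1 / sqrt (g X p 1 1 * gram_det g X p))"

lemma finner_frame:
  assumes g: "riemannian_metric A g" and k: "X \<in> charts_at A p" and la: "linear a" and lb: "linear b"
  shows "finner g X p a b = a (frame1 g X p) * b (frame1 g X p) + a (frame2 g X p) * b (frame2 g X p)"
proof -
  define E F G S where "E = g X p 1 1" and "F = g X p 1 \<i>" and "G = g X p \<i> \<i>" and "S = sqrt (E * gram_det g X p)"
  have E: "E > 0" and D: "gram_det g X p > 0" using metric_pos[OF g k] by (auto simp: E_def)
  have Dd: "gram_det g X p = E * G - F\<^sup>2" by (simp add: gram_det_def E_def F_def G_def)
  have S: "S * S = E * (E * G - F\<^sup>2)" "S \<noteq> 0" using E D by (auto simp: S_def Dd)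
  have rE: "sqrt E * sqrt E = E" "sqrt E \<noteq> 0" using E by auto
  have f1: "c (frame1 g X p) = c 1 / sqrt E" if "linear c" for c :: "complex \<Rightarrow> real"
    using linear_complex[OF that, of "frame1 g X p"] by (simp add: frame1_def E_def)
  have f2: "c (frame2 g X p) = (E * c \<i> - F * c 1) / S" if "linear c" for c :: "complex \<Rightarrow> real"
    using linear_complex[OF that, of "frame2 g X p"]
    by (simp add: frame2_def flip: E_def F_def S_def) (simp add: diff_divide_distrib)
  have "a (frame1 g X p) * b (frame1 g X p) + a (frame2 g X p) * b (frame2 g X p)
      = (a 1 * b 1) / E + (E * a \<i> - F * a 1) * (E * b \<i> - F * b 1) / (E * (E * G - F\<^sup>2))"
    unfolding f1[OF la] f1[OF lb] f2[OF la] f2[OF lb] times_divide_times_eq S(1) rE(1) ..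
  also have "\<dots> = ((a 1 * b 1) * (E * G - F\<^sup>2) + (E * a \<i> - F * a 1) * (E * b \<i> - F * b 1)) / (E * (E * G - F\<^sup>2))"
    using E D Dd by (simp add: add_divide_distrib)
  also have "(a 1 * b 1) * (E * G - F\<^sup>2) + (E * a \<i> - F * a 1) * (E * b \<i> - F * b 1)
     = E * (G * (a 1 * b 1) - F * (a 1 * b \<i> + a \<i> * b 1) + E * (a \<i> * b \<i>))"
    by (simp add: power2_eq_square algebra_simps)
  finally show ?thesis unfolding finner_def Dd using E by (simp add: E_def[symmetric] F_def[symmetric] G_def[symmetric])
qed

lemma frame_orthonormal:
  assumes g: "riemannian_metric A g" and k: "X \<in> charts_at A p"
  shows "g X p (frame1 g X p) (frame1 g X p) = 1" "g X p (frame1 g X p) (frame2 g X p) = 0"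
    "g X p (frame2 g X p) (frame2 g X p) = 1"
proof -
  define E F G S where "E = g X p 1 1" and "F = g X p 1 \<i>" and "G = g X p \<i> \<i>" and "S = sqrt (E * gram_det g X p)"
  have E: "E > 0" and D: "gram_det g X p > 0" using metric_pos[OF g k] by (auto simp: E_def)
  have Dd: "gram_det g X p = E * G - F\<^sup>2" by (simp add: gram_det_def E_def F_def G_def)
  have S: "S * S = E * (E * G - F\<^sup>2)" "S \<noteq> 0" using E D by (auto simp: S_def Dd)
  have rE: "sqrt E * sqrt E = E" "sqrt E \<noteq> 0" using E by auto
  have b: "bilinear (g X p)" "\<And>v w. g X p v w = g X p w v"
    using g k unfolding riemannian_metric_def sym_tensor_def by blast+
  have c: "Re (frame1 g X p) = 1 / sqrt E" "Im (frame1 g X p) = 0"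
    "Re (frame2 g X p) = - F / S" "Im (frame2 g X p) = E / S"
    by (simp_all add: frame1_def frame2_def E_def F_def S_def)
  note e = bilinear_complex[OF b, unfolded E_def[symmetric] F_def[symmetric] G_def[symmetric]]
  show "g X p (frame1 g X p) (frame1 g X p) = 1"
    unfolding e[of "frame1 g X p"] c using rE by (simp add: field_simps)
  show "g X p (frame1 g X p) (frame2 g X p) = 0"
    unfolding e[of "frame1 g X p"] c using rE S(2) by (simp add: field_simps)
  have "g X p (frame2 g X p) (frame2 g X p) = (F * F * E - 2 * (F * E * F) + E * E * G) / (S * S)"
    unfolding e[of "frame2 g X p"] c using S(2) by (simp add: field_simps)
  also have "\<dots> = 1" using E D unfolding S(1) Dd by (simp add: power2_eq_square algebra_simps)
  finally show "g X p (frame2 g X p) (frame2 g X p) = 1" .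
qed

lemma finner_nonneg:
  assumes "riemannian_metric A g" "X \<in> charts_at A p" "linear a"
  shows "0 \<le> finner g X p a a"
  unfolding finner_frame[OF assms assms(3)] by simp

lemma finner_split:
  assumes g: "riemannian_metric A g" and k: "X \<in> charts_at A p" and l: "linear a" "linear b" and d: "0 < d"
  shows "finner g X p a a \<le> (1 + d) * finner g X p b b + (1 + 1 / d) * finner g X p (\<lambda>v. a v - b v) (\<lambda>v. a v - b v)"
proof -
  have ld: "linear (\<lambda>v. a v - b v)" using l by (rule linear_compose_sub)
  let ?u = "frame1 g X p" and ?v = "frame2 g X p"
  have "(a ?u)\<^sup>2 + (a ?v)\<^sup>2 \<le> (1 + d) * ((b ?u)\<^sup>2 + (b ?v)\<^sup>2) + (1 + 1 / d) * ((a ?u - b ?u)\<^sup>2 + (a ?v - b ?v)\<^sup>2)"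
    using square_split[OF d, of "a ?u" "b ?u"] square_split[OF d, of "a ?v" "b ?v"]
    unfolding distrib_left by linarith
  thus ?thesis
    unfolding finner_frame[OF g k l(1) l(1)] finner_frame[OF g k l(2) l(2)] finner_frame[OF g k ld ld]
    by (simp add: power2_eq_square)
qed

lemma form_norm_nonneg:
  assumes g: "riemannian_metric A g" and w: "one_form A \<omega>"
  shows "0 \<le> form_norm_sq A g \<omega> p"
  unfolding form_norm_sq_eq[OF g w ch] by (rule finner_nonneg[OF g ch]) (use w ch in \<open>simp add: one_form_def\<close>)

lemma form_norm_measurable:
  assumes g: "riemannian_metric A g" and w: "is_weak_differential A u \<omega>"
  shows "form_norm_sq A g \<omega> \<in> borel_measurable borel"
proof (rule surface_measurableI)
  fix X assume k: "X \<in> smooth_charts A"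
  note V = chart_open(2)[OF is_chart[OF k]]
  have o: "one_form A \<omega>" using w by (simp add: is_weak_differential_def)
  have m: "(\<lambda>z. indicator (im_ch X) z * \<omega> X (param X z) v) \<in> borel_measurable borel" for v
    by (rule borel_measurable_exhaust[OF V]) (use w k in \<open>auto simp: is_weak_differential_def\<close>)
  have mg: "(\<lambda>z. indicator (im_ch X) z * f z) \<in> borel_measurable borel"
    if "Ck_on 0 (im_ch X) f" for f :: "complex \<Rightarrow> real"
  proof -
    have "(\<lambda>z. if z \<in> im_ch X then f z else 0) \<in> borel_measurable borel"
      using that V by (intro borel_measurable_continuous_on_if) auto
    moreover have "(\<lambda>z. if z \<in> im_ch X then f z else 0) = (\<lambda>z. indicator (im_ch X) z * f z)"
      by (auto simp: indicator_def fun_eq_iff)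
    ultimately show ?thesis by simp
  qed
  let ?i = "indicator (im_ch X) :: complex \<Rightarrow> real"
  \<comment> \<open>The components of \<open>\<omega>\<close> are known to be measurable after
    multiplication by the indicator; outside the image the quotient reads 0 / 0 = 0.\<close>
  have "(\<lambda>z. ((?i z * g X (param X z) \<i> \<i>) * ((?i z * \<omega> X (param X z) 1) * (?i z * \<omega> X (param X z) 1))
      - (?i z * g X (param X z) 1 \<i>) * ((?i z * \<omega> X (param X z) 1) * (?i z * \<omega> X (param X z) \<i>) + (?i z * \<omega> X (param X z) \<i>) * (?i z * \<omega> X (param X z) 1))
      + (?i z * g X (param X z) 1 1) * ((?i z * \<omega> X (param X z) \<i>) * (?i z * \<omega> X (param X z) \<i>)))
      / (?i z * gram_det g X (param X z))) \<in> borel_measurable borel"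
    by (intro borel_measurable_divide borel_measurable_add borel_measurable_diff borel_measurable_times m mg
        metric_Ck[OF g k] gram_Ck[OF g k])
  also have "(\<lambda>z. ((?i z * g X (param X z) \<i> \<i>) * ((?i z * \<omega> X (param X z) 1) * (?i z * \<omega> X (param X z) 1))
      - (?i z * g X (param X z) 1 \<i>) * ((?i z * \<omega> X (param X z) 1) * (?i z * \<omega> X (param X z) \<i>) + (?i z * \<omega> X (param X z) \<i>) * (?i z * \<omega> X (param X z) 1))
      + (?i z * g X (param X z) 1 1) * ((?i z * \<omega> X (param X z) \<i>) * (?i z * \<omega> X (param X z) \<i>)))
      / (?i z * gram_det g X (param X z))) = (\<lambda>z. ?i z * form_norm_sq A g \<omega> (param X z))"
  proof
    fix z
    show "((?i z * g X (param X z) \<i> \<i>) * ((?i z * \<omega> X (param X z) 1) * (?i z * \<omega> X (param X z) 1))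
      - (?i z * g X (param X z) 1 \<i>) * ((?i z * \<omega> X (param X z) 1) * (?i z * \<omega> X (param X z) \<i>) + (?i z * \<omega> X (param X z) \<i>) * (?i z * \<omega> X (param X z) 1))
      + (?i z * g X (param X z) 1 1) * ((?i z * \<omega> X (param X z) \<i>) * (?i z * \<omega> X (param X z) \<i>)))
      / (?i z * gram_det g X (param X z)) = ?i z * form_norm_sq A g \<omega> (param X z)"
    proof (cases "z \<in> im_ch X")
      case True
      have "X \<in> charts_at A (param X z)" using k chart_param_dom[OF True] by (rule charts_atI)
      from form_norm_sq_eq[OF g o this] show ?thesis using True unfolding finner_def by simp
    qed simp
  qed
  finally show "(\<lambda>z. indicator (im_ch X) z * form_norm_sq A g \<omega> (param X z)) \<in> borel_measurable borel" .
qed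

text \<open>Chartwise uniqueness of weak differentials, collected over the finite cover. Energies
  thus do not depend on the choice behind \<open>weak_differential\<close>.\<close>

lemma form_norm_AE_unique:
  assumes g: "riemannian_metric A g" and w: "is_weak_differential A u \<omega>" and w': "is_weak_differential A u \<omega>'"
  shows "AE p in area g. form_norm_sq A g \<omega> p = form_norm_sq A g \<omega>' p"
proof -
  let ?P = "\<lambda>p. form_norm_sq A g \<omega> p = form_norm_sq A g \<omega>' p"
  have o: "one_form A \<omega>" "one_form A \<omega>'" using w w' by (auto simp: is_weak_differential_def)
  have sets: "{p \<in> dom_ch X. \<not> ?P p} \<in> sets borel" if "X \<in> smooth_charts A" for X
  proof -
    have "{p. form_norm_sq A g \<omega> p \<noteq> form_norm_sq A g \<omega>' p} \<in> sets borel"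
      using form_norm_measurable[OF g w] form_norm_measurable[OF g w'] by measurable
    moreover have "dom_ch X \<in> sets borel" using chart_open(1)[OF is_chart[OF that]] by simp
    moreover have "{p \<in> dom_ch X. \<not> ?P p} = dom_ch X \<inter> {p. form_norm_sq A g \<omega> p \<noteq> form_norm_sq A g \<omega>' p}" by blast
    ultimately show ?thesis by simp
  qed
  have null: "{p \<in> dom_ch X. \<not> ?P p} \<in> null_sets (area g)" if k: "X \<in> smooth_charts A" for X
  proof -
    have "AE z in lborel. z \<in> im_ch X \<longrightarrow> ?P (param X z)"
      using weak_differential_AE_unique[OF w w' k, of 1] weak_differential_AE_unique[OF w w' k, of \<i>]
    proof eventually_elim
      case (elim z)
      show ?case
      proof
        assume z: "z \<in> im_ch X"
        have "X \<in> charts_at A (param X z)" using k chart_param_dom[OF z] by (rule charts_atI)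
        thus "?P (param X z)" using elim z form_norm_sq_eq[OF g o(1)] form_norm_sq_eq[OF g o(2)]
          by (simp add: finner_def)
      qed
    qed
    from area_chart_null[OF g k this sets[OF k]] show ?thesis
      using sets[OF k] sets_area[OF g] by (auto intro!: null_setsI)
  qed
  have "(\<Union>j\<in>{..<length cover}. {p \<in> dom_ch (cover ! j). \<not> ?P p}) \<in> null_sets (area g)"
    using null cover(1) by (intro null_sets_UN') auto
  thus ?thesis
  proof (rule AE_I')
    have "p \<in> (\<Union>j<length cover. dom_ch (cover ! j))" for p using cover(2) by blast
    thus "{p \<in> space (area g). \<not> ?P p} \<subseteq> (\<Union>j\<in>{..<length cover}. {p \<in> dom_ch (cover ! j). \<not> ?P p})"
      by blast
  qed
qed

lemma weak_differential_weak: "is_weak_differential A u \<omega> \<Longrightarrow> is_weak_differential A u (weak_differential A u)"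
  unfolding weak_differential_def by (rule someI[of "is_weak_differential A u"])

definition gradp :: "'a tensor2 \<Rightarrow> ('a \<Rightarrow> real) \<Rightarrow> ('a \<Rightarrow> real) \<Rightarrow> 'a \<Rightarrow> real" where
  "gradp g u v p = finner g (ch p) p (cdiff u (ch p) p) (cdiff v (ch p) p)"

lemma gradp_chart:
  assumes g: "riemannian_metric A g" and u: "u \<in> C1" and v: "v \<in> C1" and k: "X \<in> charts_at A p"
  shows "gradp g u v p = finner g X p (cdiff u X p) (cdiff v X p)"
  unfolding gradp_def
proof (rule finner_transform[OF metric_sym[OF g] ch k _ cdiff_linear[OF u k] cdiff_linear[OF v k]])
  show "gram_det g (ch p) p \<noteq> 0" using metric_pos(2)[OF g ch, of p] by simp
  show "cdiff u (ch p) p w = cdiff u X p (tder (ch p) X p w)" "cdiff v (ch p) p w = cdiff v X p (tder (ch p) X p w)" for w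
    using cdiff_one_form[OF u] cdiff_one_form[OF v] ch k unfolding one_form_def by blast+
qed

lemma gradp_continuous:
  assumes g: "riemannian_metric A g" and u: "u \<in> C1" and v: "v \<in> C1"
  shows "continuous_on UNIV (gradp g u v)"
proof (rule surface_continuousI)
  fix X assume k: "X \<in> smooth_charts A"
  have ka: "X \<in> charts_at A (param X z)" if "z \<in> im_ch X" for z
    using k chart_param_dom[OF that] by (rule charts_atI)
  have gc: "continuous_on (im_ch X) (\<lambda>z. g X (param X z) x y)" for x y
    by (rule Ck_on_continuous[OF metric_Ck[OF g k, of 0]])
  have "continuous_on (im_ch X) (\<lambda>z. finner g X (param X z) (cdiff u X (param X z)) (cdiff v X (param X z)))"
    unfolding finner_def
  proof (intro continuous_on_divide continuous_on_add continuous_on_diff continuous_on_mult gc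
      cdiff_continuous[OF u k] cdiff_continuous[OF v k] Ck_on_continuous[OF gram_Ck[OF g k, of 0]] ballI)
    show "gram_det g X (param X z) \<noteq> 0" if "z \<in> im_ch X" for z
      using metric_pos(2)[OF g ka[OF that]] by simp
  qed
  thus "continuous_on (im_ch X) (\<lambda>z. gradp g u v (param X z))"
    by (rule continuous_on_cong[THEN iffD1, rotated -1]) (simp_all add: gradp_chart[OF g u v ka])
qed

lemma dirichlet_energy_C1:
  assumes g: "riemannian_metric A g" and u: "u \<in> C1"
  shows "dirichlet_energy A g u = (LINT p|area g. gradp g u u p)"
    and "integrable (area g) (form_norm_sq A g (weak_differential A u))"
proof -
  note w = weak_differential_weak[OF cdiff_weak[OF u]]
  have eq: "form_norm_sq A g (cdiff u) = gradp g u u"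
    by (auto simp: form_norm_sq_ch gradp_def)
  have ae: "AE p in area g. form_norm_sq A g (weak_differential A u) p = gradp g u u p"
    using form_norm_AE_unique[OF g w cdiff_weak[OF u]] unfolding eq .
  have m: "form_norm_sq A g (weak_differential A u) \<in> borel_measurable (area g)"
    using form_norm_measurable[OF g w] measurable_cong_sets[OF sets_area[OF g] refl] by blast
  have m': "gradp g u u \<in> borel_measurable (area g)"
    using borel_measurable_continuous_onI[OF gradp_continuous[OF g u u]] measurable_cong_sets[OF sets_area[OF g] refl] by blast
  show "dirichlet_energy A g u = (LINT p|area g. gradp g u u p)"
    unfolding dirichlet_energy_def area_measure_area[OF g] by (rule integral_cong_AE[OF m m' ae])
  have "integrable (area g) (gradp g u u)"
  proof -
    have "finite_measure (area g)"
    proof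
      have "space (area g) = UNIV" using sets_eq_imp_space_eq[OF sets_area[OF g]] by simp
      thus "emeasure (area g) (space (area g)) \<noteq> \<infinity>" using area_finite[OF g] by simp
    qed
    moreover have "bounded (gradp g u u ` UNIV)"
      using gradp_continuous[OF g u u] compact_surface compact_continuous_image compact_imp_bounded by blast
    then obtain B where "\<And>p. norm (gradp g u u p) \<le> B" by (auto simp: bounded_iff)
    ultimately show ?thesis using finite_measure.integrable_const_bound[of "area g" "gradp g u u" B] m' by simp
  qed
  thus "integrable (area g) (form_norm_sq A g (weak_differential A u))"
    using integrable_cong_AE[OF m m' ae] by simp
qed

lemma C1_const: "(\<lambda>_. a) \<in> C1"
  unfolding C1_def o_def by (auto intro: Ck_on_const)

lemma im_open: "X \<in> smooth_charts A \<Longrightarrow> open (im_ch X)"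
  by (rule chart_open(2)[OF is_chart])

lemma C1_add: "u \<in> C1 \<Longrightarrow> v \<in> C1 \<Longrightarrow> (\<lambda>p. u p + v p) \<in> C1"
  unfolding C1_def o_def using Ck_on_add[OF im_open] by blast

lemma C1_mult: "u \<in> C1 \<Longrightarrow> v \<in> C1 \<Longrightarrow> (\<lambda>p. u p * v p) \<in> C1"
  unfolding C1_def o_def using Ck_on_mult[OF im_open] by blast

lemma C1_inverse: "u \<in> C1 \<Longrightarrow> (\<And>p. u p \<noteq> 0) \<Longrightarrow> (\<lambda>p. inverse (u p)) \<in> C1"
  unfolding C1_def o_def using Ck_on_inverse[OF im_open] by blast

lemma coord_in: "p \<in> dom_ch X \<Longrightarrow> coord X p \<in> im_ch X"
  by (rule imageI)

lemma cdiff_deriv: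
  assumes "u \<in> C1" "X \<in> charts_at A p"
  shows "((\<lambda>z. u (param X z)) has_derivative cdiff u X p) (at (coord X p))"
  using differentiable_has_derivative[OF C1_differentiable[OF assms(1) charts_atD(1)[OF assms(2)] coord_in[OF charts_atD(2)[OF assms(2)]]]]
  unfolding cdiff_def[abs_def] by (simp add: o_def)

lemma cdiff_eqI: "((\<lambda>z. u (param X z)) has_derivative f) (at (coord X p)) \<Longrightarrow> cdiff u X p v = f v"
  unfolding cdiff_def o_def by (simp add: frechet_derivative_eqI)

lemma cdiff_const: "cdiff (\<lambda>_. a) X p v = 0"
  by (rule cdiff_eqI) simp

lemma cdiff_add: "u \<in> C1 \<Longrightarrow> v \<in> C1 \<Longrightarrow> X \<in> charts_at A p \<Longrightarrow> cdiff (\<lambda>p. u p + v p) X p x = cdiff u X p x + cdiff v X p x"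
  by (rule cdiff_eqI, rule has_derivative_add) (rule cdiff_deriv; assumption)+

lemma cdiff_mult:
  assumes "u \<in> C1" "v \<in> C1" "X \<in> charts_at A p"
  shows "cdiff (\<lambda>p. u p * v p) X p x = u p * cdiff v X p x + cdiff u X p x * v p"
proof -
  have "param X (coord X p) = p"
    by (rule chart_param_coord[OF is_chart[OF charts_atD(1)[OF assms(3)]] charts_atD(2)[OF assms(3)]])
  with has_derivative_mult[OF cdiff_deriv[OF assms(1,3)] cdiff_deriv[OF assms(2,3)]]
  show ?thesis by (intro cdiff_eqI) simp
qed

definition G1 :: "'a tensor2 \<Rightarrow> ('a \<Rightarrow> real) \<Rightarrow> 'a \<Rightarrow> real" where
  "G1 g u p = cdiff u (ch p) p (frame1 g (ch p) p)"

definition G2 :: "'a tensor2 \<Rightarrow> ('a \<Rightarrow> real) \<Rightarrow> 'a \<Rightarrow> real" where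
  "G2 g u p = cdiff u (ch p) p (frame2 g (ch p) p)"

lemma gradp_frame:
  assumes g: "riemannian_metric A g" and u: "u \<in> C1" and v: "v \<in> C1"
  shows "gradp g u v p = G1 g u p * G1 g v p + G2 g u p * G2 g v p"
  unfolding gradp_def G1_def G2_def
  by (rule finner_frame[OF g ch cdiff_linear[OF u ch] cdiff_linear[OF v ch]])

lemma gradient_structure_surface:
  assumes g: "riemannian_metric A g"
  shows "gradient_structure (area g) C1 (G1 g) (G2 g)"
proof -
  have sp: "space (area g) = UNIV" using sets_eq_imp_space_eq[OF sets_area[OF g]] by simp
  interpret finite_measure "area g"
    by (rule finite_measureI) (use area_finite[OF g] sp in simp)
  show ?thesis
  proof
    show "compact (UNIV :: 'a set)" by (rule compact_surface)
    show "sets (area g) = sets borel" by (rule sets_area[OF g])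
    show "emeasure (area g) U \<noteq> 0" if "open U" "U \<noteq> {}" for U using area_open_pos[OF g that] .
    show "continuous_on UNIV u" if "u \<in> C1" for u using C1_continuous[OF that] .
    show "(\<lambda>_. a) \<in> C1" for a by (rule C1_const)
    show "(\<lambda>p. u p + v p) \<in> C1" "(\<lambda>p. u p * v p) \<in> C1" if "u \<in> C1" "v \<in> C1" for u v
      using that by (rule C1_add, rule C1_mult)
    show "(\<lambda>p. inverse (u p)) \<in> C1" if "u \<in> C1" "\<And>p. u p \<noteq> 0" for u using that by (rule C1_inverse)
    show "G1 g (\<lambda>_. a) p = 0" "G2 g (\<lambda>_. a) p = 0" for a p by (simp_all add: G1_def G2_def cdiff_const)
    show "G1 g (\<lambda>p. u p + v p) p = G1 g u p + G1 g v p" "G2 g (\<lambda>p. u p + v p) p = G2 g u p + G2 g v p"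
      if "u \<in> C1" "v \<in> C1" for u v p unfolding G1_def G2_def by (intro cdiff_add that ch)+
    show "G1 g (\<lambda>p. u p * v p) p = u p * G1 g v p + G1 g u p * v p" "G2 g (\<lambda>p. u p * v p) p = u p * G2 g v p + G2 g u p * v p"
      if "u \<in> C1" "v \<in> C1" for u v p unfolding G1_def G2_def by (intro cdiff_mult that ch)+
    show "continuous_on UNIV (\<lambda>p. G1 g u p * G1 g v p + G2 g u p * G2 g v p)" if "u \<in> C1" "v \<in> C1" for u v
      using gradp_continuous[OF g that] unfolding gradp_frame[OF g that, abs_def] .
  qed
qed

text \<open>Scaling by \<open>r\<close> multiplies the Gram determinant by \<open>r^2\<close> and
  its root by \<open>r\<close>. Zeros of \<open>r\<close> are allowed, as they occur at branch
  points.\<close>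

lemma is_area_density:
  assumes g: "riemannian_metric A g" and r: "r \<in> borel_measurable borel" "\<And>p. 0 \<le> r p"
    and h: "\<And>X p v w. h X p v w = r p * g X p v w"
  shows "area_measure A h = density (area g) (\<lambda>p. ennreal (r p))"
proof (rule area_measure_eq)
  have d: "density_of h X z = r (param X z) * density_of g X z" for X z
  proof -
    have "gram_det h X (param X z) = (r (param X z))\<^sup>2 * gram_det g X (param X z)"
      by (simp add: gram_det_def h power2_eq_square algebra_simps)
    thus ?thesis using r(2) by (simp add: density_of_def real_sqrt_mult)
  qed
  show "is_area A h (density (area g) (\<lambda>p. ennreal (r p)))"
    unfolding is_area_def
  proof (intro conjI ballI impI)
    show "sets (density (area g) (\<lambda>p. ennreal (r p))) = sets borel" by (simp add: sets_area[OF g])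
    fix X B assume k: "X \<in> smooth_charts A" and B: "B \<in> sets borel" "B \<subseteq> dom_ch X"
    have "(\<lambda>p. ennreal (r p)) \<in> borel_measurable (area g)"
      using r(1) measurable_cong_sets[OF sets_area[OF g] refl] by (intro measurable_compose[OF _ measurable_ennreal]) blast
    hence "emeasure (density (area g) (\<lambda>p. ennreal (r p))) B = (\<integral>\<^sup>+p\<in>B. ennreal (r p) \<partial>area g)"
      using B(1) sets_area[OF g] by (intro emeasure_density) auto
    also have "\<dots> = (\<integral>\<^sup>+z\<in>coord X ` B. ennreal (density_of g X z) * ennreal (r (param X z)) \<partial>lborel)"
      using r(1) by (intro nn_integral_area[OF g k B] measurable_compose[OF _ measurable_ennreal])
    also have "\<dots> = (\<integral>\<^sup>+z\<in>coord X ` B. ennreal (density_of h X z) \<partial>lborel)"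
    proof (rule nn_integral_cong)
      fix z
      show "ennreal (density_of g X z) * ennreal (r (param X z)) * indicator (coord X ` B) z
        = ennreal (density_of h X z) * indicator (coord X ` B) z"
        unfolding d ennreal_mult'[OF r(2)] by (simp only: mult_ac)
    qed
    finally show "emeasure (density (area g) (\<lambda>p. ennreal (r p))) B = (\<integral>\<^sup>+z\<in>coord X ` B. ennreal (density_of h X z) \<partial>lborel)" .
  qed
qed

section \<open>The first eigenvalue of a conformal metric over a smooth background\<close>

context
  fixes gr g0 g :: "'a tensor2" and r :: "'a \<Rightarrow> real"
  assumes gr: "gr \<in> c" and g0: "g0 \<in> c" and rC: "r \<in> C1" and r0: "\<And>p. 0 \<le> r p"
    and gr_g: "\<And>X p v w. g X p v w = r p * gr X p v w"
begin

lemmas mr = class_metric[OF gr] and m0 = class_metric[OF g0]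

lemma areaM: "borel_measurable (area gr) = borel_measurable borel"
  by (rule measurable_cong_sets[OF sets_area[OF mr] refl])

lemma area_g: "area_measure A g = density (area gr) (\<lambda>p. ennreal (r p))"
  by (rule is_area_density[OF mr borel_measurable_continuous_onI[OF C1_continuous[OF rC]] r0 gr_g])

lemma integral_area_g: "f \<in> borel_measurable borel \<Longrightarrow> (LINT p|area_measure A g. f p) = (LINT p|area gr. f p * r p)"
  unfolding area_g using C1_continuous[OF rC] r0
  by (subst integral_density) (auto simp: areaM mult.commute intro: borel_measurable_continuous_onI)

lemma integrable_area_g: "f \<in> borel_measurable borel \<Longrightarrow> integrable (area_measure A g) f \<longleftrightarrow> integrable (area gr) (\<lambda>p. f p * r p)"
  unfolding area_g using C1_continuous[OF rC] r0
  by (subst integrable_density) (auto simp: areaM mult.commute intro: borel_measurable_continuous_onI)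

lemma sets_area_g: "sets (area_measure A g) = sets borel"
  unfolding area_g by (simp add: sets_area[OF mr])

interpretation gs: gradient_structure "area gr" C1 "G1 gr" "G2 gr"
  by (rule gradient_structure_surface[OF mr])

lemma grad_inner_gradp: "u \<in> C1 \<Longrightarrow> v \<in> C1 \<Longrightarrow> gs.grad_inner u v = gradp gr u v"
  by (auto simp: gs.grad_inner_def gradp_frame[OF mr])

text \<open>Conformal invariance in dimension two: passing from \<open>gr\<close> to
  \<open>g0 = q gr\<close> multiplies the area by \<open>q\<close> and divides the squared gradient
  by \<open>q\<close>.\<close>

lemma dirichlet_energy_eq:
  assumes u: "u \<in> C1"
  shows "dirichlet_energy A g0 u = gs.energy u u"
proof -
  obtain q where q: "\<And>p. q p > 0" "\<And>X p v w. g0 X p v w = q p * gr X p v w"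
    using class_conformal[OF gr g0] by blast
  have qc: "continuous_on UNIV q"
  proof (rule surface_continuousI)
    fix X assume k: "X \<in> smooth_charts A"
    have nz: "gr X (param X z) 1 1 \<noteq> 0" if "z \<in> im_ch X" for z
      using metric_pos(1)[OF mr charts_atI[OF k chart_param_dom[OF that]]] by simp
    have "continuous_on (im_ch X) (\<lambda>z. g0 X (param X z) 1 1 / gr X (param X z) 1 1)"
      using nz by (intro continuous_on_divide Ck_on_continuous[OF metric_Ck[OF m0 k, of 0]]
          Ck_on_continuous[OF metric_Ck[OF mr k, of 0]]) blast
    thus "continuous_on (im_ch X) (\<lambda>z. q (param X z))"
      by (rule continuous_on_cong[THEN iffD1, rotated -1]) (simp_all add: q(2) nz)
  qed
  note qm = borel_measurable_continuous_onI[OF qc]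
  have a0: "area g0 = density (area gr) (\<lambda>p. ennreal (q p))"
    unfolding area_measure_area[OF m0, symmetric]
    by (rule is_area_density[OF mr qm less_imp_le[OF q(1)] q(2)])
  have gp: "q p * gradp g0 u u p = gradp gr u u p" for p
  proof -
    have gd: "gram_det g0 (ch p) p = (q p)\<^sup>2 * gram_det gr (ch p) p"
      by (simp add: gram_det_def q(2) power2_eq_square algebra_simps)
    have num: "g0 (ch p) p \<i> \<i> * x - g0 (ch p) p 1 \<i> * y + g0 (ch p) p 1 1 * z
      = q p * (gr (ch p) p \<i> \<i> * x - gr (ch p) p 1 \<i> * y + gr (ch p) p 1 1 * z)" for x y z
      by (simp add: q(2) algebra_simps)
    show ?thesis unfolding gradp_def finner_def num gd using q(1)[of p] by (simp add: power2_eq_square)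
  qed
  have "dirichlet_energy A g0 u = (LINT p|area g0. gradp g0 u u p)" by (rule dirichlet_energy_C1(1)[OF m0 u])
  also have "\<dots> = (LINT p|area gr. q p *\<^sub>R gradp g0 u u p)"
    unfolding a0 using q(1) qm borel_measurable_continuous_onI[OF gradp_continuous[OF m0 u u]]
    by (intro integral_density) (auto simp: areaM intro: less_imp_le)
  also have "\<dots> = gs.energy u u" unfolding gs.energy_def grad_inner_gradp[OF u u] by (simp add: gp)
  finally show ?thesis .
qed

lemma C1_measurable: "u \<in> C1 \<Longrightarrow> u \<in> borel_measurable borel"
  by (rule borel_measurable_continuous_onI[OF C1_continuous])

lemma C1_finite_energy:
  assumes u: "u \<in> C1"
  shows "u \<in> finite_energy_functions A g0 g"
proof -
  have "(\<lambda>p. (u p)\<^sup>2) \<in> borel_measurable borel" by (rule C1_measurable[OF gs.C_power2[OF u]])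
  hence "integrable (area_measure A g) (\<lambda>p. (u p)\<^sup>2)"
    using integrable_area_g gs.C_integrable[OF gs.C_mult[OF gs.C_power2[OF u] rC]] by simp
  thus ?thesis
    unfolding finite_energy_functions_def using C1_measurable[OF u] cdiff_weak[OF u] dirichlet_energy_C1(2)[OF m0 u]
    by (auto simp: area_measure_area[OF m0])
qed

lemma weak_diff:
  assumes w: "is_weak_differential A u \<omega>" and w': "is_weak_differential A v \<omega>'"
  shows "is_weak_differential A (\<lambda>p. u p - v p) (\<lambda>X p x. \<omega> X p x - \<omega>' X p x)"
proof -
  have o: "one_form A \<omega>" "one_form A \<omega>'" using w w' by (auto simp: is_weak_differential_def)
  have od: "one_form A (\<lambda>X p x. \<omega> X p x - \<omega>' X p x)"
    unfolding one_form_def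
  proof (intro conjI allI ballI)
    fix p X assume k: "X \<in> charts_at A p"
    show "linear (\<lambda>x. \<omega> X p x - \<omega>' X p x)"
    proof (rule linear_compose_sub)
      show "linear (\<omega> X p)" "linear (\<omega>' X p)" using o k unfolding one_form_def by blast+
    qed
    fix X' x assume k': "X' \<in> charts_at A p"
    have "\<omega> X p x = \<omega> X' p (tder X X' p x)" "\<omega>' X p x = \<omega>' X' p (tder X X' p x)"
      using o k k' unfolding one_form_def by blast+
    thus "\<omega> X p x - \<omega>' X p x = \<omega> X' p (tder X X' p x) - \<omega>' X' p (tder X X' p x)" by simp
  qed
  show ?thesis
    unfolding is_weak_differential_def
  proof (intro conjI od ballI allI impI)
    fix X K x assume k: "X \<in> smooth_charts A" and K: "compact K \<and> K \<subseteq> im_ch X"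
    have i: "set_integrable lborel K (\<lambda>z. u (param X z))" "set_integrable lborel K (\<lambda>z. v (param X z))"
      "set_integrable lborel K (\<lambda>z. \<omega> X (param X z) x)" "set_integrable lborel K (\<lambda>z. \<omega>' X (param X z) x)"
      using w w' k K unfolding is_weak_differential_def by blast+
    show "set_integrable lborel K (\<lambda>z. u (param X z) - v (param X z))"
      "set_integrable lborel K (\<lambda>z. \<omega> X (param X z) x - \<omega>' X (param X z) x)"
      using i by (auto intro: set_integral_diff)
    fix \<eta> assume e: "smooth_on UNIV \<eta> \<and> (\<forall>z. z \<notin> K \<longrightarrow> \<eta> z = (0::real))"
    have bb: "integrable lborel (\<lambda>z. f z * h z)"
      if f: "set_integrable lborel K f" and h: "continuous_on UNIV h" "\<And>z. z \<notin> K \<Longrightarrow> h z = 0" for f h :: "complex \<Rightarrow> real"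
    proof -
      have "bounded (h ` K)" using h(1) K by (meson compact_continuous_image compact_imp_bounded continuous_on_subset subset_UNIV)
      then obtain B where B: "\<And>z. z \<in> K \<Longrightarrow> \<bar>h z\<bar> \<le> B" by (auto simp: bounded_iff)
      define M where "M = max B 1"
      have M: "M > 0" "\<bar>h z\<bar> \<le> M" for z
        using B[of z] h(2)[of z] by (cases "z \<in> K"; simp add: M_def)+
      have "integrable lborel (\<lambda>z. f z * (h z / M))"
      proof (rule set_integrable_times_bounded[OF f])
        show "(\<lambda>z. h z / M) \<in> borel_measurable borel" using borel_measurable_continuous_onI[OF h(1)] by simp
        show "\<bar>h z / M\<bar> \<le> 1" for z using M by (simp add: abs_divide)
        show "z \<notin> K \<Longrightarrow> h z / M = 0" for z using h(2) by simp
      qed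
      hence "integrable lborel (\<lambda>z. M * (f z * (h z / M)))" by (rule Bochner_Integration.integrable_mult_right)
      moreover have "(\<lambda>z. M * (f z * (h z / M))) = (\<lambda>z. f z * h z)" using M(1) by (auto simp: fun_eq_iff)
      ultimately show ?thesis by simp
    qed
    have C1e: "Ck_on 1 UNIV \<eta>" using e by (simp add: smooth_on_def)
    have ec: "continuous_on UNIV \<eta>" by (rule Ck_on_continuous[OF C1e])
    have dc: "continuous_on UNIV (\<lambda>z. pderiv_at \<eta> z x)" using C1e by simp
    have dz: "pderiv_at \<eta> z x = 0" if "z \<notin> K" for z
    proof -
      have "frechet_derivative \<eta> (at z) = frechet_derivative (\<lambda>_. 0) (at z)"
        using e K that by (intro frechet_derivative_cong_open[of "- K"]) (auto simp: compact_imp_closed open_Compl)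
      thus ?thesis by simp
    qed
    have ez: "\<eta> z = 0" if "z \<notin> K" for z using e that by blast
    have "(LINT z|lborel. u (param X z) * pderiv_at \<eta> z x) = - (LINT z|lborel. \<omega> X (param X z) x * \<eta> z)"
      "(LINT z|lborel. v (param X z) * pderiv_at \<eta> z x) = - (LINT z|lborel. \<omega>' X (param X z) x * \<eta> z)"
      using w w' k K e unfolding is_weak_differential_def by blast+
    thus "(LINT z|lborel. (u (param X z) - v (param X z)) * pderiv_at \<eta> z x)
      = - (LINT z|lborel. (\<omega> X (param X z) x - \<omega>' X (param X z) x) * \<eta> z)"
      using bb[OF i(1) dc dz] bb[OF i(2) dc dz] bb[OF i(3) ec ez] bb[OF i(4) ec ez]
      by (simp add: left_diff_distrib)
  qed
qed

text \<open>The pointwise inequality \<open>finner_split\<close> is integrated; the form chosen for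
  the difference agrees in norm almost everywhere with the difference of the chosen forms.\<close>

lemma energy_split:
  assumes u: "u \<in> finite_energy_functions A g0 g" and v: "v \<in> finite_energy_functions A g0 g" and d: "0 < d"
  shows "dirichlet_energy A g0 u \<le> (1 + d) * dirichlet_energy A g0 v + (1 + 1 / d) * dirichlet_energy A g0 (\<lambda>p. u p - v p)"
proof -
  let ?N = "form_norm_sq A g0"
  let ?wu = "weak_differential A u" and ?wv = "weak_differential A v" and ?wd = "weak_differential A (\<lambda>p. u p - v p)"
  define \<omega> where "\<omega> = (\<lambda>X p x. ?wu X p x - ?wv X p x)"
  have w: "is_weak_differential A u ?wu" "is_weak_differential A v ?wv"
    using u v weak_differential_weak unfolding finite_energy_functions_def by blast+
  have wd: "is_weak_differential A (\<lambda>p. u p - v p) \<omega>" unfolding \<omega>_def by (rule weak_diff[OF w])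
  note wd' = weak_differential_weak[OF wd]
  have i: "integrable (area g0) (?N ?wu)" "integrable (area g0) (?N ?wv)"
    using u v unfolding finite_energy_functions_def area_measure_area[OF m0] by blast+
  have M: "borel_measurable (area g0) = borel_measurable borel" by (rule measurable_cong_sets[OF sets_area[OF m0] refl])
  have mm: "?N ?wd \<in> borel_measurable (area g0)" "?N \<omega> \<in> borel_measurable (area g0)"
    using form_norm_measurable[OF m0 wd'] form_norm_measurable[OF m0 wd] unfolding M by blast+
  have ae: "AE p in area g0. ?N ?wd p = ?N \<omega> p" by (rule form_norm_AE_unique[OF m0 wd' wd])
  have lin: "linear (?wu (ch p) p)" "linear (?wv (ch p) p)" for p
  proof -
    have "one_form A ?wu" "one_form A ?wv" using w by (simp_all add: is_weak_differential_def)
    thus "linear (?wu (ch p) p)" "linear (?wv (ch p) p)" using ch[of p] unfolding one_form_def by blast+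
  qed
  have o: "one_form A \<omega>" using wd by (simp add: is_weak_differential_def)
  have pt: "?N ?wu p \<le> (1 + d) * ?N ?wv p + (1 + 1 / d) * ?N \<omega> p" for p
    unfolding form_norm_sq_ch \<omega>_def by (rule finner_split[OF m0 ch lin d])
  \<comment> \<open>Integrability of the difference comes from the same splitting with
    \<open>d = 1\<close>, applied to the difference and \<open>?wu\<close>.\<close>
  have pt2: "?N \<omega> p \<le> 2 * ?N ?wu p + 2 * ?N ?wv p" for p
  proof -
    have ld: "linear (\<lambda>x. ?wu (ch p) p x - ?wv (ch p) p x)" using lin by (rule linear_compose_sub)
    have "?N \<omega> p \<le> (1 + 1) * ?N ?wu p + (1 + 1 / 1) * finner g0 (ch p) p
       (\<lambda>x. (?wu (ch p) p x - ?wv (ch p) p x) - ?wu (ch p) p x) (\<lambda>x. (?wu (ch p) p x - ?wv (ch p) p x) - ?wu (ch p) p x)"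
      unfolding form_norm_sq_ch \<omega>_def by (rule finner_split[OF m0 ch ld lin(1)]) simp
    also have "finner g0 (ch p) p (\<lambda>x. (?wu (ch p) p x - ?wv (ch p) p x) - ?wu (ch p) p x) (\<lambda>x. (?wu (ch p) p x - ?wv (ch p) p x) - ?wu (ch p) p x)
       = ?N ?wv p"
      unfolding form_norm_sq_ch finner_def by simp
    finally show ?thesis by simp
  qed
  have i\<omega>: "integrable (area g0) (?N \<omega>)"
  proof (rule Bochner_Integration.integrable_bound)
    show "integrable (area g0) (\<lambda>p. 2 * ?N ?wu p + 2 * ?N ?wv p)" using i by simp
    show "AE p in area g0. norm (?N \<omega> p) \<le> norm (2 * ?N ?wu p + 2 * ?N ?wv p)"
      using pt2 form_norm_nonneg[OF m0 o] by (auto intro: order_trans[OF _ abs_ge_self])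
  qed (rule mm)
  have "dirichlet_energy A g0 (\<lambda>p. u p - v p) = (LINT p|area g0. ?N \<omega> p)"
    unfolding dirichlet_energy_def area_measure_area[OF m0] by (rule integral_cong_AE[OF mm ae])
  moreover have "(LINT p|area g0. ?N ?wu p) \<le> (LINT p|area g0. (1 + d) * ?N ?wv p + (1 + 1 / d) * ?N \<omega> p)"
    using i i\<omega> pt by (intro integral_mono) auto
  ultimately show ?thesis
    unfolding dirichlet_energy_def area_measure_area[OF m0] using i i\<omega> by simp
qed

lemma L2_split:
  assumes u: "u \<in> finite_energy_functions A g0 g" and v: "v \<in> finite_energy_functions A g0 g" and d: "0 < d"
  shows "(LINT p|area_measure A g. (u p)\<^sup>2) \<le> (1 + d) * (LINT p|area_measure A g. (v p)\<^sup>2)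
    + (1 + 1 / d) * (LINT p|area_measure A g. (u p - v p)\<^sup>2)"
proof -
  let ?m = "area_measure A g"
  have i: "integrable ?m (\<lambda>p. (u p)\<^sup>2)" "integrable ?m (\<lambda>p. (v p)\<^sup>2)"
    and b: "u \<in> borel_measurable borel" "v \<in> borel_measurable borel"
    using u v unfolding finite_energy_functions_def by blast+
  have iw: "integrable ?m (\<lambda>p. (u p - v p)\<^sup>2)"
  proof (rule Bochner_Integration.integrable_bound)
    show "integrable ?m (\<lambda>p. 2 * (u p)\<^sup>2 + 2 * (v p)\<^sup>2)" using i by simp
    have "(\<lambda>p. (u p - v p)\<^sup>2) \<in> borel_measurable borel" using b by measurable
    thus "(\<lambda>p. (u p - v p)\<^sup>2) \<in> borel_measurable ?m"
      using measurable_cong_sets[OF sets_area_g refl] by blast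
    have "(u p - v p)\<^sup>2 \<le> 2 * (u p)\<^sup>2 + 2 * (v p)\<^sup>2" for p
      using square_split[of 1 "u p - v p" "u p"] by simp
    thus "AE p in ?m. norm ((u p - v p)\<^sup>2) \<le> norm (2 * (u p)\<^sup>2 + 2 * (v p)\<^sup>2)" by simp
  qed
  have "(LINT p|?m. (u p)\<^sup>2) \<le> (LINT p|?m. (1 + d) * (v p)\<^sup>2 + (1 + 1 / d) * (u p - v p)\<^sup>2)"
    using i iw square_split[OF d] by (intro integral_mono) auto
  thus ?thesis using i iw by simp
qed

lemma dirichlet_nonneg:
  assumes "\<exists>\<omega>. is_weak_differential A u \<omega>"
  shows "0 \<le> dirichlet_energy A g0 u"
proof -
  have "one_form A (weak_differential A u)"
    using assms weak_differential_weak unfolding is_weak_differential_def by blast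
  thus ?thesis unfolding dirichlet_energy_def using form_norm_nonneg[OF m0] by simp
qed

text \<open>The limits in \<open>rayleigh_quotient\<close> carry information only along convergent
  sequences, so even the sign of the quotient depends on this.\<close>

lemma H1_convergent:
  assumes u: "u \<in> H1 A g0 g"
  shows "convergent (\<lambda>k. dirichlet_energy A g0 (u k))" "convergent (\<lambda>k. LINT p|area_measure A g. (u k p)\<^sup>2)"
proof -
  have fe: "u k \<in> finite_energy_functions A g0 g" for k using u by (simp add: H1_def)
  have wk: "\<exists>\<omega>. is_weak_differential A (u k) \<omega>" for k using fe unfolding finite_energy_functions_def by blast
  have wd: "\<exists>\<omega>. is_weak_differential A (\<lambda>p. u m p - u n p) \<omega>" for m n
    using wk weak_diff by blast
  have N: "\<exists>K. \<forall>m\<ge>K. \<forall>n\<ge>K. h1_norm_sq A g0 g (\<lambda>p. u m p - u n p) < e" if "0 < e" for e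
    using u that by (simp add: H1_def)
  have a: "0 \<le> (LINT p|area_measure A g. (u m p - u n p)\<^sup>2)" "0 \<le> dirichlet_energy A g0 (\<lambda>p. u m p - u n p)" for m n
    using dirichlet_nonneg[OF wd] by auto
  show "convergent (\<lambda>k. dirichlet_energy A g0 (u k))"
  proof (rule convergent_of_square_split)
    show "0 \<le> dirichlet_energy A g0 (u k)" for k by (rule dirichlet_nonneg[OF wk])
    show "dirichlet_energy A g0 (u m) \<le> (1 + d) * dirichlet_energy A g0 (u n) + (1 + 1 / d) * dirichlet_energy A g0 (\<lambda>p. u m p - u n p)"
      if "0 < d" for m n d using energy_split[OF fe fe that] .
    show "\<exists>K. \<forall>m\<ge>K. \<forall>n\<ge>K. dirichlet_energy A g0 (\<lambda>p. u m p - u n p) < e" if e: "0 < e" for e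
    proof -
      obtain K where K: "\<And>m n. m \<ge> K \<Longrightarrow> n \<ge> K \<Longrightarrow> h1_norm_sq A g0 g (\<lambda>p. u m p - u n p) < e" using N[OF e] by blast
      have "dirichlet_energy A g0 (\<lambda>p. u m p - u n p) < e" if "m \<ge> K" "n \<ge> K" for m n
        using K[OF that] a(1)[of m n] unfolding h1_norm_sq_def by linarith
      thus ?thesis by blast
    qed
  qed
  show "convergent (\<lambda>k. LINT p|area_measure A g. (u k p)\<^sup>2)"
  proof (rule convergent_of_square_split)
    show "0 \<le> (LINT p|area_measure A g. (u k p)\<^sup>2)" for k by simp
    show "(LINT p|area_measure A g. (u m p)\<^sup>2) \<le> (1 + d) * (LINT p|area_measure A g. (u n p)\<^sup>2)
      + (1 + 1 / d) * (LINT p|area_measure A g. (u m p - u n p)\<^sup>2)" if "0 < d" for m n d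
      using L2_split[OF fe fe that] .
    show "\<exists>K. \<forall>m\<ge>K. \<forall>n\<ge>K. (LINT p|area_measure A g. (u m p - u n p)\<^sup>2) < e" if e: "0 < e" for e
    proof -
      obtain K where K: "\<And>m n. m \<ge> K \<Longrightarrow> n \<ge> K \<Longrightarrow> h1_norm_sq A g0 g (\<lambda>p. u m p - u n p) < e" using N[OF e] by blast
      have "(LINT p|area_measure A g. (u m p - u n p)\<^sup>2) < e" if "m \<ge> K" "n \<ge> K" for m n
        using K[OF that] a(2)[of m n] unfolding h1_norm_sq_def by linarith
      thus ?thesis by blast
    qed
  qed
qed

lemma rayleigh_nonneg:
  assumes "u \<in> lambda1_competitors A g0 g"
  shows "0 \<le> rayleigh_quotient A g0 g u"
proof -
  have u: "u \<in> H1 A g0 g" using assms by (simp add: lambda1_competitors_def)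
  hence fe: "u k \<in> finite_energy_functions A g0 g" for k by (simp add: H1_def)
  have wk: "\<exists>\<omega>. is_weak_differential A (u k) \<omega>" for k using fe unfolding finite_energy_functions_def by blast
  have "0 \<le> lim (\<lambda>k. dirichlet_energy A g0 (u k))"
    using H1_convergent(1)[OF u] dirichlet_nonneg[OF wk] by (intro LIMSEQ_le_const[OF convergent_LIMSEQ_iff[THEN iffD1]]) auto
  moreover have "0 \<le> lim (\<lambda>k. LINT p|area_measure A g. (u k p)\<^sup>2)"
    using H1_convergent(2)[OF u] by (intro LIMSEQ_le_const[OF convergent_LIMSEQ_iff[THEN iffD1]]) auto
  ultimately show ?thesis by (simp add: rayleigh_quotient_def)
qed

lemma C1_competitor:
  assumes w: "w \<in> C1" and mean: "(LINT p|area gr. w p * r p) = 0" and nz: "(LINT p|area gr. (w p)\<^sup>2 * r p) \<noteq> 0"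
  shows "(\<lambda>k. w) \<in> lambda1_competitors A g0 g"
    and "rayleigh_quotient A g0 g (\<lambda>k. w) = gs.energy w w / (LINT p|area gr. (w p)\<^sup>2 * r p)"
proof -
  let ?I = "LINT p|area gr. (w p)\<^sup>2 * r p"
  have pos: "?I > 0" using nz r0 by (simp add: less_le)
  have fe: "w \<in> finite_energy_functions A g0 g" by (rule C1_finite_energy[OF w])
  have I: "(LINT p|area_measure A g. (w p)\<^sup>2) = ?I"
    by (rule integral_area_g[OF C1_measurable[OF gs.C_power2[OF w]]])
  have m: "(LINT p|area_measure A g. w p) = 0"
    using integral_area_g[OF C1_measurable[OF w]] mean by simp
  have zero: "h1_norm_sq A g0 g (\<lambda>p. 0) = 0"
    using dirichlet_energy_eq[OF C1_const, of 0] by (simp add: h1_norm_sq_def gs.energy_const_right)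
  have "(\<lambda>k. w) \<in> H1 A g0 g" using fe zero by (simp add: H1_def)
  moreover have "h1_norm_sq A g0 g w \<noteq> 0"
    using pos I dirichlet_nonneg cdiff_weak[OF w] unfolding h1_norm_sq_def by (metis add_pos_nonneg less_irrefl)
  ultimately show "(\<lambda>k. w) \<in> lambda1_competitors A g0 g"
    using m by (simp add: lambda1_competitors_def)
  show "rayleigh_quotient A g0 g (\<lambda>k. w) = gs.energy w w / ?I"
    by (simp add: rayleigh_quotient_def dirichlet_energy_eq[OF w] I)
qed

text \<open>Rayleigh quotients are bounded below by 0, so their infimum is at most the quotient of
  each C^1 function.\<close>

lemma lambda1_poincare:
  assumes w: "w \<in> C1" and mean: "(LINT p|area gr. w p * r p) = 0"
  shows "lambda1 A g0 g * (LINT p|area gr. (w p)\<^sup>2 * r p) \<le> gs.energy w w"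
proof (cases "(LINT p|area gr. (w p)\<^sup>2 * r p) = 0")
  case True
  have "0 \<le> gs.energy w w" unfolding gs.energy_def gs.grad_inner_def by simp
  thus ?thesis using True by simp
next
  case False
  have pos: "(LINT p|area gr. (w p)\<^sup>2 * r p) > 0" using False r0 by (simp add: less_le)
  have "bdd_below (rayleigh_quotient A g0 g ` lambda1_competitors A g0 g)"
    by (rule bdd_belowI[of _ 0]) (auto intro: rayleigh_nonneg)
  hence "lambda1 A g0 g \<le> rayleigh_quotient A g0 g (\<lambda>k. w)"
    unfolding lambda1_def by (intro cInf_lower imageI C1_competitor(1)[OF w mean False])
  thus ?thesis using pos unfolding C1_competitor(2)[OF w mean False] by (simp add: pos_le_divide_eq)
qed

text \<open>A zero integral would make the continuous function \<open>u^2 r\<close> vanish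
  identically, while the zeros of \<open>r\<close> contain no nonempty open set.\<close>

lemma C1_mass_nonzero:
  assumes u: "u \<in> C1" and dense: "\<And>U. open U \<Longrightarrow> U \<noteq> {} \<Longrightarrow> \<exists>p\<in>U. r p \<noteq> 0" and nz: "\<not> (\<forall>p. u p = 0)"
  shows "(LINT p|area gr. (u p)\<^sup>2 * r p) \<noteq> 0"
proof
  assume z: "(LINT p|area gr. (u p)\<^sup>2 * r p) = 0"
  have zz: "(u p)\<^sup>2 * r p = 0" for p
    by (rule gs.integral_pos_zero[OF gs.C_cont[OF gs.C_mult[OF gs.C_power2[OF u] rC]] _ z]) (simp add: r0)
  have "open {p. u p \<noteq> 0}" using C1_continuous[OF u] open_Collect_neq[of u "\<lambda>_. 0"] continuous_on_const by blast
  then obtain p where "u p \<noteq> 0" "r p \<noteq> 0" using dense[of "{p. u p \<noteq> 0}"] nz by blast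
  thus False using zz[of p] by simp
qed

lemma eigenspaceI:
  assumes u: "u \<in> C1" and dense: "\<And>U. open U \<Longrightarrow> U \<noteq> {} \<Longrightarrow> \<exists>p\<in>U. r p \<noteq> 0"
    and mean: "(LINT p|area gr. u p * r p) = 0" and E: "gs.energy u u = lambda1 A g0 g * (LINT p|area gr. (u p)\<^sup>2 * r p)"
  shows "u \<in> lambda1_eigenspace A g0 g"
proof (cases "\<forall>p. u p = 0")
  case True
  thus ?thesis by (simp add: lambda1_eigenspace_def)
next
  case False
  have nz: "(LINT p|area gr. (u p)\<^sup>2 * r p) \<noteq> 0"
    by (rule C1_mass_nonzero[OF u _ False]) (rule dense)
  have "gs.energy u u / (LINT p|area gr. (u p)\<^sup>2 * r p) = lambda1 A g0 g * (LINT p|area gr. (u p)\<^sup>2 * r p) / (LINT p|area gr. (u p)\<^sup>2 * r p)"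
    by (rule arg_cong[OF E])
  hence "gs.energy u u / (LINT p|area gr. (u p)\<^sup>2 * r p) = lambda1 A g0 g" unfolding nonzero_mult_div_cancel_right[OF nz] .
  hence "rayleigh_quotient A g0 g (\<lambda>k. u) = lambda1 A g0 g" by (rule trans[OF C1_competitor(2)[OF u mean nz]])
  thus ?thesis using C1_competitor(1)[OF u mean nz] by (simp add: lambda1_eigenspace_def)
qed

lemma eigenspace_energy:
  assumes u: "u \<in> C1" and e: "u \<in> lambda1_eigenspace A g0 g" and dense: "\<And>U. open U \<Longrightarrow> U \<noteq> {} \<Longrightarrow> \<exists>p\<in>U. r p \<noteq> 0"
  shows "(LINT p|area gr. u p * r p) = 0 \<and> gs.energy u u = lambda1 A g0 g * (LINT p|area gr. (u p)\<^sup>2 * r p)"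
proof (cases "\<forall>p. u p = 0")
  case True
  hence "u = (\<lambda>_. 0)" by auto
  thus ?thesis using gs.energy_const_right[of u 0] by simp
next
  case False
  let ?I = "LINT p|area gr. (u p)\<^sup>2 * r p"
  have c: "(\<lambda>k. u) \<in> lambda1_competitors A g0 g" and ray: "rayleigh_quotient A g0 g (\<lambda>k. u) = lambda1 A g0 g"
    using e False by (auto simp: lambda1_eigenspace_def)
  have I: "(LINT p|area_measure A g. (u p)\<^sup>2) = ?I"
    by (rule integral_area_g[OF C1_measurable[OF gs.C_power2[OF u]]])
  have m: "(LINT p|area gr. u p * r p) = 0"
    using integral_area_g[OF C1_measurable[OF u]] c by (simp add: lambda1_competitors_def)
  have "?I \<noteq> 0" by (rule C1_mass_nonzero[OF u _ False]) (rule dense)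
  thus ?thesis using ray m by (simp add: rayleigh_quotient_def dirichlet_energy_eq[OF u] I field_simps)
qed

end

end

text \<open>For the symmetric matrix \<open>M\<close> with entries \<open>E\<close>,
  \<open>F\<close>, \<open>G\<close>, Cayley-Hamilton gives \<open>tr M * M - det M = M^2\<close>,
  so the two sides differ by the squared length of \<open>M (a, b)\<close>. For positive
  \<open>E + G\<close> the quadratic form is thus at least determinant over trace times
  \<open>a^2 + b^2\<close>.\<close>

lemma gram_lower_bound:
  fixes E F G a b :: real
  shows "(E * G - F\<^sup>2) * (a\<^sup>2 + b\<^sup>2) \<le> (E + G) * (E * a\<^sup>2 + 2 * F * a * b + G * b\<^sup>2)"
proof -
  have "(E + G) * (E * a\<^sup>2 + 2 * F * a * b + G * b\<^sup>2) - (E * G - F\<^sup>2) * (a\<^sup>2 + b\<^sup>2) = (E * a + F * b)\<^sup>2 + (F * a + G * b)\<^sup>2"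
    by (simp add: power2_eq_square algebra_simps)
  moreover have "0 \<le> (E * a + F * b)\<^sup>2 + (F * a + G * b)\<^sup>2" by simp
  ultimately show ?thesis by linarith
qed

section \<open>Branched minimal immersions over a smooth background metric\<close>

context conformal_surface
begin

lemma coord_deriv_cdiff: "coord_deriv \<Phi> X p v i = cdiff (\<lambda>p. \<Phi> p i) X p v"
  by (simp add: coord_deriv_def cdiff_def o_def)

lemma open_infinite:
  assumes "open U" "U \<noteq> {}"
  shows "infinite (U :: 'a set)"
proof
  assume fin: "finite U"
  obtain p where p: "p \<in> U" using assms(2) by blast
  note ck = is_chart[OF charts_atD(1)[OF ch[of p]]] and pd = charts_atD(2)[OF ch[of p]]
  let ?V = "coord (ch p) ` (dom_ch (ch p) \<inter> U)"
  have "open ?V" by (rule chart_image_open[OF ck assms(1)])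
  moreover have "finite ?V" using fin by simp
  moreover have "?V \<noteq> {}" using p pd by blast
  ultimately show False using finite_imp_not_open by blast
qed

lemma immersion_Ck:
  assumes "branched_minimal_immersion A c n \<Phi>" "i \<le> n" "X \<in> smooth_charts A"
  shows "Ck_on k (im_ch X) (\<lambda>z. \<Phi> (param X z) i)"
  using assms unfolding branched_minimal_immersion_def smooth_fun_def smooth_on_def by (simp add: o_def)

lemma immersion_C1:
  assumes "branched_minimal_immersion A c n \<Phi>" "i \<le> n"
  shows "(\<lambda>p. \<Phi> p i) \<in> C1"
  unfolding C1_def o_def using immersion_Ck[OF assms] by blast

lemma immersion_unit:
  assumes "branched_minimal_immersion A c n \<Phi>"
  shows "dot n (\<Phi> p) (\<Phi> p) = 1" "i > n \<Longrightarrow> \<Phi> p i = 0"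
  using assms unfolding branched_minimal_immersion_def nsphere dot_def by (auto simp: power2_eq_square)

text \<open>For a branched minimal immersion, conformality makes one direction in one chart
  sufficient; at branch points the value is 0.\<close>

definition conf_factor :: "'a tensor2 \<Rightarrow> nat \<Rightarrow> ('a \<Rightarrow> nat \<Rightarrow> real) \<Rightarrow> 'a \<Rightarrow> real" where
  "conf_factor gr n \<Phi> p = pullback_metric A n \<Phi> (ch p) p 1 1 / gr (ch p) p 1 1"

context
  fixes gr :: "'a tensor2" and n :: nat and \<Phi> :: "'a \<Rightarrow> nat \<Rightarrow> real"
  assumes gr: "gr \<in> c" and bmi: "branched_minimal_immersion A c n \<Phi>"
begin

lemma mgr: "riemannian_metric A gr"
  by (rule class_metric[OF gr])

abbreviation r where "r \<equiv> conf_factor gr n \<Phi>"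

lemma pullback_factor:
  shows "pullback_metric A n \<Phi> X p v w = r p * gr X p v w" and "0 \<le> r p"
    and "r p = 0 \<longleftrightarrow> branch_point A n \<Phi> p"
proof -
  have "(\<forall>X v w. pullback_metric A n \<Phi> X p v w = r p * gr X p v w) \<and> 0 \<le> r p \<and> (r p = 0 \<longleftrightarrow> branch_point A n \<Phi> p)"
  proof (cases "branch_point A n \<Phi> p")
    case True
    hence z: "pullback_metric A n \<Phi> X p v w = 0" for X v w
      by (simp add: pullback_metric_def branch_point_def)
    hence "r p = 0" by (simp add: conf_factor_def)
    thus ?thesis using z True by simp
  next
    case False
    then obtain q where q: "q > 0" "\<And>X v w. pullback_metric A n \<Phi> X p v w = q * gr X p v w"
      using bmi gr unfolding branched_minimal_immersion_def conformal_at_def by blast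
    have "r p = q" using metric_pos(1)[OF mgr ch, of p] by (simp add: conf_factor_def q(2))
    thus ?thesis using q False by simp
  qed
  thus "pullback_metric A n \<Phi> X p v w = r p * gr X p v w" and "0 \<le> r p"
    and "r p = 0 \<longleftrightarrow> branch_point A n \<Phi> p" by blast+
qed

lemma factor_chart:
  assumes k: "X \<in> charts_at A p"
  shows "dot n (\<lambda>i. cdiff (\<lambda>p. \<Phi> p i) X p v) (\<lambda>i. cdiff (\<lambda>p. \<Phi> p i) X p w) = r p * gr X p v w"
  using pullback_factor(1)[of X p v w] k by (simp add: pullback_metric_def coord_deriv_cdiff dot_def)

lemma factor_C1: "r \<in> C1"
  unfolding C1_def
proof (intro CollectI ballI)
  fix X assume k: "X \<in> smooth_charts A"
  have ka: "X \<in> charts_at A (param X z)" if "z \<in> im_ch X" for z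
    using k chart_param_dom[OF that] by (rule charts_atI)
  have nz: "gr X (param X z) 1 1 \<noteq> 0" if "z \<in> im_ch X" for z
    using metric_pos(1)[OF mgr ka[OF that]] by simp
  have d: "Ck_on 1 (im_ch X) (\<lambda>z. pderiv_at (\<lambda>z. \<Phi> (param X z) i) z 1)" if "i \<le> n" for i
    using immersion_Ck[OF bmi that k, of "Suc 1"] by (rule Ck_on_SucD(2))
  have "Ck_on 1 (im_ch X) (\<lambda>z. (\<Sum>i\<le>n. pderiv_at (\<lambda>z. \<Phi> (param X z) i) z 1 * pderiv_at (\<lambda>z. \<Phi> (param X z) i) z 1) / gr X (param X z) 1 1)"
    by (intro Ck_on_divide Ck_on_sum Ck_on_mult im_open k metric_Ck[OF mgr k] d nz) auto
  thus "Ck_on 1 (im_ch X) (r \<circ> param X)"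
  proof (rule Ck_on_cong[OF im_open[OF k], rotated])
    fix z assume z: "z \<in> im_ch X"
    have "r (param X z) * gr X (param X z) 1 1 = (\<Sum>i\<le>n. pderiv_at (\<lambda>z. \<Phi> (param X z) i) z 1 * pderiv_at (\<lambda>z. \<Phi> (param X z) i) z 1)"
      unfolding factor_chart[OF ka[OF z], symmetric] by (simp add: dot_def cdiff_param[OF z] o_def)
    thus "(\<Sum>i\<le>n. pderiv_at (\<lambda>z. \<Phi> (param X z) i) z 1 * pderiv_at (\<lambda>z. \<Phi> (param X z) i) z 1) / gr X (param X z) 1 1 = (r \<circ> param X) z"
      using nz[OF z] by (simp add: field_simps)
  qed
qed

lemma factor_zeros: "finite {p. r p = 0}"
  unfolding pullback_factor(3) using bmi by (simp add: branched_minimal_immersion_def)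

lemma factor_dense:
  assumes "open U" "U \<noteq> {}"
  shows "\<exists>p\<in>U. r p \<noteq> 0"
proof (rule ccontr)
  assume "\<not> ?thesis"
  hence "U \<subseteq> {p. r p = 0}" by blast
  thus False using open_infinite[OF assms] factor_zeros finite_subset by blast
qed

text \<open>Off the branch points the differential is bounded below by a multiple of the norm, which
  the first order error cannot compensate close to \<open>z\<close>.\<close>

lemma isolated_preimage:
  assumes k: "X \<in> smooth_charts A" and z: "z \<in> im_ch X" and nb: "r (param X z) \<noteq> 0"
  shows "\<exists>d>0. \<forall>w\<in>ball z d. w \<noteq> z \<longrightarrow> (\<exists>i\<le>n. \<Phi> (param X w) i \<noteq> \<Phi> (param X z) i)"
proof -
  let ?p = "param X z"
  have ka: "X \<in> charts_at A ?p" using k chart_param_dom[OF z] by (rule charts_atI)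
  define E F G where "E = gr X ?p 1 1" and "F = gr X ?p 1 \<i>" and "G = gr X ?p \<i> \<i>"
  have E: "E > 0" and D: "E * G - F\<^sup>2 > 0" using metric_pos[OF mgr ka] by (auto simp: E_def F_def G_def gram_det_def)
  have "0 < E * G" using D by (smt (verit) zero_le_power2)
  hence G: "G > 0" using E by (simp add: zero_less_mult_iff)
  have rp: "r ?p > 0" using nb pullback_factor(2)[of ?p] by simp
  define m where "m = r ?p * ((E * G - F\<^sup>2) / (E + G))"
  have m: "m > 0" using rp D E G by (simp add: m_def)
  have lower: "m * (norm h)\<^sup>2 \<le> (\<Sum>i\<le>n. (cdiff (\<lambda>p. \<Phi> p i) X ?p h)\<^sup>2)" for h
  proof -
    have b: "bilinear (gr X ?p)" "\<And>v w. gr X ?p v w = gr X ?p w v"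
      using mgr ka unfolding riemannian_metric_def sym_tensor_def by blast+
    have "(E * G - F\<^sup>2) * (norm h)\<^sup>2 \<le> (E + G) * gr X ?p h h"
    proof -
      have g: "gr X ?p h h = E * (Re h)\<^sup>2 + 2 * F * Re h * Im h + G * (Im h)\<^sup>2"
        unfolding bilinear_complex[OF b, of h h] E_def F_def G_def by (simp add: power2_eq_square)
      show ?thesis unfolding g cmod_power2 by (rule gram_lower_bound)
    qed
    hence "(E * G - F\<^sup>2) / (E + G) * (norm h)\<^sup>2 \<le> gr X ?p h h" using E G by (simp add: field_simps)
    hence "m * (norm h)\<^sup>2 \<le> r ?p * gr X ?p h h"
      unfolding m_def mult.assoc by (rule mult_left_mono) (use rp in simp)
    also have "\<dots> = (\<Sum>i\<le>n. (cdiff (\<lambda>p. \<Phi> p i) X ?p h)\<^sup>2)"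
      unfolding factor_chart[OF ka, symmetric] by (simp add: dot_def power2_eq_square)
    finally show ?thesis .
  qed
  \<comment> \<open>\<open>e\<close> is the error allowed in each coordinate: squared and summed
    over \<open>n + 1\<close> coordinates it amounts to half of the lower bound
    \<open>m\<close>.\<close>
  define e where "e = sqrt (m / (2 * (real n + 1)))"
  have e: "e > 0" "e\<^sup>2 * (real n + 1) = m / 2"
  proof -
    show "e > 0" using m by (simp add: e_def)
    have "e\<^sup>2 = m / (2 * (real n + 1))" using m unfolding e_def by (intro real_sqrt_pow2) simp
    moreover have "real n + 1 > 0" by simp
    ultimately show "e\<^sup>2 * (real n + 1) = m / 2" by (simp add: field_simps)
  qed
  have "\<exists>d>0. \<forall>w. norm (w - z) < d \<longrightarrow> \<bar>\<Phi> (param X w) i - \<Phi> ?p i - cdiff (\<lambda>p. \<Phi> p i) X ?p (w - z)\<bar> \<le> e * norm (w - z)" if "i \<le> n" for i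
    using cdiff_deriv[OF immersion_C1[OF bmi that] ka] e(1) unfolding has_derivative_at_alt chart_coord_param[OF z] by auto
  then obtain d where d: "\<And>i. i \<le> n \<Longrightarrow> d i > 0"
    "\<And>i w. i \<le> n \<Longrightarrow> norm (w - z) < d i \<Longrightarrow> \<bar>\<Phi> (param X w) i - \<Phi> ?p i - cdiff (\<lambda>p. \<Phi> p i) X ?p (w - z)\<bar> \<le> e * norm (w - z)"
    by metis
  define d0 where "d0 = Min (d ` {..n})"
  have d0: "d0 > 0" "\<And>i. i \<le> n \<Longrightarrow> d0 \<le> d i" using d(1) by (auto simp: d0_def)
  have "\<exists>i\<le>n. \<Phi> (param X w) i \<noteq> \<Phi> ?p i" if w: "w \<in> ball z d0" "w \<noteq> z" for w
  proof (rule ccontr)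
    assume "\<not> ?thesis"
    hence same: "\<Phi> (param X w) i = \<Phi> ?p i" if "i \<le> n" for i using that by blast
    have nw: "norm (w - z) < d0" using w(1) by (simp add: dist_norm norm_minus_commute)
    have "\<bar>cdiff (\<lambda>p. \<Phi> p i) X ?p (w - z)\<bar> \<le> e * norm (w - z)" if "i \<le> n" for i
      using d(2)[OF that, of w] d0(2)[OF that] nw same[OF that] by simp
    hence "(cdiff (\<lambda>p. \<Phi> p i) X ?p (w - z))\<^sup>2 \<le> (e * norm (w - z))\<^sup>2" if "i \<le> n" for i
      using that by (simp add: abs_le_square_iff[symmetric] e(1) less_imp_le)
    hence "(\<Sum>i\<le>n. (cdiff (\<lambda>p. \<Phi> p i) X ?p (w - z))\<^sup>2) \<le> (\<Sum>i\<le>n. (e * norm (w - z))\<^sup>2)"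
      by (intro sum_mono) simp
    also have "\<dots> = m / 2 * (norm (w - z))\<^sup>2" unfolding e(2)[symmetric] by (simp add: power_mult_distrib algebra_simps)
    finally have "m * (norm (w - z))\<^sup>2 \<le> m / 2 * (norm (w - z))\<^sup>2" using lower[of "w - z"] by linarith
    moreover have "(norm (w - z))\<^sup>2 > 0" using w(2) by simp
    ultimately show False using m by simp
  qed
  thus ?thesis using d0(1) by blast
qed

text \<open>Off the finitely many branch points a fibre is discrete, hence countable in each
  chart.\<close>

lemma null_preimage: "emeasure (area gr) {p. \<forall>i\<le>n. \<Phi> p i = x i} = 0"
proof -
  let ?Z = "{p. \<forall>i\<le>n. \<Phi> p i = x i}"
  have "?Z = (\<Inter>i\<in>{..n}. {p. \<Phi> p i = x i})" by auto
  moreover have "closed \<dots>"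
    by (intro closed_INT ballI closed_Collect_eq continuous_on_const C1_continuous[OF immersion_C1[OF bmi]]) simp
  ultimately have Z: "?Z \<in> sets borel" by simp
  have "emeasure (area gr) (?Z \<inter> piece j) = 0" if j: "j < length cover" for j
  proof -
    let ?k = "cover ! j"
    note k = cover(1)[OF j] and ck = is_chart[OF cover(1)[OF j]]
    let ?S = "{z \<in> im_ch ?k. (\<forall>i\<le>n. \<Phi> (param ?k z) i = x i) \<and> r (param ?k z) \<noteq> 0}"
    have "countable ?S"
    proof (rule countable_discrete)
      fix z assume z: "z \<in> ?S"
      then obtain d where d: "d > 0" "\<And>w. w \<in> ball z d \<Longrightarrow> w \<noteq> z \<Longrightarrow> \<exists>i\<le>n. \<Phi> (param ?k w) i \<noteq> \<Phi> (param ?k z) i"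
        using isolated_preimage[OF k, of z] by blast
      have "ball z d \<inter> ?S \<subseteq> {z}"
      proof
        fix w assume w: "w \<in> ball z d \<inter> ?S"
        show "w \<in> {z}"
        proof (rule ccontr)
          assume "w \<notin> {z}"
          then obtain i where "i \<le> n" "\<Phi> (param ?k w) i \<noteq> \<Phi> (param ?k z) i" using d(2) w by blast
          thus False using w z by simp
        qed
      qed
      thus "\<exists>U. open U \<and> z \<in> U \<and> U \<inter> ?S \<subseteq> {z}" using d(1) by (intro exI[of _ "ball z d"]) simp
    qed
    hence cN: "countable (?S \<union> coord ?k ` {p. r p = 0})" using factor_zeros by (simp add: countable_finite)
    have B: "?Z \<inter> piece j \<in> sets borel" "?Z \<inter> piece j \<subseteq> dom_ch ?k"
    proof -
      show "?Z \<inter> piece j \<in> sets borel" using Z piece_borel[OF j] by (rule sets.Int)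
      show "?Z \<inter> piece j \<subseteq> dom_ch ?k" using piece_dom[of j] by (rule le_infI2)
    qed
    have sub: "coord ?k ` (?Z \<inter> piece j) \<subseteq> ?S \<union> coord ?k ` {p. r p = 0}"
    proof
      fix z assume "z \<in> coord ?k ` (?Z \<inter> piece j)"
      then obtain p where p: "p \<in> ?Z" "p \<in> piece j" "z = coord ?k p" by blast
      have pd: "p \<in> dom_ch ?k" using p(2) piece_dom by blast
      hence "param ?k z = p" using chart_param_coord[OF ck] p(3) by simp
      thus "z \<in> ?S \<union> coord ?k ` {p. r p = 0}" using p pd by (cases "r p = 0") auto
    qed
    have "emeasure (area gr) (?Z \<inter> piece j) = (\<integral>\<^sup>+z\<in>coord ?k ` (?Z \<inter> piece j). ennreal (density_of gr ?k z) \<partial>lborel)"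
      using is_area_area[OF mgr] k B unfolding is_area_def by blast
    also have "\<dots> = (\<integral>\<^sup>+(z::complex). 0 \<partial>lborel)"
    proof (rule nn_integral_cong_AE)
      have "AE z in lborel. z \<notin> ?S \<union> coord ?k ` {p. r p = 0}"
        by (rule AE_not_in[OF countable_imp_null_set_lborel[OF cN]])
      thus "AE z in lborel. ennreal (density_of gr ?k z) * indicator (coord ?k ` (?Z \<inter> piece j)) z = 0"
      proof eventually_elim
        case (elim z)
        hence "z \<notin> coord ?k ` (?Z \<inter> piece j)" using sub by blast
        thus ?case by simp
      qed
    qed
    finally show ?thesis by simp
  qed
  thus ?thesis using emeasure_pieces[OF sets_area[OF mgr] Z] by simp
qed

interpretation gs: gradient_structure "area gr" C1 "G1 gr" "G2 gr"
  by (rule gradient_structure_surface[OF mgr])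

text \<open>Summed over the coordinates, the energies give twice the area, by conformality, and the
  squares give the area, since they sum to 1. So the eigenvalue is 2, which is the constant in
  \<open>poincare\<close>.\<close>

lemma first_immersion_lambda1:
  assumes imm: "immersed_by_first_eigenfunctions A c g n \<Phi>"
  shows "gs.first_immersion n (\<lambda>i p. \<Phi> p i) r \<and> (\<exists>g0\<in>c. lambda1 A g0 g = 2)"
proof -
  obtain g0 where g0: "g0 \<in> c" and eig: "\<And>i. i \<le> n \<Longrightarrow> (\<lambda>p. \<Phi> p i) \<in> lambda1_eigenspace A g0 g"
    and g: "pullback_metric A n \<Phi> = g"
    using imm unfolding immersed_by_first_eigenfunctions_def by blast
  have gg: "g X p v w = r p * gr X p v w" for X p v w using pullback_factor(1) g by simp
  note P = lambda1_poincare[OF gr g0 factor_C1 pullback_factor(2) gg]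
  note L = eigenspace_energy[OF gr g0 factor_C1 pullback_factor(2) gg immersion_C1[OF bmi] eig factor_dense]
  note FC = immersion_C1[OF bmi]
  let ?F = "\<lambda>i p. \<Phi> p i"
  let ?l = "lambda1 A g0 g"
  have D: "dot n (\<lambda>i. G1 gr (?F i) p) (\<lambda>i. G1 gr (?F i) p) = r p"
    "dot n (\<lambda>i. G2 gr (?F i) p) (\<lambda>i. G2 gr (?F i) p) = r p"
    "dot n (\<lambda>i. G1 gr (?F i) p) (\<lambda>i. G2 gr (?F i) p) = 0" for p
    unfolding G1_def G2_def factor_chart[OF ch] frame_orthonormal[OF mgr ch] by simp_all
  have u: "dot n (\<lambda>i. ?F i p) (\<lambda>i. ?F i p) = 1" for p using immersion_unit(1)[OF bmi] by simp
  have M: "(LINT p|area gr. r p) > 0"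
  proof (rule gs.mass_pos[OF factor_C1 pullback_factor(2)])
    show "\<exists>p. r p \<noteq> 0" using factor_dense[of UNIV] by simp
  qed
  have "(\<Sum>i\<le>n. gs.energy (?F i) (?F i)) = (LINT p|area gr. (\<Sum>i\<le>n. gs.grad_inner (?F i) (?F i) p))"
    unfolding gs.energy_def using FC
    by (subst Bochner_Integration.integral_sum) (auto intro!: gs.grad_inner_integrable)
  also have "(\<lambda>p. \<Sum>i\<le>n. gs.grad_inner (?F i) (?F i) p) = (\<lambda>p. 2 * r p)"
    using D by (simp add: gs.grad_inner_def sum.distrib dot_def fun_eq_iff)
  finally have s1: "(\<Sum>i\<le>n. gs.energy (?F i) (?F i)) = 2 * (LINT p|area gr. r p)" by simp
  have "(\<Sum>i\<le>n. LINT p|area gr. (?F i p)\<^sup>2 * r p) = (LINT p|area gr. (\<Sum>i\<le>n. (?F i p)\<^sup>2 * r p))"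
    using FC factor_C1
    by (subst Bochner_Integration.integral_sum) (auto intro!: gs.C_integrable gs.C_mult gs.C_power2)
  also have "(\<lambda>p. \<Sum>i\<le>n. (?F i p)\<^sup>2 * r p) = r"
    using u by (simp add: dot_def power2_eq_square flip: sum_distrib_right)
  finally have s2: "(\<Sum>i\<le>n. LINT p|area gr. (?F i p)\<^sup>2 * r p) = (LINT p|area gr. r p)" .
  have "(\<Sum>i\<le>n. gs.energy (?F i) (?F i)) = ?l * (\<Sum>i\<le>n. LINT p|area gr. (?F i p)\<^sup>2 * r p)"
    unfolding sum_distrib_left using L by (intro sum.cong) auto
  hence "2 * (LINT p|area gr. r p) = ?l * (LINT p|area gr. r p)" unfolding s1 s2 .
  hence l: "?l = 2" using M by simp
  have "gs.first_immersion n (\<lambda>i p. \<Phi> p i) r"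
    unfolding gs.first_immersion_def
  proof (intro conjI allI impI)
    show "gs.poincare r" unfolding gs.poincare_def using P unfolding l by blast
    show "\<exists>p\<in>U. r p \<noteq> 0" if "open U" "U \<noteq> {}" for U by (rule factor_dense[OF that])
    show "(LINT p|area gr. \<Phi> p i * r p) = 0" if "i \<le> n" for i using L[OF that that] by blast
    show "gs.energy (?F i) (?F i) = 2 * (LINT p|area gr. (\<Phi> p i)\<^sup>2 * r p)" if "i \<le> n" for i
      using L[OF that that] unfolding l by blast
  qed (rule FC factor_C1 pullback_factor(2) u D null_preimage | assumption)+
  thus ?thesis using g0 l by blast
qed

end

end

section \<open>Local geometry of maps from the plane\<close>

definition pd :: "complex \<Rightarrow> (complex \<Rightarrow> nat \<Rightarrow> real) \<Rightarrow> complex \<Rightarrow> nat \<Rightarrow> real" where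
  "pd v f z i = pderiv_at (\<lambda>z. f z i) z v"

definition smooth_family :: "complex set \<Rightarrow> nat \<Rightarrow> (complex \<Rightarrow> nat \<Rightarrow> real) \<Rightarrow> bool" where
  "smooth_family V n f \<longleftrightarrow> open V \<and> (\<forall>i\<le>n. \<forall>k. Ck_on k V (\<lambda>z. f z i))"

lemma smooth_family_pd: "smooth_family V n f \<Longrightarrow> smooth_family V n (pd v f)"
  unfolding smooth_family_def pd_def by (blast intro: Ck_on_SucD(2))

lemma smooth_family_deriv:
  assumes "smooth_family V n f" "i \<le> n" "z \<in> V"
  shows "((\<lambda>z. f z i) has_derivative (\<lambda>v. pd v f z i)) (at z)"
proof -
  have "Ck_on (Suc 0) V (\<lambda>z. f z i)" using assms unfolding smooth_family_def by blast
  from Ck_on_SucD(1)[OF this assms(3)] show ?thesis unfolding pd_def .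
qed

lemma smooth_family_open: "smooth_family V n f \<Longrightarrow> open V"
  by (simp add: smooth_family_def)

lemma smooth_family_subset: "smooth_family V n f \<Longrightarrow> open W \<Longrightarrow> W \<subseteq> V \<Longrightarrow> smooth_family W n f"
  unfolding smooth_family_def by (blast intro: Ck_on_subset)

lemma smooth_family_dot_Ck:
  assumes "smooth_family V n f" "smooth_family V n g"
  shows "Ck_on k V (\<lambda>z. dot n (f z) (g z))"
  unfolding dot_def using assms unfolding smooth_family_def by (intro Ck_on_sum Ck_on_mult) auto

lemma pd_commute:
  assumes "smooth_family V n f" "i \<le> n" "z \<in> V"
  shows "pd v (pd w f) z i = pd w (pd v f) z i"
  unfolding pd_def
proof (rule mixed_partials_commute[of V])
  show "open V" "z \<in> V" using assms by (auto simp: smooth_family_def)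
  show "Ck_on 2 V (\<lambda>z. f z i)" using assms unfolding smooth_family_def by blast
qed

lemma dot_deriv:
  assumes "smooth_family V n f" "smooth_family V n g" "z \<in> V"
  shows "pderiv_at (\<lambda>z. dot n (f z) (g z)) z v = dot n (f z) (pd v g z) + dot n (pd v f z) (g z)"
proof -
  have "((\<lambda>z. \<Sum>i\<le>n. f z i * g z i) has_derivative (\<lambda>v. \<Sum>i\<le>n. f z i * pd v g z i + pd v f z i * g z i)) (at z)"
    by (intro has_derivative_sum has_derivative_mult smooth_family_deriv[OF assms(1) _ assms(3)]
        smooth_family_deriv[OF assms(2) _ assms(3)]) auto
  from frechet_derivative_eqI[OF this] show ?thesis by (simp add: dot_def sum.distrib)
qed

lemma dot_commuted: "smooth_family V n f \<Longrightarrow> z \<in> V \<Longrightarrow> dot n (pd v (pd w f) z) x = dot n (pd w (pd v f) z) x"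
  by (rule dot_cong) (auto intro: pd_commute)

section \<open>Christoffel symbols and the Gauss equation\<close>

definition same_metric :: "complex set \<Rightarrow> nat \<Rightarrow> (complex \<Rightarrow> nat \<Rightarrow> real) \<Rightarrow> nat \<Rightarrow> (complex \<Rightarrow> nat \<Rightarrow> real) \<Rightarrow> bool" where
  "same_metric V n f m g \<longleftrightarrow> (\<forall>z\<in>V. \<forall>v w. dot n (pd v f z) (pd w f z) = dot m (pd v g z) (pd w g z))"

lemma metric_deriv:
  assumes "smooth_family V n f" "z \<in> V"
  shows "pderiv_at (\<lambda>z. dot n (pd w f z) (pd x f z)) z v
    = dot n (pd v (pd w f) z) (pd x f z) + dot n (pd v (pd x f) z) (pd w f z)"
  by (subst dot_deriv[OF smooth_family_pd[OF assms(1)] smooth_family_pd[OF assms(1)] assms(2)])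
    (simp add: dot_commute[of n "pd w f z"])

text \<open>Koszul's formula for coordinate fields, which commute. It shows that second derivatives
  paired with first ones depend on the metric only.\<close>

lemma koszul:
  assumes f: "smooth_family V n f" "z \<in> V"
  shows "2 * dot n (pd v (pd w f) z) (pd x f z) = pderiv_at (\<lambda>z. dot n (pd w f z) (pd x f z)) z v
    + pderiv_at (\<lambda>z. dot n (pd v f z) (pd x f z)) z w - pderiv_at (\<lambda>z. dot n (pd v f z) (pd w f z)) z x"
  unfolding metric_deriv[OF f]
  using dot_commuted[OF f, of v w "pd x f z"] dot_commuted[OF f, of v x "pd w f z"] dot_commuted[OF f, of w x "pd v f z"]
  by simp

lemma same_metric_christoffel:
  assumes f: "smooth_family V n f" and g: "smooth_family V m g" and s: "same_metric V n f m g" and z: "z \<in> V"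
  shows "dot n (pd v (pd w f) z) (pd x f z) = dot m (pd v (pd w g) z) (pd x g z)"
proof -
  have "pderiv_at (\<lambda>z. dot n (pd w f z) (pd x f z)) z v = pderiv_at (\<lambda>z. dot m (pd w g z) (pd x g z)) z v" for v w x
    using s smooth_family_open[OF f] z unfolding same_metric_def by (subst frechet_derivative_cong_open[of V]) auto
  thus ?thesis using koszul[OF f z, of v w x] koszul[OF g z, of v w x] by simp
qed

text \<open>The third derivatives in the two terms on the right agree by symmetry and cancel. As the
  terms on the right contain only Christoffel symbols, the left side depends on the metric
  only.\<close>

lemma gauss_identity:
  assumes f: "smooth_family V n f" and z: "z \<in> V"
  shows "dot n (pd v (pd v f) z) (pd w (pd w f) z) - dot n (pd v (pd w f) z) (pd v (pd w f) z)
    = pderiv_at (\<lambda>z. dot n (pd v (pd v f) z) (pd w f z)) z w - pderiv_at (\<lambda>z. dot n (pd v (pd w f) z) (pd w f z)) z v"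
proof -
  note p = smooth_family_pd
  have 1: "pd w (pd v (pd v f)) z i = pd v (pd v (pd w f)) z i" if "i \<le> n" for i
  proof -
    have "pd w (pd v (pd v f)) z i = pd v (pd w (pd v f)) z i" by (rule pd_commute[OF p[OF f] that z])
    also have "\<dots> = pd v (pd v (pd w f)) z i"
      unfolding pd_def[of v "pd w (pd v f)"] pd_def[of v "pd v (pd w f)"]
      using pd_commute[OF f that] z smooth_family_open[OF f] by (subst frechet_derivative_cong_open[of V]) auto
    finally show ?thesis .
  qed
  have "dot n (pd w (pd v (pd v f)) z) (pd w f z) = dot n (pd v (pd v (pd w f)) z) (pd w f z)"
    by (rule dot_cong) (auto simp: 1)
  thus ?thesis
    unfolding dot_deriv[OF p[OF p[OF f]] p[OF f] z]
    by simp
qed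

text \<open>The Theorema egregium, before passing to normal components.\<close>

lemma same_metric_gauss:
  assumes f: "smooth_family V n f" and g: "smooth_family V m g" and s: "same_metric V n f m g" and z: "z \<in> V"
  shows "dot n (pd v (pd v f) z) (pd w (pd w f) z) - dot n (pd v (pd w f) z) (pd v (pd w f) z)
    = dot m (pd v (pd v g) z) (pd w (pd w g) z) - dot m (pd v (pd w g) z) (pd v (pd w g) z)"
proof -
  have "pderiv_at (\<lambda>z. dot n (pd v (pd w f) z) (pd x f z)) z y = pderiv_at (\<lambda>z. dot m (pd v (pd w g) z) (pd x g z)) z y" for v w x y
    using same_metric_christoffel[OF f g s] smooth_family_open[OF f] z by (subst frechet_derivative_cong_open[of V]) auto
  thus ?thesis unfolding gauss_identity[OF f z] gauss_identity[OF g z] by simp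
qed

lemma unit_derivs:
  assumes f: "smooth_family V n f" and u: "\<And>z. z \<in> V \<Longrightarrow> dot n (f z) (f z) = 1" and z: "z \<in> V"
  shows "dot n (f z) (pd v f z) = 0" and "dot n (f z) (pd v (pd w f) z) = - dot n (pd v f z) (pd w f z)"
proof -
  have 1: "dot n (f z) (pd v f z) = 0" if z: "z \<in> V" for z v
  proof -
    have "pderiv_at (\<lambda>z. dot n (f z) (f z)) z v = pderiv_at (\<lambda>z. 1) z v"
      using u smooth_family_open[OF f] z by (subst frechet_derivative_cong_open[of V]) auto
    thus ?thesis using dot_deriv[OF f f z, of v] by (simp add: dot_commute[of n "pd v f z"])
  qed
  show "dot n (f z) (pd v f z) = 0" by (rule 1[OF z])
  have "pderiv_at (\<lambda>z. dot n (f z) (pd w f z)) z v = pderiv_at (\<lambda>z. 0) z v"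
    using 1 smooth_family_open[OF f] z by (subst frechet_derivative_cong_open[of V]) auto
  thus "dot n (f z) (pd v (pd w f) z) = - dot n (pd v f z) (pd w f z)"
    using dot_deriv[OF f smooth_family_pd[OF f] z, of w v] by simp
qed

text \<open>The component of \<open>X\<close> normal to the cone spanned by \<open>f\<close> and its derivatives \<open>a\<close>, \<open>b\<close>.\<close>

definition coef1 :: "nat \<Rightarrow> (nat \<Rightarrow> real) \<Rightarrow> (nat \<Rightarrow> real) \<Rightarrow> (nat \<Rightarrow> real) \<Rightarrow> real" where
  "coef1 n a b X = (dot n b b * dot n X a - dot n a b * dot n X b) / (dot n a a * dot n b b - (dot n a b)\<^sup>2)"

definition coef2 :: "nat \<Rightarrow> (nat \<Rightarrow> real) \<Rightarrow> (nat \<Rightarrow> real) \<Rightarrow> (nat \<Rightarrow> real) \<Rightarrow> real" where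
  "coef2 n a b X = (dot n a a * dot n X b - dot n a b * dot n X a) / (dot n a a * dot n b b - (dot n a b)\<^sup>2)"

definition nrm :: "nat \<Rightarrow> (nat \<Rightarrow> real) \<Rightarrow> (nat \<Rightarrow> real) \<Rightarrow> (nat \<Rightarrow> real) \<Rightarrow> (nat \<Rightarrow> real) \<Rightarrow> nat \<Rightarrow> real" where
  "nrm n f a b X = (\<lambda>i. X i - dot n f X * f i - coef1 n a b X * a i - coef2 n a b X * b i)"

lemma coef_solve:
  fixes E F G x y :: real
  assumes "E * G - F\<^sup>2 \<noteq> 0"
  shows "(G * x - F * y) / (E * G - F\<^sup>2) * E + (E * y - F * x) / (E * G - F\<^sup>2) * F = x"
    "(G * x - F * y) / (E * G - F\<^sup>2) * F + (E * y - F * x) / (E * G - F\<^sup>2) * G = y"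
proof -
  have "(G * x - F * y) / (E * G - F\<^sup>2) * E + (E * y - F * x) / (E * G - F\<^sup>2) * F = ((E * G - F\<^sup>2) * x) / (E * G - F\<^sup>2)"
    by (simp add: add_divide_distrib[symmetric] power2_eq_square algebra_simps)
  thus "(G * x - F * y) / (E * G - F\<^sup>2) * E + (E * y - F * x) / (E * G - F\<^sup>2) * F = x" using assms by simp
  have "(G * x - F * y) / (E * G - F\<^sup>2) * F + (E * y - F * x) / (E * G - F\<^sup>2) * G = ((E * G - F\<^sup>2) * y) / (E * G - F\<^sup>2)"
    by (simp add: add_divide_distrib[symmetric] power2_eq_square algebra_simps)
  thus "(G * x - F * y) / (E * G - F\<^sup>2) * F + (E * y - F * x) / (E * G - F\<^sup>2) * G = y" using assms by simp
qed

context
  fixes n :: nat and f a b :: "nat \<Rightarrow> real"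
  assumes ff: "dot n f f = 1" and fa: "dot n f a = 0" and fb: "dot n f b = 0"
    and det: "dot n a a * dot n b b - (dot n a b)\<^sup>2 > 0"
begin

lemma coef_eqs:
  "coef1 n a b X * dot n a a + coef2 n a b X * dot n a b = dot n X a"
  "coef1 n a b X * dot n a b + coef2 n a b X * dot n b b = dot n X b"
  unfolding coef1_def coef2_def using coef_solve det by simp_all

lemma nrm_orthogonal: "dot n f (nrm n f a b X) = 0" "dot n a (nrm n f a b X) = 0" "dot n b (nrm n f a b X) = 0"
proof -
  show "dot n f (nrm n f a b X) = 0" using ff fa fb by (simp add: nrm_def dot_linear)
  show "dot n a (nrm n f a b X) = 0"
    using fa coef_eqs(1)[of X] by (simp add: nrm_def dot_linear dot_commute[of n a f] dot_commute[of n a X])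
  show "dot n b (nrm n f a b X) = 0"
    using fb coef_eqs(2)[of X] by (simp add: nrm_def dot_linear dot_commute[of n b f] dot_commute[of n b X] dot_commute[of n b a])
qed

lemma nrm_dot:
  assumes "dot n f w = 0" "dot n a w = 0" "dot n b w = 0"
  shows "dot n w (nrm n f a b X) = dot n w X"
  using assms by (simp add: nrm_def dot_linear dot_commute[of n w f] dot_commute[of n w a] dot_commute[of n w b])

lemma nrm_nrm: "dot n (nrm n f a b X) (nrm n f a b Y)
  = dot n X Y - dot n f X * dot n f Y - coef1 n a b X * dot n Y a - coef2 n a b X * dot n Y b"
proof -
  have "dot n (nrm n f a b X) (nrm n f a b Y) = dot n (nrm n f a b X) Y"
    by (rule nrm_dot) (rule nrm_orthogonal)+
  thus ?thesis by (simp add: nrm_def dot_linear dot_commute[of n a Y] dot_commute[of n b Y])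
qed

end

text \<open>\<open>N1\<close>, \<open>N2\<close>, \<open>N3\<close> are the values of a second
  fundamental form on the pairs of basis vectors. Squaring the trace relation expresses
  \<open>G^2 |N1|^2 + E^2 |N3|^2\<close> by \<open>|N2|^2\<close>; Cauchy-Schwarz and the inequality
  of means bound it below by \<open>2 E G |N2|^2\<close>, and \<open>E G > F^2\<close> leaves only
  zero.\<close>

lemma tracefree_degenerate_zero:
  assumes E: "E > 0" and D: "E * G - F\<^sup>2 > (0::real)"
    and tr: "\<And>i. i \<le> n \<Longrightarrow> G * N1 i - 2 * F * N2 i + E * N3 i = 0"
    and deg: "dot n N1 N3 = dot n N2 N2"
  shows "dot n N1 N1 = 0" "dot n N2 N2 = 0" "dot n N3 N3 = 0"
proof -
  have "0 < E * G" using D by (smt (verit) zero_le_power2)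
  hence G: "G > 0" using E by (simp add: zero_less_mult_iff)
  define x y z where "x = dot n N1 N1" and "y = dot n N2 N2" and "z = dot n N3 N3"
  have nn: "x \<ge> 0" "y \<ge> 0" "z \<ge> 0" by (simp_all add: x_def y_def z_def)
  have "dot n (\<lambda>i. G * N1 i + E * N3 i) (\<lambda>i. G * N1 i + E * N3 i) = dot n (\<lambda>i. (2 * F) * N2 i) (\<lambda>i. (2 * F) * N2 i)"
    by (rule dot_cong) (use tr in \<open>simp_all add: algebra_simps\<close>)
  hence eq: "G\<^sup>2 * x + E\<^sup>2 * z + 2 * E * G * y = 4 * F\<^sup>2 * y"
    using deg unfolding dot_linear x_def[symmetric] y_def[symmetric] z_def[symmetric] dot_commute[of n N3 N1]
    by (simp add: power2_eq_square algebra_simps)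
  have cs: "y\<^sup>2 \<le> x * z" using dot_Cauchy_Schwarz[of n N1 N3] by (simp add: deg x_def y_def z_def)
  have "(2 * E * G * y)\<^sup>2 \<le> (G\<^sup>2 * x + E\<^sup>2 * z)\<^sup>2"
  proof -
    have "(2 * E * G * y)\<^sup>2 \<le> 4 * (G\<^sup>2 * x) * (E\<^sup>2 * z)"
      using mult_left_mono[OF cs, of "4 * E\<^sup>2 * G\<^sup>2"] by (simp add: power_mult_distrib algebra_simps)
    also have "\<dots> \<le> (G\<^sup>2 * x + E\<^sup>2 * z)\<^sup>2"
    proof -
      have "4 * X * Y \<le> (X + Y)\<^sup>2" for X Y :: real
      proof -
        have "0 \<le> (X - Y)\<^sup>2" by simp
        thus ?thesis by (simp add: power2_eq_square algebra_simps)
      qed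
      thus ?thesis .
    qed
    finally show ?thesis .
  qed
  hence "2 * E * G * y \<le> G\<^sup>2 * x + E\<^sup>2 * z" by (rule power2_le_imp_le) (use nn in simp)
  hence "4 * ((E * G - F\<^sup>2) * y) \<le> 0" using eq by (simp add: algebra_simps)
  hence "y \<le> 0" using D by (simp add: mult_le_0_iff)
  hence y: "y = 0" using nn by simp
  hence "G\<^sup>2 * x + E\<^sup>2 * z = 0" using eq by simp
  hence "G\<^sup>2 * x = 0 \<and> E\<^sup>2 * z = 0" using nn by (simp add: add_nonneg_eq_0_iff)
  thus "dot n N1 N1 = 0" "dot n N2 N2 = 0" "dot n N3 N3 = 0" using y E G by (simp_all add: x_def y_def z_def)
qed

text \<open>\<open>d\<close> is the triple product of \<open>f\<close>, \<open>a\<close>,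
  \<open>b\<close>. Its square is their Gram determinant, and Cramer's rule recovers
  \<open>w\<close> from its inner products.\<close>

lemma normal_dim3_zero:
  assumes ff: "dot 2 f f = 1" and fa: "dot 2 f a = 0" and fb: "dot 2 f b = 0"
    and det: "dot 2 a a * dot 2 b b - (dot 2 a b)\<^sup>2 > 0"
    and w: "dot 2 f w = 0" "dot 2 a w = 0" "dot 2 b w = 0"
  shows "\<forall>i\<le>2. w i = 0"
proof -
  have e: "dot 2 x y = x 0 * y 0 + x 1 * y 1 + x 2 * y 2" for x y
    by (simp add: dot_def numeral_2_eq_2)
  define d where "d = f 0 * (a 1 * b 2 - a 2 * b 1) - f 1 * (a 0 * b 2 - a 2 * b 0) + f 2 * (a 0 * b 1 - a 1 * b 0)"
  have "d\<^sup>2 = dot 2 f f * (dot 2 a a * dot 2 b b - (dot 2 a b)\<^sup>2) - dot 2 f a * (dot 2 f a * dot 2 b b - dot 2 a b * dot 2 f b)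
     + dot 2 f b * (dot 2 f a * dot 2 a b - dot 2 a a * dot 2 f b)"
    unfolding e d_def by (simp add: power2_eq_square algebra_simps)
  hence d: "d \<noteq> 0" using ff fa fb det by auto
  have "d * w 0 = (a 1 * b 2 - a 2 * b 1) * dot 2 f w - (f 1 * b 2 - f 2 * b 1) * dot 2 a w + (f 1 * a 2 - f 2 * a 1) * dot 2 b w"
    "d * w 1 = - (a 0 * b 2 - a 2 * b 0) * dot 2 f w + (f 0 * b 2 - f 2 * b 0) * dot 2 a w - (f 0 * a 2 - f 2 * a 0) * dot 2 b w"
    "d * w 2 = (a 0 * b 1 - a 1 * b 0) * dot 2 f w - (f 0 * b 1 - f 1 * b 0) * dot 2 a w + (f 0 * a 1 - f 1 * a 0) * dot 2 b w"
    unfolding e d_def by (simp_all add: algebra_simps)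
  hence "w 0 = 0" "w 1 = 0" "w 2 = 0" using d w by auto
  moreover have "i = 0 \<or> i = 1 \<or> i = 2" if "i \<le> 2" for i :: nat using that by auto
  ultimately show ?thesis by blast
qed

text \<open>Gronwall's argument along the segment from \<open>z0\<close>: the squared 1-jet
  \<open>q\<close> satisfies \<open>q' \<le> K q\<close> and starts at 0.\<close>

lemma one_jet_vanishes:
  fixes l :: "complex \<Rightarrow> real"
  assumes l: "Ck_on 2 (ball z0 R) l" and C: "0 \<le> C"
    and bnd: "\<And>z v w. z \<in> ball z0 R \<Longrightarrow> v \<in> {1, \<i>} \<Longrightarrow> w \<in> {1, \<i>} \<Longrightarrow>
      \<bar>pderiv_at (\<lambda>z. pderiv_at l z w) z v\<bar> \<le> C * (\<bar>l z\<bar> + \<bar>pderiv_at l z 1\<bar> + \<bar>pderiv_at l z \<i>\<bar>)"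
    and z0: "l z0 = 0" "pderiv_at l z0 1 = 0" "pderiv_at l z0 \<i> = 0" and z: "z \<in> ball z0 R"
  shows "l z = 0"
proof -
  have l2: "Ck_on (Suc 1) (ball z0 R) l" using l by (simp add: numeral_2_eq_2)
  have dl: "l differentiable (at x)" and ddl: "(\<lambda>z. pderiv_at l z w) differentiable (at x)" if "x \<in> ball z0 R" for x w
    using l2 that by auto
  define v where "v = z - z0"
  define x where "x = (\<lambda>t. z0 + t *\<^sub>R v)"
  define a where "a = (\<lambda>t. l (x t))"
  define b where "b = (\<lambda>w t. pderiv_at l (x t) w)"
  define S where "S = (\<lambda>t. \<bar>a t\<bar> + \<bar>b 1 t\<bar> + \<bar>b \<i> t\<bar>)"
  define q where "q = (\<lambda>t. (a t)\<^sup>2 + (b 1 t)\<^sup>2 + (b \<i> t)\<^sup>2)"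
  define Q where "Q = norm v * 2"
  have Q: "\<bar>Re v\<bar> + \<bar>Im v\<bar> \<le> Q" using abs_Re_le_cmod[of v] abs_Im_le_cmod[of v] by (simp add: Q_def)
  have Q0: "Q \<ge> 0" by (simp add: Q_def)
  have xb: "x t \<in> ball z0 R" if "0 \<le> t" "t \<le> 1" for t
  proof -
    have "dist z0 (x t) = t * norm v" using that by (simp add: x_def dist_norm)
    also have "\<dots> \<le> norm v" using that by (simp add: mult_left_le_one_le)
    also have "\<dots> < R" using z by (simp add: v_def dist_norm norm_minus_commute)
    finally show ?thesis by simp
  qed
  have lin2: "pderiv_at h y v = Re v * pderiv_at h y 1 + Im v * pderiv_at h y \<i>" if "h differentiable (at y)" for h :: "complex \<Rightarrow> real" and y
    using frechet_derivative_complex[OF that, of v] by simp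
  have est: "\<bar>Re v * y1 + Im v * y2\<bar> \<le> Q * M" if "\<bar>y1\<bar> \<le> M" "\<bar>y2\<bar> \<le> M" for y1 y2 M :: real
  proof -
    have "\<bar>Re v * y1 + Im v * y2\<bar> \<le> \<bar>Re v\<bar> * \<bar>y1\<bar> + \<bar>Im v\<bar> * \<bar>y2\<bar>"
      using abs_triangle_ineq[of "Re v * y1" "Im v * y2"] by (simp add: abs_mult)
    also have "\<dots> \<le> \<bar>Re v\<bar> * M + \<bar>Im v\<bar> * M" using that by (intro add_mono mult_left_mono) auto
    also have "\<dots> \<le> Q * M" using mult_right_mono[OF Q, of M] that by (simp add: distrib_right)
    finally show ?thesis .
  qed
  \<comment> \<open>\<open>Q\<close> accounts for the direction of the segment, \<open>C\<close> for
    the second derivatives in terms of the sum \<open>S\<close> of the 1-jet, and the factor 3 for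
    \<open>S^2 \<le> 3 q\<close>.\<close>
  define K where "K = 2 * (Q + 2 * (Q * C)) * 3"
  have da: "(a has_real_derivative pderiv_at l (x t) v) (at t)" and
    db: "(b w has_real_derivative pderiv_at (\<lambda>z. pderiv_at l z w) (x t) v) (at t)" if t: "0 \<le> t" "t \<le> 1" for t w
    unfolding a_def b_def x_def using xb[OF t] dl ddl by (auto intro!: directional_DERIV simp: x_def)
  define q' where "q' = (\<lambda>t. 2 * a t * pderiv_at l (x t) v + 2 * b 1 t * pderiv_at (\<lambda>z. pderiv_at l z 1) (x t) v
      + 2 * b \<i> t * pderiv_at (\<lambda>z. pderiv_at l z \<i>) (x t) v)"
  have dq: "(q has_real_derivative q' t) (at t)" if t: "0 \<le> t" "t \<le> 1" for t
    unfolding q_def q'_def by (rule derivative_eq_intros da[OF t] db[OF t] | simp)+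
  have qK: "q' t \<le> K * q t" if t: "0 \<le> t" "t \<le> 1" for t
  proof -
    have 1: "\<bar>pderiv_at l (x t) v\<bar> \<le> Q * S t"
      unfolding lin2[OF dl[OF xb[OF t]]] by (rule est) (auto simp: S_def b_def)
    have 2: "\<bar>pderiv_at (\<lambda>z. pderiv_at l z w) (x t) v\<bar> \<le> Q * (C * S t)" if "w \<in> {1, \<i>}" for w
      unfolding lin2[OF ddl[OF xb[OF t]]]
      by (rule est) (use bnd[OF xb[OF t] _ that] in \<open>auto simp: S_def a_def b_def\<close>)
    have le: "p * y \<le> S t * M" if "\<bar>p\<bar> \<le> S t" "\<bar>y\<bar> \<le> M" for p y M
    proof -
      have "p * y \<le> \<bar>p\<bar> * \<bar>y\<bar>" by (metis abs_ge_self abs_mult)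
      also have "\<dots> \<le> S t * M" using that by (intro mult_mono) auto
      finally show ?thesis .
    qed
    have "a t * pderiv_at l (x t) v \<le> S t * (Q * S t)" by (rule le[OF _ 1]) (simp add: S_def)
    moreover have "b 1 t * pderiv_at (\<lambda>z. pderiv_at l z 1) (x t) v \<le> S t * (Q * (C * S t))"
      by (rule le[OF _ 2]) (simp_all add: S_def)
    moreover have "b \<i> t * pderiv_at (\<lambda>z. pderiv_at l z \<i>) (x t) v \<le> S t * (Q * (C * S t))"
      by (rule le[OF _ 2]) (simp_all add: S_def)
    ultimately have "q' t \<le> 2 * (S t * (Q * S t)) + 4 * (S t * (Q * (C * S t)))" by (simp add: q'_def)
    also have "\<dots> = 2 * (Q + 2 * (Q * C)) * (S t)\<^sup>2" by (simp add: power2_eq_square algebra_simps)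
    also have "\<dots> \<le> 2 * (Q + 2 * (Q * C)) * (3 * q t)"
    proof (rule mult_left_mono)
      have "(\<bar>r\<bar> + \<bar>s\<bar> + \<bar>u\<bar>)\<^sup>2 \<le> 3 * (r\<^sup>2 + s\<^sup>2 + u\<^sup>2)" for r s u :: real
      proof -
        have "0 \<le> (\<bar>r\<bar> - \<bar>s\<bar>)\<^sup>2 + (\<bar>s\<bar> - \<bar>u\<bar>)\<^sup>2 + (\<bar>r\<bar> - \<bar>u\<bar>)\<^sup>2" by simp
        also have "\<dots> = 3 * (r\<^sup>2 + s\<^sup>2 + u\<^sup>2) - (\<bar>r\<bar> + \<bar>s\<bar> + \<bar>u\<bar>)\<^sup>2"
          by (simp add: power2_sum power2_diff) (simp add: power2_eq_square algebra_simps flip: abs_mult)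
        finally show ?thesis by simp
      qed
      thus "(S t)\<^sup>2 \<le> 3 * q t" by (simp add: S_def q_def)
      show "0 \<le> 2 * (Q + 2 * (Q * C))" using Q0 C by simp
    qed
    finally show ?thesis by (simp add: K_def algebra_simps)
  qed
  define h where "h = (\<lambda>t. q t * exp (- (K * t)))"
  have "h 1 \<le> h 0"
  proof (rule DERIV_nonpos_imp_nonincreasing[of 0 1 h])
    fix t :: real assume t: "0 \<le> t" "t \<le> 1"
    have "(h has_real_derivative q' t * exp (- (K * t)) + q t * (exp (- (K * t)) * - K)) (at t)"
      unfolding h_def by (rule derivative_eq_intros dq[OF t] | simp)+
    moreover have "q' t * exp (- (K * t)) + q t * (exp (- (K * t)) * - K) = (q' t - K * q t) * exp (- (K * t))"
      by (simp add: algebra_simps)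
    moreover have "\<dots> \<le> 0" using qK[OF t] by (intro mult_nonpos_nonneg) auto
    ultimately show "\<exists>y. (h has_real_derivative y) (at t) \<and> y \<le> 0" by auto
  qed simp
  moreover have "h 0 = 0" using z0 by (simp add: h_def q_def a_def b_def x_def)
  ultimately have "q 1 * exp (- (K * 1)) \<le> 0" by (simp add: h_def)
  hence "q 1 \<le> 0" by (simp add: mult_le_0_iff)
  moreover have "(a 1)\<^sup>2 \<le> q 1" by (simp add: q_def)
  ultimately have "(a 1)\<^sup>2 \<le> 0" by linarith
  thus ?thesis by (simp add: a_def x_def v_def)
qed

section \<open>Minimal and totally geodesic maps in a chart\<close>

definition immersed :: "complex set \<Rightarrow> nat \<Rightarrow> (complex \<Rightarrow> nat \<Rightarrow> real) \<Rightarrow> bool" where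
  "immersed V n f \<longleftrightarrow> smooth_family V n f \<and> (\<forall>z\<in>V. dot n (f z) (f z) = 1 \<and>
     dot n (pd 1 f z) (pd 1 f z) * dot n (pd \<i> f z) (pd \<i> f z) - (dot n (pd 1 f z) (pd \<i> f z))\<^sup>2 > 0)"

text \<open>The second fundamental form within the sphere, followed by the Christoffel symbols of
  the second kind.\<close>

abbreviation sff where "sff n f v w z \<equiv> nrm n (f z) (pd 1 f z) (pd \<i> f z) (pd v (pd w f) z)"
abbreviation chr1 where "chr1 n f v w z \<equiv> coef1 n (pd 1 f z) (pd \<i> f z) (pd v (pd w f) z)"
abbreviation chr2 where "chr2 n f v w z \<equiv> coef2 n (pd 1 f z) (pd \<i> f z) (pd v (pd w f) z)"

text \<open>Flatness refers to the second fundamental form within the sphere (totally geodesic), not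
  to the curvature of the induced metric.\<close>

definition flat_at :: "nat \<Rightarrow> (complex \<Rightarrow> nat \<Rightarrow> real) \<Rightarrow> complex \<Rightarrow> bool" where
  "flat_at n f z \<longleftrightarrow> (\<forall>i\<le>n. sff n f 1 1 z i = 0 \<and> sff n f 1 \<i> z i = 0 \<and> sff n f \<i> \<i> z i = 0)"

text \<open>Zero mean curvature: the trace of the second fundamental form, multiplied by the
  determinant of the metric, is tested against every normal \<open>x\<close>.\<close>

definition tracefree :: "nat \<Rightarrow> (complex \<Rightarrow> nat \<Rightarrow> real) \<Rightarrow> complex \<Rightarrow> bool" where
  "tracefree n f z \<longleftrightarrow> (\<forall>x. dot n (f z) x = 0 \<longrightarrow> dot n (pd 1 f z) x = 0 \<longrightarrow> dot n (pd \<i> f z) x = 0 \<longrightarrow>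
     dot n (pd \<i> f z) (pd \<i> f z) * dot n x (pd 1 (pd 1 f) z) - 2 * dot n (pd 1 f z) (pd \<i> f z) * dot n x (pd 1 (pd \<i> f) z)
     + dot n (pd 1 f z) (pd 1 f z) * dot n x (pd \<i> (pd \<i> f) z) = 0)"

lemma immersedD:
  assumes "immersed V n f"
  shows "smooth_family V n f" and "z \<in> V \<Longrightarrow> dot n (f z) (f z) = 1"
    and "z \<in> V \<Longrightarrow> dot n (f z) (pd v f z) = 0"
    and "z \<in> V \<Longrightarrow> dot n (pd 1 f z) (pd 1 f z) * dot n (pd \<i> f z) (pd \<i> f z) - (dot n (pd 1 f z) (pd \<i> f z))\<^sup>2 > 0"
  using assms unit_derivs(1)[of V n f z v] unfolding immersed_def by blast+

context
  fixes V n f z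
  assumes f: "immersed V n f" and z: "z \<in> V"
begin

lemmas immersed_nrm_orthogonal = nrm_orthogonal[OF immersedD(2)[OF f z] immersedD(3)[OF f z] immersedD(3)[OF f z] immersedD(4)[OF f z]]
lemmas immersed_nrm_dot = nrm_dot[OF immersedD(2)[OF f z] immersedD(3)[OF f z] immersedD(3)[OF f z] immersedD(4)[OF f z]]
lemmas immersed_nrm_nrm = nrm_nrm[OF immersedD(2)[OF f z] immersedD(3)[OF f z] immersedD(3)[OF f z] immersedD(4)[OF f z]]

end

lemma immersed_E_pos:
  assumes "immersed V n f" "z \<in> V"
  shows "dot n (pd 1 f z) (pd 1 f z) > 0"
proof (rule ccontr)
  assume "\<not> ?thesis"
  hence "dot n (pd 1 f z) (pd 1 f z) = 0" using dot_self_nonneg[of n "pd 1 f z"] by linarith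
  thus False using immersedD(4)[OF assms] by simp
qed

lemma sff_commute: "immersed V n f \<Longrightarrow> z \<in> V \<Longrightarrow> i \<le> n \<Longrightarrow> sff n f v w z i = sff n f w v z i"
proof -
  assume a: "immersed V n f" "z \<in> V" "i \<le> n"
  have "dot n x (pd v (pd w f) z) = dot n x (pd w (pd v f) z)" "dot n (pd v (pd w f) z) x = dot n (pd w (pd v f) z) x" for x
    using dot_commuted[OF immersedD(1)[OF a(1)] a(2), of v w x] by (simp_all add: dot_commute)
  thus ?thesis using pd_commute[OF immersedD(1)[OF a(1)] a(3,2), of v w]
    by (simp add: nrm_def coef1_def coef2_def)
qed

text \<open>The traced vector is itself normal, so testing \<open>tracefree\<close> with it shows
  that its length is zero.\<close>

lemma tracefree_sff:
  assumes f: "immersed V n f" "z \<in> V" and t: "tracefree n f z" and i: "i \<le> n"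
  shows "dot n (pd \<i> f z) (pd \<i> f z) * sff n f 1 1 z i - 2 * dot n (pd 1 f z) (pd \<i> f z) * sff n f 1 \<i> z i
     + dot n (pd 1 f z) (pd 1 f z) * sff n f \<i> \<i> z i = 0"
proof -
  note o = immersed_nrm_orthogonal[OF f]
  note d = immersed_nrm_dot[OF f]
  let ?G = "dot n (pd \<i> f z) (pd \<i> f z)" and ?F = "2 * dot n (pd 1 f z) (pd \<i> f z)" and ?E = "dot n (pd 1 f z) (pd 1 f z)"
  define N where "N = (\<lambda>i. ?G * sff n f 1 1 z i - ?F * sff n f 1 \<i> z i + ?E * sff n f \<i> \<i> z i)"
  have N: "dot n (f z) N = 0" "dot n (pd 1 f z) N = 0" "dot n (pd \<i> f z) N = 0"
    unfolding N_def dot_linear o by simp_all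
  have "dot n N N = ?G * dot n N (sff n f 1 1 z) - ?F * dot n N (sff n f 1 \<i> z) + ?E * dot n N (sff n f \<i> \<i> z)"
    by (subst (2) N_def) (simp add: dot_linear)
  also have "\<dots> = 0" unfolding d[OF N] using t N unfolding tracefree_def by simp
  finally show ?thesis using i unfolding dot_self_eq_0_iff by (simp add: N_def)
qed

lemma flat_if_gauss:
  assumes f: "immersed V n f" "z \<in> V" and t: "tracefree n f z"
    and deg: "dot n (sff n f 1 1 z) (sff n f \<i> \<i> z) = dot n (sff n f 1 \<i> z) (sff n f 1 \<i> z)"
  shows "flat_at n f z"
  using tracefree_degenerate_zero[OF immersed_E_pos[OF f] immersedD(4)[OF f] tracefree_sff[OF f t] deg]
  unfolding dot_self_eq_0_iff flat_at_def by blast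

text \<open>Inside the 2-sphere there is no normal direction left.\<close>

lemma flat_dim2:
  assumes f: "immersed V 2 f" "z \<in> V"
  shows "flat_at 2 f z"
  unfolding flat_at_def
  using normal_dim3_zero[OF immersedD(2)[OF f] immersedD(3)[OF f] immersedD(3)[OF f] immersedD(4)[OF f] immersed_nrm_orthogonal[OF f]]
  by blast

lemma same_metric_coef:
  assumes f: "immersed V n f" and g: "immersed V m g" and s: "same_metric V n f m g" and z: "z \<in> V"
  shows "chr1 n f v w z = chr1 m g v w z" "chr2 n f v w z = chr2 m g v w z"
  using s z same_metric_christoffel[OF immersedD(1)[OF f] immersedD(1)[OF g] s z]
  unfolding same_metric_def by (simp_all add: coef1_def coef2_def)

text \<open>Metric and Christoffel symbols agree, so by the Gauss equation the determinants of the
  two second fundamental forms agree. One is zero by flatness, and a trace-free form with zero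
  determinant vanishes.\<close>

lemma flat_transfer:
  assumes f: "immersed V n f" and g: "immersed V m g" and s: "same_metric V n f m g" and z: "z \<in> V"
    and t: "tracefree n f z" and flat: "flat_at m g z"
  shows "flat_at n f z"
proof (rule flat_if_gauss[OF f z t])
  note sf = immersedD(1)[OF f] and sg = immersedD(1)[OF g]
  have u: "dot n (f z) (pd v (pd w f) z) = dot m (g z) (pd v (pd w g) z)" for v w
    using unit_derivs(2)[OF sf immersedD(2)[OF f] z, of v w] unit_derivs(2)[OF sg immersedD(2)[OF g] z, of v w] s z
    unfolding same_metric_def by simp
  have "dot n (sff n f 1 1 z) (sff n f \<i> \<i> z) - dot n (sff n f 1 \<i> z) (sff n f 1 \<i> z)
    = dot m (sff m g 1 1 z) (sff m g \<i> \<i> z) - dot m (sff m g 1 \<i> z) (sff m g 1 \<i> z)"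
    unfolding immersed_nrm_nrm[OF f z] immersed_nrm_nrm[OF g z]
      same_metric_coef[OF f g s z] u same_metric_christoffel[OF sf sg s z]
    using same_metric_gauss[OF sf sg s z, of 1 \<i>] by linarith
  also have "\<dots> = 0"
  proof -
    have "dot m (sff m g 1 1 z) (sff m g \<i> \<i> z) = dot m (\<lambda>i. 0) (\<lambda>i. 0)"
      by (rule dot_cong) (use flat in \<open>simp_all add: flat_at_def\<close>)
    moreover have "dot m (sff m g 1 \<i> z) (sff m g 1 \<i> z) = dot m (\<lambda>i. 0) (\<lambda>i. 0)"
      by (rule dot_cong) (use flat in \<open>simp_all add: flat_at_def\<close>)
    ultimately show ?thesis by simp
  qed
  finally show "dot n (sff n f 1 1 z) (sff n f \<i> \<i> z) = dot n (sff n f 1 \<i> z) (sff n f 1 \<i> z)" by simp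
qed

lemma flat_second_deriv:
  assumes f: "immersed V n f" "z \<in> V" and flat: "flat_at n f z" and vw: "v \<in> {1, \<i>}" "w \<in> {1, \<i>}" and i: "i \<le> n"
  shows "pd v (pd w f) z i = - dot n (pd v f z) (pd w f z) * f z i + chr1 n f v w z * pd 1 f z i + chr2 n f v w z * pd \<i> f z i"
proof -
  have "sff n f v w z i = 0" using flat vw i sff_commute[OF f i, of \<i> 1] unfolding flat_at_def by auto
  thus ?thesis using unit_derivs(2)[OF immersedD(1,2)[OF f(1)] f(2), of v w] by (simp add: nrm_def)
qed

lemma smooth_family_const: "open V \<Longrightarrow> smooth_family V n (\<lambda>_. b)"
  by (simp add: smooth_family_def Ck_on_const)

lemma coef_Ck:
  assumes f: "immersed V n f" and X: "smooth_family V n X"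
  shows "Ck_on k V (\<lambda>z. coef1 n (pd 1 f z) (pd \<i> f z) (X z))" "Ck_on k V (\<lambda>z. coef2 n (pd 1 f z) (pd \<i> f z) (X z))"
  unfolding coef1_def coef2_def power2_eq_square
  using immersedD(4)[OF f]
  by (intro Ck_on_divide Ck_on_diff Ck_on_mult smooth_family_dot_Ck smooth_family_pd X immersedD(1)[OF f] smooth_family_open[OF X];
      force simp: power2_eq_square)+

lemma dot_const_deriv:
  assumes f: "smooth_family V n f" "z \<in> V"
  shows "((\<lambda>z. dot n x (f z)) has_derivative (\<lambda>v. dot n x (pd v f z))) (at z)"
  unfolding dot_def using f by (intro has_derivative_sum has_derivative_mult_right smooth_family_deriv) auto

lemma Ck_has_derivative: "Ck_on 1 V h \<Longrightarrow> z \<in> V \<Longrightarrow> (h has_derivative pderiv_at h z) (at z)"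
  using Ck_on_SucD(1)[of 0 V h z] by simp

section \<open>A fixed vector in the span of the map and its differential\<close>

context
  fixes V n f and b :: "nat \<Rightarrow> real"
  assumes f: "immersed V n f" and cone: "\<And>z i. z \<in> V \<Longrightarrow> i \<le> n \<Longrightarrow> nrm n (f z) (pd 1 f z) (pd \<i> f z) b i = 0"
begin

abbreviation al where "al z \<equiv> coef1 n (pd 1 f z) (pd \<i> f z) b"
abbreviation be where "be z \<equiv> coef2 n (pd 1 f z) (pd \<i> f z) b"

lemma opV: "open V"
  using smooth_family_open[OF immersedD(1)[OF f]] .

lemma cone_split: "z \<in> V \<Longrightarrow> dot n x b = dot n (f z) b * dot n x (f z) + al z * dot n x (pd 1 f z) + be z * dot n x (pd \<i> f z)"
proof -
  assume z: "z \<in> V"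
  have "dot n x b = dot n x (\<lambda>i. dot n (f z) b * f z i + al z * pd 1 f z i + be z * pd \<i> f z i)"
    by (rule dot_cong) (use cone[OF z] in \<open>auto simp: nrm_def algebra_simps\<close>)
  thus ?thesis unfolding dot_linear .
qed

text \<open>The expression of \<open>b\<close> by \<open>f\<close> and its derivatives is
  differentiated and paired with a normal \<open>x\<close>; only the second derivatives of
  \<open>f\<close> survive.\<close>

lemma cone_normal:
  assumes z: "z \<in> V" and x: "dot n x (f z) = 0" "dot n x (pd 1 f z) = 0" "dot n x (pd \<i> f z) = 0"
  shows "al z * dot n x (pd 1 (pd v f) z) + be z * dot n x (pd \<i> (pd v f) z) = 0"
proof -
  note s = immersedD(1)[OF f] and p = smooth_family_pd[OF immersedD(1)[OF f]]
  note c = smooth_family_const[OF opV, of n b]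
  have 1: "((\<lambda>z. dot n (f z) b) has_derivative pderiv_at (\<lambda>z. dot n (f z) b) z) (at z)"
    by (rule Ck_has_derivative[OF smooth_family_dot_Ck[OF s c] z])
  note 2 = Ck_has_derivative[OF coef_Ck(1)[OF f c] z] and 3 = Ck_has_derivative[OF coef_Ck(2)[OF f c] z]
  have "((\<lambda>z. dot n (f z) b * dot n x (f z) + al z * dot n x (pd 1 f z) + be z * dot n x (pd \<i> f z)) has_derivative
     (\<lambda>v. dot n (f z) b * dot n x (pd v f z) + pderiv_at (\<lambda>z. dot n (f z) b) z v * dot n x (f z)
      + (al z * dot n x (pd v (pd 1 f) z) + pderiv_at al z v * dot n x (pd 1 f z))
      + (be z * dot n x (pd v (pd \<i> f) z) + pderiv_at be z v * dot n x (pd \<i> f z)))) (at z)" (is "(?h has_derivative ?d) _")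
    by (intro has_derivative_add has_derivative_mult 1 2 3 dot_const_deriv[OF s z] dot_const_deriv[OF p z])
  moreover have "(?h has_derivative (\<lambda>v. 0)) (at z)"
    by (rule has_derivative_cong_open[OF opV z, THEN iffD1, OF _ has_derivative_const[of "dot n x b"]]) (rule cone_split)
  ultimately have "?d = (\<lambda>v. 0)" by (rule has_derivative_unique)
  hence "?d v = 0" by (rule fun_cong)
  moreover have "dot n x (pd v f z) = 0"
    using x(2,3) frechet_derivative_complex[OF differentiableI[OF dot_const_deriv[OF s z, of x]], of v]
    unfolding frechet_derivative_eqI[OF dot_const_deriv[OF s z, of x]] by simp
  ultimately have "al z * dot n x (pd v (pd 1 f) z) + be z * dot n x (pd v (pd \<i> f) z) = 0" using x by simp
  thus ?thesis using dot_commuted[OF s z, of v _ x] by (simp add: dot_commute[of n x])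
qed

text \<open>By \<open>cone_normal\<close> the tangent vector with components \<open>al z\<close>,
  \<open>be z\<close> lies in the kernel of the second fundamental form, and a form with nontrivial
  kernel has zero determinant.\<close>

lemma cone_gauss:
  assumes z: "z \<in> V" and ab: "al z \<noteq> 0 \<or> be z \<noteq> 0"
  shows "dot n (sff n f 1 1 z) (sff n f \<i> \<i> z) = dot n (sff n f 1 \<i> z) (sff n f 1 \<i> z)"
proof -
  note o = immersed_nrm_orthogonal[OF f z]
  have d: "dot n (sff n f v w z) (pd v' (pd w' f) z) = dot n (sff n f v w z) (sff n f v' w' z)" for v w v' w'
    by (rule immersed_nrm_dot[OF f z o, symmetric])
  have c: "dot n x (sff n f \<i> 1 z) = dot n x (sff n f 1 \<i> z)" for x
    by (rule dot_cong) (use sff_commute[OF f z] in auto)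
  have e: "al z * dot n (sff n f v w z) (sff n f 1 v' z) + be z * dot n (sff n f v w z) (sff n f \<i> v' z) = 0" for v w v'
    using cone_normal[OF z, of "sff n f v w z" v'] o unfolding d by (simp add: dot_commute[of n _ "f z"] dot_commute[of n _ "pd 1 f z"] dot_commute[of n _ "pd \<i> f z"])
  have "al z * dot n (sff n f 1 1 z) (sff n f \<i> \<i> z) = al z * dot n (sff n f 1 \<i> z) (sff n f 1 \<i> z)"
    using e[of \<i> \<i> 1] e[of 1 \<i> \<i>] unfolding c dot_commute[of n "sff n f \<i> \<i> z" "sff n f 1 1 z"] dot_commute[of n "sff n f \<i> \<i> z" "sff n f 1 \<i> z"]
    by linarith
  moreover have "be z * dot n (sff n f 1 1 z) (sff n f \<i> \<i> z) = be z * dot n (sff n f 1 \<i> z) (sff n f 1 \<i> z)"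
    using e[of 1 \<i> 1] e[of 1 1 \<i>] unfolding c dot_commute[of n "sff n f 1 \<i> z" "sff n f 1 1 z"]
    by linarith
  ultimately show ?thesis using ab by auto
qed

text \<open>Where the determinant is nonzero, \<open>cone_gauss\<close> makes \<open>b\<close> a
  multiple of \<open>f\<close> on an open set. Differentiating this relation gives
  \<open>b . f = 0\<close>, so \<open>b = 0\<close>. Hence the determinant vanishes, and
  trace-freeness finishes the argument.\<close>

lemma cone_flat:
  assumes b: "\<exists>i\<le>n. b i \<noteq> 0" and t: "\<And>z. z \<in> V \<Longrightarrow> tracefree n f z" and z: "z \<in> V"
  shows "flat_at n f z"
proof (rule flat_if_gauss[OF f z t[OF z]], rule ccontr)
  note s = immersedD(1)[OF f] and p = smooth_family_pd[OF immersedD(1)[OF f]]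
  define K where "K z = dot n (sff n f 1 1 z) (sff n f \<i> \<i> z) - dot n (sff n f 1 \<i> z) (sff n f 1 \<i> z)" for z
  let ?K = "\<lambda>v w v' w' z. dot n (pd v (pd w f) z) (pd v' (pd w' f) z) - dot n (f z) (pd v (pd w f) z) * dot n (f z) (pd v' (pd w' f) z)
    - chr1 n f v w z * dot n (pd v' (pd w' f) z) (pd 1 f z) - chr2 n f v w z * dot n (pd v' (pd w' f) z) (pd \<i> f z)"
  assume "dot n (sff n f 1 1 z) (sff n f \<i> \<i> z) \<noteq> dot n (sff n f 1 \<i> z) (sff n f 1 \<i> z)"
  hence Kz: "K z \<noteq> 0" by (simp add: K_def)
  have "continuous_on V (\<lambda>z. ?K 1 1 \<i> \<i> z - ?K 1 \<i> 1 \<i> z)"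
    by (rule Ck_on_continuous[of 0])
      (intro Ck_on_diff Ck_on_mult smooth_family_dot_Ck smooth_family_pd s coef_Ck[OF f] opV)
  hence Kc: "continuous_on V K"
    by (rule continuous_on_cong[THEN iffD1, rotated 2, OF _ refl]) (simp add: K_def immersed_nrm_nrm[OF f])
  define W where "W = V \<inter> K -` (- {0})"
  have W: "open W" "z \<in> W" "W \<subseteq> V"
    using Kz z continuous_open_preimage[OF Kc opV, of "- {0}"] by (auto simp: W_def)
  have ab: "al y = 0 \<and> be y = 0" if "y \<in> W" for y
    using cone_gauss[of y] that by (auto simp: W_def K_def)
  have bf: "dot n x b = dot n (f y) b * dot n x (f y)" if "y \<in> W" for x y
    using cone_split[of y x] ab[OF that] that W(3) by auto
  \<comment> \<open>Pairing with this tangent vector isolates \<open>b . f\<close> times its squared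
    length, which is positive.\<close>
  let ?x = "pd 1 f z"
  have "((\<lambda>y. dot n (f y) b * dot n ?x (f y)) has_derivative (\<lambda>v. dot n (f z) b * dot n ?x (pd v f z)
       + pderiv_at (\<lambda>z. dot n (f z) b) z v * dot n ?x (f z))) (at z)" (is "(?h has_derivative ?d) _")
    by (intro has_derivative_mult dot_const_deriv[OF s z] Ck_has_derivative[OF _ z] smooth_family_dot_Ck s smooth_family_const opV)
  moreover have "(?h has_derivative (\<lambda>v. 0)) (at z)"
    by (rule has_derivative_cong_open[OF W(1,2), THEN iffD1, OF _ has_derivative_const[of "dot n ?x b"]]) (rule bf)
  ultimately have "?d = (\<lambda>v. 0)" by (rule has_derivative_unique)
  hence "?d 1 = 0" by (rule fun_cong)
  hence "dot n (f z) b = 0"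
    using immersed_E_pos[OF f z] immersedD(3)[OF f z, of 1] by (simp add: dot_commute[of n ?x "f z"])
  moreover have "dot n b b = dot n (f z) b * dot n b (f z)" by (rule bf[OF W(2)])
  ultimately have "dot n b b = 0" by (simp only: mult_zero_left)
  thus False using b unfolding dot_self_eq_0_iff by blast
qed

end

text \<open>When both second fundamental forms vanish, the second derivatives of the two maps are
  the same linear combinations of their 1-jets, with coefficients given by the common metric. So
  \<open>l\<close> solves a linear second order system, and \<open>one_jet_vanishes\<close>
  applies.\<close>

lemma flat_jet_vanishes:
  assumes f: "immersed V n f" and g: "immersed V m g" and s: "same_metric V n f m g"
    and ff: "\<And>z. z \<in> V \<Longrightarrow> flat_at n f z" and fg: "\<And>z. z \<in> V \<Longrightarrow> flat_at m g z"
    and l: "l = (\<lambda>z. dot n x (f z) + dot m y (g z))" and z: "z0 \<in> V"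
    and j: "l z0 = 0" "\<And>v. dot n x (pd v f z0) + dot m y (pd v g z0) = 0"
  shows "\<exists>R>0. \<forall>z\<in>ball z0 R. z \<in> V \<and> l z = 0"
proof -
  note sf = immersedD(1)[OF f] and sg = immersedD(1)[OF g]
  have opV: "open V" using smooth_family_open[OF sf] .
  have lk: "Ck_on k V l" for k
    unfolding l by (intro Ck_on_add smooth_family_dot_Ck smooth_family_const sf sg opV)
  have l1: "pderiv_at l z v = dot n x (pd v f z) + dot m y (pd v g z)" if "z \<in> V" for z v
    unfolding l using frechet_derivative_eqI[OF has_derivative_add[OF dot_const_deriv[OF sf that] dot_const_deriv[OF sg that]]] by simp
  have l2: "pderiv_at (\<lambda>z. pderiv_at l z w) z v = dot n x (pd v (pd w f) z) + dot m y (pd v (pd w g) z)" if "z \<in> V" for z v w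
  proof -
    have "pderiv_at (\<lambda>z. pderiv_at l z w) z v = pderiv_at (\<lambda>z. dot n x (pd w f z) + dot m y (pd w g z)) z v"
      by (subst frechet_derivative_cong_open[OF opV that]) (auto simp: l1)
    thus ?thesis
      using frechet_derivative_eqI[OF has_derivative_add[OF dot_const_deriv[OF smooth_family_pd[OF sf] that] dot_const_deriv[OF smooth_family_pd[OF sg] that]]] by simp
  qed
  have sm: "dot m (pd v g z) (pd w g z) = dot n (pd v f z) (pd w f z)" if "z \<in> V" for v w z
    using s that unfolding same_metric_def by simp
  have flat: "pderiv_at (\<lambda>z. pderiv_at l z w) z v = - dot n (pd v f z) (pd w f z) * l z + chr1 n f v w z * pderiv_at l z 1 + chr2 n f v w z * pderiv_at l z \<i>"
    if z: "z \<in> V" and vw: "v \<in> {1, \<i>}" "w \<in> {1, \<i>}" for z v w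
  proof -
    have "dot n x (pd v (pd w f) z) = dot n x (\<lambda>i. - dot n (pd v f z) (pd w f z) * f z i + chr1 n f v w z * pd 1 f z i + chr2 n f v w z * pd \<i> f z i)"
      by (rule dot_cong) (use flat_second_deriv[OF f z ff[OF z] vw] in auto)
    moreover have "dot m y (pd v (pd w g) z) = dot m y (\<lambda>i. - dot n (pd v f z) (pd w f z) * g z i + chr1 n f v w z * pd 1 g z i + chr2 n f v w z * pd \<i> g z i)"
      by (rule dot_cong) (use flat_second_deriv[OF g z fg[OF z] vw] in \<open>auto simp: sm[OF z] same_metric_coef[OF f g s z]\<close>)
    ultimately show ?thesis unfolding l2[OF z] dot_linear l1[OF z] by (simp add: l algebra_simps)
  qed
  obtain R where R: "R > 0" "cball z0 R \<subseteq> V" using opV z open_contains_cball by blast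
  have "\<exists>B. \<forall>z\<in>cball z0 R. \<bar>h z\<bar> \<le> B" if "continuous_on V h" for h :: "complex \<Rightarrow> real"
  proof -
    have "compact (h ` cball z0 R)"
      using continuous_on_subset[OF that R(2)] by (intro compact_continuous_image compact_cball)
    thus ?thesis using compact_imp_bounded[of "h ` cball z0 R"] unfolding bounded_iff by auto
  qed
  hence bd: "\<exists>B. \<forall>z\<in>cball z0 R. \<bar>h z\<bar> \<le> B" if "Ck_on 0 V h" for h :: "complex \<Rightarrow> real" using that by simp
  have "\<exists>B. \<forall>z\<in>cball z0 R. \<bar>dot n (pd v f z) (pd w f z)\<bar> \<le> B" for v w
    by (rule bd) (intro smooth_family_dot_Ck smooth_family_pd sf)
  then obtain B1 where B1: "\<And>v w z. z \<in> cball z0 R \<Longrightarrow> \<bar>dot n (pd v f z) (pd w f z)\<bar> \<le> B1 v w" by metis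
  have "\<exists>B. \<forall>z\<in>cball z0 R. \<bar>chr1 n f v w z\<bar> \<le> B" for v w
    by (rule bd) (intro coef_Ck[OF f] smooth_family_pd sf)
  then obtain B2 where B2: "\<And>v w z. z \<in> cball z0 R \<Longrightarrow> \<bar>chr1 n f v w z\<bar> \<le> B2 v w" by metis
  have "\<exists>B. \<forall>z\<in>cball z0 R. \<bar>chr2 n f v w z\<bar> \<le> B" for v w
    by (rule bd) (intro coef_Ck[OF f] smooth_family_pd sf)
  then obtain B3 where B3: "\<And>v w z. z \<in> cball z0 R \<Longrightarrow> \<bar>chr2 n f v w z\<bar> \<le> B3 v w" by metis
  \<comment> \<open>One constant that dominates all coefficients for all pairs of basis
    directions.\<close>
  define C where "C = (\<Sum>v\<in>{1, \<i>}. \<Sum>w\<in>{1, \<i>}. \<bar>B1 v w\<bar> + \<bar>B2 v w\<bar> + \<bar>B3 v w\<bar>)"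
  have C0: "C \<ge> 0" unfolding C_def by (intro sum_nonneg) auto
  have CB: "\<bar>B1 v w\<bar> + \<bar>B2 v w\<bar> + \<bar>B3 v w\<bar> \<le> C" if "v \<in> {1, \<i>}" "w \<in> {1, \<i>}" for v w
  proof -
    have "\<bar>B1 v w\<bar> + \<bar>B2 v w\<bar> + \<bar>B3 v w\<bar> \<le> (\<Sum>w\<in>{1, \<i>}. \<bar>B1 v w\<bar> + \<bar>B2 v w\<bar> + \<bar>B3 v w\<bar>)"
      by (rule member_le_sum[OF that(2)]) auto
    also have "\<dots> \<le> C" unfolding C_def
      by (rule member_le_sum[where f = "\<lambda>v. \<Sum>w\<in>{1, \<i>}. \<bar>B1 v w\<bar> + \<bar>B2 v w\<bar> + \<bar>B3 v w\<bar>", OF that(1)]) (auto intro!: sum_nonneg)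
    finally show ?thesis .
  qed
  have "l z = 0" if zb: "z \<in> ball z0 R" for z
  proof (rule one_jet_vanishes[of z0 R l C z, OF _ C0 _ j(1) _ _ zb])
    have bV: "ball z0 R \<subseteq> V" using R(2) ball_subset_cball by blast
    show "Ck_on 2 (ball z0 R) l" by (rule Ck_on_subset[OF lk bV])
    show "pderiv_at l z0 1 = 0" "pderiv_at l z0 \<i> = 0" using l1[OF z] j(2) by simp_all
    fix z v w assume z: "z \<in> ball z0 R" and vw: "v \<in> {1, \<i>}" "w \<in> {1, \<i>::complex}"
    have zc: "z \<in> cball z0 R" "z \<in> V" using z bV by auto
    have le: "\<bar>b\<bar> \<le> C" if "\<bar>b\<bar> \<le> B1 v w \<or> \<bar>b\<bar> \<le> B2 v w \<or> \<bar>b\<bar> \<le> B3 v w" for b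
      using that CB[OF vw] by linarith
    have "\<bar>pderiv_at (\<lambda>z. pderiv_at l z w) z v\<bar> \<le> \<bar>dot n (pd v f z) (pd w f z)\<bar> * \<bar>l z\<bar> + \<bar>chr1 n f v w z\<bar> * \<bar>pderiv_at l z 1\<bar> + \<bar>chr2 n f v w z\<bar> * \<bar>pderiv_at l z \<i>\<bar>"
    proof -
      have "\<bar>- a * b + c * d + e * h\<bar> \<le> \<bar>a\<bar> * \<bar>b\<bar> + \<bar>c\<bar> * \<bar>d\<bar> + \<bar>e\<bar> * \<bar>h\<bar>" for a b c d e h :: real
        unfolding abs_mult[symmetric] by linarith
      thus ?thesis unfolding flat[OF zc(2) vw] .
    qed
    also have "\<dots> \<le> C * \<bar>l z\<bar> + C * \<bar>pderiv_at l z 1\<bar> + C * \<bar>pderiv_at l z \<i>\<bar>"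
      using B1[OF zc(1)] B2[OF zc(1)] B3[OF zc(1)] by (intro add_mono mult_right_mono le) auto
    finally show "\<bar>pderiv_at (\<lambda>z. pderiv_at l z w) z v\<bar> \<le> C * (\<bar>l z\<bar> + \<bar>pderiv_at l z 1\<bar> + \<bar>pderiv_at l z \<i>\<bar>)"
      by (simp add: algebra_simps)
  qed
  thus ?thesis using R ball_subset_cball by (intro exI[of _ R]) auto
qed

section \<open>Flat maps of the surface\<close>

definition loc :: "'a chart \<Rightarrow> ('a \<Rightarrow> nat \<Rightarrow> real) \<Rightarrow> complex \<Rightarrow> nat \<Rightarrow> real" where
  "loc X \<Phi> z i = \<Phi> (param X z) i"

definition df :: "('a::t2_space \<Rightarrow> nat \<Rightarrow> real) \<Rightarrow> 'a chart \<Rightarrow> 'a \<Rightarrow> complex \<Rightarrow> nat \<Rightarrow> real" where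
  "df \<Phi> X p v i = cdiff (\<lambda>p. \<Phi> p i) X p v"

lemma pd_loc: "pd v (loc X \<Phi>) (coord X p) = df \<Phi> X p v"
  by (rule ext) (simp add: pd_def loc_def df_def cdiff_def o_def)

context conformal_surface
begin

definition smap :: "nat \<Rightarrow> ('a \<Rightarrow> nat \<Rightarrow> real) \<Rightarrow> bool" where
  "smap n \<Phi> \<longleftrightarrow> (\<forall>i\<le>n. \<forall>X\<in>smooth_charts A. \<forall>k. Ck_on k (im_ch X) (\<lambda>z. \<Phi> (param X z) i)) \<and>
     (\<forall>p. dot n (\<Phi> p) (\<Phi> p) = 1)"

text \<open>The finite exceptional set \<open>P\<close> is a parameter, so that two maps can be
  compared off a common set.\<close>

definition imm_off :: "'a set \<Rightarrow> nat \<Rightarrow> ('a \<Rightarrow> nat \<Rightarrow> real) \<Rightarrow> bool" where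
  "imm_off P n \<Phi> \<longleftrightarrow> finite P \<and> smap n \<Phi> \<and> (\<forall>p. p \<notin> P \<longrightarrow> (\<forall>X\<in>charts_at A p.
     dot n (df \<Phi> X p 1) (df \<Phi> X p 1) * dot n (df \<Phi> X p \<i>) (df \<Phi> X p \<i>) - (dot n (df \<Phi> X p 1) (df \<Phi> X p \<i>))\<^sup>2 > 0))"

definition flat_off :: "'a set \<Rightarrow> nat \<Rightarrow> ('a \<Rightarrow> nat \<Rightarrow> real) \<Rightarrow> bool" where
  "flat_off P n \<Phi> \<longleftrightarrow> imm_off P n \<Phi> \<and> (\<forall>p. p \<notin> P \<longrightarrow> (\<forall>X\<in>charts_at A p. flat_at n (loc X \<Phi>) (coord X p)))"

definition same_pull :: "nat \<Rightarrow> ('a \<Rightarrow> nat \<Rightarrow> real) \<Rightarrow> nat \<Rightarrow> ('a \<Rightarrow> nat \<Rightarrow> real) \<Rightarrow> bool" where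
  "same_pull n \<Phi> m \<Psi> \<longleftrightarrow> (\<forall>p. \<forall>X\<in>charts_at A p. \<forall>v w.
     dot n (df \<Phi> X p v) (df \<Phi> X p w) = dot m (df \<Psi> X p v) (df \<Psi> X p w))"

lemma smap_family: "smap n \<Phi> \<Longrightarrow> X \<in> smooth_charts A \<Longrightarrow> smooth_family (im_ch X) n (loc X \<Phi>)"
  unfolding smap_def smooth_family_def loc_def using im_open by blast

lemma smap_C1: "smap n \<Phi> \<Longrightarrow> i \<le> n \<Longrightarrow> (\<lambda>p. \<Phi> p i) \<in> C1"
  unfolding smap_def C1_def o_def by blast

lemma smap_immersion: "branched_minimal_immersion A c n \<Phi> \<Longrightarrow> smap n \<Phi>"
  unfolding smap_def using immersion_Ck immersion_unit(1) by blast

lemma dot_cdiff: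
  assumes s: "smap n \<Phi>" and k: "X \<in> charts_at A p"
  shows "((\<lambda>z. dot n x (\<Phi> (param X z))) has_derivative (\<lambda>v. dot n x (df \<Phi> X p v))) (at (coord X p))"
  using dot_const_deriv[OF smap_family[OF s charts_atD(1)[OF k]] coord_in[OF charts_atD(2)[OF k]], of x, unfolded pd_loc]
  unfolding loc_def[abs_def] .

lemma off_open:
  assumes P: "finite P" and k: "X \<in> smooth_charts A"
  shows "open {z \<in> im_ch X. param X z \<notin> P}"
proof -
  note ck = is_chart[OF k]
  have "open (coord X ` (dom_ch X \<inter> - P))"
    by (rule chart_image_open[OF ck open_Compl[OF finite_imp_closed[OF P]]])
  moreover have "coord X ` (dom_ch X \<inter> - P) = {z \<in> im_ch X. param X z \<notin> P}"
  proof (intro subset_antisym subsetI)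
    fix z assume "z \<in> coord X ` (dom_ch X \<inter> - P)"
    then obtain p where p: "p \<in> dom_ch X" "p \<notin> P" "z = coord X p" by blast
    thus "z \<in> {z \<in> im_ch X. param X z \<notin> P}" using chart_param_coord[OF ck p(1)] by simp
  next
    fix z assume z: "z \<in> {z \<in> im_ch X. param X z \<notin> P}"
    hence "z = coord X (param X z)" "param X z \<in> dom_ch X \<inter> - P"
      using chart_coord_param[of z X] chart_param_dom[of z X] by auto
    thus "z \<in> coord X ` (dom_ch X \<inter> - P)" by (rule image_eqI)
  qed
  ultimately show ?thesis by simp
qed

lemma imm_off_immersed:
  assumes i: "imm_off P n \<Phi>" and k: "X \<in> smooth_charts A"
  shows "immersed {z \<in> im_ch X. param X z \<notin> P} n (loc X \<Phi>)"
  unfolding immersed_def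
proof (intro conjI ballI)
  have s: "smap n \<Phi>" and P: "finite P" using i unfolding imm_off_def by blast+
  show "smooth_family {z \<in> im_ch X. param X z \<notin> P} n (loc X \<Phi>)"
    by (rule smooth_family_subset[OF smap_family[OF s k] off_open[OF P k]]) blast
  fix z assume z: "z \<in> {z \<in> im_ch X. param X z \<notin> P}"
  show "dot n (loc X \<Phi> z) (loc X \<Phi> z) = 1" using s unfolding smap_def loc_def[abs_def] by blast
  have ka: "X \<in> charts_at A (param X z)" using k chart_param_dom[of z X] z by (intro charts_atI) auto
  have e: "pd v (loc X \<Phi>) z = df \<Phi> X (param X z) v" for v
    using pd_loc[of v X \<Phi> "param X z"] chart_coord_param[of z X] z by simp
  show "dot n (pd 1 (loc X \<Phi>) z) (pd 1 (loc X \<Phi>) z) * dot n (pd \<i> (loc X \<Phi>) z) (pd \<i> (loc X \<Phi>) z) - (dot n (pd 1 (loc X \<Phi>) z) (pd \<i> (loc X \<Phi>) z))\<^sup>2 > 0"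
    unfolding e using i ka z unfolding imm_off_def by blast
qed

lemma same_pull_chart:
  assumes "same_pull n \<Phi> m \<Psi>" "X \<in> smooth_charts A"
  shows "same_metric {z \<in> im_ch X. param X z \<notin> P} n (loc X \<Phi>) m (loc X \<Psi>)"
  unfolding same_metric_def
proof (intro ballI allI)
  fix z v w assume z: "z \<in> {z \<in> im_ch X. param X z \<notin> P}"
  have ka: "X \<in> charts_at A (param X z)" using assms(2) chart_param_dom[of z X] z by (intro charts_atI) auto
  have e: "pd v (loc X F) z = df F X (param X z) v" for v F
    using pd_loc[of v X F "param X z"] chart_coord_param[of z X] z by simp
  show "dot n (pd v (loc X \<Phi>) z) (pd w (loc X \<Phi>) z) = dot m (pd v (loc X \<Psi>) z) (pd w (loc X \<Psi>) z)"
    unfolding e using assms(1) ka unfolding same_pull_def by blast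
qed

lemma flat_off_chart:
  assumes "flat_off P n \<Phi>" "X \<in> smooth_charts A" "z \<in> {z \<in> im_ch X. param X z \<notin> P}"
  shows "flat_at n (loc X \<Phi>) z"
proof -
  have ka: "X \<in> charts_at A (param X z)" using assms(2,3) chart_param_dom[of z X] by (intro charts_atI) auto
  hence "flat_at n (loc X \<Phi>) (coord X (param X z))" using assms(1,3) unfolding flat_off_def by blast
  thus ?thesis using chart_coord_param[of z X] assms(3) by simp
qed

lemma chart_preimage_open:
  assumes k: "X \<in> smooth_charts A" and W: "open W"
  shows "open (dom_ch X \<inter> coord X -` W)"
  by (rule continuous_open_preimage[OF chart_open(3)[OF is_chart[OF k]] chart_open(1)[OF is_chart[OF k]] W])

lemma closure_zero:
  assumes k: "X \<in> charts_at A q" and h: "continuous_on (im_ch X) h" and q: "q \<in> closure Z"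
    and z: "\<And>p. p \<in> Z \<Longrightarrow> p \<in> dom_ch X \<Longrightarrow> h (coord X p) = (0::real)"
  shows "h (coord X q) = 0"
proof (rule ccontr)
  assume nz: "h (coord X q) \<noteq> 0"
  note k' = charts_atD(1)[OF k] and qd = charts_atD(2)[OF k]
  let ?W = "im_ch X \<inter> h -` (- {0})"
  have "open ?W" by (rule continuous_open_preimage[OF h im_open[OF k']]) (simp add: open_Compl)
  hence "open (dom_ch X \<inter> coord X -` ?W)" by (rule chart_preimage_open[OF k'])
  moreover have "q \<in> dom_ch X \<inter> coord X -` ?W" using qd coord_in[OF qd] nz by simp
  ultimately obtain p where "p \<in> Z" "p \<in> dom_ch X \<inter> coord X -` ?W"
    using q unfolding closure_iff_nhds_not_empty by blast
  thus False using z[of p] by simp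
qed

section \<open>Unique continuation on the surface\<close>

context
  fixes P n \<Phi> m \<Psi> and x y :: "nat \<Rightarrow> real"
  assumes ff: "flat_off P n \<Phi>" and fg: "flat_off P m \<Psi>" and sp: "same_pull n \<Phi> m \<Psi>"
begin

abbreviation ell where "ell p \<equiv> dot n x (\<Phi> p) + dot m y (\<Psi> p)"
abbreviation ell1 where "ell1 X p v \<equiv> dot n x (df \<Phi> X p v) + dot m y (df \<Psi> X p v)"

lemma ell_maps: "imm_off P n \<Phi>" "imm_off P m \<Psi>" "smap n \<Phi>" "smap m \<Psi>" "finite P"
  using ff fg unfolding flat_off_def imm_off_def by blast+

lemma ell_deriv:
  assumes k: "X \<in> charts_at A p"
  shows "((\<lambda>z. ell (param X z)) has_derivative ell1 X p) (at (coord X p))"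
  by (rule has_derivative_add[OF dot_cdiff[OF ell_maps(3) k] dot_cdiff[OF ell_maps(4) k]])

lemma ell_Ck: "X \<in> smooth_charts A \<Longrightarrow> Ck_on k (im_ch X) (\<lambda>z. ell (param X z))"
  using Ck_on_add[OF im_open smooth_family_dot_Ck[OF smooth_family_const smap_family[OF ell_maps(3)], OF im_open]
    smooth_family_dot_Ck[OF smooth_family_const smap_family[OF ell_maps(4)], OF im_open], of X k x y]
  unfolding loc_def[abs_def] by blast

lemma jet_local:
  assumes p: "p \<notin> P" and k: "X \<in> charts_at A p" and l: "ell p = 0" and l1: "\<And>v. ell1 X p v = 0"
  shows "\<exists>U. open U \<and> p \<in> U \<and> (\<forall>q\<in>U. ell q = 0)"
proof -
  note k' = charts_atD(1)[OF k] and pd = charts_atD(2)[OF k]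
  note pc = chart_param_coord[OF is_chart[OF k']]
  let ?V = "{z \<in> im_ch X. param X z \<notin> P}"
  have z: "coord X p \<in> ?V" using coord_in[OF pd] pc[OF pd] p by simp
  have "\<exists>R>0. \<forall>z\<in>ball (coord X p) R. z \<in> ?V \<and> dot n x (loc X \<Phi> z) + dot m y (loc X \<Psi> z) = 0"
  proof (rule flat_jet_vanishes[OF imm_off_immersed[OF ell_maps(1) k'] imm_off_immersed[OF ell_maps(2) k']
      same_pull_chart[OF sp k'] flat_off_chart[OF ff k'] flat_off_chart[OF fg k'] refl z])
    show "dot n x (loc X \<Phi> (coord X p)) + dot m y (loc X \<Psi> (coord X p)) = 0"
      using l unfolding loc_def[abs_def] pc[OF pd] .
    show "dot n x (pd v (loc X \<Phi>) (coord X p)) + dot m y (pd v (loc X \<Psi>) (coord X p)) = 0" for v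
      unfolding pd_loc by (rule l1)
  qed
  then obtain R where R: "R > 0" "\<And>z. z \<in> ball (coord X p) R \<Longrightarrow> dot n x (loc X \<Phi> z) + dot m y (loc X \<Psi> z) = 0" by blast
  let ?U = "dom_ch X \<inter> coord X -` ball (coord X p) R"
  have "ell q = 0" if q: "q \<in> ?U" for q
    using R(2)[of "coord X q"] pc[of q] q unfolding loc_def[abs_def] by simp
  moreover have "open ?U" by (rule chart_preimage_open[OF k' open_ball])
  ultimately show ?thesis using pd R(1) by (intro exI[of _ ?U]) simp
qed

text \<open>The interior of the zero set, to be shown closed as well.\<close>

abbreviation Zset where "Zset \<equiv> interior {p. ell p = 0}"

lemma Zset_zero: "p \<in> Zset \<Longrightarrow> ell p = 0"
  using interior_subset by blast

lemma closure_ell: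
  assumes q: "q \<in> closure Zset"
  shows "ell q = 0"
proof -
  note k = ch[of q] and k' = charts_atD(1)[OF ch[of q]] and qd = charts_atD(2)[OF ch[of q]]
  note pc = chart_param_coord[OF is_chart[OF k']]
  have "ell (param (ch q) (coord (ch q) q)) = 0"
  proof (rule closure_zero[OF k _ q, of "\<lambda>z. ell (param (ch q) z)"])
    show "continuous_on (im_ch (ch q)) (\<lambda>z. ell (param (ch q) z))" by (rule Ck_on_continuous[OF ell_Ck[OF k']])
    show "ell (param (ch q) (coord (ch q) p)) = 0" if "p \<in> Zset" "p \<in> dom_ch (ch q)" for p
      using Zset_zero[OF that(1)] pc[OF that(2)] by simp
  qed
  thus ?thesis unfolding pc[OF qd] .
qed

text \<open>At a limit point \<open>ell\<close> and its differential vanish by continuity, and off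
  \<open>P\<close> a vanishing 1-jet spreads to a neighbourhood.\<close>

lemma closure_regular:
  assumes q: "q \<in> closure Zset" and qP: "q \<notin> P"
  shows "q \<in> Zset"
proof -
  note k = ch[of q] and k' = charts_atD(1)[OF ch[of q]] and qd = charts_atD(2)[OF ch[of q]]
  note pc = chart_param_coord[OF is_chart[OF k']]
  let ?h = "\<lambda>z. ell (param (ch q) z)"
  have d: "Ck_on (Suc 0) (im_ch (ch q)) ?h" by (rule ell_Ck[OF k'])
  have "pderiv_at ?h (coord (ch q) q) v = 0" for v
  proof (rule closure_zero[OF k _ q, of "\<lambda>z. pderiv_at ?h z v"])
    show "continuous_on (im_ch (ch q)) (\<lambda>z. pderiv_at ?h z v)" using Ck_on_SucD(2)[OF d] by simp
    fix p assume p: "p \<in> Zset" "p \<in> dom_ch (ch q)"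
    let ?W = "coord (ch q) ` (dom_ch (ch q) \<inter> Zset)"
    have W: "open ?W" by (rule chart_image_open[OF is_chart[OF k'] open_interior])
    have "pderiv_at ?h (coord (ch q) p) = pderiv_at (\<lambda>z. 0) (coord (ch q) p)"
    proof (rule frechet_derivative_cong_open[OF W])
      show "coord (ch q) p \<in> ?W" using p by blast
      fix z assume "z \<in> ?W"
      then obtain p' where "p' \<in> dom_ch (ch q)" "p' \<in> Zset" "z = coord (ch q) p'" by blast
      thus "?h z = 0" using Zset_zero[of p'] pc[of p'] by simp
    qed
    thus "pderiv_at ?h (coord (ch q) p) v = 0" by simp
  qed
  hence "ell1 (ch q) q v = 0" for v using frechet_derivative_eqI[OF ell_deriv[OF k]] by metis
  from jet_local[OF qP k closure_ell[OF q] this]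
  obtain U where "open U" "q \<in> U" "U \<subseteq> {p. ell p = 0}" by blast
  thus ?thesis by (rule interiorI)
qed

text \<open>What remains are points of \<open>P\<close>. A small punctured disc around such a point
  avoids \<open>P\<close> and is connected; \<open>Zset\<close> is open and relatively closed in it
  and meets it, so it fills the disc.\<close>

lemma closure_all:
  assumes q: "q \<in> closure Zset"
  shows "q \<in> Zset"
proof (rule ccontr)
  assume qZ: "q \<notin> Zset"
  note k = ch[of q] and k' = charts_atD(1)[OF ch[of q]] and qd = charts_atD(2)[OF ch[of q]]
  let ?k = "ch q"
  note ck = is_chart[OF k']
  note pc = chart_param_coord[OF ck]
  have oV: "open {z \<in> im_ch ?k. param ?k z \<notin> P - {q}}" by (rule off_open[OF _ k']) (simp add: ell_maps(5))
  have "coord ?k q \<in> {z \<in> im_ch ?k. param ?k z \<notin> P - {q}}" using coord_in[OF qd] pc[OF qd] by simp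
  then obtain R where R: "R > 0" "ball (coord ?k q) R \<subseteq> {z \<in> im_ch ?k. param ?k z \<notin> P - {q}}"
    using oV open_contains_ball by blast
  let ?B = "ball (coord ?k q) R"
  let ?S = "?B - {coord ?k q}"
  let ?U = "dom_ch ?k \<inter> coord ?k -` ?B"
  have U: "open ?U" "q \<in> ?U" using chart_preimage_open[OF k' open_ball] qd R(1) by auto
  have US: "p = q \<or> p \<in> param ?k ` ?S" if "p \<in> ?U" for p
  proof (cases "coord ?k p = coord ?k q")
    case True
    have "p = param ?k (coord ?k p)" using pc[of p] that by simp
    also have "\<dots> = q" unfolding True by (rule pc[OF qd])
    finally show ?thesis by simp
  next
    case False
    have "p = param ?k (coord ?k p)" using pc[of p] that by simp
    moreover have "coord ?k p \<in> ?S" using that False by simp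
    ultimately show ?thesis by blast
  qed
  let ?T = "param ?k ` ?S"
  have TP: "p \<notin> P" if pT: "p \<in> ?T" for p
  proof -
    obtain z where z: "z \<in> ?S" "p = param ?k z" using pT by blast
    hence zi: "z \<in> im_ch ?k" "p \<notin> P - {q}" using R(2) by auto
    have "p \<noteq> q" using chart_coord_param[OF zi(1)] z by auto
    thus ?thesis using zi(2) by blast
  qed
  have "connected ?S" by (rule connected_punctured_ball) simp
  moreover have "continuous_on ?S (param ?k)"
    by (rule continuous_on_subset[OF chart_open(4)[OF ck]]) (use R(2) in blast)
  ultimately have cT: "connected ?T" by (intro connected_continuous_image)
  have "?T \<subseteq> Zset \<union> - closure Zset" using closure_regular TP by blast
  hence "Zset \<inter> ?T = {} \<or> - closure Zset \<inter> ?T = {}"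
    using connectedD[OF cT open_interior open_Compl[OF closed_closure], of "{p. ell p = 0}" Zset] closure_subset[of Zset] by blast
  moreover have "Zset \<inter> ?T \<noteq> {}"
  proof -
    obtain p where "p \<in> Zset" "p \<in> ?U" using q U unfolding closure_iff_nhds_not_empty by blast
    thus ?thesis using US[of p] qZ by blast
  qed
  ultimately have "?T \<subseteq> Zset" using closure_regular TP by blast
  hence "?U \<subseteq> {p. ell p = 0}" using US Zset_zero closure_ell[OF q] by blast
  hence "q \<in> Zset" using U by (intro interiorI)
  thus False using qZ by simp
qed

text \<open>\<open>Zset\<close> is nonempty by \<open>jet_local\<close>, open and closed, and the
  surface is connected.\<close>

lemma unique_continuation:
  assumes p: "p \<notin> P" and k: "X \<in> charts_at A p" and l: "ell p = 0" and l1: "\<And>v. ell1 X p v = 0"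
  shows "ell q = 0"
proof -
  obtain U where "open U" "p \<in> U" "U \<subseteq> {p. ell p = 0}" using jet_local[OF assms] by blast
  hence pZ: "p \<in> Zset" by (rule interiorI)
  have "open (- Zset)"
  proof -
    have "closure Zset = Zset" using closure_all closure_subset by blast
    thus ?thesis using closed_closure[of Zset] by (metis open_Compl)
  qed
  hence "Zset \<inter> UNIV = {} \<or> - Zset \<inter> UNIV = {}"
    by (intro connectedD[OF connected_surface open_interior]) auto
  thus ?thesis using pZ Zset_zero[of q] by blast
qed

end

section \<open>Harmonicity and the second fundamental form\<close>

lemma sqrt_differentiable:
  fixes h :: "complex \<Rightarrow> real"
  assumes "h differentiable (at z)" "h z > 0"
  shows "(\<lambda>z. sqrt (h z)) differentiable (at z)"
  using has_derivative_real_sqrt[OF assms(2) differentiable_has_derivative[OF assms(1)]] by (rule differentiableI)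

lemma chart_pt:
  assumes "X \<in> charts_at A p"
  shows "coord X p \<in> im_ch X" "open (im_ch X)" "param X (coord X p) = p"
  using coord_in[OF charts_atD(2)[OF assms]] im_open[OF charts_atD(1)[OF assms]]
    chart_param_coord[OF is_chart[OF charts_atD(1)[OF assms]] charts_atD(2)[OF assms]] by auto

context
  fixes g :: "'a tensor2" and X p
  assumes g: "riemannian_metric A g" and k: "X \<in> charts_at A p"
begin

text \<open>\<open>lapX\<close> and \<open>lapY\<close> are the two flux components inside
  \<open>laplacian\<close>, named so that their differentiability can be stated.\<close>

definition lapX :: "('a \<Rightarrow> real) \<Rightarrow> complex \<Rightarrow> real" where
  "lapX u z = (g X (param X z) \<i> \<i> * pderiv_at (u \<circ> param X) z 1 - g X (param X z) 1 \<i> * pderiv_at (u \<circ> param X) z \<i>) / sqrt (gram_det g X (param X z))"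

definition lapY :: "('a \<Rightarrow> real) \<Rightarrow> complex \<Rightarrow> real" where
  "lapY u z = (g X (param X z) 1 1 * pderiv_at (u \<circ> param X) z \<i> - g X (param X z) 1 \<i> * pderiv_at (u \<circ> param X) z 1) / sqrt (gram_det g X (param X z))"

lemma laplacian_XY: "laplacian g X u p = - (pderiv_at (lapX u) (coord X p) 1 + pderiv_at (lapY u) (coord X p) \<i>) / sqrt (gram_det g X (param X (coord X p)))"
  by (simp add: laplacian_def lapX_def[abs_def] lapY_def[abs_def] Let_def)

lemmas zi = chart_pt[OF k]

lemma metric_diff: "(\<lambda>z. g X (param X z) v w) differentiable (at (coord X p))"
  by (rule differentiableI[OF Ck_on_SucD(1)[OF metric_Ck[OF g charts_atD(1)[OF k], of "Suc 0"] zi(1)]])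

lemma area_diff: "(\<lambda>z. sqrt (gram_det g X (param X z))) differentiable (at (coord X p))"
  using differentiableI[OF Ck_on_SucD(1)[OF gram_Ck[OF g charts_atD(1)[OF k], of "Suc 0"] zi(1)]]
  by (rule sqrt_differentiable) (simp add: zi(3) metric_pos(2)[OF g k])

lemma area_nz: "sqrt (gram_det g X (param X (coord X p))) \<noteq> 0"
  using metric_pos(2)[OF g k] zi(3) by simp

lemma pderiv_diff:
  assumes "Ck_on 2 (im_ch X) (u \<circ> param X)"
  shows "(\<lambda>z. pderiv_at (u \<circ> param X) z v) differentiable (at (coord X p))"
proof -
  have "Ck_on (Suc (Suc 0)) (im_ch X) (u \<circ> param X)" using assms by (simp add: numeral_2_eq_2)
  from Ck_on_SucD(1)[OF Ck_on_SucD(2)[OF this] zi(1)] show ?thesis by (rule differentiableI)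
qed

lemma lapXY_diff:
  assumes "Ck_on 2 (im_ch X) (u \<circ> param X)"
  shows "lapX u differentiable (at (coord X p))" "lapY u differentiable (at (coord X p))"
  unfolding lapX_def[abs_def] lapY_def[abs_def]
  by (intro differentiable_divide differentiable_diff differentiable_mult metric_diff area_diff area_nz pderiv_diff[OF assms])+

lemma laplacian_sum:
  assumes U: "\<And>i. i \<le> (n::nat) \<Longrightarrow> Ck_on 2 (im_ch X) (U i \<circ> param X)"
  shows "laplacian g X (\<lambda>q. \<Sum>i\<le>n. x i * U i q) p = (\<Sum>i\<le>n. x i * laplacian g X (U i) p)"
proof -
  have d: "pderiv_at ((\<lambda>q. \<Sum>i\<le>n. x i * U i q) \<circ> param X) z v = (\<Sum>i\<le>n. x i * pderiv_at (U i \<circ> param X) z v)" if z: "z \<in> im_ch X" for z v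
  proof -
    have "((\<lambda>z. \<Sum>i\<le>n. x i * (U i \<circ> param X) z) has_derivative (\<lambda>v. \<Sum>i\<le>n. x i * pderiv_at (U i \<circ> param X) z v)) (at z)"
    proof (intro has_derivative_sum has_derivative_mult_right)
      fix i assume "i \<in> {..n}"
      hence "Ck_on (Suc 1) (im_ch X) (U i \<circ> param X)" using U[of i] by (simp add: numeral_2_eq_2)
      thus "(U i \<circ> param X has_derivative pderiv_at (U i \<circ> param X) z) (at z)" by (rule Ck_on_SucD(1)[OF _ z])
    qed
    from frechet_derivative_eqI[OF this] show ?thesis by (simp add: o_def)
  qed
  have X: "lapX (\<lambda>q. \<Sum>i\<le>n. x i * U i q) z = (\<Sum>i\<le>n. x i * lapX (U i) z)" if "z \<in> im_ch X" for z
    unfolding lapX_def d[OF that] by (simp add: sum_distrib_left sum_subtractf[symmetric] sum_divide_distrib algebra_simps)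
  have Y: "lapY (\<lambda>q. \<Sum>i\<le>n. x i * U i q) z = (\<Sum>i\<le>n. x i * lapY (U i) z)" if "z \<in> im_ch X" for z
    unfolding lapY_def d[OF that] by (simp add: sum_distrib_left sum_subtractf[symmetric] sum_divide_distrib algebra_simps)
  have S: "pderiv_at (\<lambda>z. \<Sum>i\<le>n. x i * H i z) (coord X p) v = (\<Sum>i\<le>n. x i * pderiv_at (H i) (coord X p) v)"
    if "\<And>i. i \<le> n \<Longrightarrow> H i differentiable (at (coord X p))" for H v
  proof -
    have "((\<lambda>z. \<Sum>i\<le>n. x i * H i z) has_derivative (\<lambda>v. \<Sum>i\<le>n. x i * pderiv_at (H i) (coord X p) v)) (at (coord X p))"
      using that by (intro has_derivative_sum has_derivative_mult_right differentiable_has_derivative) auto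
    from frechet_derivative_eqI[OF this] show ?thesis by simp
  qed
  have cX: "pderiv_at (lapX (\<lambda>q. \<Sum>i\<le>n. x i * U i q)) (coord X p) = pderiv_at (\<lambda>z. \<Sum>i\<le>n. x i * lapX (U i) z) (coord X p)"
    by (rule frechet_derivative_cong_open[OF zi(2,1) X])
  have cY: "pderiv_at (lapY (\<lambda>q. \<Sum>i\<le>n. x i * U i q)) (coord X p) = pderiv_at (\<lambda>z. \<Sum>i\<le>n. x i * lapY (U i) z) (coord X p)"
    by (rule frechet_derivative_cong_open[OF zi(2,1) Y])
  have "pderiv_at (lapX (\<lambda>q. \<Sum>i\<le>n. x i * U i q)) (coord X p) 1 = (\<Sum>i\<le>n. x i * pderiv_at (lapX (U i)) (coord X p) 1)"
    unfolding cX by (rule S) (rule lapXY_diff[OF U])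
  moreover have "pderiv_at (lapY (\<lambda>q. \<Sum>i\<le>n. x i * U i q)) (coord X p) \<i> = (\<Sum>i\<le>n. x i * pderiv_at (lapY (U i)) (coord X p) \<i>)"
    unfolding cY by (rule S) (rule lapXY_diff[OF U])
  ultimately show ?thesis
    unfolding laplacian_XY
    by (simp add: sum_divide_distrib sum.distrib[symmetric] sum_negf[symmetric] algebra_simps)
qed

text \<open>At a critical point the derivatives of the metric are multiplied by zero, and only the
  trace of the Hessian remains.\<close>

lemma laplacian_critical:
  assumes u: "Ck_on 2 (im_ch X) (u \<circ> param X)" and 0: "\<And>v. pderiv_at (u \<circ> param X) (coord X p) v = 0"
    and l: "laplacian g X u p = 0"
  shows "g X p \<i> \<i> * pderiv_at (\<lambda>z. pderiv_at (u \<circ> param X) z 1) (coord X p) 1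
    - g X p 1 \<i> * pderiv_at (\<lambda>z. pderiv_at (u \<circ> param X) z \<i>) (coord X p) 1
    - g X p 1 \<i> * pderiv_at (\<lambda>z. pderiv_at (u \<circ> param X) z 1) (coord X p) \<i>
    + g X p 1 1 * pderiv_at (\<lambda>z. pderiv_at (u \<circ> param X) z \<i>) (coord X p) \<i> = 0" (is "?L = 0")
proof -
  let ?z = "coord X p" and ?u = "\<lambda>v z. pderiv_at (u \<circ> param X) z v" and ?W = "\<lambda>z. sqrt (gram_det g X (param X z))"
  have pr: "pderiv_at (\<lambda>z. (a z * ?u v z - b z * ?u w z) / ?W z) ?z x = (a ?z * pderiv_at (?u v) ?z x - b ?z * pderiv_at (?u w) ?z x) / ?W ?z"
    if a: "a differentiable (at ?z)" and b: "b differentiable (at ?z)" for a b v w x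
  proof -
    note D = differentiable_has_derivative
    have "((\<lambda>z. (a z * ?u v z - b z * ?u w z) / ?W z) has_derivative
      (\<lambda>x. - (a ?z * ?u v ?z - b ?z * ?u w ?z) * (inverse (?W ?z) * pderiv_at ?W ?z x * inverse (?W ?z))
        + (a ?z * pderiv_at (?u v) ?z x + pderiv_at a ?z x * ?u v ?z - (b ?z * pderiv_at (?u w) ?z x + pderiv_at b ?z x * ?u w ?z)) / ?W ?z)) (at ?z)"
      by (intro has_derivative_divide has_derivative_diff has_derivative_mult D[OF a] D[OF b] D[OF pderiv_diff[OF u]] D[OF area_diff] area_nz)
    from frechet_derivative_eqI[OF this] show ?thesis by (simp add: 0)
  qed
  have "pderiv_at (lapX u) ?z 1 + pderiv_at (lapY u) ?z \<i> = ?L / ?W ?z"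
    unfolding lapX_def[abs_def] lapY_def[abs_def] pr[OF metric_diff metric_diff] zi(3)
    by (simp add: diff_divide_distrib add_divide_distrib)
  thus ?thesis using l area_nz unfolding laplacian_XY by simp
qed

end

lemma df_factor:
  assumes "gr \<in> c" "branched_minimal_immersion A c n \<Phi>" "X \<in> charts_at A p"
  shows "dot n (df \<Phi> X p v) (df \<Phi> X p w) = conf_factor gr n \<Phi> p * gr X p v w"
  using factor_chart[OF assms] unfolding df_def[abs_def] .

text \<open>For a normal vector \<open>x\<close> at \<open>p\<close> the height function
  \<open>x . \<Phi>\<close> is critical at \<open>p\<close>, and harmonicity makes its Laplacian
  vanish there because \<open>x\<close> is tangent to the sphere. By conformality, the conclusion is
  \<open>laplacian_critical\<close> times the conformal factor.\<close>

lemma immersion_tracefree: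
  assumes b: "branched_minimal_immersion A c n \<Phi>" and p: "\<not> branch_point A n \<Phi> p" and k: "X \<in> charts_at A p"
  shows "tracefree n (loc X \<Phi>) (coord X p)"
  unfolding tracefree_def
proof (intro allI impI)
  let ?z = "coord X p" and ?f = "loc X \<Phi>"
  fix x assume x: "dot n (?f ?z) x = 0" "dot n (pd 1 ?f ?z) x = 0" "dot n (pd \<i> ?f ?z) x = 0"
  obtain gr where gr: "gr \<in> c" using class_nonempty by blast
  note g = class_metric[OF gr] and k' = charts_atD(1)[OF k] and z = chart_pt[OF k]
  note sf = smap_family[OF smap_immersion[OF b] k']
  let ?u = "\<lambda>q. \<Sum>i\<le>n. x i * \<Phi> q i"
  have h: "harmonic_at A gr n \<Phi> p" using b p gr unfolding branched_minimal_immersion_def by blast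
  have U: "Ck_on 2 (im_ch X) ((\<lambda>q. \<Phi> q i) \<circ> param X)" if "i \<le> n" for i
    using immersion_Ck[OF b that k', of 2] by (simp add: o_def)
  have "(\<Sum>i\<le>n. x i * \<Phi> p i) = 0" using x(1) z(3) by (simp add: dot_def loc_def mult.commute)
  hence "(\<Sum>i\<le>n. x i * laplacian gr X (\<lambda>q. \<Phi> q i) p) = 0" using h k unfolding harmonic_at_def by blast
  hence l: "laplacian gr X ?u p = 0" using laplacian_sum[OF g k U, where x = x] by simp
  have ud: "?u \<circ> param X = (\<lambda>z. dot n x (?f z))" by (simp add: dot_def loc_def o_def fun_eq_iff)
  have d1: "pderiv_at (\<lambda>z. dot n x (?f z)) y v = dot n x (pd v ?f y)" if "y \<in> im_ch X" for y v
    by (rule fun_cong[OF frechet_derivative_eqI[OF dot_const_deriv[OF sf that]]])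
  have c2: "pderiv_at (\<lambda>y. pderiv_at (\<lambda>z. dot n x (?f z)) y w) ?z = pderiv_at (\<lambda>y. dot n x (pd w ?f y)) ?z" for w
    by (rule frechet_derivative_cong_open[OF z(2,1) d1])
  have d2: "pderiv_at (\<lambda>y. pderiv_at (\<lambda>z. dot n x (?f z)) y w) ?z v = dot n x (pd v (pd w ?f) ?z)" for v w
    unfolding c2
    by (rule fun_cong[OF frechet_derivative_eqI[OF dot_const_deriv[OF smooth_family_pd[OF sf] z(1)]]])
  have "Ck_on 2 (im_ch X) (?u \<circ> param X)" unfolding ud
    by (intro smooth_family_dot_Ck sf smooth_family_const z(2))
  moreover have "pderiv_at (?u \<circ> param X) ?z v = 0" for v
  proof -
    have "dot n x (pd v ?f ?z) = 0"
      using x(2,3) frechet_derivative_complex[OF differentiableI[OF dot_const_deriv[OF sf z(1), of x]], of v]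
      unfolding frechet_derivative_eqI[OF dot_const_deriv[OF sf z(1), of x]] by (simp add: dot_commute[of n x])
    thus ?thesis unfolding ud d1[OF z(1)] .
  qed
  ultimately have "gr X p \<i> \<i> * dot n x (pd 1 (pd 1 ?f) ?z) - gr X p 1 \<i> * dot n x (pd 1 (pd \<i> ?f) ?z)
      - gr X p 1 \<i> * dot n x (pd \<i> (pd 1 ?f) ?z) + gr X p 1 1 * dot n x (pd \<i> (pd \<i> ?f) ?z) = 0"
    using laplacian_critical[OF g k _ _ l] unfolding ud d2 by blast
  moreover have "dot n x (pd \<i> (pd 1 ?f) ?z) = dot n x (pd 1 (pd \<i> ?f) ?z)"
    using dot_commuted[OF sf z(1), of \<i> 1 x] by (simp add: dot_commute[of n x])
  ultimately have e: "gr X p \<i> \<i> * dot n x (pd 1 (pd 1 ?f) ?z) - 2 * gr X p 1 \<i> * dot n x (pd 1 (pd \<i> ?f) ?z)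
      + gr X p 1 1 * dot n x (pd \<i> (pd \<i> ?f) ?z) = 0" by simp
  have "conf_factor gr n \<Phi> p * gr X p \<i> \<i> * dot n x (pd 1 (pd 1 ?f) ?z) - 2 * (conf_factor gr n \<Phi> p * gr X p 1 \<i>) * dot n x (pd 1 (pd \<i> ?f) ?z)
      + conf_factor gr n \<Phi> p * gr X p 1 1 * dot n x (pd \<i> (pd \<i> ?f) ?z)
    = conf_factor gr n \<Phi> p * (gr X p \<i> \<i> * dot n x (pd 1 (pd 1 ?f) ?z) - 2 * gr X p 1 \<i> * dot n x (pd 1 (pd \<i> ?f) ?z)
      + gr X p 1 1 * dot n x (pd \<i> (pd \<i> ?f) ?z))" by (simp add: algebra_simps)
  thus "dot n (pd \<i> ?f ?z) (pd \<i> ?f ?z) * dot n x (pd 1 (pd 1 ?f) ?z) - 2 * dot n (pd 1 ?f ?z) (pd \<i> ?f ?z) * dot n x (pd 1 (pd \<i> ?f) ?z)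
     + dot n (pd 1 ?f ?z) (pd 1 ?f ?z) * dot n x (pd \<i> (pd \<i> ?f) ?z) = 0"
    unfolding pd_loc[of 1 X \<Phi> p] pd_loc[of \<i> X \<Phi> p] df_factor[OF gr b k] e by simp
qed

section \<open>Normal vectors\<close>

text \<open>Normality at \<open>p\<close> to the cone over the image, expressed without reference to
  a particular chart.\<close>

definition nv :: "nat \<Rightarrow> ('a \<Rightarrow> nat \<Rightarrow> real) \<Rightarrow> 'a \<Rightarrow> (nat \<Rightarrow> real) \<Rightarrow> bool" where
  "nv n \<Phi> p x \<longleftrightarrow> dot n x (\<Phi> p) = 0 \<and> (\<forall>X\<in>charts_at A p. \<forall>v. dot n x (df \<Phi> X p v) = 0)"

lemma df_complex:
  assumes "smap n \<Phi>" "X \<in> charts_at A p" "i \<le> n"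
  shows "df \<Phi> X p v i = Re v * df \<Phi> X p 1 i + Im v * df \<Phi> X p \<i> i"
  unfolding df_def by (rule linear_complex[OF cdiff_linear[OF smap_C1[OF assms(1,3)] assms(2)]])

lemma nvI:
  assumes s: "smap n \<Phi>" and k: "X \<in> charts_at A p"
    and x: "dot n x (\<Phi> p) = 0" "dot n x (df \<Phi> X p 1) = 0" "dot n x (df \<Phi> X p \<i>) = 0"
  shows "nv n \<Phi> p x"
  unfolding nv_def
proof (intro conjI x(1) ballI allI)
  fix X' v assume k': "X' \<in> charts_at A p"
  have "dot n x (df \<Phi> X' p v) = dot n x (df \<Phi> X p (tder X' X p v))"
  proof (rule dot_cong[OF refl])
    fix i assume "i \<le> n"
    from cdiff_one_form[OF smap_C1[OF s this]] k k' show "df \<Phi> X' p v i = df \<Phi> X p (tder X' X p v) i"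
      unfolding one_form_def df_def by blast
  qed
  also have "\<dots> = dot n x (\<lambda>i. Re (tder X' X p v) * df \<Phi> X p 1 i + Im (tder X' X p v) * df \<Phi> X p \<i> i)"
    by (rule dot_cong[OF refl]) (rule df_complex[OF s k])
  also have "\<dots> = 0" unfolding dot_linear x by simp
  finally show "dot n x (df \<Phi> X' p v) = 0" .
qed

text \<open>Unique continuation for the single function \<open>x . \<Phi>\<close>, the second vector
  being 0.\<close>

lemma flat_nv_zero:
  assumes f: "flat_off P n \<Phi>" and p: "p \<notin> P" and x: "nv n \<Phi> p x"
  shows "nv n \<Phi> q x"
proof -
  have s: "smap n \<Phi>" using f unfolding flat_off_def imm_off_def by blast
  have "dot n x (\<Phi> q) + dot n (\<lambda>_. 0) (\<Phi> q) = 0" for q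
    by (rule unique_continuation[OF f f _ p ch]) (use x ch in \<open>auto simp: same_pull_def nv_def\<close>)
  hence z: "dot n x (\<Phi> q) = 0" for q by simp
  have "dot n x (df \<Phi> X q v) = 0" if k: "X \<in> charts_at A q" for X v
    using frechet_derivative_eqI[OF dot_cdiff[OF s k, of x]] unfolding z by (simp add: fun_eq_iff)
  thus ?thesis using z unfolding nv_def by blast
qed

lemma normal_part_zero:
  assumes i: "imm_off P n \<Phi>" and p: "p \<notin> P" and k: "X \<in> charts_at A p"
    and x: "\<And>N. nv n \<Phi> p N \<Longrightarrow> dot n N x = 0" and j: "j \<le> n"
  shows "nrm n (\<Phi> p) (df \<Phi> X p 1) (df \<Phi> X p \<i>) x j = 0"
proof -
  have s: "smap n \<Phi>" using i unfolding imm_off_def by blast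
  note k' = charts_atD(1)[OF k] and z = chart_pt[OF k]
  have zV: "coord X p \<in> {z \<in> im_ch X. param X z \<notin> P}" using z p by simp
  have l: "loc X \<Phi> (coord X p) = \<Phi> p" using z(3) by (simp add: loc_def fun_eq_iff)
  note o = immersed_nrm_orthogonal[OF imm_off_immersed[OF i k'] zV, unfolded pd_loc l]
  let ?N = "nrm n (\<Phi> p) (df \<Phi> X p 1) (df \<Phi> X p \<i>) x"
  have "nv n \<Phi> p ?N" by (rule nvI[OF s k]) (simp_all add: o dot_commute[of n ?N])
  hence "dot n ?N ?N = 0"
    using immersed_nrm_dot[OF imm_off_immersed[OF i k'] zV, unfolded pd_loc l, OF o] x by simp
  thus ?thesis using j unfolding dot_self_eq_0_iff by blast
qed

text \<open>\<open>\<Phi> q\<close> is orthogonal to every normal vector at \<open>p\<close>, so it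
  has no normal part there.\<close>

lemma flat_span:
  assumes f: "flat_off P n \<Phi>" and p: "p \<notin> P" and k: "X \<in> charts_at A p" and j: "j \<le> n"
  shows "\<Phi> q j = dot n (\<Phi> p) (\<Phi> q) * \<Phi> p j + coef1 n (df \<Phi> X p 1) (df \<Phi> X p \<i>) (\<Phi> q) * df \<Phi> X p 1 j
    + coef2 n (df \<Phi> X p 1) (df \<Phi> X p \<i>) (\<Phi> q) * df \<Phi> X p \<i> j"
proof -
  have i: "imm_off P n \<Phi>" using f unfolding flat_off_def by blast
  have "dot n N (\<Phi> q) = 0" if "nv n \<Phi> p N" for N using flat_nv_zero[OF f p that, of q] unfolding nv_def by blast
  from normal_part_zero[OF i p k this j] show ?thesis by (simp add: nrm_def)
qed

end

lemma dot_sum_left: "dot n (\<lambda>i. \<Sum>k\<in>K. c k * e k i) X = (\<Sum>k\<in>K. c k * dot n (e k) X)"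
  unfolding dot_def sum_distrib_right sum_distrib_left
  by (subst sum.swap) (simp add: mult.assoc)

lemma unit_scale:
  assumes "dot n w w \<noteq> 0"
  defines "u \<equiv> \<lambda>i. inverse (sqrt (dot n w w)) * w i"
  shows "dot n u u = 1" "w i = sqrt (dot n w w) * u i" "dot n x u = inverse (sqrt (dot n w w)) * dot n x w"
proof -
  have s: "sqrt (dot n w w) * sqrt (dot n w w) = dot n w w" "sqrt (dot n w w) \<noteq> 0" using assms(1) by auto
  have "dot n u u = inverse (sqrt (dot n w w)) * (inverse (sqrt (dot n w w)) * dot n w w)" unfolding u_def dot_linear ..
  thus "dot n u u = 1" using s by (metis left_inverse mult.assoc mult_1)
  show "w i = sqrt (dot n w w) * u i" using s(2) by (simp add: u_def)
  show "dot n x u = inverse (sqrt (dot n w w)) * dot n x w" unfolding u_def dot_linear ..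
qed

text \<open>Gram-Schmidt, phrased as a reconstruction formula on the span because this is what
  transports inner products and derivatives to three coordinates.\<close>

lemma orthonormal_basis3:
  fixes a b d :: "nat \<Rightarrow> real"
  assumes lin_indep: "\<forall>x y z. (\<forall>i\<le>n. x * a i + y * b i + z * d i = 0) \<longrightarrow> x = 0 \<and> y = 0 \<and> z = 0"
  shows "\<exists>e :: nat \<Rightarrow> nat \<Rightarrow> real. \<forall>x y z. \<forall>i\<le>n.
    x * a i + y * b i + z * d i = (\<Sum>k\<le>2. dot n (e k) (\<lambda>i. x * a i + y * b i + z * d i) * e k i)"
proof -
  have ind: "x = 0 \<and> y = 0 \<and> z = 0" if "\<And>i. i \<le> n \<Longrightarrow> x * a i + y * b i + z * d i = 0" for x y z
    using lin_indep that by blast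
  define e0 where "e0 = (\<lambda>i. inverse (sqrt (dot n a a)) * a i)"
  have "dot n a a \<noteq> 0" using ind[of 1 0 0] unfolding dot_self_eq_0_iff by auto
  note u0 = unit_scale[OF this]
  have e0: "e0 i = inverse (sqrt (dot n a a)) * a i" for i unfolding e0_def ..
  note u0 = u0(1)[folded e0_def] u0(2)[folded e0] u0(3)[folded e0_def]
  define b' where "b' = (\<lambda>i. b i - dot n e0 b * e0 i)"
  have "dot n b' b' \<noteq> 0"
  proof
    assume "dot n b' b' = 0"
    hence z: "b' i = 0" if "i \<le> n" for i using that unfolding dot_self_eq_0_iff by blast
    have "- dot n e0 b * inverse (sqrt (dot n a a)) * a i + 1 * b i + 0 * d i = 0" if "i \<le> n" for i
      using z[OF that] by (simp add: b'_def e0_def)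
    from ind[OF this] show False by simp
  qed
  note u1 = unit_scale[OF this]
  define e1 where "e1 = (\<lambda>i. inverse (sqrt (dot n b' b')) * b' i)"
  have e1: "e1 i = inverse (sqrt (dot n b' b')) * b' i" for i unfolding e1_def ..
  note u1 = u1(1)[folded e1_def] u1(2)[folded e1] u1(3)[folded e1_def]
  have "dot n e0 b' = 0" unfolding b'_def dot_linear u0(1) by simp
  hence o01: "dot n e0 e1 = 0" unfolding u1(3) by simp
  define d' where "d' = (\<lambda>i. d i - dot n e0 d * e0 i - dot n e1 d * e1 i)"
  have "dot n d' d' \<noteq> 0"
  proof
    assume "dot n d' d' = 0"
    hence z: "d' i = 0" if "i \<le> n" for i using that unfolding dot_self_eq_0_iff by blast
    let ?s = "inverse (sqrt (dot n a a))" and ?t = "inverse (sqrt (dot n b' b'))"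
    have "(- dot n e0 d * ?s + dot n e1 d * ?t * dot n e0 b * ?s) * a i + (- dot n e1 d * ?t) * b i + 1 * d i = 0" if "i \<le> n" for i
    proof -
      have "(- dot n e0 d * ?s + dot n e1 d * ?t * dot n e0 b * ?s) * a i + (- dot n e1 d * ?t) * b i + 1 * d i
        = d i - dot n e0 d * (?s * a i) - dot n e1 d * (?t * (b i - dot n e0 b * (?s * a i)))" by (simp add: algebra_simps)
      also have "\<dots> = d' i"
        using fun_cong[OF e0_def, of i] fun_cong[OF e1_def, of i] fun_cong[OF b'_def, of i] fun_cong[OF d'_def, of i] by simp
      finally show ?thesis using z[OF that] by simp
    qed
    from ind[OF this] show False by simp
  qed
  note u2 = unit_scale[OF this]
  define e2 where "e2 = (\<lambda>i. inverse (sqrt (dot n d' d')) * d' i)"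
  have e2: "e2 i = inverse (sqrt (dot n d' d')) * d' i" for i unfolding e2_def ..
  note u2 = u2(1)[folded e2_def] u2(2)[folded e2] u2(3)[folded e2_def]
  have "dot n e0 d' = 0" "dot n e1 d' = 0" unfolding d'_def dot_linear u0(1) u1(1) dot_commute[of n e1 e0] o01 by simp_all
  hence o2: "dot n e0 e2 = 0" "dot n e1 e2 = 0" unfolding u2(3) by simp_all
  define e where "e k = (if k = 0 then e0 else if k = 1 then e1 else e2)" for k :: nat
  show ?thesis
  proof (rule exI[of _ e], intro allI impI)
    fix x y z i
    define v where "v = (\<lambda>i. x * a i + y * b i + z * d i)"
    have "\<exists>p q r. \<forall>i. v i = p * e0 i + q * e1 i + r * e2 i"
    proof -
      have b: "b i = dot n e0 b * e0 i + sqrt (dot n b' b') * e1 i" for i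
        using u1(2)[of i] fun_cong[OF b'_def, of i] by linarith
      have d: "d i = dot n e0 d * e0 i + dot n e1 d * e1 i + sqrt (dot n d' d') * e2 i" for i
        using u2(2)[of i] fun_cong[OF d'_def, of i] by linarith
      have "v i = (x * sqrt (dot n a a) + y * dot n e0 b + z * dot n e0 d) * e0 i
          + (y * sqrt (dot n b' b') + z * dot n e1 d) * e1 i + (z * sqrt (dot n d' d')) * e2 i" for i
        unfolding v_def u0(2)[of i] b[of i] d[of i] by (simp only: algebra_simps)
      thus ?thesis by blast
    qed
    then obtain p q r where v: "v = (\<lambda>i. p * e0 i + q * e1 i + r * e2 i)" by blast
    have "dot n e0 v = p" "dot n e1 v = q" "dot n e2 v = r"
      unfolding v dot_linear u0(1) u1(1) u2(1) dot_commute[of n e1 e0] dot_commute[of n e2 e0] dot_commute[of n e2 e1] o01 o2 by simp_all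
    thus "x * a i + y * b i + z * d i = (\<Sum>k\<le>2. dot n (e k) (\<lambda>i. x * a i + y * b i + z * d i) * e k i)"
      unfolding v_def[symmetric] by (simp add: numeral_2_eq_2 e_def) (simp add: v fun_cong[OF v_def, symmetric])
  qed
qed

section \<open>Vanishing defect and equatorial images\<close>

context conformal_surface
begin

lemma pullback_df: "X \<in> charts_at A p \<Longrightarrow> pullback_metric A n \<Phi> X p v w = dot n (df \<Phi> X p v) (df \<Phi> X p w)"
  unfolding pullback_metric_def coord_deriv_cdiff df_def[abs_def] dot_def by simp

lemma branch_point_df: "branch_point A n \<Phi> p \<longleftrightarrow> (\<forall>X\<in>charts_at A p. \<forall>v. dot n (df \<Phi> X p v) (df \<Phi> X p v) = 0)"
  unfolding branch_point_def dot_self_eq_0_iff coord_deriv_cdiff df_def by blast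

abbreviation BP where "BP n \<Phi> \<equiv> {p. branch_point A n \<Phi> p}"

lemma immersion_imm_off:
  assumes b: "branched_minimal_immersion A c n \<Phi>"
  shows "imm_off (BP n \<Phi>) n \<Phi>"
  unfolding imm_off_def
proof (intro conjI allI impI ballI)
  show "finite (BP n \<Phi>)" using b unfolding branched_minimal_immersion_def by blast
  show "smap n \<Phi>" by (rule smap_immersion[OF b])
  fix p X assume p: "p \<notin> BP n \<Phi>" and k: "X \<in> charts_at A p"
  obtain gr where gr: "gr \<in> c" using class_nonempty by blast
  let ?r = "conf_factor gr n \<Phi> p"
  have "?r > 0" using pullback_factor(2,3)[OF gr b, of p] p by simp
  moreover have "?r * gr X p 1 1 * (?r * gr X p \<i> \<i>) - (?r * gr X p 1 \<i>)\<^sup>2 = ?r\<^sup>2 * gram_det gr X p"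
    by (simp add: gram_det_def power2_eq_square algebra_simps)
  ultimately show "dot n (df \<Phi> X p 1) (df \<Phi> X p 1) * dot n (df \<Phi> X p \<i>) (df \<Phi> X p \<i>) - (dot n (df \<Phi> X p 1) (df \<Phi> X p \<i>))\<^sup>2 > 0"
    unfolding df_factor[OF gr b k] using metric_pos(2)[OF class_metric[OF gr] k] by simp
qed

lemma regular_point:
  assumes "branched_minimal_immersion A c n \<Phi>"
  obtains p where "p \<notin> BP n \<Phi>"
  using open_infinite[of UNIV] immersion_imm_off[OF assms] finite_subset[of UNIV "BP n \<Phi>"] unfolding imm_off_def by blast

context
  fixes gr :: "'a tensor2"
  assumes gr: "gr \<in> c"
begin

interpretation gs: gradient_structure "area gr" C1 "G1 gr" "G2 gr"
  by (rule gradient_structure_surface[OF class_metric[OF gr]])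

context
  fixes n \<Phi>
  assumes bmi: "branched_minimal_immersion A c n \<Phi>" and fi: "gs.first_immersion n (\<lambda>i p. \<Phi> p i) (conf_factor gr n \<Phi>)"
begin

abbreviation X1 where "X1 p \<equiv> \<lambda>i. G1 gr (\<lambda>q. \<Phi> q i) p"
abbreviation X2 where "X2 p \<equiv> \<lambda>i. G2 gr (\<lambda>q. \<Phi> q i) p"

lemma X12: "X1 p = df \<Phi> (ch p) p (frame1 gr (ch p) p)" "X2 p = df \<Phi> (ch p) p (frame2 gr (ch p) p)"
  by (simp_all add: G1_def G2_def df_def fun_eq_iff)

lemma frame_rel:
  "dot n (\<Phi> p) (\<Phi> p) = 1" "dot n (X1 p) (X1 p) = conf_factor gr n \<Phi> p" "dot n (X2 p) (X2 p) = conf_factor gr n \<Phi> p"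
  "dot n (X1 p) (X2 p) = 0" "dot n (\<Phi> p) (X1 p) = 0" "dot n (\<Phi> p) (X2 p) = 0"
  using gs.unit[OF fi, of p] gs.D11[OF fi, of p] gs.D22[OF fi, of p] gs.D12[OF fi, of p]
    gs.unit_orthogonal[of n "\<lambda>i p. \<Phi> p i" p, OF gs.FC[OF fi] gs.unit[OF fi]] by simp_all

lemma defect_eq: "gs.defect n (\<lambda>i p. \<Phi> p i) (conf_factor gr n \<Phi>) b p
  = conf_factor gr n \<Phi> p * (dot n b b - (dot n b (\<Phi> p))\<^sup>2) - ((dot n b (X1 p))\<^sup>2 + (dot n b (X2 p))\<^sup>2)"
  unfolding gs.defect_def gs.grad_inner_def gs.D1_lin[OF fi] gs.D2_lin[OF fi] by (simp add: lin_def power2_eq_square)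

text \<open>Equality in Bessel's inequality puts \<open>b\<close> into the span of
  \<open>\<Phi> p\<close> and the frame derivatives, to all of which \<open>N\<close> is
  orthogonal.\<close>

lemma defect_cone:
  assumes d: "gs.defect n (\<lambda>i p. \<Phi> p i) (conf_factor gr n \<Phi>) b p = 0" and p: "p \<notin> BP n \<Phi>" and N: "nv n \<Phi> p N"
  shows "dot n N b = 0"
proof -
  let ?r = "conf_factor gr n \<Phi> p"
  have r: "?r > 0" using pullback_factor(2,3)[OF gr bmi, of p] p by simp
  have e: "(dot n b (X1 p))\<^sup>2 + (dot n b (X2 p))\<^sup>2 = ?r * (dot n b b - (dot n b (\<Phi> p))\<^sup>2)" using d unfolding defect_eq by simp
  have "dot n N b = dot n N (\<lambda>i. dot n b (\<Phi> p) * \<Phi> p i + (dot n b (X1 p) / ?r) * X1 p i + (dot n b (X2 p) / ?r) * X2 p i)"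
    by (rule dot_cong[OF refl]) (rule dot_Bessel_eq[OF frame_rel r e])
  also have "\<dots> = 0" using N ch[of p] unfolding dot_linear X12 nv_def by simp
  finally show ?thesis .
qed

text \<open>A converse to \<open>defect_cone\<close>. At a branch point the defect is nonnegative
  and at the same time minus a sum of squares; elsewhere the residual \<open>w\<close> of
  \<open>b\<close> is itself normal, so it is orthogonal to \<open>b\<close> and therefore
  zero.\<close>

lemma defect_zero:
  assumes b: "\<And>N. p \<notin> BP n \<Phi> \<Longrightarrow> nv n \<Phi> p N \<Longrightarrow> dot n N b = 0"
  shows "gs.defect n (\<lambda>i p. \<Phi> p i) (conf_factor gr n \<Phi>) b p = 0"
proof (cases "p \<in> BP n \<Phi>")
  case True
  hence r: "conf_factor gr n \<Phi> p = 0" using pullback_factor(3)[OF gr bmi, of p] by simp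
  have "0 \<le> gs.defect n (\<lambda>i p. \<Phi> p i) (conf_factor gr n \<Phi>) b p" by (rule gs.defect_nonneg[OF fi])
  moreover have "0 \<le> (dot n b (X1 p))\<^sup>2 + (dot n b (X2 p))\<^sup>2" by simp
  ultimately show ?thesis unfolding defect_eq r by linarith
next
  case False
  let ?r = "conf_factor gr n \<Phi> p" and ?k = "ch p"
  have r: "?r \<noteq> 0" using pullback_factor(3)[OF gr bmi, of p] False by simp
  define w where "w = (\<lambda>i. b i - dot n b (\<Phi> p) * \<Phi> p i - (dot n b (X1 p) / ?r) * X1 p i - (dot n b (X2 p) / ?r) * X2 p i)"
  note s = smap_immersion[OF bmi] and fr = frame_rel[of p]
  have w: "dot n w (\<Phi> p) = 0" "dot n w (X1 p) = 0" "dot n w (X2 p) = 0"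
    unfolding w_def dot_linear dot_commute[of n "X1 p" "\<Phi> p"] dot_commute[of n "X2 p" "\<Phi> p"] dot_commute[of n "X2 p" "X1 p"] fr
    using r by simp_all
  have E: "gr ?k p 1 1 > 0" and D: "gram_det gr ?k p > 0" using metric_pos[OF class_metric[OF gr] ch] by auto
  have dv: "dot n w (df \<Phi> ?k p v) = Re v * dot n w (df \<Phi> ?k p 1) + Im v * dot n w (df \<Phi> ?k p \<i>)" for v
  proof -
    have "dot n w (df \<Phi> ?k p v) = dot n w (\<lambda>i. Re v * df \<Phi> ?k p 1 i + Im v * df \<Phi> ?k p \<i> i)"
      by (rule dot_cong[OF refl]) (rule df_complex[OF s ch])
    thus ?thesis unfolding dot_linear .
  qed
  have w1: "dot n w (df \<Phi> ?k p 1) = 0"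
    using w(2) E unfolding X12 dv[of "frame1 gr ?k p"] by (simp add: frame1_def)
  have "dot n w (df \<Phi> ?k p \<i>) = 0"
    using w(3) E D unfolding X12 dv[of "frame2 gr ?k p"] w1 by (simp add: frame2_def)
  hence "nv n \<Phi> p w" by (intro nvI[OF s ch] w(1) w1)
  hence "dot n w b = 0" using b False by blast
  hence "dot n w w = 0"
  proof -
    have "dot n w w = dot n w b - dot n b (\<Phi> p) * dot n w (\<Phi> p) - (dot n b (X1 p) / ?r) * dot n w (X1 p) - (dot n b (X2 p) / ?r) * dot n w (X2 p)"
      by (subst (2) w_def) (simp only: dot_linear)
    thus ?thesis using w \<open>dot n w b = 0\<close> by simp
  qed
  thus ?thesis
    using dot_residual_square[OF fr(1-6) r w_def] unfolding defect_eq by simp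
qed

text \<open>Zero defect everywhere places the fixed vector \<open>b\<close> in the span of the map
  and its differential at each regular point, the situation of \<open>cone_flat\<close>;
  trace-freeness is minimality.\<close>

lemma defect_flat:
  assumes b: "\<exists>i\<le>n. b i \<noteq> 0" and d: "\<And>p. gs.defect n (\<lambda>i p. \<Phi> p i) (conf_factor gr n \<Phi>) b p = 0"
  shows "flat_off (BP n \<Phi>) n \<Phi>"
  unfolding flat_off_def
proof (intro conjI allI impI ballI)
  note i = immersion_imm_off[OF bmi]
  show "imm_off (BP n \<Phi>) n \<Phi>" by (rule i)
  fix p X assume p: "p \<notin> BP n \<Phi>" and k: "X \<in> charts_at A p"
  note k' = charts_atD(1)[OF k]
  let ?V = "{z \<in> im_ch X. param X z \<notin> BP n \<Phi>}"
  have V: "\<exists>q. q \<notin> BP n \<Phi> \<and> X \<in> charts_at A q \<and> z = coord X q \<and> loc X \<Phi> z = \<Phi> q" if z: "z \<in> ?V" for z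
    using z charts_atI[OF k' chart_param_dom[of z X]] chart_coord_param[of z X]
    by (intro exI[of _ "param X z"]) (simp add: loc_def fun_eq_iff)
  show "flat_at n (loc X \<Phi>) (coord X p)"
  proof (rule cone_flat[OF imm_off_immersed[OF i k'] _ b])
    fix z j assume z: "z \<in> ?V" and j: "j \<le> n"
    obtain q where q: "q \<notin> BP n \<Phi>" "X \<in> charts_at A q" "z = coord X q" "loc X \<Phi> z = \<Phi> q" using V[OF z] by blast
    show "nrm n (loc X \<Phi> z) (pd 1 (loc X \<Phi>) z) (pd \<i> (loc X \<Phi>) z) b j = 0"
      unfolding q(4) unfolding q(3) pd_loc by (rule normal_part_zero[OF i q(1,2) defect_cone[OF d q(1)] j])
  next
    fix z assume z: "z \<in> ?V"
    obtain q where q: "q \<notin> BP n \<Phi>" "X \<in> charts_at A q" "z = coord X q" using V[OF z] by blast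
    thus "tracefree n (loc X \<Phi>) z" using immersion_tracefree[OF bmi _ q(2)] by simp
  next
    show "coord X p \<in> ?V" using chart_pt[OF k] p by simp
  qed
qed

text \<open>\<open>flat_span\<close> confines the image to the span of the 1-jet at a regular point.
  Every unit vector \<open>v\<close> of the span is attained: all normals are orthogonal to
  \<open>- v\<close>, so its defect vanishes, and \<open>two_sphere_onto\<close> yields a preimage
  of \<open>v\<close>.\<close>

lemma flat_equatorial:
  assumes f: "flat_off (BP n \<Phi>) n \<Phi>"
  shows "equatorial_two_sphere n (range \<Phi>)"
proof -
  obtain p where p: "p \<notin> BP n \<Phi>" using regular_point[OF bmi] by blast
  let ?k = "ch p"
  let ?a = "\<Phi> p" and ?b = "df \<Phi> ?k p 1" and ?d = "df \<Phi> ?k p \<i>"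
  note i = immersion_imm_off[OF bmi] and s = smap_immersion[OF bmi] and k = ch[of p]
  have z0: "\<Phi> q i = 0" "df \<Phi> X q v i = 0" if "i > n" for q i v X
  proof -
    have z: "\<Phi> q i = 0" for q using immersion_unit(2)[OF bmi that] .
    show "\<Phi> q i = 0" by (rule z)
    show "df \<Phi> X q v i = 0" unfolding df_def z by (rule cdiff_const)
  qed
  have zV: "coord ?k p \<in> {z \<in> im_ch ?k. param ?k z \<notin> BP n \<Phi>}" using chart_pt[OF k] p by simp
  have l: "loc ?k \<Phi> (coord ?k p) = \<Phi> p" using chart_pt(3)[OF k] by (simp add: loc_def fun_eq_iff)
  note I = imm_off_immersed[OF i charts_atD(1)[OF k]]
  have ab: "dot n ?a ?b = 0" "dot n ?a ?d = 0" "dot n ?a ?a = 1"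
    using immersedD(2)[OF I zV] immersedD(3)[OF I zV] unfolding pd_loc l by blast+
  have det: "dot n ?b ?b * dot n ?d ?d - (dot n ?b ?d)\<^sup>2 > 0" using immersedD(4)[OF I zV] unfolding pd_loc l .
  show ?thesis
    unfolding equatorial_two_sphere_def
  proof (rule exI[of _ ?a], rule exI[of _ ?b], rule exI[of _ ?d], intro conjI allI impI)
    show "{?a, ?b, ?d} \<subseteq> topspace (Euclidean_space (Suc n))"
      using z0 by (auto simp: topspace_Euclidean_space)
    fix x y z assume "\<forall>i. x * ?a i + y * ?b i + z * ?d i = 0"
    hence "(\<lambda>i. x * ?a i + y * ?b i + z * ?d i) = (\<lambda>_. 0)" by blast
    hence e: "x * dot n ?a w + y * dot n ?b w + z * dot n ?d w = 0" for w
      using arg_cong[of _ _ "\<lambda>u. dot n u w"] unfolding dot_linear[symmetric] by simp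
    show x: "x = 0" using e[of ?a] ab by (simp add: dot_commute[of n ?b ?a] dot_commute[of n ?d ?a])
    have e1: "y * dot n ?b ?b + z * dot n ?b ?d = 0" and e2: "y * dot n ?b ?d + z * dot n ?d ?d = 0"
      using e[of ?b] e[of ?d] x by (simp_all add: dot_commute[of n ?d ?b])
    have "y * (dot n ?b ?b * dot n ?d ?d - (dot n ?b ?d)\<^sup>2) = (y * dot n ?b ?b + z * dot n ?b ?d) * dot n ?d ?d - (y * dot n ?b ?d + z * dot n ?d ?d) * dot n ?b ?d"
      by (simp add: power2_eq_square algebra_simps)
    thus "y = 0" using det unfolding e1 e2 by simp
    have "z * (dot n ?b ?b * dot n ?d ?d - (dot n ?b ?d)\<^sup>2) = (y * dot n ?b ?d + z * dot n ?d ?d) * dot n ?b ?b - (y * dot n ?b ?b + z * dot n ?b ?d) * dot n ?b ?d"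
      by (simp add: power2_eq_square algebra_simps)
    thus "z = 0" using det unfolding e1 e2 by simp
  next
    show "range \<Phi> = topspace (nsphere n) \<inter> {\<lambda>i. x * ?a i + y * ?b i + z * ?d i |x y z. True}" (is "_ = _ \<inter> ?S")
    proof (intro subset_antisym subsetI IntI)
      fix v assume "v \<in> range \<Phi>"
      then obtain q where q: "v = \<Phi> q" by blast
      show "v \<in> topspace (nsphere n)" using bmi q unfolding branched_minimal_immersion_def by blast
      have "\<Phi> q j = dot n (\<Phi> p) (\<Phi> q) * ?a j + coef1 n ?b ?d (\<Phi> q) * ?b j + coef2 n ?b ?d (\<Phi> q) * ?d j" for j
      proof (cases "j \<le> n")
        case True
        thus ?thesis by (rule flat_span[OF f p k])
      next
        case False
        hence "j > n" by simp
        thus ?thesis by (simp add: z0)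
      qed
      hence "v = (\<lambda>j. dot n (\<Phi> p) (\<Phi> q) * ?a j + coef1 n ?b ?d (\<Phi> q) * ?b j + coef2 n ?b ?d (\<Phi> q) * ?d j)"
        unfolding q by blast
      thus "v \<in> ?S" by blast
    next
      fix v assume "v \<in> topspace (nsphere n) \<inter> ?S"
      then obtain x y z where v: "v = (\<lambda>i. x * ?a i + y * ?b i + z * ?d i)" and vs: "v \<in> topspace (nsphere n)" by blast
      have vn: "dot n v v = 1" "\<And>i. i > n \<Longrightarrow> v i = 0" using vs unfolding nsphere dot_def by (auto simp: power2_eq_square)
      have "\<exists>q. \<forall>i\<le>n. \<Phi> q i = - (- v i)"
      proof (rule gs.two_sphere_onto[OF fi])
        show "dot n (\<lambda>i. - v i) (\<lambda>i. - v i) = 1" using vn(1) by (simp add: dot_linear)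
        fix q
        show "gs.defect n (\<lambda>i p. \<Phi> p i) (conf_factor gr n \<Phi>) (\<lambda>i. - v i) q = 0"
        proof (rule defect_zero)
          fix N assume q: "q \<notin> BP n \<Phi>" and N: "nv n \<Phi> q N"
          have "nv n \<Phi> p N" by (rule flat_nv_zero[OF f q N])
          thus "dot n N (\<lambda>i. - v i) = 0" using k unfolding v dot_linear nv_def by simp
        qed
      qed
      then obtain q where q: "\<And>i. i \<le> n \<Longrightarrow> \<Phi> q i = v i" by auto
      have "v i = \<Phi> q i" for i
      proof (cases "i \<le> n")
        case True
        thus ?thesis by (rule q[symmetric])
      next
        case False
        hence "i > n" by simp
        thus ?thesis using vn(2) z0(1) by metis
      qed
      hence "v = \<Phi> q" by (rule ext)
      thus "v \<in> range \<Phi>" by (rule range_eqI)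
    qed
  qed
qed

end

end

text \<open>Coordinates in an orthonormal basis of the 3-dimensional subspace give a map to the
  2-sphere with the same induced metric. They are constant linear combinations of the old
  coordinates, so harmonicity and the eigenvalue equation carry over.\<close>

lemma equatorial_rotate:
  assumes imm: "immersed_by_first_eigenfunctions A c g n \<Phi>" and eq: "equatorial_two_sphere n (range \<Phi>)"
  shows "\<exists>\<Psi>. immersed_by_first_eigenfunctions A c g 2 \<Psi>"
proof -
  have bmi: "branched_minimal_immersion A c n \<Phi>" and pg: "pullback_metric A n \<Phi> = g" and con: "g \<in> conical_metrics A c"
    using imm unfolding immersed_by_first_eigenfunctions_def by blast+
  note s = smap_immersion[OF bmi]
  obtain a b d where sub: "{a, b, d} \<subseteq> topspace (Euclidean_space (Suc n))"
    and ind: "\<And>x y z. (\<forall>i. x * a i + y * b i + z * d i = 0) \<Longrightarrow> x = 0 \<and> y = 0 \<and> z = 0"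
    and R: "range \<Phi> = topspace (nsphere n) \<inter> {\<lambda>i. x * a i + y * b i + z * d i | x y z :: real. True}"
    using eq unfolding equatorial_two_sphere_def by blast
  have v0: "a i = 0" "b i = 0" "d i = 0" if "\<not> i \<le> n" for i
    using sub that by (auto simp: topspace_Euclidean_space)
  have "\<forall>x y z. (\<forall>i\<le>n. x * a i + y * b i + z * d i = 0) \<longrightarrow> x = 0 \<and> y = 0 \<and> z = 0"
  proof (intro allI impI ind)
    fix x y z i assume "\<forall>i\<le>n. x * a i + y * b i + z * d i = 0"
    thus "x * a i + y * b i + z * d i = 0" using v0[of i] by (cases "i \<le> n") auto
  qed
  from orthonormal_basis3[OF this] obtain e :: "nat \<Rightarrow> nat \<Rightarrow> real" where
    e: "\<And>x y z i. i \<le> n \<Longrightarrow> x * a i + y * b i + z * d i = (\<Sum>k\<le>2. dot n (e k) (\<lambda>i. x * a i + y * b i + z * d i) * e k i)"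
    by blast
  have expand: "\<Phi> p i = (\<Sum>k\<le>2. dot n (e k) (\<Phi> p) * e k i)" if i: "i \<le> n" for p i
  proof -
    have "\<Phi> p \<in> range \<Phi>" by (rule rangeI)
    then obtain x y z where q: "\<Phi> p = (\<lambda>i. x * a i + y * b i + z * d i)" unfolding R by blast
    show ?thesis unfolding q by (rule e[OF i])
  qed
  define \<Psi> where "\<Psi> p k = (if k \<le> 2 then dot n (e k) (\<Phi> p) else 0)" for p and k :: nat
  have ex: "\<Phi> p i = (\<Sum>k\<le>2. \<Psi> p k * e k i)" if "i \<le> n" for p i
    unfolding expand[OF that, of p] by (rule sum.cong) (simp_all add: \<Psi>_def)
  have Pd: "((\<lambda>z. \<Psi> (param X z) k) has_derivative (\<lambda>v. dot n (e k) (df \<Phi> X p v))) (at (coord X p))"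
    if "k \<le> 2" "X \<in> charts_at A p" for X p k
    using dot_cdiff[OF s that(2), of "e k"] that(1) by (simp add: \<Psi>_def)
  have dP: "df \<Psi> X p v k = dot n (e k) (df \<Phi> X p v)" if "k \<le> 2" "X \<in> charts_at A p" for X p k v
    unfolding df_def[of \<Psi>] by (rule cdiff_eqI[OF Pd[OF that]])
  have dF: "df \<Phi> X p v i = (\<Sum>k\<le>2. df \<Psi> X p v k * e k i)" if i: "i \<le> n" and k: "X \<in> charts_at A p" for X p v i
  proof -
    have "((\<lambda>z. \<Sum>k\<le>2. \<Psi> (param X z) k * e k i) has_derivative (\<lambda>v. \<Sum>k\<le>2. dot n (e k) (df \<Phi> X p v) * e k i)) (at (coord X p))"
      using Pd[OF _ k] by (intro has_derivative_sum has_derivative_mult_left) auto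
    hence "((\<lambda>z. \<Phi> (param X z) i) has_derivative (\<lambda>v. \<Sum>k\<le>2. dot n (e k) (df \<Phi> X p v) * e k i)) (at (coord X p))"
      unfolding ex[OF i] .
    from cdiff_eqI[OF this, of v] have "df \<Phi> X p v i = (\<Sum>k\<le>2. dot n (e k) (df \<Phi> X p v) * e k i)" unfolding df_def[of \<Phi> X p v i] .
    also have "\<dots> = (\<Sum>k\<le>2. df \<Psi> X p v k * e k i)" by (rule sum.cong) (simp_all add: dP[OF _ k])
    finally show ?thesis .
  qed
  have dd: "dot 2 (df \<Psi> X p v) (df \<Psi> X p w) = dot n (df \<Phi> X p v) (df \<Phi> X p w)" if k: "X \<in> charts_at A p" for X p v w
  proof -
    have "dot n (df \<Phi> X p v) (df \<Phi> X p w) = dot n (\<lambda>i. \<Sum>k\<le>2. df \<Psi> X p v k * e k i) (df \<Phi> X p w)"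
      by (rule dot_cong[OF dF[OF _ k] refl])
    also have "\<dots> = (\<Sum>k\<le>2. df \<Psi> X p v k * dot n (e k) (df \<Phi> X p w))" by (rule dot_sum_left)
    also have "\<dots> = dot 2 (df \<Psi> X p v) (df \<Psi> X p w)"
      unfolding dot_def[of 2] by (rule sum.cong) (simp_all add: dP[OF _ k])
    finally show ?thesis ..
  qed
  have unit: "dot 2 (\<Psi> p) (\<Psi> p) = 1" for p
  proof -
    have "dot n (\<Phi> p) (\<Phi> p) = dot n (\<lambda>i. \<Sum>k\<le>2. \<Psi> p k * e k i) (\<Phi> p)"
      by (rule dot_cong[OF ex refl])
    also have "\<dots> = (\<Sum>k\<le>2. \<Psi> p k * dot n (e k) (\<Phi> p))" by (rule dot_sum_left)
    also have "\<dots> = dot 2 (\<Psi> p) (\<Psi> p)"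
      unfolding dot_def[of 2] by (rule sum.cong) (simp_all add: \<Psi>_def)
    finally show ?thesis using immersion_unit(1)[OF bmi, of p] by simp
  qed
  have pull: "pullback_metric A 2 \<Psi> = pullback_metric A n \<Phi>"
  proof (intro ext)
    fix X p v w
    show "pullback_metric A 2 \<Psi> X p v w = pullback_metric A n \<Phi> X p v w"
    proof (cases "X \<in> charts_at A p")
      case True
      thus ?thesis unfolding pullback_df[OF True] by (rule dd)
    next
      case False
      thus ?thesis unfolding pullback_metric_def by simp
    qed
  qed
  have br: "branch_point A 2 \<Psi> p \<longleftrightarrow> branch_point A n \<Phi> p" for p
    unfolding branch_point_df using dd by (metis (no_types, lifting))
  have sm: "Ck_on k (im_ch X) (\<lambda>z. \<Psi> (param X z) i)" if "i \<le> 2" "X \<in> smooth_charts A" for X i k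
    using smooth_family_dot_Ck[OF smooth_family_const[OF im_open[OF that(2)], of n "e i"] smap_family[OF s that(2)], of k] that(1)
    by (simp add: \<Psi>_def loc_def[abs_def])
  have harm: "harmonic_at A g0 2 \<Psi> p" if g0: "g0 \<in> c" and h: "harmonic_at A g0 n \<Phi> p" for g0 p
    unfolding harmonic_at_def
  proof (intro ballI allI impI)
    fix X and w :: "nat \<Rightarrow> real" assume k: "X \<in> charts_at A p" and w: "(\<Sum>k\<le>2. w k * \<Psi> p k) = 0"
    note m0 = class_metric[OF g0]
    have U: "Ck_on 2 (im_ch X) ((\<lambda>q. \<Phi> q i) \<circ> param X)" if "i \<le> n" for i
      using immersion_Ck[OF bmi that charts_atD(1)[OF k], of 2] by (simp add: o_def)
    have L: "laplacian g0 X (\<lambda>q. \<Psi> q k) p = (\<Sum>i\<le>n. e k i * laplacian g0 X (\<lambda>q. \<Phi> q i) p)" if "k \<le> 2" for k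
      using laplacian_sum[where U = "\<lambda>i q. \<Phi> q i" and x = "e k", OF m0 k U] that by (simp add: \<Psi>_def dot_def)
    \<comment> \<open>The vector \<open>w\<close> on the three new coordinates is turned into one on
      the old coordinates, where harmonicity of \<open>\<Phi>\<close> can be tested.\<close>
    let ?w = "\<lambda>i. \<Sum>k\<le>2. w k * e k i"
    have "(\<Sum>i\<le>n. ?w i * \<Phi> p i) = (\<Sum>k\<le>2. w k * dot n (e k) (\<Phi> p))" using dot_sum_left[where n = n and K = "{..2}" and c = w and e = e and X = "\<Phi> p"] unfolding dot_def[of n ?w] .
    also have "\<dots> = 0" unfolding w[symmetric] by (rule sum.cong) (simp_all add: \<Psi>_def)
    finally have wz: "(\<Sum>i\<le>n. ?w i * \<Phi> p i) = 0" .
    have H: "(\<Sum>i\<le>n. x i * \<Phi> p i) = 0 \<Longrightarrow> (\<Sum>i\<le>n. x i * laplacian g0 X (\<lambda>q. \<Phi> q i) p) = 0" for x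
      using h k unfolding harmonic_at_def by blast
    note H[OF wz]
    moreover have "(\<Sum>i\<le>n. ?w i * laplacian g0 X (\<lambda>q. \<Phi> q i) p) = (\<Sum>k\<le>2. w k * laplacian g0 X (\<lambda>q. \<Psi> q k) p)"
      using dot_sum_left[where n = n and K = "{..2}" and c = w and e = e and X = "\<lambda>i. laplacian g0 X (\<lambda>q. \<Phi> q i) p"] unfolding dot_def by (simp add: L)
    ultimately show "(\<Sum>k\<le>2. w k * laplacian g0 X (\<lambda>q. \<Psi> q k) p) = 0" by simp
  qed
  have bmi2: "branched_minimal_immersion A c 2 \<Psi>"
    unfolding branched_minimal_immersion_def
  proof (intro conjI allI impI ballI)
    show "\<Psi> p \<in> topspace (nsphere 2)" for p
      using unit[of p] unfolding nsphere by (simp add: dot_def power2_eq_square \<Psi>_def)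
    show "smooth_fun A UNIV (\<lambda>p. \<Psi> p i)" if "i \<le> 2" for i
      using sm[OF that] unfolding smooth_fun_def smooth_on_def by (simp add: o_def)
    show "\<exists>p q. \<Psi> p \<noteq> \<Psi> q"
    proof (rule ccontr)
      assume "\<not> ?thesis"
      hence eqP: "\<Psi> p = \<Psi> q" for p q by blast
      have "\<Phi> p i = \<Phi> q i" for p q i
      proof (cases "i \<le> n")
        case True
        show ?thesis unfolding ex[OF True] eqP[of p q] ..
      next
        case False
        thus ?thesis using immersion_unit(2)[OF bmi] by simp
      qed
      hence "\<Phi> p = \<Phi> q" for p q by blast
      thus False using bmi unfolding branched_minimal_immersion_def by blast
    qed
    show "finite {p. branch_point A 2 \<Psi> p}" unfolding br using bmi unfolding branched_minimal_immersion_def by blast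
    fix g0 p assume g0: "g0 \<in> c" and p: "\<not> branch_point A 2 \<Psi> p"
    have hc: "harmonic_at A g0 n \<Phi> p" "conformal_at A g0 n \<Phi> p"
      using bmi g0 p unfolding branched_minimal_immersion_def br by blast+
    show "harmonic_at A g0 2 \<Psi> p" by (rule harm[OF g0 hc(1)])
    show "conformal_at A g0 2 \<Psi> p" using hc(2) unfolding conformal_at_def pull .
  qed
  obtain gr where gr: "gr \<in> c" using class_nonempty by blast
  interpret gs: gradient_structure "area gr" C1 "G1 gr" "G2 gr"
    by (rule gradient_structure_surface[OF class_metric[OF gr]])
  let ?F = "\<lambda>i p. \<Phi> p i" and ?r = "conf_factor gr n \<Phi>"
  obtain g0 where fi: "gs.first_immersion n ?F ?r" and g0: "g0 \<in> c" and l: "lambda1 A g0 g = 2"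
    using first_immersion_lambda1[OF gr bmi imm] by blast
  have gg: "g X p v w = ?r p * gr X p v w" for X p v w using pullback_factor(1)[OF gr bmi] unfolding pg .
  have "(\<lambda>p. \<Psi> p k) \<in> lambda1_eigenspace A g0 g" if k: "k \<le> 2" for k
  proof -
    have P: "(\<lambda>p. \<Psi> p k) = lin n ?F (e k)" using k by (simp add: \<Psi>_def lin_def fun_eq_iff)
    note lC = gs.lin_in_C[OF fi, of "e k"]
    show ?thesis
      unfolding P
    proof (rule eigenspaceI[OF gr g0 factor_C1[OF gr bmi] pullback_factor(2)[OF gr bmi] gg lC])
      show "\<exists>p\<in>U. ?r p \<noteq> 0" if "open U" "U \<noteq> {}" for U by (rule factor_dense[OF gr bmi that])
      \<comment> \<open>The eigenvalue equation tested with the constant 1 gives weighted mean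
        zero.\<close>
      have "gs.energy (lin n ?F (e k)) (\<lambda>_. 1) = 0" by (rule gs.energy_const_right)
      thus "(LINT p|area gr. lin n ?F (e k) p * ?r p) = 0" unfolding gs.energy_lin[OF fi C1_const] by simp
      show "gs.energy (lin n ?F (e k)) (lin n ?F (e k)) = lambda1 A g0 g * (LINT p|area gr. (lin n ?F (e k) p)\<^sup>2 * ?r p)"
        unfolding gs.energy_lin[OF fi lC] l by (simp add: power2_eq_square)
    qed
  qed
  thus ?thesis
    unfolding immersed_by_first_eigenfunctions_def using con bmi2 pull pg g0 by (intro exI[of _ \<Psi>]) blast
qed

end

section \<open>Conformal automorphisms of the sphere\<close>

text \<open>Inverse of \<open>to_R3\<close> on sequences supported on the first three indices; it
  makes computations with \<open>dot\<close> available in \<open>real^3\<close>.\<close>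

definition fr3 :: "real^3 \<Rightarrow> nat \<Rightarrow> real" where
  "fr3 x i = (if i = 0 then x $ 1 else if i = 1 then x $ 2 else if i = 2 then x $ 3 else 0)"

lemma dot_2: "dot 2 x y = x 0 * y 0 + x 1 * y 1 + x 2 * y 2"
  by (simp add: dot_def numeral_2_eq_2)

lemma inner_fr3: "x \<bullet> y = dot 2 (fr3 x) (fr3 y)"
  by (simp add: inner_vec_def sum_3 dot_2 fr3_def)

lemma inner_to_R3: "to_R3 x \<bullet> to_R3 y = dot 2 x y"
  by (simp add: inner_vec_def sum_3 dot_2 to_R3_def)

lemma to_R3_eqI: "(\<And>i. i \<le> 2 \<Longrightarrow> x i = y i) \<Longrightarrow> to_R3 x = to_R3 y"
  by (simp add: to_R3_def)

lemma to_R3_fr3: "to_R3 (fr3 x) = x"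
  by (simp add: vec_eq_iff forall_3 to_R3_def fr3_def)

lemma to_R3_linear: "to_R3 (\<lambda>i. x i + y i) = to_R3 x + to_R3 y" "to_R3 (\<lambda>i. a * x i) = a *\<^sub>R to_R3 x"
  by (simp_all add: vec_eq_iff forall_3 to_R3_def)

lemma fr3_linear: "fr3 (x + y) i = fr3 x i + fr3 y i" "fr3 (x - y) i = fr3 x i - fr3 y i" "fr3 (a *\<^sub>R x) i = a * fr3 x i"
  by (simp_all add: fr3_def)

text \<open>The Moebius map of \<open>moebius_dot\<close>, now on \<open>real^3\<close>.\<close>

definition moeb :: "real^3 \<Rightarrow> real^3 \<Rightarrow> real^3" where
  "moeb b x = (let sc = sqrt (1 - b \<bullet> b); c = 1 / (1 + sc) in c *\<^sub>R b + (sc / (1 + b \<bullet> x)) *\<^sub>R (x + c *\<^sub>R b))"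

lemma orthogonal_dot: "orthogonal_transformation L \<Longrightarrow> L x \<bullet> L y = x \<bullet> y"
  and orthogonal_lin: "orthogonal_transformation L \<Longrightarrow> linear L"
  by (simp_all add: orthogonal_transformation_def)

lemma moeb_orthogonal:
  assumes "orthogonal_transformation L"
  shows "moeb (L b) (L x) = L (moeb b x)"
  using linear_add[OF orthogonal_lin[OF assms]] linear_scale[OF orthogonal_lin[OF assms]]
  by (simp add: moeb_def orthogonal_dot[OF assms] Let_def)

context
  fixes b :: "real^3"
  assumes b: "b \<bullet> b < 1"
begin

definition sc where "sc = sqrt (1 - b \<bullet> b)"
definition cc where "cc = 1 / (1 + sc)"

lemma sc_facts: "0 < sc" "b \<bullet> b = 1 - sc\<^sup>2" "cc * (1 + sc) = 1"
proof -
  show sc: "0 < sc" using b by (simp add: sc_def)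
  show "b \<bullet> b = 1 - sc\<^sup>2" using b by (simp add: sc_def)
  show "cc * (1 + sc) = 1" using sc by (simp add: cc_def)
qed

lemma moeb_eq: "moeb b x = cc *\<^sub>R b + (sc / (1 + b \<bullet> x)) *\<^sub>R (x + cc *\<^sub>R b)"
  by (simp add: moeb_def sc_def cc_def Let_def)

lemma sphere_pos: "x \<in> sphere 0 1 \<Longrightarrow> 0 < 1 + b \<bullet> x"
proof -
  assume x: "x \<in> sphere 0 1"
  have "\<bar>b \<bullet> x\<bar> \<le> norm b * norm x" by (rule Cauchy_Schwarz_ineq2)
  moreover have "norm b < 1" using b by (simp add: norm_eq_sqrt_inner)
  ultimately show ?thesis using x by simp
qed

lemma moeb_sphere: "x \<in> sphere 0 1 \<Longrightarrow> moeb b x \<in> sphere 0 1"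
proof -
  assume x: "x \<in> sphere 0 1"
  have f: "dot 2 (fr3 x) (fr3 x) = 1" using x unfolding inner_fr3[symmetric] by (simp add: norm_eq_1)
  have "dot 2 (\<lambda>i. cc * fr3 b i + (sc / (1 + b \<bullet> x)) * (fr3 x i + cc * fr3 b i)) (\<lambda>i. cc * fr3 b i + (sc / (1 + b \<bullet> x)) * (fr3 x i + cc * fr3 b i)) = 1"
    by (rule moebius_dot(2)[OF f, of "\<lambda>_. 0" "\<lambda>_. 0"]) (use sc_facts sphere_pos[OF x] in \<open>simp_all add: inner_fr3[symmetric] cc_def\<close>)
  moreover have "(\<lambda>i. cc * fr3 b i + (sc / (1 + b \<bullet> x)) * (fr3 x i + cc * fr3 b i)) = fr3 (moeb b x)"
    by (rule ext) (simp add: moeb_eq fr3_linear)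
  ultimately show ?thesis using inner_fr3[of "moeb b x" "moeb b x"] by (simp add: norm_eq_1)
qed

text \<open>For the image \<open>y\<close> one has \<open>1 - b . y = sc^2 / q\<close>, so the map
  with parameter \<open>- b\<close> rescales by \<open>q / sc\<close>, which cancels the factor
  \<open>sc / q\<close>.\<close>

lemma moeb_inverse:
  assumes q: "1 + b \<bullet> x \<noteq> 0"
  shows "moeb (- b) (moeb b x) = x"
proof -
  define q where "q = 1 + b \<bullet> x"
  define y where "y = moeb b x"
  have q0: "q \<noteq> 0" using q by (simp add: q_def)
  have cb: "cc * (1 - sc\<^sup>2) = 1 - sc"
  proof -
    have "cc * (1 - sc\<^sup>2) = (cc * (1 + sc)) * (1 - sc)" by (simp add: power2_eq_square algebra_simps)
    thus ?thesis unfolding sc_facts(3) by simp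
  qed
  have y: "y = cc *\<^sub>R b + (sc / q) *\<^sub>R (x + cc *\<^sub>R b)" unfolding y_def moeb_eq q_def ..
  have "b \<bullet> y = cc * (1 - sc\<^sup>2) + (sc / q) * ((q - 1) + cc * (1 - sc\<^sup>2))"
    unfolding y inner_add_right inner_scaleR_right sc_facts(2) by (simp add: q_def)
  also have "\<dots> = 1 - sc\<^sup>2 / q" unfolding cb using q0 by (simp add: field_simps power2_eq_square)
  finally have by': "1 + (- b) \<bullet> y = sc\<^sup>2 / q" by simp
  have "moeb (- b) y = cc *\<^sub>R (- b) + (sc / (sc\<^sup>2 / q)) *\<^sub>R (y + cc *\<^sub>R (- b))"
    unfolding moeb_def Let_def by' by (simp add: sc_def cc_def)
  also have "sc / (sc\<^sup>2 / q) = q / sc" using sc_facts(1) by (simp add: power2_eq_square)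
  also have "y + cc *\<^sub>R (- b) = (sc / q) *\<^sub>R (x + cc *\<^sub>R b)" unfolding y by simp
  also have "cc *\<^sub>R (- b) + (q / sc) *\<^sub>R (sc / q) *\<^sub>R (x + cc *\<^sub>R b) = x"
    using sc_facts(1) q0 by simp
  finally show ?thesis unfolding y_def .
qed

text \<open>The orthogonal \<open>L\<close> is included because the inverse of a Moebius map
  followed by an orthogonal map is again of this form. The smooth extension is the same formula on
  the half-space where the denominator is positive.\<close>

lemma moeb_conformal:
  assumes L: "orthogonal_transformation L" and T: "\<And>x. x \<in> sphere 0 1 \<Longrightarrow> T x = L (moeb b x)"
  shows "conformal_sphere_map T"
  unfolding conformal_sphere_map_def
proof (intro conjI)
  note ll = orthogonal_lin[OF L]
  have bl: "bounded_linear L" using ll by (simp add: linear_conv_bounded_linear)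
  show "T ` sphere 0 1 \<subseteq> sphere 0 1"
    using moeb_sphere T orthogonal_dot[OF L] by (auto simp: norm_eq_sqrt_inner)
  define F where "F = (\<lambda>x. L (cc *\<^sub>R b) + (sc / (1 + b \<bullet> x)) *\<^sub>R (L x + L (cc *\<^sub>R b)))"
  let ?U = "{x. 0 < 1 + b \<bullet> x}"
  have U: "open ?U" by (intro open_Collect_less continuous_on_const continuous_on_add continuous_on_inner continuous_on_id)
  have sm: "smooth_on ?U F"
    unfolding smooth_on_def F_def
    by (intro allI Ck_on_add[OF U] Ck_on_const Ck_on_scaleR[OF U] Ck_on_divide[OF U] Ck_on_linear[OF bl] Ck_on_linear[OF bounded_linear_inner_right]) auto
  have FT: "F x = T x" if "x \<in> sphere 0 1" for x
    unfolding F_def T[OF that] moeb_eq using linear_add[OF ll] linear_scale[OF ll] by simp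
  have conf: "pderiv_at F x v \<bullet> pderiv_at F x w = sc\<^sup>2 / (1 + b \<bullet> x)\<^sup>2 * (v \<bullet> w)"
    if x: "x \<in> sphere 0 1" and v: "v \<bullet> x = 0" and w: "w \<bullet> x = 0" for x v w
  proof -
    define q where "q = 1 + b \<bullet> x"
    have q: "q > 0" using sphere_pos[OF x] by (simp add: q_def)
    have "((\<lambda>x. sc / (1 + b \<bullet> x)) has_derivative (\<lambda>v. - sc * (inverse q * (b \<bullet> v) * inverse q) + 0 / q)) (at x)"
      unfolding q_def by (intro has_derivative_divide has_derivative_const) (use q in \<open>auto intro!: derivative_eq_intros simp: q_def\<close>)
    moreover have "((\<lambda>x. L x + L (cc *\<^sub>R b)) has_derivative L) (at x)"
      using has_derivative_add[OF bounded_linear.has_derivative[OF bl has_derivative_ident] has_derivative_const] by simp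
    ultimately have "(F has_derivative (\<lambda>v. 0 + ((sc / (1 + b \<bullet> x)) *\<^sub>R L v + (- sc * (inverse q * (b \<bullet> v) * inverse q) + 0 / q) *\<^sub>R (L x + L (cc *\<^sub>R b))))) (at x)"
      unfolding F_def by (intro has_derivative_add has_derivative_const has_derivative_scaleR)
    from fun_cong[OF frechet_derivative_eqI[OF this]]
    have d: "pderiv_at F x v = L ((sc / q) *\<^sub>R v - (sc * (b \<bullet> v) / q\<^sup>2) *\<^sub>R (x + cc *\<^sub>R b))" for v
      using linear_diff[OF ll] linear_add[OF ll] linear_scale[OF ll]
      by (simp add: q_def divide_inverse power2_eq_square mult.assoc mult.left_commute)
    have fr: "fr3 ((sc / q) *\<^sub>R v - (sc * (b \<bullet> v) / q\<^sup>2) *\<^sub>R (x + cc *\<^sub>R b)) = (\<lambda>i. (sc / q) * fr3 v i - (sc * dot 2 (fr3 b) (fr3 v) / q\<^sup>2) * (fr3 x i + cc * fr3 b i))" for v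
      by (rule ext) (simp add: fr3_linear inner_fr3)
    have f: "dot 2 (fr3 x) (fr3 x) = 1" using x unfolding inner_fr3[symmetric] by (simp add: norm_eq_1)
    have "pderiv_at F x v \<bullet> pderiv_at F x w = sc\<^sup>2 / q\<^sup>2 * dot 2 (fr3 v) (fr3 w)"
      unfolding d orthogonal_dot[OF L] inner_fr3[of "_ - _"] fr
      by (rule moebius_dot(1)[OF f]) (use sc_facts q v w in \<open>simp_all add: inner_fr3[symmetric] cc_def q_def inner_commute[of x]\<close>)
    thus ?thesis by (simp add: q_def inner_fr3)
  qed
  show "\<exists>U F. open U \<and> sphere 0 1 \<subseteq> U \<and> smooth_on U F \<and> (\<forall>x\<in>sphere 0 1. F x = T x) \<and>
        (\<forall>x\<in>sphere 0 1. \<exists>r>0. \<forall>v w. v \<bullet> x = 0 \<and> w \<bullet> x = 0 \<longrightarrow> pderiv_at F x v \<bullet> pderiv_at F x w = r * (v \<bullet> w))"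
  proof (intro exI[of _ ?U] exI[of _ F] conjI U sm ballI)
    show "sphere 0 1 \<subseteq> ?U" using sphere_pos by blast
    show "F x = T x" if "x \<in> sphere 0 1" for x by (rule FT[OF that])
    show "\<exists>r>0. \<forall>v w. v \<bullet> x = 0 \<and> w \<bullet> x = 0 \<longrightarrow> pderiv_at F x v \<bullet> pderiv_at F x w = r * (v \<bullet> w)" if x: "x \<in> sphere 0 1" for x
      using conf[OF x] sc_facts(1) sphere_pos[OF x] by (intro exI[of _ "sc\<^sup>2 / (1 + b \<bullet> x)\<^sup>2"]) simp
  qed
qed

end

text \<open>By \<open>moeb_orthogonal\<close> the orthogonal map can be moved past the Moebius map,
  which changes the parameter from \<open>b\<close> to \<open>M b\<close>. The inverse is therefore
  \<open>N\<close> after the Moebius map with parameter \<open>- M b\<close>.\<close>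

lemma moeb_automorphism:
  assumes b: "b \<bullet> b < 1" and M: "orthogonal_transformation M"
  shows "conformal_automorphism_S2 (\<lambda>x. M (moeb b x))"
proof -
  let ?T = "\<lambda>x. M (moeb b x)" and ?S = "sphere (0::real^3) 1"
  have nM: "M x \<in> ?S \<longleftrightarrow> x \<in> ?S" for x using orthogonal_dot[OF M] by (simp add: norm_eq_sqrt_inner)
  have inj: "inj M" by (rule orthogonal_transformation_inj[OF M])
  have sur: "surj M" by (rule orthogonal_transformation_surj[OF M])
  define N where "N = inv M"
  have MN: "M (N x) = x" "N (M x) = x" for x using inj sur by (simp_all add: N_def surj_f_inv_f)
  have N: "orthogonal_transformation N" unfolding N_def by (rule orthogonal_transformation_inv[OF M])
  have b': "(- M b) \<bullet> (- M b) < 1" using b by (simp add: orthogonal_dot[OF M])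
  have nz: "1 + b \<bullet> x \<noteq> 0" if "x \<in> ?S" for x using sphere_pos[OF b that] by simp
  have injT: "inj_on ?T ?S"
    by (rule inj_onI) (use moeb_inverse[OF b nz] inj in \<open>metis injD\<close>)
  have inv: "N (moeb (- M b) y) \<in> ?S \<and> ?T (N (moeb (- M b) y)) = y" if y: "y \<in> ?S" for y
  proof
    have "moeb (- M b) y \<in> ?S" by (rule moeb_sphere[OF b' y])
    thus "N (moeb (- M b) y) \<in> ?S" using nM[of "N (moeb (- M b) y)"] by (simp only: MN)
    have "?T (N (moeb (- M b) y)) = moeb (- (- M b)) (moeb (- M b) y)"
      unfolding moeb_orthogonal[OF M, symmetric] MN by simp
    also have "\<dots> = y" using moeb_inverse[OF b', of y] sphere_pos[OF b' y] by simp
    finally show "?T (N (moeb (- M b) y)) = y" .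
  qed
  have inT: "?T ` ?S \<subseteq> ?S" using moeb_sphere[OF b] nM by blast
  have bij: "bij_betw ?T ?S ?S"
    unfolding bij_betw_def using injT inT inv by (metis (no_types, lifting) image_iff subsetI subset_antisym)
  have "inv_into ?S ?T y = N (moeb (- M b) y)" if "y \<in> ?S" for y
    using inv[OF that] inv_into_f_eq[OF injT] by blast
  hence "conformal_sphere_map (inv_into ?S ?T)" by (rule moeb_conformal[OF b' N])
  thus ?thesis unfolding conformal_automorphism_S2_def using bij moeb_conformal[OF b M refl] by blast
qed

text \<open>The linear map carrying one frame to the other is orthogonal since the Gram matrices
  agree. The last clause recognises images by inner products with the frames, the form in which
  unique continuation delivers them.\<close>

lemma rigid_R3:
  fixes f a d f' a' d' :: "real^3"
  assumes f: "f \<bullet> f = 1" "f \<bullet> a = 0" "f \<bullet> d = 0" and f': "f' \<bullet> f' = 1" "f' \<bullet> a' = 0" "f' \<bullet> d' = 0"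
    and gram: "a' \<bullet> a' = a \<bullet> a" "a' \<bullet> d' = a \<bullet> d" "d' \<bullet> d' = d \<bullet> d"
    and det: "(a \<bullet> a) * (d \<bullet> d) - (a \<bullet> d)\<^sup>2 > 0"
  shows "\<exists>M. orthogonal_transformation M \<and>
    (\<forall>y y'. f \<bullet> y = f' \<bullet> y' \<longrightarrow> a \<bullet> y = a' \<bullet> y' \<longrightarrow> d \<bullet> y = d' \<bullet> y' \<longrightarrow> M y = y')"
proof -
  define E F G where "E = a \<bullet> a" and "F = a \<bullet> d" and "G = d \<bullet> d"
  define c1 where "c1 x y = (G * x - F * y) / (E * G - F\<^sup>2)" for x y
  define c2 where "c2 x y = (E * y - F * x) / (E * G - F\<^sup>2)" for x y
  have D: "E * G - F\<^sup>2 > 0" using det by (simp add: E_def F_def G_def)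
  have cs: "c1 x y * E + c2 x y * F = x" "c1 x y * F + c2 x y * G = y" for x y
    unfolding c1_def c2_def using coef_solve[of E G F x y] D by simp_all
  have expand: "y = (u \<bullet> y) *\<^sub>R u + c1 (v \<bullet> y) (w \<bullet> y) *\<^sub>R v + c2 (v \<bullet> y) (w \<bullet> y) *\<^sub>R w"
    if u: "u \<bullet> u = 1" "u \<bullet> v = 0" "u \<bullet> w = 0" and g: "v \<bullet> v = E" "v \<bullet> w = F" "w \<bullet> w = G" for u v w y :: "real^3"
  proof -
    define z where "z = y - ((u \<bullet> y) *\<^sub>R u + c1 (v \<bullet> y) (w \<bullet> y) *\<^sub>R v + c2 (v \<bullet> y) (w \<bullet> y) *\<^sub>R w)"
    have "u \<bullet> z = 0" unfolding z_def inner_diff_right inner_add_right inner_scaleR_right u by simp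
    moreover have "v \<bullet> z = 0"
      unfolding z_def inner_diff_right inner_add_right inner_scaleR_right g inner_commute[of v u] u using cs(1) by simp
    moreover have "w \<bullet> z = 0"
      unfolding z_def inner_diff_right inner_add_right inner_scaleR_right inner_commute[of w u] inner_commute[of w v] g u using cs(2) by simp
    moreover have "(v \<bullet> v) * (w \<bullet> w) - (v \<bullet> w)\<^sup>2 > 0" unfolding g by (rule D)
    ultimately have "\<forall>i\<le>2. fr3 z i = 0"
      using normal_dim3_zero[of "fr3 u" "fr3 v" "fr3 w" "fr3 z"] u unfolding inner_fr3 by blast
    hence "to_R3 (fr3 z) = to_R3 (\<lambda>_. 0)" by (intro to_R3_eqI) blast
    hence "z = 0" unfolding to_R3_fr3 by (simp add: vec_eq_iff forall_3 to_R3_def)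
    thus ?thesis by (simp add: z_def)
  qed
  define M where "M y = (f \<bullet> y) *\<^sub>R f' + c1 (a \<bullet> y) (d \<bullet> y) *\<^sub>R a' + c2 (a \<bullet> y) (d \<bullet> y) *\<^sub>R d'" for y
  have ca: "c1 (x + x') (y + y') = c1 x y + c1 x' y'" "c2 (x + x') (y + y') = c2 x y + c2 x' y'"
    "c1 (r * x) (r * y) = r * c1 x y" "c2 (r * x) (r * y) = r * c2 x y" for r x y x' y'
    unfolding c1_def c2_def by (simp_all add: add_divide_distrib[symmetric] algebra_simps)
  have "linear M"
    by (rule linearI) (simp_all add: M_def inner_add_right inner_scaleR_right ca scaleR_add_left scaleR_add_right)
  moreover have "M x \<bullet> M y = x \<bullet> y" for x y
  proof -
    let ?e = "\<lambda>x u v w. (f \<bullet> x) *\<^sub>R u + c1 (a \<bullet> x) (d \<bullet> x) *\<^sub>R v + c2 (a \<bullet> x) (d \<bullet> x) *\<^sub>R w"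
    have g: "?e x u v w \<bullet> ?e y u v w = (f \<bullet> x) * (f \<bullet> y) + c1 (a \<bullet> x) (d \<bullet> x) * c1 (a \<bullet> y) (d \<bullet> y) * E
        + (c1 (a \<bullet> x) (d \<bullet> x) * c2 (a \<bullet> y) (d \<bullet> y) + c2 (a \<bullet> x) (d \<bullet> x) * c1 (a \<bullet> y) (d \<bullet> y)) * F
        + c2 (a \<bullet> x) (d \<bullet> x) * c2 (a \<bullet> y) (d \<bullet> y) * G"
      if u: "u \<bullet> u = 1" "u \<bullet> v = 0" "u \<bullet> w = 0" and g: "v \<bullet> v = E" "v \<bullet> w = F" "w \<bullet> w = G" for u v w :: "real^3"
      unfolding inner_add_left inner_add_right inner_scaleR_left inner_scaleR_right
        inner_commute[of v u] inner_commute[of w u] inner_commute[of w v] u g by (simp add: algebra_simps)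
    have e: "M x \<bullet> M y = ?e x f a d \<bullet> ?e y f a d"
      unfolding M_def g[OF f', unfolded gram, OF E_def[symmetric] F_def[symmetric] G_def[symmetric]]
        g[OF f E_def[symmetric] F_def[symmetric] G_def[symmetric]] ..
    have "?e z f a d = z" for z by (rule expand[OF f E_def[symmetric] F_def[symmetric] G_def[symmetric], symmetric])
    thus ?thesis unfolding e by simp
  qed
  moreover have "M y = y'" if "f \<bullet> y = f' \<bullet> y'" "a \<bullet> y = a' \<bullet> y'" "d \<bullet> y = d' \<bullet> y'" for y y'
    unfolding M_def that by (rule expand[OF f' gram[folded E_def F_def G_def], symmetric])
  ultimately show ?thesis unfolding orthogonal_transformation_def by blast
qed

context conformal_surface
begin

section \<open>Comparing two immersions\<close>

lemma same_pullI: "pullback_metric A n \<Phi> = pullback_metric A m \<Psi> \<Longrightarrow> same_pull n \<Phi> m \<Psi>"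
  unfolding same_pull_def using pullback_df by metis

lemma flat_off_dim2:
  assumes "imm_off P 2 \<Phi>"
  shows "flat_off P 2 \<Phi>"
  unfolding flat_off_def
proof (intro conjI assms allI impI ballI)
  fix p X assume p: "p \<notin> P" and k: "X \<in> charts_at A p"
  have "coord X p \<in> {z \<in> im_ch X. param X z \<notin> P}" using chart_pt[OF k] p by simp
  thus "flat_at 2 (loc X \<Phi>) (coord X p)" by (rule flat_dim2[OF imm_off_immersed[OF assms charts_atD(1)[OF k]]])
qed

lemma imm_off_same_pull:
  assumes "imm_off P m \<Psi>" "same_pull n \<Phi> m \<Psi>" "smap n \<Phi>"
  shows "imm_off P n \<Phi>"
  unfolding imm_off_def
proof (intro conjI allI impI ballI assms(3))
  show "finite P" using assms(1) unfolding imm_off_def by blast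
  fix p X assume p: "p \<notin> P" and k: "X \<in> charts_at A p"
  have e: "dot n (df \<Phi> X p v) (df \<Phi> X p w) = dot m (df \<Psi> X p v) (df \<Psi> X p w)" for v w
    using assms(2) k unfolding same_pull_def by blast
  show "dot n (df \<Phi> X p 1) (df \<Phi> X p 1) * dot n (df \<Phi> X p \<i>) (df \<Phi> X p \<i>) - (dot n (df \<Phi> X p 1) (df \<Phi> X p \<i>))\<^sup>2 > 0"
    unfolding e using assms(1) p k unfolding imm_off_def by blast
qed

lemma imm_bmi: "immersed_by_first_eigenfunctions A c g n \<Phi> \<Longrightarrow> branched_minimal_immersion A c n \<Phi>"
  and imm_pull: "immersed_by_first_eigenfunctions A c g n \<Phi> \<Longrightarrow> pullback_metric A n \<Phi> = g"
  unfolding immersed_by_first_eigenfunctions_def by blast+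

lemma imm_flat_equatorial:
  assumes imm: "immersed_by_first_eigenfunctions A c g n \<Phi>" and f: "flat_off (BP n \<Phi>) n \<Phi>"
  shows "equatorial_two_sphere n (range \<Phi>)"
proof -
  obtain gr where gr: "gr \<in> c" using class_nonempty by blast
  show ?thesis using flat_equatorial[OF gr imm_bmi[OF imm] conjunct1[OF first_immersion_lambda1[OF gr imm_bmi[OF imm] imm]] f] .
qed

text \<open>\<open>compare\<close> over one background metric; its parameter has zero defect
  everywhere, so \<open>defect_flat\<close> applies whenever it is nonzero.\<close>

lemma compare_immersions:
  assumes gr: "gr \<in> c" and imm: "immersed_by_first_eigenfunctions A c g n \<Phi>" and imm': "immersed_by_first_eigenfunctions A c g' m \<Psi>"
  shows "\<exists>b. dot n b b < 1
    \<and> (\<forall>p. conf_factor gr m \<Psi> p = (1 - dot n b b) / (1 + dot n b (\<Phi> p))\<^sup>2 * conf_factor gr n \<Phi> p)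
    \<and> ((\<exists>i\<le>n. b i \<noteq> 0) \<longrightarrow> flat_off (BP n \<Phi>) n \<Phi>)"
proof -
  interpret gs: gradient_structure "area gr" C1 "G1 gr" "G2 gr"
    by (rule gradient_structure_surface[OF class_metric[OF gr]])
  note fi = conjunct1[OF first_immersion_lambda1[OF gr imm_bmi[OF imm] imm]]
  note fi' = conjunct1[OF first_immersion_lambda1[OF gr imm_bmi[OF imm'] imm']]
  obtain b where b: "dot n b b < 1"
    and r: "\<And>p. conf_factor gr m \<Psi> p = (1 - dot n b b) / (1 + lin n (\<lambda>i p. \<Phi> p i) b p)\<^sup>2 * conf_factor gr n \<Phi> p"
    and d: "\<And>p. gs.defect n (\<lambda>i p. \<Phi> p i) (conf_factor gr n \<Phi>) b p = 0"
    using gs.compare[OF fi fi'] by blast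
  show ?thesis
  proof (intro exI[of _ b] conjI b allI impI)
    show "conf_factor gr m \<Psi> p = (1 - dot n b b) / (1 + dot n b (\<Phi> p))\<^sup>2 * conf_factor gr n \<Phi> p" for p
      using r[of p] unfolding lin_def .
    show "flat_off (BP n \<Phi>) n \<Phi>" if "\<exists>i\<le>n. b i \<noteq> 0"
      by (rule defect_flat[OF gr imm_bmi[OF imm] fi that d])
  qed
qed

text \<open>A nonzero parameter would make \<open>\<Phi>\<close> flat and its image equatorial; with
  parameter 0 the conformal factors coincide.\<close>

lemma nonequatorial_unique:
  assumes imm: "immersed_by_first_eigenfunctions A c g n \<Phi>" and ne: "\<not> equatorial_two_sphere n (range \<Phi>)"
    and imm': "immersed_by_first_eigenfunctions A c g' m \<Psi>"
  shows "g' = g"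
proof -
  obtain gr where gr: "gr \<in> c" using class_nonempty by blast
  obtain b where r: "\<forall>p. conf_factor gr m \<Psi> p = (1 - dot n b b) / (1 + dot n b (\<Phi> p))\<^sup>2 * conf_factor gr n \<Phi> p"
    and f: "(\<exists>i\<le>n. b i \<noteq> 0) \<longrightarrow> flat_off (BP n \<Phi>) n \<Phi>"
    using compare_immersions[OF gr imm imm'] by (elim exE conjE)
  have "\<forall>i\<le>n. b i = 0" using f imm_flat_equatorial[OF imm] ne by blast
  hence "dot n b x = 0" for x by (simp add: dot_def)
  hence rr: "conf_factor gr m \<Psi> p = conf_factor gr n \<Phi> p" for p using spec[OF r, of p] by simp
  show ?thesis
  proof (intro ext)
    fix X p v w
    show "g' X p v w = g X p v w"
      using pullback_factor(1)[OF gr imm_bmi[OF imm], of X p v w] pullback_factor(1)[OF gr imm_bmi[OF imm'], of X p v w]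
      unfolding rr imm_pull[OF imm] imm_pull[OF imm'] by simp
  qed
qed

text \<open>A map to the 2-sphere is flat, and by uniqueness it would induce the same metric as
  \<open>\<Phi>\<close>. The Gauss equation then transfers flatness to \<open>\<Phi>\<close>, whose
  image would be equatorial.\<close>

lemma nonequatorial_no_S2:
  assumes imm: "immersed_by_first_eigenfunctions A c g n \<Phi>" and ne: "\<not> equatorial_two_sphere n (range \<Phi>)"
  shows "\<not> immersed_by_first_eigenfunctions A c g' 2 \<Psi>"
proof
  assume imm': "immersed_by_first_eigenfunctions A c g' 2 \<Psi>"
  have g: "pullback_metric A n \<Phi> = pullback_metric A 2 \<Psi>"
    unfolding imm_pull[OF imm] imm_pull[OF imm'] nonequatorial_unique[OF imm ne imm'] ..
  note sp = same_pullI[OF g] and b = imm_bmi[OF imm]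
  note i = immersion_imm_off[OF b]
  have sp': "same_pull 2 \<Psi> n \<Phi>" using sp unfolding same_pull_def by metis
  \<comment> \<open>Both maps induce the same metric, so the branch set of \<open>\<Phi>\<close>
    serves as exceptional set for \<open>\<Psi>\<close> too.\<close>
  have fP: "flat_off (BP n \<Phi>) 2 \<Psi>"
    by (rule flat_off_dim2[OF imm_off_same_pull[OF i sp' smap_immersion[OF imm_bmi[OF imm']]]])
  hence iP: "imm_off (BP n \<Phi>) 2 \<Psi>" unfolding flat_off_def by blast
  have "flat_off (BP n \<Phi>) n \<Phi>"
    unfolding flat_off_def
  proof (intro conjI i allI impI ballI)
    fix p X assume p: "p \<notin> BP n \<Phi>" and k: "X \<in> charts_at A p"
    note k' = charts_atD(1)[OF k]
    have z: "coord X p \<in> {z \<in> im_ch X. param X z \<notin> BP n \<Phi>}" using chart_pt[OF k] p by simp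
    have t: "tracefree n (loc X \<Phi>) (coord X p)" using immersion_tracefree[OF b _ k] p by blast
    show "flat_at n (loc X \<Phi>) (coord X p)"
      by (rule flat_transfer[OF imm_off_immersed[OF i k'] imm_off_immersed[OF iP k'] same_pull_chart[OF sp k'] z t flat_off_chart[OF fP k' z]])
  qed
  thus False using imm_flat_equatorial[OF imm] ne by blast
qed

lemma df_orthogonal:
  assumes s: "smap n \<Phi>" and k: "X \<in> charts_at A p"
  shows "dot n (\<Phi> p) (df \<Phi> X p v) = 0"
proof -
  have l: "loc X \<Phi> (coord X p) = \<Phi> p" using chart_pt(3)[OF k] by (simp add: loc_def fun_eq_iff)
  have "dot n (loc X \<Phi> z) (loc X \<Phi> z) = 1" for z using s unfolding smap_def loc_def[abs_def] by blast
  from unit_derivs(1)[OF smap_family[OF s charts_atD(1)[OF k]] this chart_pt(1)[OF k], of v]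
  show ?thesis unfolding pd_loc l .
qed

text \<open>Unique continuation for \<open>x . \<Phi> - y . \<Psi>\<close> propagates equality of
  inner products from the 1-jets at \<open>p\<close> to all points; \<open>rigid_R3\<close> turns
  this into one orthogonal map.\<close>

lemma rigid_surface:
  assumes i: "imm_off P 2 \<Phi>" and i': "imm_off P 2 \<Psi>" and sp: "same_pull 2 \<Phi> 2 \<Psi>" and p: "p \<notin> P"
  shows "\<exists>M. orthogonal_transformation M \<and> (\<forall>q. to_R3 (\<Psi> q) = M (to_R3 (\<Phi> q)))"
proof -
  note f = flat_off_dim2[OF i] and f' = flat_off_dim2[OF i'] and k = ch[of p]
  have s: "smap 2 \<Phi>" and s': "smap 2 \<Psi>" using i i' unfolding imm_off_def by blast+
  have u: "dot 2 (\<Phi> p) (\<Phi> p) = 1" "dot 2 (\<Psi> p) (\<Psi> p) = 1" using s s' unfolding smap_def by blast+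
  note o = df_orthogonal[OF s k] df_orthogonal[OF s' k]
  have e: "dot 2 (df \<Phi> (ch p) p v) (df \<Phi> (ch p) p w) = dot 2 (df \<Psi> (ch p) p v) (df \<Psi> (ch p) p w)" for v w
    using sp k unfolding same_pull_def by blast
  have uc: "dot 2 x (\<Phi> q) = dot 2 y (\<Psi> q)"
    if xy: "dot 2 x (\<Phi> p) = dot 2 y (\<Psi> p)" "\<And>v. dot 2 x (df \<Phi> (ch p) p v) = dot 2 y (df \<Psi> (ch p) p v)" for x y q
  proof -
    have "dot 2 x (\<Phi> q) + dot 2 (\<lambda>i. - y i) (\<Psi> q) = 0"
      by (rule unique_continuation[OF f f' sp p k]) (use xy in \<open>simp_all add: dot_linear\<close>)
    thus ?thesis by (simp add: dot_linear)
  qed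
  let ?a = "df \<Phi> (ch p) p 1" and ?d = "df \<Phi> (ch p) p \<i>" and ?a' = "df \<Psi> (ch p) p 1" and ?d' = "df \<Psi> (ch p) p \<i>"
  have "\<exists>M. orthogonal_transformation M \<and> (\<forall>y y'. to_R3 (\<Phi> p) \<bullet> y = to_R3 (\<Psi> p) \<bullet> y' \<longrightarrow>
      to_R3 ?a \<bullet> y = to_R3 ?a' \<bullet> y' \<longrightarrow> to_R3 ?d \<bullet> y = to_R3 ?d' \<bullet> y' \<longrightarrow> M y = y')"
  proof (rule rigid_R3; unfold inner_to_R3)
    show "dot 2 ?a ?a * dot 2 ?d ?d - (dot 2 ?a ?d)\<^sup>2 > 0" using i p k unfolding imm_off_def by blast
  qed (simp_all add: u o e)
  then obtain M where M: "orthogonal_transformation M"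
    "\<And>y y'. to_R3 (\<Phi> p) \<bullet> y = to_R3 (\<Psi> p) \<bullet> y' \<Longrightarrow> to_R3 ?a \<bullet> y = to_R3 ?a' \<bullet> y' \<Longrightarrow> to_R3 ?d \<bullet> y = to_R3 ?d' \<bullet> y' \<Longrightarrow> M y = y'"
    by blast
  have "M (to_R3 (\<Phi> q)) = to_R3 (\<Psi> q)" for q
  proof (rule M(2); unfold inner_to_R3)
    show "dot 2 (\<Phi> p) (\<Phi> q) = dot 2 (\<Psi> p) (\<Psi> q)" by (rule uc) (simp_all add: u o)
    show "dot 2 ?a (\<Phi> q) = dot 2 ?a' (\<Psi> q)" "dot 2 ?d (\<Phi> q) = dot 2 ?d' (\<Psi> q)"
      by (rule uc; simp add: e o dot_commute[of 2 "df _ _ _ _" "\<Phi> p"] dot_commute[of 2 "df _ _ _ _" "\<Psi> p"])+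
  qed
  thus ?thesis using M(1) by metis
qed

text \<open>The parameter of the comparison gives a Moebius map after which \<open>\<Phi>\<close>
  induces the metric of \<open>\<Psi>\<close>; rigidity supplies the remaining orthogonal map.
  Flatness of the transformed map \<open>\<psi>\<close> comes from the dimension of its
  target.\<close>

lemma S2_unique:
  assumes imm: "immersed_by_first_eigenfunctions A c g 2 \<Phi>" and imm': "immersed_by_first_eigenfunctions A c g' 2 \<Psi>"
  shows "\<exists>T. conformal_automorphism_S2 T \<and> (\<forall>p. to_R3 (\<Psi> p) = T (to_R3 (\<Phi> p)))"
proof -
  obtain gr where gr: "gr \<in> c" using class_nonempty by blast
  note B = imm_bmi[OF imm] and B' = imm_bmi[OF imm']
  obtain b where b: "dot 2 b b < 1"
    and r': "\<forall>p. conf_factor gr 2 \<Psi> p = (1 - dot 2 b b) / (1 + dot 2 b (\<Phi> p))\<^sup>2 * conf_factor gr 2 \<Phi> p"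
    using compare_immersions[OF gr imm imm'] by (elim exE conjE)
  note r = spec[OF r']
  define s where "s = sqrt (1 - dot 2 b b)"
  define c0 where "c0 = 1 / (1 + s)"
  define q where "q p = 1 + dot 2 b (\<Phi> p)" for p
  have s: "0 < s" "dot 2 b b = 1 - s\<^sup>2" using b by (simp_all add: s_def)
  have unit: "dot 2 (\<Phi> p) (\<Phi> p) = 1" for p by (rule immersion_unit(1)[OF B])
  have q0: "q p \<noteq> 0" for p
    using dot_unit_lower[of 2 "\<Phi> p" b, OF unit] b unfolding q_def by simp
  define \<psi> where "\<psi> p i = c0 * b i + (s / q p) * (\<Phi> p i + c0 * b i)" for p i
  have psi_moeb: "to_R3 (\<psi> p) = moeb (to_R3 b) (to_R3 (\<Phi> p))" for p
    unfolding moeb_def Let_def inner_to_R3 \<psi>_def[abs_def] to_R3_linear s_def c0_def q_def ..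
  note S = smap_immersion[OF B]
  have smap: "smap 2 \<psi>"
    unfolding smap_def
  proof (intro conjI allI impI ballI)
    fix i X k assume i: "i \<le> (2::nat)" and k: "X \<in> smooth_charts A"
    have "Ck_on k (im_ch X) (\<lambda>z. dot 2 b (\<Phi> (param X z)))"
      using smooth_family_dot_Ck[OF smooth_family_const[OF im_open[OF k], of 2 b] smap_family[OF S k], of k]
      unfolding loc_def[abs_def] .
    hence "Ck_on k (im_ch X) (\<lambda>z. q (param X z))"
      unfolding q_def by (intro Ck_on_add[OF im_open[OF k]] Ck_on_const)
    thus "Ck_on k (im_ch X) (\<lambda>z. \<psi> (param X z) i)"
      unfolding \<psi>_def using q0
      by (intro Ck_on_add[OF im_open[OF k]] Ck_on_mult[OF im_open[OF k]] Ck_on_divide[OF im_open[OF k]] Ck_on_const immersion_Ck[OF B i k])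
  next
    show "dot 2 (\<psi> p) (\<psi> p) = 1" for p
      unfolding \<psi>_def[abs_def]
      by (rule moebius_dot(2)[where f = "\<Phi> p" and x = "\<lambda>_. 0" and y = "\<lambda>_. 0" and q = "q p", OF unit]) (use s q0 in \<open>simp_all add: q_def c0_def\<close>)
  qed
  have dpsi: "df \<psi> X p v i = (s / q p) * df \<Phi> X p v i - (s * dot 2 b (df \<Phi> X p v) / (q p)\<^sup>2) * (\<Phi> p i + c0 * b i)"
    if k: "X \<in> charts_at A p" and i: "i \<le> 2" for X p v i
  proof -
    let ?z = "coord X p"
    note pc = chart_pt(3)[OF k]
    have dq: "((\<lambda>z. q (param X z)) has_derivative (\<lambda>v. dot 2 b (df \<Phi> X p v))) (at ?z)"
      unfolding q_def using has_derivative_add[OF has_derivative_const dot_cdiff[OF S k, of b]] by simp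
    have d1: "((\<lambda>z. s / q (param X z)) has_derivative
      (\<lambda>v. - s * (inverse (q (param X ?z)) * dot 2 b (df \<Phi> X p v) * inverse (q (param X ?z))) + 0 / q (param X ?z))) (at ?z)"
      by (rule has_derivative_divide[OF has_derivative_const dq q0])
    have d2: "((\<lambda>z. \<Phi> (param X z) i + c0 * b i) has_derivative (\<lambda>v. df \<Phi> X p v i + 0)) (at ?z)"
      unfolding df_def by (intro has_derivative_add has_derivative_const cdiff_deriv[OF immersion_C1[OF B i] k])
    have "((\<lambda>z. \<psi> (param X z) i) has_derivative (\<lambda>v. 0 + (s / q (param X ?z) * (df \<Phi> X p v i + 0) +
       (- s * (inverse (q (param X ?z)) * dot 2 b (df \<Phi> X p v) * inverse (q (param X ?z))) + 0 / q (param X ?z)) * (\<Phi> (param X ?z) i + c0 * b i)))) (at ?z)"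
      unfolding \<psi>_def by (rule has_derivative_add[OF has_derivative_const has_derivative_mult[OF d1 d2]])
    from cdiff_eqI[OF this, of v] show ?thesis
      unfolding df_def[of \<psi>] pc by (simp add: divide_inverse power2_eq_square mult.assoc mult.left_commute)
  qed
  have sp: "same_pull 2 \<psi> 2 \<Psi>"
    unfolding same_pull_def
  proof (intro allI ballI)
    fix p X v w assume k: "X \<in> charts_at A p"
    let ?d = "\<lambda>v i. (s / q p) * df \<Phi> X p v i - (s * dot 2 b (df \<Phi> X p v) / (q p)\<^sup>2) * (\<Phi> p i + c0 * b i)"
    have "dot 2 (df \<psi> X p v) (df \<psi> X p w) = dot 2 (?d v) (?d w)"
      by (rule dot_cong) (rule dpsi[OF k], assumption)+
    also have "\<dots> = s\<^sup>2 / (q p)\<^sup>2 * dot 2 (df \<Phi> X p v) (df \<Phi> X p w)"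
      by (rule moebius_dot(1)[OF unit df_orthogonal[OF S k] df_orthogonal[OF S k] s(2,1) q_def q0 c0_def])
    also have "\<dots> = conf_factor gr 2 \<Psi> p * gr X p v w"
      unfolding df_factor[OF gr B k] r q_def using s by simp
    also have "\<dots> = dot 2 (df \<Psi> X p v) (df \<Psi> X p w)" by (rule df_factor[OF gr B' k, symmetric])
    finally show "dot 2 (df \<psi> X p v) (df \<psi> X p w) = dot 2 (df \<Psi> X p v) (df \<Psi> X p w)" .
  qed
  note i' = immersion_imm_off[OF B']
  obtain p where p: "p \<notin> BP 2 \<Psi>" using regular_point[OF B'] by blast
  obtain M where M: "orthogonal_transformation M" "\<And>q. to_R3 (\<Psi> q) = M (to_R3 (\<psi> q))"
    using rigid_surface[OF imm_off_same_pull[OF i' sp smap] i' sp p] by blast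
  have "conformal_automorphism_S2 (\<lambda>x. M (moeb (to_R3 b) x))"
    by (rule moeb_automorphism[OF _ M(1)]) (simp add: inner_to_R3 b)
  thus ?thesis using M(2) unfolding psi_moeb by (intro exI[of _ "\<lambda>x. M (moeb (to_R3 b) x)"]) blast
qed

end

theorem theorem1p4:
  fixes A :: "'a::t2_space chart set" and c :: "'a tensor2 set"
  assumes "smooth_atlas A"
    and "compact (UNIV :: 'a set)"
    and "connected (UNIV :: 'a set)"
    and "conformal_class A c"
  shows "(category_1 A c \<or> category_2 A c \<or> category_3 A c) \<and>
      \<not> (category_1 A c \<and> category_2 A c) \<and>
      \<not> (category_1 A c \<and> category_3 A c) \<and>
      \<not> (category_2 A c \<and> category_3 A c) \<and>
      (category_3 A c \<longrightarrow>
        (\<forall>g g' \<Phi> \<Phi>'. immersed_by_first_eigenfunctions A c g 2 \<Phi> \<and>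
            immersed_by_first_eigenfunctions A c g' 2 \<Phi>' \<longrightarrow>
          (\<exists>T. conformal_automorphism_S2 T \<and> (\<forall>p. to_R3 (\<Phi>' p) = T (to_R3 (\<Phi> p))))))"
proof -
  interpret conformal_surface A c
    using assms by (rule conformal_surface.intro)
  have "category_2 A c \<or> category_3 A c" if n1: "\<not> category_1 A c"
  proof -
    obtain g n \<Phi> where imm: "immersed_by_first_eigenfunctions A c g n \<Phi>" using n1 unfolding category_1_def by blast
    show ?thesis
    proof (cases "equatorial_two_sphere n (range \<Phi>)")
      case True
      thus ?thesis using equatorial_rotate[OF imm] unfolding category_3_def by blast
    next
      case False
      \<comment> \<open>The non-equatorial immersion already determines the metric of every other
        immersion by first eigenfunctions.\<close>
      have "category_2 A c"
        unfolding category_2_def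
      proof (rule ex1I)
        show "\<exists>m \<Phi>. immersed_by_first_eigenfunctions A c g m \<Phi> \<and> \<not> equatorial_two_sphere m (range \<Phi>)"
          using imm False by blast
        show "g' = g" if "\<exists>m \<Phi>. immersed_by_first_eigenfunctions A c g' m \<Phi> \<and> \<not> equatorial_two_sphere m (range \<Phi>)" for g'
          using that nonequatorial_unique[OF imm False] by blast
      qed
      thus ?thesis ..
    qed
  qed
  moreover have "\<not> (category_1 A c \<and> category_2 A c)" unfolding category_1_def category_2_def by blast
  moreover have "\<not> (category_1 A c \<and> category_3 A c)" unfolding category_1_def category_3_def by blast
  moreover have "\<not> (category_2 A c \<and> category_3 A c)"
    using nonequatorial_no_S2 unfolding category_2_def category_3_def by blast
  ultimately show ?thesis using S2_unique by blast
qed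

end
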